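(* Let $f(Z)=\sum_{i=1}^d \alpha_i Z^i\in\mathbb{R}[Z]$ be any polynomial of degree $d\ge 3$ whose leading coefficient $\alpha_d$ is irrational and of Diophantine type $\tau=1$. Let $m$ be a positive integer and $k\in\{0,\ldots,m-1\}$. Then $$D_f(\mathcal{E}_{k,m}(r))\le 2^{-\min\{\nu_1(d),\nu_2(d)\}r+o(r)}$$ as $r\to\infty$, where $$\nu_1(d)=\frac{d-2}{2d^2-2d+1}\qquad\text{and}\qquad \nu_2(d)=\frac1{2d^2-6d+6}.$$
   Context: $\sigma(n)$ denotes the sum of the binary digits of the nonnegative integer $n$, and $\mathcal{E}_{k,m}(r)=\{0\le n<2^r:\ \sigma(n)\equiv k\pmod m\}$. The Diophantine type of an irrational number $\alpha$ is $$\tau=\sup\left\{\vartheta\in\mathbb{R}:\ \liminf_{q\to\infty,\ q\in\mathbb{N}}q^{\vartheta}\|\alpha q\|=0\right\},$$ where $\|x\|$ is the distance from $x\in\mathbb{R}$ to the nearest integer. For a finite nonempty set $M$ of nonnegative integers, the discrepancy of $\{\{f(n)\}: n\in M\}$ is $$D_f(M)=\sup_{\mathcal{I}\subseteq[0,1)}\left|\frac{\#\{n\in M:\ \{f(n)\}\in\mathcal{I}\}}{\#M}-\mathcal{L}(\mathcal{I})\right|,$$ where the supremum is over intervals $\mathcal{I}\subseteq[0,1)$, $\{y\}$ is the fractional part of $y$, and $\mathcal{L}$ is Lebesgue measure. The notation $o(r)$ means: for every $\varepsilon>0$ there is $r_0$ (depending on $\varepsilon$, $f$ and $m$) such that for all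 $r\ge r_0$ the bound holds with $o(r)$ replaced by $\varepsilon r$. *)

theory Defs
  imports
    "HOL-Analysis.Analysis"
    "HOL-Computational_Algebra.Polynomial"
    "HOL-Number_Theory.Cong"
begin

(* As n < 2 ^ n, the positions i < n contain all nonzero binary digits of n. *)
definition binary_digit_sum :: "nat \<Rightarrow> nat" where
  "binary_digit_sum n = (\<Sum>i<n. n div 2 ^ i mod 2)"

definition digit_sum_class :: "nat \<Rightarrow> nat \<Rightarrow> nat \<Rightarrow> nat set" where
  "digit_sum_class k m r = {n. n < 2 ^ r \<and> [binary_digit_sum n = k] (mod m)}"

definition dist_nearest_int :: "real \<Rightarrow> real" where
  "dist_nearest_int x = \<bar>x - of_int (round x)\<bar>"

(* The supremum is taken in the extended reals: it is infinite for Liouville numbers. *)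
definition diophantine_type :: "real \<Rightarrow> ereal" where
  "diophantine_type \<alpha> = Sup (ereal ` {\<theta> :: real.
     liminf (\<lambda>q :: nat. ereal (real q powr \<theta> * dist_nearest_int (\<alpha> * real q))) = 0})"

(* Meaningful for finite nonempty M; the intervals may be open, closed or half-open. *)
definition discrepancy :: "(nat \<Rightarrow> real) \<Rightarrow> nat set \<Rightarrow> real" where
  "discrepancy f M = (SUP I \<in> {I :: real set. is_interval I \<and> I \<subseteq> {0..<1}}.
     \<bar>real (card {n \<in> M. frac (f n) \<in> I}) / real (card M) - measure lborel I\<bar>)"

definition nu1 :: "nat \<Rightarrow> real" where
  "nu1 d = (real d - 2) / (2 * real d ^ 2 - 2 * real d + 1)"

definition nu2 :: "nat \<Rightarrow> real" where
  "nu2 d = 1 / (2 * real d ^ 2 - 6 * real d + 6)"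

end

theory Submission
  imports Defs "HOL-Real_Asymp.Real_Asymp"
begin

text \<open>Since \<open>\<sigma>(u + 2\<^sup>s v) = \<sigma>(u) + \<sigma>(v)\<close> for \<open>u
  < 2\<^sup>s\<close>, the exponential sum of \<open>z\<^bsup>\<sigma>(n)\<^esup> e(h f(n))\<close>
  over \<open>n < 2\<^sup>r\<close> splits as a double sum with separated weights over
  \<open>u\<close> and \<open>v\<close>. As \<open>u\<^sup>d\<close> has a coefficient independent
  of \<open>v\<close>, only a polynomial of degree \<open>d - 1\<close> in \<open>u\<close> matters,
  with leading coefficient \<open>h d \<alpha>\<^sub>d 2\<^sup>s v\<close> up to an additive
  constant, and these points are well spaced modulo 1 because \<open>\<alpha>\<^sub>d\<close> has
  type 1. For \<open>d \<ge> 6\<close>, Hoelder's inequality in \<open>v\<close> and the large sieve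
  in that single coefficient reduce the bound to Vinogradov's mean value theorem in degree \<open>d
  - 1\<close>, which is deduced from \<open>P\<close>-adic decoupling for the moment curve with one
  large prime \<open>P\<close>. For \<open>d \<le> 5\<close> Weyl differencing of the differenced
  sums over \<open>u\<close> is enough. Orthogonality of the characters modulo \<open>m\<close>
  passes to the digit classes, each containing about \<open>2\<^sup>r / m\<close> numbers, and the
  Erdos-Turan inequality turns the bounds for \<open>h \<le> 2\<^bsup>\<nu>r\<^esup>\<close> into
  the discrepancy estimate.\<close>

section \<open>The additive character\<close>

text \<open>Neither of the two bounds covers all degrees. The sieve admits every \<nu> with
  \<open>\<nu> * (1 + d * (d - 1)^2) \<le> d - 2\<close>, asymptotically twice \<open>nu2 d\<close>;
  at d = 3 this is exactly \<open>nu1 3\<close> = 1/13, but at d = 4 it gives 2/37 against 1/14, and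
  at d = 5 it gives 1/27 against 1/26. The exponent of Weyl differencing decays like 1/2^(d - 1):
  enough up to d = 6, too little from d = 7 on. Inside a block nothing is used about the weights
  beyond modulus 1. In the sieve they therefore stay as arbitrary bounded coefficients of u, which a
  mean value counting solutions tolerates; before Weyl differencing the Cauchy-Schwarz inequality
  over u removes them, at the price of comparing two blocks v and v'. The prime P is fixed once the
  degree is known and only the number n of P-adic digits grows. Constants may depend on P, and a
  loss \<open>P powr (\<epsilon> * n)\<close> is a loss U powr \<epsilon> in the length U of the
  sum. Averages over the finite group of polynomial phases take the place of integrals over a
  torus.\<close>

definition e :: "real \<Rightarrow> complex" where
  "e x = cis (2 * pi * x)"

lemma e_add: "e (x + y) = e x * e y"
  by (simp add: e_def cis_mult distrib_left)

lemma e_0 [simp]: "e 0 = 1"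
  by (simp add: e_def)

lemma norm_e [simp]: "cmod (e x) = 1"
  by (simp add: e_def)

lemma e_of_int [simp]: "e (of_int n) = 1"
  by (simp add: e_def cis_multiple_2pi)

lemma e_add_int [simp]: "e (x + of_int n) = e x"
  by (simp add: e_add)

lemma e_minus: "e (- x) = cnj (e x)"
  by (simp add: e_def cis_cnj)

lemma e_diff: "e (x - y) = e x * cnj (e y)"
  using e_add[of x "-y"] by (simp add: e_minus)

lemma e_power: "e x ^ n = e (of_nat n * x)"
  by (induction n) (simp_all add: e_add distrib_right)

lemma e_sum: "e (\<Sum>i\<in>A. g i) = (\<Prod>i\<in>A. e (g i))"
  by (induction A rule: infinite_finite_induct) (auto simp: e_add)

lemma e_eqI: "x - y \<in> \<int> \<Longrightarrow> e x = e y"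
  by (metis Ints_cases add_diff_cancel_left' diff_add_cancel e_add_int)

lemma e_eq_1D:
  assumes "e x = 1" shows "x \<in> \<int>"
proof -
  obtain n :: int where "2 * pi * x = of_int (2 * n) * pi"
    using assms by (auto simp: e_def cis_conv_exp exp_eq_1)
  then have "x = of_int n" by simp
  then show ?thesis by simp
qed

lemma mult_cnj_unit: "cmod z = 1 \<Longrightarrow> z * cnj z = 1"
  by (simp add: complex_norm_square[symmetric])

section \<open>Finite averages\<close>

definition av :: "'a set \<Rightarrow> ('a \<Rightarrow> real) \<Rightarrow> real" where
  "av G F = (\<Sum>x\<in>G. F x) / card G"

lemma av_cong: "(\<And>x. x \<in> G \<Longrightarrow> F x = F' x) \<Longrightarrow> av G F = av G F'"
  by (simp add: av_def)

lemma av_mono: "(\<And>x. x \<in> G \<Longrightarrow> F x \<le> F' x) \<Longrightarrow> av G F \<le> av G F'"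
  by (simp add: av_def divide_right_mono sum_mono)

lemma av_nonneg: "(\<And>x. x \<in> G \<Longrightarrow> 0 \<le> F x) \<Longrightarrow> 0 \<le> av G F"
  by (simp add: av_def sum_nonneg)

lemma av_add: "av G (\<lambda>x. F x + F' x) = av G F + av G F'"
  by (simp add: av_def sum.distrib add_divide_distrib)

lemma av_sum: "av G (\<lambda>x. \<Sum>i\<in>I. F i x) = (\<Sum>i\<in>I. av G (F i))"
  unfolding av_def by (subst sum.swap) (simp add: sum_divide_distrib)

lemma av_cmult: "av G (\<lambda>x. c * F x) = c * av G F"
  by (simp add: av_def sum_distrib_left)

lemma av_const: "finite G \<Longrightarrow> G \<noteq> {} \<Longrightarrow> av G (\<lambda>x. c) = c"
  by (simp add: av_def)

lemma av_eq_0D: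
  assumes "finite G" "av G F = 0" "\<And>x. x \<in> G \<Longrightarrow> 0 \<le> F x" "x \<in> G"
  shows "F x = 0"
proof -
  have "G \<noteq> {}" using assms by auto
  then have "(\<Sum>x\<in>G. F x) = 0" using assms(1,2) by (simp add: av_def)
  then show ?thesis using assms by (simp add: sum_nonneg_eq_0_iff)
qed

section \<open>Hoelder's inequality for finite sums and averages\<close>

lemma powr_AM_GM:
  fixes x y t :: real
  assumes "0 \<le> x" "0 \<le> y" "0 \<le> t" "t \<le> 1"
  shows "x powr t * y powr (1 - t) \<le> t * x + (1 - t) * y"
proof (cases "x = 0 \<or> y = 0")
  case True
  then show ?thesis using assms by auto
next
  case False
  then show ?thesis
    using Youngs_inequality_0[of t "1 - t" x y] assms by simp
qed

text \<open>After both sums are normalised to 1 this is the weighted AM-GM inequality applied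
  termwise. The exponents t and 1 - t on nonnegative functions, instead of norms with dual
  exponents, let the bilinear interpolation below use it without taking roots.\<close>

lemma sum_Holder:
  fixes F H :: "'a \<Rightarrow> real"
  assumes t: "0 \<le> t" "t \<le> 1"
    and F: "\<And>x. x \<in> G \<Longrightarrow> 0 \<le> F x" and H: "\<And>x. x \<in> G \<Longrightarrow> 0 \<le> H x"
  shows "(\<Sum>x\<in>G. F x powr t * H x powr (1 - t))
    \<le> (\<Sum>x\<in>G. F x) powr t * (\<Sum>x\<in>G. H x) powr (1 - t)"
proof (cases "finite G")
  case fin: True
  define f where "f = (\<Sum>x\<in>G. F x)"
  define h where "h = (\<Sum>x\<in>G. H x)"
  have f0: "f \<ge> 0" and h0: "h \<ge> 0" using F H by (auto simp: f_def h_def sum_nonneg)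
  show ?thesis
  proof (cases "f = 0 \<or> h = 0")
    case True
    then have "\<And>x. x \<in> G \<Longrightarrow> F x = 0 \<or> H x = 0"
      using F H fin by (auto simp: f_def h_def sum_nonneg_eq_0_iff)
    then have "(\<Sum>x\<in>G. F x powr t * H x powr (1 - t)) = 0"
      by (intro sum.neutral) auto
    then show ?thesis by simp
  next
    case False
    then have fp: "f > 0" and hp: "h > 0" using f0 h0 by auto
    have "(\<Sum>x\<in>G. F x powr t * H x powr (1 - t)) =
      f powr t * h powr (1 - t) * (\<Sum>x\<in>G. (F x / f) powr t * (H x / h) powr (1 - t))"
      unfolding sum_distrib_left
      by (intro sum.cong refl) (use F H fp hp in \<open>simp add: powr_divide\<close>)
    also have "\<dots> \<le> f powr t * h powr (1 - t) * (\<Sum>x\<in>G. t * (F x / f) + (1 - t) * (H x / h))"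
      by (intro mult_left_mono sum_mono powr_AM_GM) (use F H fp hp t in auto)
    also have "(\<Sum>x\<in>G. t * (F x / f) + (1 - t) * (H x / h)) = t * (f / f) + (1 - t) * (h / h)"
      unfolding sum.distrib f_def h_def
      by (simp only: sum_distrib_left[symmetric] sum_divide_distrib[symmetric])
    also have "\<dots> = 1" using fp hp by simp
    finally show ?thesis by (simp add: f_def h_def)
  qed
qed auto

lemma av_Holder:
  fixes F H :: "'a \<Rightarrow> real"
  assumes t: "0 \<le> t" "t \<le> 1"
    and F: "\<And>x. x \<in> G \<Longrightarrow> 0 \<le> F x" and H: "\<And>x. x \<in> G \<Longrightarrow> 0 \<le> H x"
  shows "av G (\<lambda>x. F x powr t * H x powr (1 - t)) \<le> av G F powr t * av G H powr (1 - t)"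
proof (cases "card G = 0")
  case False
  have "av G (\<lambda>x. F x powr t * H x powr (1 - t))
    \<le> ((\<Sum>x\<in>G. F x) powr t * (\<Sum>x\<in>G. H x) powr (1 - t)) / card G"
    unfolding av_def by (intro divide_right_mono sum_Holder assms) auto
  also have "real (card G) = real (card G) powr t * real (card G) powr (1 - t)"
    using False by (simp flip: powr_add)
  also have "((\<Sum>x\<in>G. F x) powr t * (\<Sum>x\<in>G. H x) powr (1 - t)) / \<dots> =
    av G F powr t * av G H powr (1 - t)"
    unfolding av_def using F H by (simp add: powr_divide sum_nonneg)
  finally show ?thesis .
qed (auto simp: av_def)

lemma sum_powr_le:
  fixes F :: "'a \<Rightarrow> real"
  assumes t: "0 \<le> t" "t \<le> 1" and F: "\<And>x. x \<in> G \<Longrightarrow> 0 \<le> F x"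
  shows "(\<Sum>x\<in>G. F x powr t) \<le> (\<Sum>x\<in>G. F x) powr t * real (card G) powr (1 - t)"
  using sum_Holder[OF t, of G F "\<lambda>_. 1"] F by simp

text \<open>The power mean inequality: Hoelder with exponent 1/n applied to the n-th powers, the
  second factor being constant.\<close>

lemma sum_power_le:
  fixes F :: "'a \<Rightarrow> real"
  assumes F: "\<And>x. x \<in> G \<Longrightarrow> 0 \<le> F x" and n: "n > 0"
  shows "(\<Sum>x\<in>G. F x) ^ n \<le> real (card G) ^ (n - 1) * (\<Sum>x\<in>G. F x ^ n)"
proof -
  define S where "S = (\<Sum>x\<in>G. F x ^ n)"
  have S0: "S \<ge> 0" unfolding S_def using F by (simp add: sum_nonneg)
  have "(\<Sum>x\<in>G. F x) = (\<Sum>x\<in>G. (F x ^ n) powr (1 / n))"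
    by (intro sum.cong refl) (use F n in \<open>auto simp: root_powr_inverse[symmetric] real_root_power_cancel powr_powr simp flip: powr_realpow'\<close>)
  also have "\<dots> \<le> S powr (1 / n) * real (card G) powr (1 - 1 / n)"
    unfolding S_def by (intro sum_powr_le) (use F n in auto)
  finally have "(\<Sum>x\<in>G. F x) ^ n \<le> (S powr (1 / n) * real (card G) powr (1 - 1 / n)) ^ n"
    by (intro power_mono sum_nonneg F)
  also have "\<dots> = S * real (card G) ^ (n - 1)"
  proof (cases "card G = 0")
    case True
    then have "S = 0" unfolding S_def by (auto simp: card_eq_0_iff)
    then show ?thesis using n by simp
  next
    case False
    have "(S powr (1 / n)) ^ n = S"
      using S0 n by (cases "S = 0") (auto simp: powr_powr simp flip: powr_realpow)
    moreover have "(real (card G) powr (1 - 1 / n)) ^ n = real (card G) powr (real n - 1)"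
      using False n by (simp add: powr_powr left_diff_distrib flip: powr_realpow)
    moreover have "real (card G) powr (real n - 1) = real (card G) ^ (n - 1)"
      using False n by (subst powr_realpow[symmetric]) (auto simp: of_nat_diff)
    ultimately show ?thesis by (simp add: power_mult_distrib)
  qed
  finally show ?thesis by (simp add: S_def mult.commute)
qed

section \<open>Exponential sums over the groups of polynomial phases\<close>

text \<open>Phases are functions on the integers rather than coefficient vectors, so that
  polynomials inducing the same phase are identified. Under pointwise multiplication they form a
  finite abelian group; averaging over it is the integral over the coefficients, discretised at
  denominator \<open>P ^ M\<close>.\<close>

definition phases :: "nat \<Rightarrow> nat \<Rightarrow> nat \<Rightarrow> (int \<Rightarrow> complex) set" where
  "phases P k M = {\<xi>. \<exists>q :: int poly. degree q \<le> k \<and> \<xi> = (\<lambda>x. e (of_int (poly q x) / real P ^ M))}"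

definition expsum :: "(int \<Rightarrow> complex) \<Rightarrow> int set \<Rightarrow> (int \<Rightarrow> complex) \<Rightarrow> complex" where
  "expsum a X \<xi> = (\<Sum>x\<in>X. a x * \<xi> x)"

definition rclass :: "nat \<Rightarrow> int set \<Rightarrow> nat \<Rightarrow> int \<Rightarrow> int set" where
  "rclass P X n i = {x \<in> X. x mod int P ^ n = i}"

lemma phasesI: "degree q \<le> k \<Longrightarrow> (\<lambda>x. e (of_int (poly q x) / real P ^ M)) \<in> phases P k M"
  by (auto simp: phases_def)

lemma phases_mult:
  assumes "\<xi> \<in> phases P k M" "\<psi> \<in> phases P k M"
  shows "(\<lambda>x. \<xi> x * \<psi> x) \<in> phases P k M"
proof -
  obtain q q' where "degree q \<le> k" "\<xi> = (\<lambda>x. e (of_int (poly q x) / real P ^ M))"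
    "degree q' \<le> k" "\<psi> = (\<lambda>x. e (of_int (poly q' x) / real P ^ M))"
    using assms by (auto simp: phases_def)
  then have "(\<lambda>x. \<xi> x * \<psi> x) = (\<lambda>x. e (of_int (poly (q + q') x) / real P ^ M))" "degree (q + q') \<le> k"
    by (auto simp: e_add add_divide_distrib degree_add_le)
  then show ?thesis by (auto simp: phases_def)
qed

lemma norm_phases: "\<xi> \<in> phases P k M \<Longrightarrow> cmod (\<xi> x) = 1"
  by (auto simp: phases_def)

lemma phases_nonempty: "phases P k M \<noteq> {}"
  using phasesI[of 0 k] by fastforce

lemma e_poly_cong:
  assumes "P > 0" "\<And>i. [coeff q i = coeff q' i] (mod (int P ^ M))"
  shows "e (of_int (poly q x) / real P ^ M) = e (of_int (poly q' x) / real P ^ M)"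
proof -
  have "[:int P ^ M:] dvd q - q'"
    using assms(2) by (simp add: const_poly_dvd_iff cong_iff_dvd_diff)
  then obtain s where "q - q' = [:int P ^ M:] * s" by (auto simp: dvd_def)
  then have "poly q x - poly q' x = int P ^ M * poly s x"
    by (metis poly_diff poly_mult poly_pCons poly_0 mult_zero_right add_0_right)
  then have "real_of_int (poly q x) - of_int (poly q' x) = real P ^ M * of_int (poly s x)"
    by (metis of_int_diff of_int_mult of_int_of_nat_eq of_int_power)
  then have "of_int (poly q x) / real P ^ M - of_int (poly q' x) / real P ^ M = of_int (poly s x)"
    using assms(1) by (simp add: field_simps)
  then show ?thesis by (intro e_eqI) simp
qed

lemma finite_phases: "finite (phases P k M)" if "P > 0"
proof -
  define A where "A = Poly ` {xs :: int list. set xs \<subseteq> {0..<int P ^ M} \<and> length xs = k + 1}"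
  have "finite A" unfolding A_def by (intro finite_imageI finite_lists_length_eq) auto
  moreover have "phases P k M \<subseteq> (\<lambda>q x. e (of_int (poly q x) / real P ^ M)) ` A"
  proof
    fix \<xi> assume "\<xi> \<in> phases P k M"
    then obtain q where q: "degree q \<le> k" "\<xi> = (\<lambda>x. e (of_int (poly q x) / real P ^ M))"
      by (auto simp: phases_def)
    define xs where "xs = map (\<lambda>i. coeff q i mod int P ^ M) [0..<k + 1]"
    have "Poly xs \<in> A"
      unfolding A_def by (intro imageI) (use that in \<open>auto simp: xs_def\<close>)
    moreover have "\<xi> = (\<lambda>x. e (of_int (poly (Poly xs) x) / real P ^ M))"
      unfolding q(2)
    proof (rule ext, rule e_poly_cong[OF that])
      fix i show "[coeff q i = coeff (Poly xs) i] (mod (int P ^ M))"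
        using q(1) by (cases "i < k + 1")
          (auto simp: xs_def nth_default_def coeff_eq_0 cong_def simp del: upt_Suc)
    qed
    ultimately show "\<xi> \<in> (\<lambda>q x. e (of_int (poly q x) / real P ^ M)) ` A" by auto
  qed
  ultimately show ?thesis using finite_surj by blast
qed

text \<open>Multiplication by a fixed phase is injective, because phases never vanish, and maps the
  finite group into itself; hence it permutes the group.\<close>

lemma av_phases_shift:
  assumes "P > 0" "\<psi> \<in> phases P k M"
  shows "av (phases P k M) (\<lambda>\<xi>. F (\<lambda>x. \<xi> x * \<psi> x)) = av (phases P k M) F"
proof -
  let ?m = "\<lambda>\<xi> x. \<xi> x * \<psi> x :: complex"
  have "\<And>x. \<psi> x \<noteq> 0" using norm_phases[OF assms(2)] by (metis norm_zero zero_neq_one)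
  then have inj: "inj_on ?m (phases P k M)"
    by (intro inj_onI) (auto simp: fun_eq_iff)
  have "?m ` phases P k M \<subseteq> phases P k M" using phases_mult assms(2) by auto
  then have "?m ` phases P k M = phases P k M"
    using inj finite_phases[OF assms(1)] by (intro endo_inj_surj)
  then have "(\<Sum>\<xi>\<in>phases P k M. F (?m \<xi>)) = (\<Sum>\<xi>\<in>phases P k M. F \<xi>)"
    using sum.reindex[OF inj, of F] by (simp add: o_def)
  then show ?thesis by (simp add: av_def)
qed

text \<open>By translation invariance a further average over any finite family of shifts may be
  inserted. The family need be neither a subgroup nor injectively indexed, so no quotient of the
  group has to be formed.\<close>

lemma av_phases_double:
  assumes "P > 0" "finite S" "S \<noteq> {}" "\<And>u. u \<in> S \<Longrightarrow> s u \<in> phases P k M"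
  shows "av (phases P k M) F = av (phases P k M) (\<lambda>\<xi>. av S (\<lambda>u. F (\<lambda>x. \<xi> x * s u x)))"
proof -
  have "av (phases P k M) (\<lambda>\<xi>. av S (\<lambda>u. F (\<lambda>x. \<xi> x * s u x))) =
    av S (\<lambda>u. av (phases P k M) (\<lambda>\<xi>. F (\<lambda>x. \<xi> x * s u x)))"
    unfolding av_def by (subst sum_divide_distrib[symmetric], subst sum.swap)
      (simp add: sum_divide_distrib mult.commute)
  also have "\<dots> = av S (\<lambda>u. av (phases P k M) F)"
    by (intro av_cong av_phases_shift assms)
  finally show ?thesis using av_const assms by metis
qed

lemma finite_rclass [simp]: "finite X \<Longrightarrow> finite (rclass P X n i)"
  by (simp add: rclass_def)

lemma rclass_0 [simp]: "rclass P X 0 0 = X"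
  by (auto simp: rclass_def)

lemma mod_power_mod:
  fixes x :: int shows "A \<le> B \<Longrightarrow> x mod int P ^ B mod int P ^ A = x mod int P ^ A"
  by (meson le_imp_power_dvd mod_mod_cancel)

lemma expsum_split:
  assumes "P > 0" "finite X" "A \<le> B"
  shows "expsum a (rclass P X A i) \<xi> =
    (\<Sum>j | j \<in> {0..<int P ^ B} \<and> j mod int P ^ A = i. expsum a (rclass P X B j) \<xi>)"
proof -
  let ?J = "{j. j \<in> {0..<int P ^ B} \<and> j mod int P ^ A = i}"
  have "rclass P X A i = (\<Union>j\<in>?J. rclass P X B j)"
    using assms by (auto simp: rclass_def mod_power_mod)
  then show ?thesis unfolding expsum_def
    using assms by (subst sum.UNION_disjoint[symmetric]) (auto simp: rclass_def intro: finite_subset[of _ "{0..<int P ^ B}"])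
qed

lemma residues_eq_image:
  assumes "P > 0" "i \<in> {0..<int P ^ A}"
  shows "{j. j \<in> {0..<int P ^ (A + c)} \<and> j mod int P ^ A = i} = (\<lambda>t. i + int P ^ A * t) ` {0..<int P ^ c}"
proof safe
  fix j assume j: "j \<in> {0..<int P ^ (A + c)}" "i = j mod int P ^ A"
  then have "j = j mod int P ^ A + int P ^ A * (j div int P ^ A)" by simp
  moreover have "j div int P ^ A \<in> {0..<int P ^ c}"
  proof -
    have "int P ^ A * (j div int P ^ A) \<le> j"
      using mult_div_mod_eq[of "int P ^ A" j] assms(2) j(2) unfolding atLeastLessThan_iff by linarith
    also have "j < int P ^ A * int P ^ c" using j by (simp add: power_add)
    finally show ?thesis using j assms by (auto simp: pos_imp_zdiv_nonneg_iff)
  qed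
  ultimately show "j \<in> (\<lambda>t. j mod int P ^ A + int P ^ A * t) ` {0..<int P ^ c}" by blast
next
  fix t :: int assume t: "t \<in> {0..<int P ^ c}"
  have "int P ^ A * t + i < int P ^ A * t + int P ^ A" using assms by auto
  also have "\<dots> = int P ^ A * (t + 1)" by (simp add: algebra_simps)
  also have "\<dots> \<le> int P ^ A * int P ^ c" using t assms by (intro mult_left_mono) auto
  finally show "i + int P ^ A * t \<in> {0..<int P ^ (A + c)}" using t assms by (auto simp: power_add)
  show "(i + int P ^ A * t) mod int P ^ A = i" using assms by simp
qed

lemma card_residues:
  assumes "P > 0" "i \<in> {0..<int P ^ A}" "A \<le> B"
  shows "card {j. j \<in> {0..<int P ^ B} \<and> j mod int P ^ A = i} = P ^ (B - A)"
proof -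
  have inj: "inj_on (\<lambda>t. i + int P ^ A * t) {0..<int P ^ (B - A)}"
    using assms by (intro inj_onI) auto
  show ?thesis
    using residues_eq_image[OF assms(1,2), of "B - A"] assms(3) card_image[OF inj] by simp
      (metis nat_int of_nat_power)
qed

section \<open>Decoupling constants\<close>

text \<open>\<open>2 * tri k\<close> is the critical exponent of the moment curve of degree k, and
  \<open>tri k\<close> is the sum of the degrees 1, ..., k.\<close>

definition tri :: "nat \<Rightarrow> nat" where
  "tri k = k * (k + 1) div 2"

text \<open>Decoupling into the \<open>P ^ n\<close> residue classes modulo \<open>P ^ n\<close> at
  the critical exponent p = 2 tri k. The power \<open>P ^ (n * (tri k - 1))\<close> is N^(p/2 - 1)
  with N = P^n, the cost of passing from a square function to a sum of p-th powers, so
  \<open>D\<close> measures only the genuine loss. Arbitrary coefficients and supports are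
  quantified, since the inequality is later applied to coefficients already twisted by other phases.
  On a class modulo \<open>P ^ n\<close> phases of degree k become constant up to this point exactly
  at denominator \<open>P ^ (k * n)\<close> after rescaling, which fixes the group.\<close>

definition Dec :: "nat \<Rightarrow> nat \<Rightarrow> nat \<Rightarrow> real \<Rightarrow> bool" where
  "Dec P k n D \<longleftrightarrow> (\<forall>a X. finite X \<longrightarrow>
     av (phases P k (k * n)) (\<lambda>\<xi>. cmod (expsum a X \<xi>) ^ (2 * tri k)) \<le>
     D * real P ^ (n * (tri k - 1)) * (\<Sum>j\<in>{0..<int P ^ n}.
       av (phases P k (k * n)) (\<lambda>\<xi>. cmod (expsum a (rclass P X n j) \<xi>) ^ (2 * tri k))))"

lemma DecD:
  assumes "Dec P k n D" "finite X"
  shows "av (phases P k (k * n)) (\<lambda>\<xi>. cmod (expsum a X \<xi>) ^ (2 * tri k)) \<le>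
     D * real P ^ (n * (tri k - 1)) * (\<Sum>j\<in>{0..<int P ^ n}.
       av (phases P k (k * n)) (\<lambda>\<xi>. cmod (expsum a (rclass P X n j) \<xi>) ^ (2 * tri k)))"
  using assms unfolding Dec_def by blast

lemma two_tri: "2 * tri k = k * (k + 1)"
  unfolding tri_def by simp

lemma real_tri: "real (tri k) = real k * (real k + 1) / 2"
  using two_tri[of k] by (metis nonzero_mult_div_cancel_left of_nat_1 of_nat_add of_nat_mult of_nat_numeral zero_neq_numeral)

lemma tri_mono: "l \<le> k \<Longrightarrow> tri l \<le> tri k"
  unfolding tri_def by (intro div_le_mono mult_le_mono) auto

lemma tri_pos: "k > 0 \<Longrightarrow> tri k > 0"
  using two_tri[of k] by (cases "tri k") auto

lemma Dec_mono: "Dec P k n D \<Longrightarrow> D \<le> D' \<Longrightarrow> Dec P k n D'"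
  unfolding Dec_def
  by (smt (verit, ccfv_SIG) av_nonneg mult_right_mono norm_ge_zero of_nat_0_le_iff sum_nonneg zero_le_power)

text \<open>The power mean inequality over the \<open>P ^ n\<close> classes costs
  \<open>P ^ (n * (2 * tri k - 1))\<close>; dividing by the normalisation of \<open>Dec\<close>
  leaves the stated constant. It starts the descent of the exponent and covers small n.\<close>

lemma Dec_trivial:
  assumes "P > 0" "k > 0"
  shows "Dec P k n (real P ^ (n * tri k))"
  unfolding Dec_def
proof (intro allI impI)
  fix a and X :: "int set" assume X: "finite X"
  let ?K = "tri k" and ?G = "phases P k (k * n)"
  have K: "?K > 0" using tri_pos assms by auto
  have "cmod (expsum a X \<xi>) ^ (2 * ?K) \<le>
      real P ^ (n * (2 * ?K - 1)) * (\<Sum>j\<in>{0..<int P ^ n}. cmod (expsum a (rclass P X n j) \<xi>) ^ (2 * ?K))" for \<xi>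
  proof -
    have "expsum a X \<xi> = (\<Sum>j\<in>{0..<int P ^ n}. expsum a (rclass P X n j) \<xi>)"
      using expsum_split[OF assms(1) X, of 0 n a 0 \<xi>] by (simp add: atLeastLessThan_def Int_def)
    then have "cmod (expsum a X \<xi>) \<le> (\<Sum>j\<in>{0..<int P ^ n}. cmod (expsum a (rclass P X n j) \<xi>))"
      by (simp add: norm_sum)
    then have "cmod (expsum a X \<xi>) ^ (2 * ?K) \<le> (\<Sum>j\<in>{0..<int P ^ n}. cmod (expsum a (rclass P X n j) \<xi>)) ^ (2 * ?K)"
      by (intro power_mono) auto
    also have "\<dots> \<le> real (card {0..<int P ^ n}) ^ (2 * ?K - 1) * (\<Sum>j\<in>{0..<int P ^ n}. cmod (expsum a (rclass P X n j) \<xi>) ^ (2 * ?K))"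
      by (intro sum_power_le) (use K in auto)
    also have "real (card {0..<int P ^ n}) = real P ^ n"
      by (simp add: nat_power_eq)
    finally show ?thesis by (simp add: power_mult)
  qed
  then have "av ?G (\<lambda>\<xi>. cmod (expsum a X \<xi>) ^ (2 * ?K)) \<le>
      av ?G (\<lambda>\<xi>. real P ^ (n * (2 * ?K - 1)) * (\<Sum>j\<in>{0..<int P ^ n}. cmod (expsum a (rclass P X n j) \<xi>) ^ (2 * ?K)))"
    by (intro av_mono)
  also have "\<dots> = real P ^ (n * (2 * ?K - 1)) * (\<Sum>j\<in>{0..<int P ^ n}. av ?G (\<lambda>\<xi>. cmod (expsum a (rclass P X n j) \<xi>) ^ (2 * ?K)))"
    by (simp add: av_cmult av_sum)
  also have "n * (2 * ?K - 1) = n * ?K + n * (?K - 1)"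
    using K by (cases ?K) (simp_all add: algebra_simps)
  finally show "av ?G (\<lambda>\<xi>. cmod (expsum a X \<xi>) ^ (2 * ?K)) \<le> real P ^ (n * ?K) * real P ^ (n * (?K - 1)) *
     (\<Sum>j\<in>{0..<int P ^ n}. av ?G (\<lambda>\<xi>. cmod (expsum a (rclass P X n j) \<xi>) ^ (2 * ?K)))"
    by (simp add: power_add)
qed

text \<open>Pulling a decoupling inequality back along \<open>t \<mapsto> i + P\<^sup>A t\<close>: only the existence of
  a lift for every phase is needed, since averages over the large group absorb any shift.\<close>

lemma Dec_transfer:
  assumes P: "P > 0" and D: "Dec P l c D" and X: "finite X" and i: "i \<in> {0..<int P ^ A}"
    and W: "\<And>\<xi>. W \<xi> \<ge> 0"
    and lift: "\<And>\<psi>. \<psi> \<in> phases P l (l * c) \<Longrightarrow> \<exists>s\<in>phases P k M. \<exists>\<kappa>. cmod \<kappa> = 1 \<and>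
      (\<forall>t. s (i + int P ^ A * t) = \<kappa> * \<psi> t) \<and> (\<forall>\<xi>\<in>phases P k M. W (\<lambda>x. \<xi> x * s x) = W \<xi>)"
  shows "av (phases P k M) (\<lambda>\<xi>. cmod (expsum a (rclass P X A i) \<xi>) ^ (2 * tri l) * W \<xi>) \<le>
    D * real P ^ (c * (tri l - 1)) *
    (\<Sum>j | j \<in> {0..<int P ^ (A + c)} \<and> j mod int P ^ A = i.
       av (phases P k M) (\<lambda>\<xi>. cmod (expsum a (rclass P X (A + c) j) \<xi>) ^ (2 * tri l) * W \<xi>))"
proof -
  let ?G = "phases P k M" and ?H = "phases P l (l * c)" and ?p = "2 * tri l"
  let ?J = "{0..<int P ^ c}" and ?h = "\<lambda>t. i + int P ^ A * t"
  have "\<forall>\<psi>\<in>?H. \<exists>s\<kappa>. fst s\<kappa> \<in> ?G \<and> cmod (snd s\<kappa>) = 1 \<and>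
      (\<forall>t. fst s\<kappa> (?h t) = snd s\<kappa> * \<psi> t) \<and> (\<forall>\<xi>\<in>?G. W (\<lambda>x. \<xi> x * fst s\<kappa> x) = W \<xi>)"
    using lift by (auto simp: Bex_def)
  then obtain s\<kappa> where s\<kappa>: "\<forall>\<psi>\<in>?H. fst (s\<kappa> \<psi>) \<in> ?G \<and> cmod (snd (s\<kappa> \<psi>)) = 1 \<and>
      (\<forall>t. fst (s\<kappa> \<psi>) (?h t) = snd (s\<kappa> \<psi>) * \<psi> t) \<and>
      (\<forall>\<xi>\<in>?G. W (\<lambda>x. \<xi> x * fst (s\<kappa> \<psi>) x) = W \<xi>)"
    by (rule bchoice[THEN exE])
  define s where "s \<psi> = fst (s\<kappa> \<psi>)" for \<psi>
  define \<kappa> where "\<kappa> \<psi> = snd (s\<kappa> \<psi>)" for \<psi>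
  have s: "\<And>\<psi>. \<psi> \<in> ?H \<Longrightarrow> s \<psi> \<in> ?G" "\<And>\<psi>. \<psi> \<in> ?H \<Longrightarrow> cmod (\<kappa> \<psi>) = 1"
    "\<And>\<psi> t. \<psi> \<in> ?H \<Longrightarrow> s \<psi> (?h t) = \<kappa> \<psi> * \<psi> t"
    "\<And>\<psi> \<xi>. \<psi> \<in> ?H \<Longrightarrow> \<xi> \<in> ?G \<Longrightarrow> W (\<lambda>x. \<xi> x * s \<psi> x) = W \<xi>"
    using s\<kappa> by (auto simp: s_def \<kappa>_def)
  have inj: "inj ?h" using P by (auto simp: inj_on_def)
  define Y where "Y = ?h -` X"
  have Y: "finite Y" unfolding Y_def by (intro finite_vimageI X inj)
  have cls: "rclass P X (A + b) (?h t) = ?h ` rclass P Y b t" if "t \<in> {0..<int P ^ b}" for t b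
  proof safe
    fix x assume x: "x \<in> rclass P X (A + b) (?h t)"
    then have "x = ?h t + int P ^ (A + b) * (x div int P ^ (A + b))"
      using mod_mult_div_eq[of x "int P ^ (A + b)"] by (simp add: rclass_def)
    then have "x = ?h (t + int P ^ b * (x div int P ^ (A + b)))"
      by (simp add: power_add algebra_simps)
    moreover have "t + int P ^ b * (x div int P ^ (A + b)) \<in> rclass P Y b t"
      using x that calculation by (auto simp: rclass_def Y_def)
    ultimately show "x \<in> ?h ` rclass P Y b t" by blast
  next
    fix u assume u: "u \<in> rclass P Y b t"
    then have "t = u mod int P ^ b" by (simp add: rclass_def)
    then obtain w where w: "u = t + int P ^ b * w" by (metis mod_mult_div_eq)
    have "?h u = ?h t + int P ^ (A + b) * w"
      unfolding w by (simp add: power_add algebra_simps)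
    moreover have "?h t \<in> {0..<int P ^ (A + b)}"
      using residues_eq_image[OF P i, of b] that by blast
    ultimately have "?h u mod int P ^ (A + b) = ?h t"
      by (metis atLeastLessThan_iff mod_mult_self2 mod_pos_pos_trivial)
    then show "?h u \<in> rclass P X (A + b) (?h t)" using u by (simp add: rclass_def Y_def)
  qed
  have cls0: "rclass P X A i = ?h ` Y" using cls[of 0 0] by simp
  have es: "cmod (expsum a (?h ` Z) (\<lambda>x. \<xi> x * s \<psi> x)) = cmod (expsum (\<lambda>t. a (?h t) * \<xi> (?h t)) Z \<psi>)"
    if "\<psi> \<in> ?H" for Z \<xi> \<psi>
  proof -
    have "expsum a (?h ` Z) (\<lambda>x. \<xi> x * s \<psi> x) = \<kappa> \<psi> * expsum (\<lambda>t. a (?h t) * \<xi> (?h t)) Z \<psi>"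
      unfolding expsum_def using inj s(3)[OF that]
      by (subst sum.reindex) (auto simp: sum_distrib_left mult_ac intro: inj_on_subset sum.cong)
    then show ?thesis using s(2)[OF that] by (simp add: norm_mult)
  qed
  \<comment> \<open>The average over the large group is refined by the shifts
    \<open>s \<psi>\<close>. As \<open>W\<close> is invariant under them it leaves the inner
    average, and what remains there is an average over the small group with coefficients twisted by
    \<open>\<xi>\<close>.\<close>
  have double: "av ?G (\<lambda>\<xi>. cmod (expsum a (?h ` Z) \<xi>) ^ ?p * W \<xi>) =
    av ?G (\<lambda>\<xi>. W \<xi> * av ?H (\<lambda>\<psi>. cmod (expsum (\<lambda>t. a (?h t) * \<xi> (?h t)) Z \<psi>) ^ ?p))" for Z
  proof -
    have "av ?G (\<lambda>\<xi>. cmod (expsum a (?h ` Z) \<xi>) ^ ?p * W \<xi>) =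
      av ?G (\<lambda>\<xi>. av ?H (\<lambda>\<psi>. cmod (expsum a (?h ` Z) (\<lambda>x. \<xi> x * s \<psi> x)) ^ ?p * W (\<lambda>x. \<xi> x * s \<psi> x)))"
      by (rule av_phases_double) (use P finite_phases phases_nonempty s in auto)
    also have "\<dots> = av ?G (\<lambda>\<xi>. av ?H (\<lambda>\<psi>. W \<xi> * cmod (expsum (\<lambda>t. a (?h t) * \<xi> (?h t)) Z \<psi>) ^ ?p))"
      by (intro av_cong) (simp add: es s(4))
    finally show ?thesis by (simp add: av_cmult)
  qed
  have "av ?G (\<lambda>\<xi>. cmod (expsum a (rclass P X A i) \<xi>) ^ ?p * W \<xi>) =
    av ?G (\<lambda>\<xi>. W \<xi> * av ?H (\<lambda>\<psi>. cmod (expsum (\<lambda>t. a (?h t) * \<xi> (?h t)) Y \<psi>) ^ ?p))"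
    unfolding cls0 by (rule double)
  also have "\<dots> \<le> av ?G (\<lambda>\<xi>. W \<xi> * (D * real P ^ (c * (tri l - 1)) *
      (\<Sum>t\<in>?J. av ?H (\<lambda>\<psi>. cmod (expsum (\<lambda>t. a (?h t) * \<xi> (?h t)) (rclass P Y c t) \<psi>) ^ ?p))))"
    by (intro av_mono mult_left_mono W DecD[OF D Y])
  also have "\<dots> = D * real P ^ (c * (tri l - 1)) * (\<Sum>t\<in>?J. av ?G (\<lambda>\<xi>. W \<xi> *
      av ?H (\<lambda>\<psi>. cmod (expsum (\<lambda>t. a (?h t) * \<xi> (?h t)) (rclass P Y c t) \<psi>) ^ ?p)))"
    unfolding av_sum[symmetric] av_cmult[symmetric]
    by (intro av_cong) (simp add: sum_distrib_left mult_ac)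
  also have "(\<Sum>t\<in>?J. av ?G (\<lambda>\<xi>. W \<xi> *
      av ?H (\<lambda>\<psi>. cmod (expsum (\<lambda>t. a (?h t) * \<xi> (?h t)) (rclass P Y c t) \<psi>) ^ ?p))) =
    (\<Sum>t\<in>?J. av ?G (\<lambda>\<xi>. cmod (expsum a (rclass P X (A + c) (?h t)) \<xi>) ^ ?p * W \<xi>))"
    unfolding double[symmetric] by (intro sum.cong refl) (use cls in auto)
  also have "\<dots> = (\<Sum>j | j \<in> {0..<int P ^ (A + c)} \<and> j mod int P ^ A = i.
       av ?G (\<lambda>\<xi>. cmod (expsum a (rclass P X (A + c) j) \<xi>) ^ ?p * W \<xi>))"
    unfolding residues_eq_image[OF P i] using inj
    by (subst sum.reindex) (auto intro: inj_on_subset)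
  finally show ?thesis .
qed

text \<open>In degree one the exponent is 2 and the inequality is an identity: the linear phases m x
  / P^n distinguish the residues modulo P^n, so the pieces are orthogonal by Parseval on the cyclic
  group of order P^n.\<close>

lemma Dec_one: assumes "P > 0" shows "Dec P 1 n 1"
  unfolding Dec_def
proof (intro allI impI)
  fix a and X :: "int set" assume X: "finite X"
  let ?G = "phases P 1 (1 * n)" and ?J = "{0..<int P ^ n}"
  define N where "N = P ^ n"
  have N: "N > 0" using assms by (simp add: N_def)
  define s where "s m x = e (real_of_int (int m * x) / real P ^ n)" for m :: nat and x :: int
  have s: "s m \<in> ?G" for m
    using phasesI[of "[:0, int m:]" 1 P n] unfolding s_def by (simp add: mult.commute)
  define f where "f j \<xi> = expsum a (rclass P X n j) \<xi>" for j \<xi>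
  have f_shift: "f j (\<lambda>x. \<xi> x * s m x) = f j \<xi> * e (real_of_int (int m * j) / real N)" for j \<xi> m
  proof -
    have "s m x = e (real_of_int (int m * j) / real N)" if "x mod int P ^ n = j" for x
    proof -
      have "x = j + int P ^ n * (x div int P ^ n)" using that by (metis mod_mult_div_eq)
      then have "real_of_int x = real_of_int (j + int P ^ n * (x div int P ^ n))" by simp
      then have "real_of_int (int m * x) / real P ^ n - real_of_int (int m * j) / real N
         = of_int (int m * (x div int P ^ n))"
        using assms by (simp add: N_def field_simps)
      then show ?thesis unfolding s_def by (intro e_eqI) simp
    qed
    then show ?thesis unfolding f_def expsum_def sum_distrib_right
      by (intro sum.cong) (auto simp: rclass_def)
  qed
  have split: "expsum a X \<xi> = (\<Sum>j\<in>?J. f j \<xi>)" for \<xi>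
    using expsum_split[OF assms X, of 0 n a 0 \<xi>] by (simp add: f_def atLeastLessThan_def Int_def)
  have parseval: "av {..<N} (\<lambda>m. cmod (\<Sum>j\<in>?J. z j * e (real_of_int (int m * j) / real N)) ^ 2)
     = (\<Sum>j\<in>?J. cmod (z j) ^ 2)" for z :: "int \<Rightarrow> complex"
  proof -
    let ?E = "\<lambda>m j. e (real_of_int (int m * j) / real N)"
    have orth: "(\<Sum>m<N. ?E m j * cnj (?E m j')) = (if j = j' then of_nat N else 0)"
      if "j \<in> ?J" "j' \<in> ?J" for j j'
    proof -
      define w where "w = e (real_of_int (j - j') / real N)"
      have "(\<Sum>m<N. ?E m j * cnj (?E m j')) = (\<Sum>m<N. w ^ m)"
        unfolding w_def e_power e_diff[symmetric] by (intro sum.cong refl arg_cong[of _ _ e]) (simp add: field_simps)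
      also have "\<dots> = (if j = j' then of_nat N else 0)"
      proof (cases "j = j'")
        case False
        have "w \<noteq> 1"
        proof
          assume "w = 1"
          then obtain t :: int where "real_of_int (j - j') / real N = of_int t"
            unfolding w_def by (auto dest!: e_eq_1D elim: Ints_cases)
          then have "real_of_int (j - j') = real_of_int (t * int N)" using N by (simp add: field_simps)
          then have "j - j' = t * int N" using of_int_eq_iff by blast
          moreover have "\<bar>j - j'\<bar> < int N" using that by (auto simp: N_def)
          ultimately have "\<bar>t\<bar> * int N < 1 * int N" by (simp add: abs_mult)
          then have "t = 0" using N by (subst (asm) mult_less_cancel_right) auto
          then show False using False \<open>j - j' = t * int N\<close> by simp
        qed
        moreover have "w ^ N = 1" unfolding w_def e_power using N e_of_int[of "j - j'"] by simp
        ultimately show ?thesis using False by (simp add: sum_gp_strict)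
      qed (simp add: w_def)
      finally show ?thesis .
    qed
    have "complex_of_real (\<Sum>m<N. cmod (\<Sum>j\<in>?J. z j * ?E m j) ^ 2) =
      (\<Sum>m<N. (\<Sum>j\<in>?J. \<Sum>j'\<in>?J. (z j * cnj (z j')) * (?E m j * cnj (?E m j'))))"
      by (simp add: complex_norm_square sum_product mult_ac del: of_real_power)
    also have "\<dots> = (\<Sum>j\<in>?J. \<Sum>j'\<in>?J. (z j * cnj (z j')) * (\<Sum>m<N. ?E m j * cnj (?E m j')))"
      unfolding sum_distrib_left by (subst sum.swap, intro sum.cong refl, subst sum.swap) simp
    also have "\<dots> = (\<Sum>j\<in>?J. (z j * cnj (z j)) * of_nat N)"
    proof (intro sum.cong refl)
      fix j assume j: "j \<in> ?J"
      have "(\<Sum>j'\<in>?J. (z j * cnj (z j')) * (\<Sum>m<N. ?E m j * cnj (?E m j'))) =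
        (\<Sum>j'\<in>?J. if j' = j then z j * cnj (z j') * of_nat N else 0)"
        by (intro sum.cong refl, subst orth) (use j in auto)
      then show "(\<Sum>j'\<in>?J. (z j * cnj (z j')) * (\<Sum>m<N. ?E m j * cnj (?E m j'))) =
        (z j * cnj (z j)) * of_nat N"
        using j by simp
    qed
    also have "\<dots> = complex_of_real (N * (\<Sum>j\<in>?J. cmod (z j) ^ 2))"
      by (simp add: complex_norm_square sum_distrib_left mult_ac del: of_real_power)
    finally have "(\<Sum>m<N. cmod (\<Sum>j\<in>?J. z j * ?E m j) ^ 2) = N * (\<Sum>j\<in>?J. cmod (z j) ^ 2)"
      using of_real_eq_iff by blast
    then show ?thesis using N by (simp add: av_def)
  qed
  have "av ?G (\<lambda>\<xi>. cmod (expsum a X \<xi>) ^ 2) = av ?G (\<lambda>\<xi>. av {..<N} (\<lambda>m. cmod (expsum a X (\<lambda>x. \<xi> x * s m x)) ^ 2))"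
    by (rule av_phases_double) (use assms N s in auto)
  also have "\<dots> = av ?G (\<lambda>\<xi>. \<Sum>j\<in>?J. cmod (f j \<xi>) ^ 2)"
    unfolding split f_shift parseval ..
  finally have "av ?G (\<lambda>\<xi>. cmod (expsum a X \<xi>) ^ 2) = (\<Sum>j\<in>?J. av ?G (\<lambda>\<xi>. cmod (f j \<xi>) ^ 2))"
    by (simp add: av_sum)
  then show "av ?G (\<lambda>\<xi>. cmod (expsum a X \<xi>) ^ (2 * tri 1)) \<le> 1 * real P ^ (n * (tri 1 - 1)) *
     (\<Sum>j\<in>?J. av ?G (\<lambda>\<xi>. cmod (expsum a (rclass P X n j) \<xi>) ^ (2 * tri 1)))"
    by (simp add: tri_def f_def)
qed

section \<open>Polynomials with a prescribed jet at one point that are flat at another\<close>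

lemma cong_linear_solvable:
  fixes u N b :: int
  assumes "coprime u N"
  shows "\<exists>c. [u * c = b] (mod N)"
proof -
  obtain v where "[u * v = 1] (mod N)" using assms cong_solve_coprime_int by blast
  then have "[u * v * b = 1 * b] (mod N)" by (intro cong_mult cong_refl)
  then show ?thesis by (intro exI[of _ "v * b"]) (simp add: mult.assoc)
qed

text \<open>Division of power series modulo X^l: the constant coefficient of \<open>Y\<close> is a
  unit modulo \<open>N\<close>, so the coefficients of the quotient are found one after
  another.\<close>

lemma poly_mult_jet_solvable:
  fixes Y :: "int poly" and g :: "nat \<Rightarrow> int"
  assumes "coprime (coeff Y 0) N"
  shows "\<exists>W. (\<forall>m\<ge>l. coeff W m = 0) \<and> (\<forall>m<l. [coeff (Y * W) m = g m] (mod N))"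
proof (induction l)
  case (Suc l)
  then obtain W where W: "\<forall>m\<ge>l. coeff W m = 0" "\<forall>m<l. [coeff (Y * W) m = g m] (mod N)"
    by auto
  obtain c where c: "[coeff Y 0 * c = g l - coeff (Y * W) l] (mod N)"
    using cong_linear_solvable[OF assms] by blast
  define W' where "W' = W + monom c l"
  have co: "coeff (Y * W') m = coeff (Y * W) m + (if m < l then 0 else coeff Y (m - l) * c)" for m
  proof -
    have "Y * W' = Y * W + monom c l * Y" by (simp add: W'_def algebra_simps)
    then show ?thesis by (simp only: coeff_add coeff_monom_mult) (simp add: mult.commute)
  qed
  have "[coeff (Y * W') m = g m] (mod N)" if "m < Suc l" for m
  proof (cases "m = l")
    case True
    then show ?thesis using cong_add[OF cong_refl[of "coeff (Y * W) l"] c] by (simp add: co)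
  next
    case False
    then show ?thesis using that W(2) by (simp add: co)
  qed
  moreover have "coeff W' m = 0" if "m \<ge> Suc l" for m
    using that W(1) by (simp add: W'_def)
  ultimately show ?case by blast
qed (intro exI[of _ 0]; simp)

text \<open>Polynomials of degree at most \<open>k\<close> that are flat to order \<open>k - l\<close> at \<open>0\<close> realise every
  \<open>l\<close>-jet (modulo constants) at a unit \<open>y\<close>: one solves for the derivative, which must be
  divisible by \<open>X\<^sup>k\<^sup>-\<^sup>l\<close>, and integrates; \<open>k < P\<close> makes the denominators units.\<close>

lemma flat_poly_jet_solvable:
  fixes y :: int and E :: "nat \<Rightarrow> int"
  assumes P: "prime P" and k: "k < P" and l: "1 \<le> l" "l \<le> k" and y: "coprime y (int P)"
  shows "\<exists>Q. degree Q \<le> k \<and> (\<forall>i\<le>k - l. coeff Q i = 0) \<and>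
    (\<forall>m\<in>{1..l}. [coeff (Q \<circ>\<^sub>p [:y, 1:]) m = E m] (mod (int P ^ R)))"
proof -
  let ?N = "int P ^ R"
  have cop: "coprime (int j) ?N" if "0 < j" "j \<le> k" for j
    using that k P by (metis coprime_commute coprime_power_right_iff coprime_int_iff le_less_trans linorder_not_less
        nat_dvd_not_less prime_imp_coprime)
  define Y where "Y = [:y, 1:] ^ (k - l)"
  have "coeff Y 0 = y ^ (k - l)" by (simp add: Y_def coeff_0_power)
  then have "coprime (coeff Y 0) ?N" using y by simp
  then obtain W where W: "\<forall>m\<ge>l. coeff W m = 0"
    "\<forall>m<l. [coeff (Y * W) m = int (m + 1) * E (m + 1)] (mod ?N)"
    using poly_mult_jet_solvable[of Y ?N l "\<lambda>m. int (m + 1) * E (m + 1)"] by auto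
  \<comment> \<open>The candidate for the derivative of \<open>Q\<close>: the factor X^(k - l) makes
    \<open>Q\<close> flat at 0, and since \<open>Y\<close> is that factor expanded at y, the
    expansion of \<open>D\<close> at y is \<open>Y * W\<close>.\<close>
  define D where "D = monom 1 (k - l) * (W \<circ>\<^sub>p [:- y, 1:])"
  have degD: "degree D \<le> k - 1"
  proof (cases "W = 0")
    case False
    have "degree W \<le> l - 1"
      using W(1) l by (intro degree_le) auto
    then have "degree (W \<circ>\<^sub>p [:- y, 1:]) \<le> l - 1"
      using degree_pcompose[of W "[:- y, 1:]"] by simp
    then have "degree D \<le> (k - l) + (l - 1)"
      unfolding D_def by (intro order.trans[OF degree_mult_le] add_mono degree_monom_le)
    then show ?thesis using l by simp
  qed (simp add: D_def)
  have "\<exists>v. [int j * v = 1] (mod ?N)" if "0 < j" "j \<le> k" for j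
    using cop[OF that] cong_solve_coprime_int by blast
  then obtain v where v: "\<And>j. 0 < j \<Longrightarrow> j \<le> k \<Longrightarrow> [int j * v j = 1] (mod ?N)" by metis
  \<comment> \<open>The formal antiderivative, with each denominator j replaced by an inverse
    \<open>v j\<close> modulo \<open>P ^ R\<close>. Its derivative therefore agrees with
    \<open>D\<close> only modulo \<open>P ^ R\<close>, which is all that is claimed.\<close>
  define Q where "Q = (\<Sum>j<k. monom (v (j + 1) * coeff D j) (j + 1))"
  have coQ: "coeff Q i = (if i \<in> {1..k} then v i * coeff D (i - 1) else 0)" for i
  proof -
    have "coeff Q i = (\<Sum>j<k. if j + 1 = i then v (j + 1) * coeff D j else 0)"
      by (simp only: Q_def coeff_sum coeff_monom)
    also have "\<dots> = (\<Sum>j<k. if j = i - 1 then (if i \<noteq> 0 then v i * coeff D (i - 1) else 0) else 0)"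
      by (intro sum.cong) auto
    also have "\<dots> = (if i \<in> {1..k} then v i * coeff D (i - 1) else 0)"
      by (subst sum.delta) auto
    finally show ?thesis .
  qed
  have degQ: "degree Q \<le> k" by (intro degree_le) (auto simp: coQ)
  have flat: "coeff Q i = 0" if "i \<le> k - l" for i
    using that by (auto simp: coQ D_def coeff_monom_mult)
  have "[coeff (pderiv Q) i = coeff D i] (mod ?N)" for i
  proof (cases "i < k")
    case True
    then have "[int (i + 1) * v (i + 1) * coeff D i = 1 * coeff D i] (mod ?N)"
      by (intro cong_mult v cong_refl) auto
    then show ?thesis using True by (simp add: coeff_pderiv coQ mult.assoc)
  next
    case False
    then have "coeff D i = 0" using degD l by (intro coeff_eq_0) auto
    then show ?thesis using False by (simp add: coeff_pderiv coQ)
  qed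
  then have "[:?N:] dvd pderiv Q - D"
    by (simp add: const_poly_dvd_iff cong_iff_dvd_diff)
  then obtain T where T: "pderiv Q = D + [:?N:] * T" by (auto simp: dvd_def algebra_simps)
  have D_y: "D \<circ>\<^sub>p [:y, 1:] = Y * W"
  proof -
    have "monom 1 n \<circ>\<^sub>p [:y, 1:] = [:y, 1:] ^ n" for n
      by (induction n) (simp_all add: monom_Suc pcompose_pCons pcompose_1)
    then have "monom 1 (k - l) \<circ>\<^sub>p [:y, 1:] = Y" by (simp add: Y_def)
    moreover have "W \<circ>\<^sub>p [:- y, 1:] \<circ>\<^sub>p [:y, 1:] = W"
      by (simp add: pcompose_assoc[symmetric] pcompose_pCons)
    ultimately show ?thesis by (simp add: D_def pcompose_mult)
  qed
  have der: "pderiv (Q \<circ>\<^sub>p [:y, 1:]) = Y * W + [:?N:] * (T \<circ>\<^sub>p [:y, 1:])"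
    by (simp add: pderiv_pcompose T pcompose_add D_y pcompose_mult pcompose_smult pderiv_pCons)
  have "[coeff (Q \<circ>\<^sub>p [:y, 1:]) m = E m] (mod ?N)" if m: "m \<in> {1..l}" for m
  proof -
    obtain m' where m': "m = Suc m'" using m by (cases m) auto
    have "int m * coeff (Q \<circ>\<^sub>p [:y, 1:]) m = coeff (pderiv (Q \<circ>\<^sub>p [:y, 1:])) m'"
      by (simp add: coeff_pderiv m')
    also have "[\<dots> = coeff (Y * W) m'] (mod ?N)"
      unfolding der by (simp add: cong_iff_dvd_diff)
    also have "[coeff (Y * W) m' = int m * E m] (mod ?N)"
      using W(2) m by (simp add: m')
    finally have "[int m * coeff (Q \<circ>\<^sub>p [:y, 1:]) m = int m * E m] (mod ?N)" .
    moreover have "coprime (int m) ?N" using cop[of m] m l by auto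
    ultimately show ?thesis by (simp add: cong_mult_lcancel)
  qed
  then show ?thesis using degQ flat by blast
qed

lemma poly_altdef_le:
  fixes Q :: "'a :: comm_semiring_1 poly"
  assumes "degree Q \<le> k"
  shows "poly Q x = (\<Sum>i\<le>k. coeff Q i * x ^ i)"
  unfolding poly_altdef using assms
  by (intro sum.mono_neutral_left) (auto simp: coeff_eq_0 not_le)

text \<open>Since i - i' is a unit modulo P, a polynomial centred at i' can omit the degrees 1, ...,
  k - l and still have any l-jet at i. On the class of i' only monomials of degree at least k - l +
  1 survive, and the second inequality in \<open>c\<close> makes them integral after division by
  \<open>P ^ R\<close>. On the class of i the terms of degree above l are multiples of P^(A (l +
  1)), which the first inequality makes integral too.\<close>

lemma phase_lift_transversal:
  assumes P: "prime P" and k: "k < P" and l: "1 \<le> l" "l \<le> k"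
    and trans: "i mod int P \<noteq> i' mod int P"
    and c: "l * c \<le> A" "l * (A + c) \<le> B * (k - l + 1)" "l * (A + c) \<le> M"
    and \<psi>: "\<psi> \<in> phases P l (l * c)"
  shows "\<exists>s\<in>phases P k M. \<exists>\<kappa>. cmod \<kappa> = 1 \<and>
      (\<forall>t. s (i + int P ^ A * t) = \<kappa> * \<psi> t) \<and> (\<forall>t. s (i' + int P ^ B * t) = 1)"
proof -
  have P0: "P > 0" using P prime_gt_0_nat by blast
  obtain q where q: "degree q \<le> l" "\<psi> = (\<lambda>x. e (of_int (poly q x) / real P ^ (l * c)))"
    using \<psi> by (auto simp: phases_def)
  define R where "R = l * (A + c)"
  define y where "y = i - i'"
  have "\<not> int P dvd y" using trans by (simp add: y_def mod_eq_dvd_iff)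
  then have "coprime y (int P)"
    using P by (metis coprime_commute prime_imp_coprime prime_nat_int_transfer)
  \<comment> \<open>Substituting \<open>P ^ A * t\<close> gives degree m the factor P^(A m). The
    prescribed factor P^((l - m) A) completes it to the uniform P^(l A), so that dividing by
    \<open>P ^ R\<close> leaves q(t) over P^(l c).\<close>
  then obtain Q where Q: "degree Q \<le> k" "\<And>j. j \<le> k - l \<Longrightarrow> coeff Q j = 0"
    "\<And>m. m \<in> {1..l} \<Longrightarrow> [coeff (Q \<circ>\<^sub>p [:y, 1:]) m = coeff q m * int P ^ ((l - m) * A)] (mod (int P ^ R))"
    using flat_poly_jet_solvable[OF P k l, of y "\<lambda>m. coeff q m * int P ^ ((l - m) * A)" R] by auto
  define h where "h = Q \<circ>\<^sub>p [:y, 1:]"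
  have degh: "degree h \<le> k" using Q(1) by (simp add: h_def degree_pcompose)
  define s where "s x = e (of_int (poly Q (x - i')) / real P ^ R)" for x
  have RM: "R \<le> M" using c by (simp add: R_def)
  have "s = (\<lambda>x. e (of_int (poly (smult (int P ^ (M - R)) (Q \<circ>\<^sub>p [:- i', 1:])) x) / real P ^ M))"
  proof
    fix x
    have "real P ^ M = real P ^ R * real P ^ (M - R)" using RM by (simp flip: power_add)
    then show "s x = e (of_int (poly (smult (int P ^ (M - R)) (Q \<circ>\<^sub>p [:- i', 1:])) x) / real P ^ M)"
      using P0 by (simp add: s_def poly_pcompose)
  qed
  moreover have "degree (smult (int P ^ (M - R)) (Q \<circ>\<^sub>p [:- i', 1:])) \<le> k"
    using Q(1) degree_smult_le[of "int P ^ (M - R)" "Q \<circ>\<^sub>p [:- i', 1:]"]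
    by (simp add: degree_pcompose)
  ultimately have s: "s \<in> phases P k M" using phasesI by metis
  have flat: "s (i' + int P ^ B * t) = 1" for t
  proof -
    have "int P ^ R dvd coeff Q j * (int P ^ B * t) ^ j" for j
    proof (cases "j \<le> k - l")
      case False
      then have "R \<le> B * j" using c(2) unfolding R_def
        by (metis Suc_eq_plus1 le_trans mult_le_mono2 not_less_eq_eq)
      then have "int P ^ R dvd (int P ^ B) ^ j" by (simp add: le_imp_power_dvd flip: power_mult)
      then show ?thesis by (simp add: power_mult_distrib)
    qed (simp add: Q)
    then have "int P ^ R dvd poly Q (int P ^ B * t)" by (simp add: poly_altdef dvd_sum)
    then obtain w where "poly Q (int P ^ B * t) = int P ^ R * w" by (auto simp: dvd_def)
    then have "real_of_int (poly Q (int P ^ B * t)) / real P ^ R = of_int w" using P0 by simp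
    then show ?thesis by (simp add: s_def)
  qed
  \<comment> \<open>The jet is prescribed only in positive degrees; \<open>\<kappa>\<close> is the
    unimodular factor that corrects the two constant terms.\<close>
  define \<kappa> where "\<kappa> = e (of_int (coeff h 0) / real P ^ R - of_int (coeff q 0) / real P ^ (l * c))"
  have split0: "{..k} = insert 0 {1..k}" by auto
  have jet: "s (i + int P ^ A * t) = \<kappa> * \<psi> t" for t
  proof -
    let ?z = "int P ^ A * t"
    have jet_term: "[coeff h m * ?z ^ m = int P ^ (l * A) * (coeff q m * t ^ m)] (mod (int P ^ R))" if "m \<in> {1..k}" for m
    proof (cases "m \<le> l")
      case True
      have "[coeff h m * ?z ^ m = coeff q m * int P ^ ((l - m) * A) * ?z ^ m] (mod (int P ^ R))"
        unfolding h_def by (intro cong_mult Q(3) cong_refl) (use True that in auto)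
      also have "coeff q m * int P ^ ((l - m) * A) * ?z ^ m = int P ^ ((l - m) * A + A * m) * (coeff q m * t ^ m)"
        by (simp add: power_mult_distrib power_add mult_ac flip: power_mult)
      also have "(l - m) * A + A * m = l * A" using True by (metis add.commute le_add_diff_inverse2 distrib_right mult.commute)
      finally show ?thesis .
    next
      case False
      have "R = l * A + l * c" by (simp add: R_def algebra_simps)
      also have "\<dots> \<le> l * A + A" using c by simp
      also have "\<dots> = A * (l + 1)" by simp
      also have "\<dots> \<le> A * m" using False by (intro mult_le_mono2) simp
      finally have "int P ^ R dvd (int P ^ A) ^ m" by (simp add: le_imp_power_dvd flip: power_mult)
      moreover have "coeff q m = 0" using False q(1) by (intro coeff_eq_0) auto
      ultimately show ?thesis by (simp add: cong_0_iff power_mult_distrib)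
    qed
    have "poly Q (y + ?z) = poly h ?z" by (simp add: h_def poly_pcompose)
    also have "\<dots> = (\<Sum>m\<le>k. coeff h m * ?z ^ m)" by (rule poly_altdef_le[OF degh])
    also have "\<dots> = coeff h 0 + (\<Sum>m\<in>{1..k}. coeff h m * ?z ^ m)"
      unfolding split0 by simp
    finally have 1: "poly Q (y + ?z) - coeff h 0 = (\<Sum>m\<in>{1..k}. coeff h m * ?z ^ m)" by simp
    have "poly q t = (\<Sum>m\<le>k. coeff q m * t ^ m)" by (rule poly_altdef_le) (use q l in auto)
    also have "\<dots> = coeff q 0 + (\<Sum>m\<in>{1..k}. coeff q m * t ^ m)"
      unfolding split0 by simp
    finally have 2: "int P ^ (l * A) * (poly q t - coeff q 0) = (\<Sum>m\<in>{1..k}. int P ^ (l * A) * (coeff q m * t ^ m))"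
      by (simp add: sum_distrib_left)
    have "[poly Q (y + ?z) - coeff h 0 = int P ^ (l * A) * (poly q t - coeff q 0)] (mod (int P ^ R))"
      unfolding 1 2 by (intro cong_sum jet_term)
    then obtain w where "poly Q (y + ?z) - coeff h 0 - int P ^ (l * A) * (poly q t - coeff q 0) = int P ^ R * w"
      by (auto simp: cong_iff_dvd_diff dvd_def)
    then have w: "real_of_int (poly Q (y + ?z)) - coeff h 0 - real P ^ (l * A) * (poly q t - coeff q 0) = real P ^ R * w"
      by (metis (no_types, lifting) of_int_diff of_int_mult of_int_of_nat_eq of_int_power)
    have R: "real P ^ R = real P ^ (l * A) * real P ^ (l * c)" by (simp add: R_def distrib_left power_add)
    have "of_int (poly Q (y + ?z)) / real P ^ R = of_int (coeff h 0) / real P ^ R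
        - of_int (coeff q 0) / real P ^ (l * c) + of_int (poly q t) / real P ^ (l * c) + of_int w"
      using w P0 unfolding R by (simp add: field_simps)
    moreover have "i + ?z - i' = y + ?z" by (simp add: y_def)
    ultimately have "s (i + ?z) = e (of_int (coeff h 0) / real P ^ R
        - of_int (coeff q 0) / real P ^ (l * c) + of_int (poly q t) / real P ^ (l * c) + of_int w)"
      unfolding s_def by (simp only:)
    then show ?thesis
      by (simp only: \<kappa>_def q(2) e_add e_of_int mult_1_right)
  qed
  show ?thesis using s flat jet by (intro bexI[of _ s] exI[of _ \<kappa>]) (auto simp: \<kappa>_def)
qed

text \<open>Rescaling with the full degree: q is rewritten in powers of x - i, and the degree-m
  coefficient is divided by P^(A m). The condition on \<open>M\<close> keeps all the remaining
  exponents of P nonnegative.\<close>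

lemma phase_lift_rescale:
  assumes P: "P > 0" and M: "k * (A + c) \<le> M" and \<psi>: "\<psi> \<in> phases P k (k * c)"
  shows "\<exists>s\<in>phases P k M. \<forall>t. s (i + int P ^ A * t) = \<psi> t"
proof -
  obtain q where q: "degree q \<le> k" "\<psi> = (\<lambda>x. e (of_int (poly q x) / real P ^ (k * c)))"
    using \<psi> by (auto simp: phases_def)
  define Q where "Q = (\<Sum>m\<le>k. smult (coeff q m * int P ^ (M - A * m - k * c)) ([:- i, 1:] ^ m))"
  have "degree Q \<le> k" unfolding Q_def
    by (intro degree_sum_le) (auto intro!: order.trans[OF degree_smult_le] order.trans[OF degree_power_le])
  moreover have "e (of_int (poly Q (i + int P ^ A * t)) / real P ^ M) = \<psi> t" for t
  proof -
    have "real_of_int (poly Q (i + int P ^ A * t)) = real P ^ (M - k * c) * of_int (poly q t)"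
    proof -
      have "coeff q m * int P ^ (M - A * m - k * c) * (int P ^ A * t) ^ m = int P ^ (M - k * c) * (coeff q m * t ^ m)"
        if "m \<le> k" for m
      proof -
        have "A * m + k * c \<le> M" using M mult_le_mono2[OF that, of A] distrib_left[of k A c] mult.commute[of k A] by linarith
        then have "M - k * c = (M - A * m - k * c) + A * m" by simp
        then have "int P ^ (M - k * c) = int P ^ (M - A * m - k * c) * (int P ^ A) ^ m"
          by (metis power_add power_mult)
        then show ?thesis by (simp add: power_mult_distrib)
      qed
      note coeff_eq = this
      have "poly Q (i + int P ^ A * t) = (\<Sum>m\<le>k. coeff q m * int P ^ (M - A * m - k * c) * (int P ^ A * t) ^ m)"
        by (simp add: Q_def poly_sum)
      also have "\<dots> = (\<Sum>m\<le>k. int P ^ (M - k * c) * (coeff q m * t ^ m))"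
        by (intro sum.cong refl coeff_eq) simp
      also have "\<dots> = int P ^ (M - k * c) * poly q t"
        by (simp add: poly_altdef_le[OF q(1)] sum_distrib_left)
      finally show ?thesis by simp
    qed
    moreover have "k * c \<le> M" using M by (simp add: distrib_left)
    then have "real P ^ M = real P ^ (M - k * c) * real P ^ (k * c)" by (simp flip: power_add)
    ultimately show ?thesis using P by (simp add: q(2))
  qed
  ultimately show ?thesis by (intro bexI[OF _ phasesI[of Q]]) auto
qed

section \<open>Bilinear estimates\<close>

text \<open>The right-hand side of decoupling for one class modulo \<open>P ^ A\<close>, without its
  constant: n - A levels are left, hence the exponent of P. It is the quantity in which all bilinear
  bounds are expressed.\<close>

definition mass :: "nat \<Rightarrow> nat \<Rightarrow> nat \<Rightarrow> (int \<Rightarrow> complex) \<Rightarrow> int set \<Rightarrow> nat \<Rightarrow> int \<Rightarrow> real" where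
  "mass P k n a X A i = real P ^ ((n - A) * (tri k - 1)) *
    (\<Sum>j | j \<in> {0..<int P ^ n} \<and> j mod int P ^ A = i.
      av (phases P k (k * n)) (\<lambda>\<xi>. cmod (expsum a (rclass P X n j) \<xi>) ^ (2 * tri k)))"

text \<open>Bilinear decoupling for two classes that differ modulo P. The right-hand side is the
  geometric mean that Hoelder's inequality would give, so that again only the constant
  \<open>C\<close> carries information. Positivity of the first mass matters at l = 0: there its
  exponent is 0 and \<open>0 powr 0 = 0\<close> would annihilate the right-hand side.\<close>

definition Bil :: "nat \<Rightarrow> nat \<Rightarrow> nat \<Rightarrow> nat \<Rightarrow> nat \<Rightarrow> nat \<Rightarrow> real \<Rightarrow> bool" where
  "Bil P k l n A B C \<longleftrightarrow> (\<forall>a X i i'. finite X \<longrightarrow> i \<in> {0..<int P ^ A} \<longrightarrow> i' \<in> {0..<int P ^ B} \<longrightarrow>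
     i mod int P \<noteq> i' mod int P \<longrightarrow> 0 < mass P k n a X A i \<longrightarrow>
     av (phases P k (k * n)) (\<lambda>\<xi>. cmod (expsum a (rclass P X A i) \<xi>) ^ (2 * tri l) *
         cmod (expsum a (rclass P X B i') \<xi>) ^ (2 * tri k - 2 * tri l)) \<le>
     C * (mass P k n a X A i powr (tri l / tri k) * mass P k n a X B i' powr (1 - tri l / tri k)))"

lemma BilD:
  assumes "Bil P k l n A B C" "finite X" "i \<in> {0..<int P ^ A}" "i' \<in> {0..<int P ^ B}"
    "i mod int P \<noteq> i' mod int P" "0 < mass P k n a X A i"
  shows "av (phases P k (k * n)) (\<lambda>\<xi>. cmod (expsum a (rclass P X A i) \<xi>) ^ (2 * tri l) *
         cmod (expsum a (rclass P X B i') \<xi>) ^ (2 * tri k - 2 * tri l)) \<le>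
     C * (mass P k n a X A i powr (tri l / tri k) * mass P k n a X B i' powr (1 - tri l / tri k))"
  using assms unfolding Bil_def by blast

lemma mass_nonneg: "0 \<le> mass P k n a X A i"
  unfolding mass_def by (intro mult_nonneg_nonneg sum_nonneg av_nonneg) auto

lemma finite_residues [simp]: "finite {j. j \<in> {0..<int P ^ n} \<and> Q j}"
  by (rule finite_subset[of _ "{0..<int P ^ n}"]) auto

lemma finite_residues' [simp]: "finite {j. 0 \<le> j \<and> j < int P ^ n \<and> Q j}"
  by (rule finite_subset[of _ "{0..<int P ^ n}"]) auto

text \<open>A class of mass 0 has vanishing exponential sum at every phase, because each nonnegative
  average in the mass is 0. This disposes of the classes excluded in \<open>Bil\<close>.\<close>

lemma mass_eq_0:
  assumes "P > 0" "finite X" "A \<le> n" "mass P k n a X A i = 0" "\<xi> \<in> phases P k (k * n)" "k > 0"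
  shows "expsum a (rclass P X A i) \<xi> = 0"
proof -
  have "(\<Sum>j | j \<in> {0..<int P ^ n} \<and> j mod int P ^ A = i.
      av (phases P k (k * n)) (\<lambda>\<xi>. cmod (expsum a (rclass P X n j) \<xi>) ^ (2 * tri k))) = 0"
    using assms by (simp add: mass_def)
  then have *: "\<forall>j\<in>{j. j \<in> {0..<int P ^ n} \<and> j mod int P ^ A = i}.
      av (phases P k (k * n)) (\<lambda>\<xi>. cmod (expsum a (rclass P X n j) \<xi>) ^ (2 * tri k)) = 0"
    by (subst (asm) sum_nonneg_eq_0_iff) (auto intro!: av_nonneg)
  have "\<And>j. j \<in> {j. j \<in> {0..<int P ^ n} \<and> j mod int P ^ A = i} \<Longrightarrow> expsum a (rclass P X n j) \<xi> = 0"
  proof -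
    fix j assume "j \<in> {j. j \<in> {0..<int P ^ n} \<and> j mod int P ^ A = i}"
    then have "cmod (expsum a (rclass P X n j) \<xi>) ^ (2 * tri k) = 0"
      using * assms finite_phases[OF assms(1)]
      by (intro av_eq_0D[of "phases P k (k * n)" "\<lambda>\<xi>. cmod (expsum a (rclass P X n j) \<xi>) ^ (2 * tri k)" \<xi>]) auto
    then show "expsum a (rclass P X n j) \<xi> = 0" by simp
  qed
  then show ?thesis
    unfolding expsum_split[OF assms(1-3), of a i \<xi>] by (intro sum.neutral) auto
qed

lemma mass_mono:
  assumes "P > 0" "A \<le> A'" "j mod int P ^ A = i"
  shows "mass P k n a X A' j \<le> mass P k n a X A i"
  unfolding mass_def
proof (intro mult_mono sum_mono2)
  show "{ja. ja \<in> {0..<int P ^ n} \<and> ja mod int P ^ A' = j} \<subseteq> {j. j \<in> {0..<int P ^ n} \<and> j mod int P ^ A = i}"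
    using assms mod_power_mod[of A A'] by auto
  show "real P ^ ((n - A') * (tri k - 1)) \<le> real P ^ ((n - A) * (tri k - 1))"
    using assms by (intro power_increasing mult_le_mono1) auto
qed (auto intro!: av_nonneg sum_nonneg)

text \<open>\<open>Dec\<close> for the remaining n - A levels, rescaled to one class;
  \<open>Dec_transfer\<close> is used with the constant weight 1.\<close>

lemma av_le_mass:
  assumes "P > 0" "Dec P k (n - A) D" "finite X" "A \<le> n" "i \<in> {0..<int P ^ A}"
  shows "av (phases P k (k * n)) (\<lambda>\<xi>. cmod (expsum a (rclass P X A i) \<xi>) ^ (2 * tri k)) \<le>
    D * mass P k n a X A i"
proof -
  have "av (phases P k (k * n)) (\<lambda>\<xi>. cmod (expsum a (rclass P X A i) \<xi>) ^ (2 * tri k) * 1) \<le>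
    D * real P ^ ((n - A) * (tri k - 1)) *
    (\<Sum>j | j \<in> {0..<int P ^ (A + (n - A))} \<and> j mod int P ^ A = i.
       av (phases P k (k * n)) (\<lambda>\<xi>. cmod (expsum a (rclass P X (A + (n - A)) j) \<xi>) ^ (2 * tri k) * 1))"
  proof (rule Dec_transfer[OF assms(1,2,3,5)])
    fix \<psi> assume "\<psi> \<in> phases P k (k * (n - A))"
    then obtain s where "s \<in> phases P k (k * n)" "\<forall>t. s (i + int P ^ A * t) = \<psi> t"
      using phase_lift_rescale[OF assms(1), of k A "n - A" "k * n" \<psi> i] assms(4) by auto
    then show "\<exists>s\<in>phases P k (k * n). \<exists>\<kappa>. cmod \<kappa> = 1 \<and> (\<forall>t. s (i + int P ^ A * t) = \<kappa> * \<psi> t) \<and>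
        (\<forall>\<xi>\<in>phases P k (k * n). (1::real) = 1)"
      by (intro bexI[of _ s] exI[of _ 1]) auto
  qed auto
  then show ?thesis using assms(4) by (simp add: mass_def)
qed

lemma Dec_iff_mass:
  "Dec P k n D \<longleftrightarrow> (\<forall>a X. finite X \<longrightarrow> av (phases P k (k * n)) (\<lambda>\<xi>. cmod (expsum a X \<xi>) ^ (2 * tri k))
     \<le> D * mass P k n a X 0 0)"
  by (simp add: Dec_def mass_def mult.assoc atLeastLessThan_def Int_def)

lemma Bil_mono:
  assumes "Bil P k l n A B C" "C \<le> C'"
  shows "Bil P k l n A B C'"
  unfolding Bil_def
proof (intro allI impI)
  fix a X i i'
  assume *: "finite (X :: int set)" "i \<in> {0..<int P ^ A}" "i' \<in> {0..<int P ^ B}"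
    "i mod int P \<noteq> i' mod int P" "0 < mass P k n a X A i"
  show "av (phases P k (k * n)) (\<lambda>\<xi>. cmod (expsum a (rclass P X A i) \<xi>) ^ (2 * tri l) *
         cmod (expsum a (rclass P X B i') \<xi>) ^ (2 * tri k - 2 * tri l)) \<le>
     C' * (mass P k n a X A i powr (tri l / tri k) * mass P k n a X B i' powr (1 - tri l / tri k))"
    by (rule order.trans[OF BilD[OF assms(1) *]]) (intro mult_right_mono assms(2), auto)
qed

section \<open>Decoupling one factor of a bilinear form in lower degree\<close>

lemma sum_residues_nested:
  fixes F :: "int \<Rightarrow> real"
  assumes "P > 0" "A \<le> B" "B \<le> C"
  shows "(\<Sum>j | j \<in> {0..<int P ^ B} \<and> j mod int P ^ A = i.
      \<Sum>j' | j' \<in> {0..<int P ^ C} \<and> j' mod int P ^ B = j. F j') =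
    (\<Sum>j' | j' \<in> {0..<int P ^ C} \<and> j' mod int P ^ A = i. F j')"
proof (subst sum.UNION_disjoint[symmetric])
  show "sum F (\<Union>j\<in>{j. j \<in> {0..<int P ^ B} \<and> j mod int P ^ A = i}. {j'. j' \<in> {0..<int P ^ C} \<and> j' mod int P ^ B = j}) =
    (\<Sum>j' | j' \<in> {0..<int P ^ C} \<and> j' mod int P ^ A = i. F j')"
    using assms by (intro sum.cong) (auto simp: mod_power_mod)
qed auto

text \<open>The lifted phases are 1 on the class of i', so the second factor is invariant under them
  and may serve as the weight \<open>W\<close>. The first factor is then decoupled in degree l
  although the ambient phases have degree k.\<close>

lemma lower_step:
  assumes P: "prime P" and k: "k < P" and l: "1 \<le> l" "l \<le> k" and D: "Dec P l c D" and X: "finite X"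
    and i: "i \<in> {0..<int P ^ A}" and i': "i mod int P \<noteq> i' mod int P"
    and c: "l * c \<le> A" "l * (A + c) \<le> B * (k - l + 1)" "l * (A + c) \<le> M"
  shows "av (phases P k M) (\<lambda>\<xi>. cmod (expsum a (rclass P X A i) \<xi>) ^ (2 * tri l) * cmod (expsum a (rclass P X B i') \<xi>) ^ q) \<le>
    D * real P ^ (c * (tri l - 1)) *
    (\<Sum>j | j \<in> {0..<int P ^ (A + c)} \<and> j mod int P ^ A = i.
       av (phases P k M) (\<lambda>\<xi>. cmod (expsum a (rclass P X (A + c) j) \<xi>) ^ (2 * tri l) *
         cmod (expsum a (rclass P X B i') \<xi>) ^ q))"
proof (rule Dec_transfer[OF prime_gt_0_nat[OF P] D X i])
  fix \<psi> assume "\<psi> \<in> phases P l (l * c)"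
  from phase_lift_transversal[OF P k l i' c this]
  obtain s \<kappa> where s: "s \<in> phases P k M" "cmod \<kappa> = 1" "\<And>t. s (i + int P ^ A * t) = \<kappa> * \<psi> t"
    "\<And>t. s (i' + int P ^ B * t) = 1" by blast
  have "expsum a (rclass P X B i') (\<lambda>x. \<xi> x * s x) = expsum a (rclass P X B i') \<xi>" for \<xi>
    unfolding expsum_def
  proof (rule sum.cong[OF refl])
    fix x assume "x \<in> rclass P X B i'"
    then have "x = i' + int P ^ B * (x div int P ^ B)"
      using mod_mult_div_eq[of x "int P ^ B"] by (simp add: rclass_def)
    then have "s x = 1" using s(4) by metis
    then show "a x * (\<xi> x * s x) = a x * \<xi> x" by simp
  qed
  then show "\<exists>s\<in>phases P k M. \<exists>\<kappa>. cmod \<kappa> = 1 \<and> (\<forall>t. s (i + int P ^ A * t) = \<kappa> * \<psi> t) \<and>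
      (\<forall>\<xi>\<in>phases P k M. cmod (expsum a (rclass P X B i') (\<lambda>x. \<xi> x * s x)) ^ q = cmod (expsum a (rclass P X B i') \<xi>) ^ q)"
    using s by (intro bexI[of _ s] exI[of _ \<kappa>]) auto
qed auto

text \<open>A single use of \<open>lower_step\<close> only refines \<open>A\<close> to \<open>A + A div l\<close>; iterating it reaches any
  admissible \<open>A'\<close>, and from \<open>A \<ge> l * c0\<close> on all but the last step have constant
  \<open>P powr (2 * \<delta> * real c)\<close>.\<close>

lemma lower_iterate:
  fixes \<delta> C :: real
  assumes P: "prime P" and k: "k < P" and l: "1 \<le> l" "l \<le> k" and \<delta>: "\<delta> > 0"
    and D: "\<And>c. Dec P l c (C * real P powr (\<delta> * real c))" and C: "C \<ge> 1"
    and D2: "\<And>c. c \<ge> c0 \<Longrightarrow> Dec P l c (real P powr (2 * \<delta> * real c))" and c0: "c0 \<ge> 1"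
    and X: "finite X"
  shows "\<lbrakk>i \<in> {0..<int P ^ A}; i mod int P \<noteq> i' mod int P; A \<le> A'; l * c0 \<le> A;
      l * A' \<le> B * (k - l + 1); l * A' \<le> M\<rbrakk> \<Longrightarrow>
    av (phases P k M) (\<lambda>\<xi>. cmod (expsum a (rclass P X A i) \<xi>) ^ (2 * tri l) * cmod (expsum a (rclass P X B i') \<xi>) ^ q) \<le>
    C * real P powr (2 * \<delta> * real (A' - A)) * real P ^ ((A' - A) * (tri l - 1)) *
    (\<Sum>j | j \<in> {0..<int P ^ A'} \<and> j mod int P ^ A = i.
       av (phases P k M) (\<lambda>\<xi>. cmod (expsum a (rclass P X A' j) \<xi>) ^ (2 * tri l) *
         cmod (expsum a (rclass P X B i') \<xi>) ^ q))"
proof (induction "A' - A" arbitrary: A i rule: less_induct)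
  case less
  have P0: "P > 0" using prime_gt_0_nat[OF P] .
  let ?N = "\<lambda>A i. av (phases P k M) (\<lambda>\<xi>. cmod (expsum a (rclass P X A i) \<xi>) ^ (2 * tri l) *
         cmod (expsum a (rclass P X B i') \<xi>) ^ q)"
  have N0: "?N A i \<ge> 0" for A i by (intro av_nonneg) auto
  show ?case
  proof (cases "A' - A \<le> A div l")
    case True
    define c where "c = A' - A"
    have A': "A' = A + c" using less.prems by (simp add: c_def)
    have "l * c \<le> l * (A div l)" using True by (simp add: c_def)
    then have "l * c \<le> A" using times_div_less_eq_dividend order.trans by blast
    then have "?N A i \<le> C * real P powr (\<delta> * real c) * real P ^ (c * (tri l - 1)) *
      (\<Sum>j | j \<in> {0..<int P ^ (A + c)} \<and> j mod int P ^ A = i. ?N (A + c) j)"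
      using less.prems unfolding A' by (intro lower_step[OF P k l D X]) auto
    also have "\<dots> \<le> C * real P powr (2 * \<delta> * real c) * real P ^ (c * (tri l - 1)) *
      (\<Sum>j | j \<in> {0..<int P ^ (A + c)} \<and> j mod int P ^ A = i. ?N (A + c) j)"
      using C \<delta> P0 by (intro mult_right_mono mult_left_mono powr_mono sum_nonneg N0) auto
    finally show ?thesis by (simp add: A')
  next
    case False
    define c where "c = A div l"
    define A1 where "A1 = A + c"
    have c: "c \<ge> c0" using less.prems l by (simp add: c_def less_eq_div_iff_mult_less_eq mult.commute)
    have A1: "A1 \<le> A'" "A < A1" using False c c0 by (auto simp: A1_def c_def)
    have A0: "A \<ge> 1" using less.prems(4) l c0 by (cases A) auto
    have "l * A1 \<le> l * A'" using A1 by simp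
    then have "l * A1 \<le> B * (k - l + 1)" "l * A1 \<le> M" using less.prems by linarith+
    then have "?N A i \<le> real P powr (2 * \<delta> * real c) * real P ^ (c * (tri l - 1)) *
      (\<Sum>j | j \<in> {0..<int P ^ A1} \<and> j mod int P ^ A = i. ?N A1 j)"
      using less.prems c unfolding A1_def by (intro lower_step[OF P k l D2 X]) (auto simp: c_def)
    also have "\<dots> \<le> real P powr (2 * \<delta> * real c) * real P ^ (c * (tri l - 1)) *
      (\<Sum>j | j \<in> {0..<int P ^ A1} \<and> j mod int P ^ A = i.
        C * real P powr (2 * \<delta> * real (A' - A1)) * real P ^ ((A' - A1) * (tri l - 1)) *
        (\<Sum>j' | j' \<in> {0..<int P ^ A'} \<and> j' mod int P ^ A1 = j. ?N A' j'))"
    proof (intro mult_left_mono sum_mono less.hyps)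
      fix j assume "j \<in> {j. j \<in> {0..<int P ^ A1} \<and> j mod int P ^ A = i}"
      then have j: "j \<in> {0..<int P ^ A1}" "j mod int P ^ A = i" by auto
      show "j \<in> {0..<int P ^ A1}" by fact
      have "j mod int P = i mod int P" using mod_power_mod[of 1 A j P] A0 j(2) by simp
      then show "j mod int P \<noteq> i' mod int P" using less.prems by simp
    qed (use A1 less.prems False in auto)
    also have "\<dots> = C * (real P powr (2 * \<delta> * real c) * real P powr (2 * \<delta> * real (A' - A1))) *
        (real P ^ (c * (tri l - 1)) * real P ^ ((A' - A1) * (tri l - 1))) *
      (\<Sum>j | j \<in> {0..<int P ^ A1} \<and> j mod int P ^ A = i.
        \<Sum>j' | j' \<in> {0..<int P ^ A'} \<and> j' mod int P ^ A1 = j. ?N A' j')"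
      by (simp add: sum_distrib_left mult_ac)
    also have "(\<Sum>j | j \<in> {0..<int P ^ A1} \<and> j mod int P ^ A = i.
        \<Sum>j' | j' \<in> {0..<int P ^ A'} \<and> j' mod int P ^ A1 = j. ?N A' j') =
      (\<Sum>j' | j' \<in> {0..<int P ^ A'} \<and> j' mod int P ^ A = i. ?N A' j')"
      using A1 P0 by (intro sum_residues_nested) auto
    also have "real P powr (2 * \<delta> * real c) * real P powr (2 * \<delta> * real (A' - A1)) = real P powr (2 * \<delta> * real (A' - A))"
      using A1 unfolding powr_add[symmetric] by (simp add: A1_def of_nat_diff algebra_simps)
    also have "real P ^ (c * (tri l - 1)) * real P ^ ((A' - A1) * (tri l - 1)) = real P ^ ((A' - A) * (tri l - 1))"
    proof -
      have "A' - A = c + (A' - A1)" using A1 by (simp add: A1_def)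
      then show ?thesis by (simp add: power_add distrib_right)
    qed
    finally show ?thesis .
  qed
qed

text \<open>An estimate at the finer scale \<open>A'\<close> is passed to the coarser scale
  \<open>A\<close>: the first class is decoupled in degree l, the estimate is applied to each
  subclass, and concavity of the power \<theta> = tri l / tri k recombines the masses. The powers of
  P from these steps, with exponents \<open>tri l - 1\<close>, \<open>(tri k - 1) * \<theta>\<close>
  and 1 - \<theta> per level, cancel exactly because tri k times \<theta> is tri l, so only the loss
  of the lower decoupling remains.\<close>

lemma Bil_refine:
  fixes \<delta> C E :: real
  assumes P: "prime P" and k: "k < P" and l: "1 \<le> l" "l \<le> k" and \<delta>: "\<delta> > 0"
    and D: "\<And>c. Dec P l c (C * real P powr (\<delta> * real c))" and C: "C \<ge> 1"
    and D2: "\<And>c. c \<ge> c0 \<Longrightarrow> Dec P l c (real P powr (2 * \<delta> * real c))" and c0: "c0 \<ge> 1"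
    and A: "A \<le> A'" "A' \<le> n" "l * c0 \<le> A" "l * A' \<le> B * (k - l + 1)"
    and bil: "Bil P k l n A' B E" and E: "E \<ge> 0"
  shows "Bil P k l n A B (C * real P powr (2 * \<delta> * real (A' - A)) * E)"
  unfolding Bil_def
proof (intro allI impI)
  fix a X i i'
  assume X: "finite (X :: int set)" and i: "i \<in> {0..<int P ^ A}" and i': "i' \<in> {0..<int P ^ B}"
    and ne: "i mod int P \<noteq> i' mod int P" and "0 < mass P k n a X A i"
  have P0: "P > 0" using prime_gt_0_nat[OF P] .
  have k0: "k > 0" using l by simp
  have A0: "A \<ge> 1" using A(3) l c0 by (cases A) auto
  define q where "q = 2 * tri k - 2 * tri l"
  define \<theta> where "\<theta> = tri l / tri k"
  have K: "tri k \<ge> 1" "tri l \<ge> 1" "tri l \<le> tri k" using tri_pos[OF k0] tri_pos[of l] l tri_mono by auto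
  have \<theta>: "0 \<le> \<theta>" "\<theta> \<le> 1" using K by (auto simp: \<theta>_def)
  let ?N = "\<lambda>A i. av (phases P k (k * n)) (\<lambda>\<xi>. cmod (expsum a (rclass P X A i) \<xi>) ^ (2 * tri l) *
         cmod (expsum a (rclass P X B i') \<xi>) ^ q)"
  let ?J = "{j. j \<in> {0..<int P ^ A'} \<and> j mod int P ^ A = i}"
  define \<sigma> where "\<sigma> A i = (\<Sum>j | j \<in> {0..<int P ^ n} \<and> j mod int P ^ A = i.
      av (phases P k (k * n)) (\<lambda>\<xi>. cmod (expsum a (rclass P X n j) \<xi>) ^ (2 * tri k)))" for A i
  have \<sigma>0: "\<sigma> A i \<ge> 0" for A i unfolding \<sigma>_def by (intro sum_nonneg av_nonneg) auto
  have mass_\<sigma>: "mass P k n a X A i = real P ^ ((n - A) * (tri k - 1)) * \<sigma> A i" for A i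
    by (simp add: mass_def \<sigma>_def)
  define m' where "m' = mass P k n a X B i' powr (1 - \<theta>)"
  have m': "m' \<ge> 0" by (simp add: m'_def)
  have "l * A' \<le> k * n" using A l by (intro mult_le_mono) auto
  then have "?N A i \<le> C * real P powr (2 * \<delta> * real (A' - A)) * real P ^ ((A' - A) * (tri l - 1)) * (\<Sum>j\<in>?J. ?N A' j)"
    using A by (intro lower_iterate[OF P k l \<delta> D C D2 c0 X i ne]) auto
  also have "(\<Sum>j\<in>?J. ?N A' j) \<le> (\<Sum>j\<in>?J. E * ((real P ^ ((n - A') * (tri k - 1)) * \<sigma> A' j) powr \<theta> * m'))"
  proof (intro sum_mono)
    fix j assume "j \<in> ?J"
    then have j: "j \<in> {0..<int P ^ A'}" "j mod int P ^ A = i" by auto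
    have ne': "j mod int P \<noteq> i' mod int P" using mod_power_mod[of 1 A j P] A0 j(2) ne by simp
    show "?N A' j \<le> E * ((real P ^ ((n - A') * (tri k - 1)) * \<sigma> A' j) powr \<theta> * m')"
    proof (cases "mass P k n a X A' j = 0")
      case True
      then have "?N A' j = av (phases P k (k * n)) (\<lambda>_. 0)"
        using mass_eq_0[OF P0 X A(2) True _ k0] K by (intro av_cong) (auto simp: power_0_left)
      then have "?N A' j = 0" by (simp add: av_def)
      then show ?thesis using E m' by simp
    next
      case False
      then have "0 < mass P k n a X A' j" using mass_nonneg[of P k n a X A' j] by linarith
      from BilD[OF bil X j(1) i' ne' this] show ?thesis
        unfolding mass_\<sigma>[symmetric] q_def m'_def \<theta>_def .
    qed
  qed
  also have "(\<Sum>j\<in>?J. E * ((real P ^ ((n - A') * (tri k - 1)) * \<sigma> A' j) powr \<theta> * m')) =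
    E * m' * real P powr (real ((n - A') * (tri k - 1)) * \<theta>) * (\<Sum>j\<in>?J. \<sigma> A' j powr \<theta>)"
    using P0 \<sigma>0 by (simp add: powr_mult sum_distrib_left mult_ac powr_powr flip: powr_realpow)
  also have "(\<Sum>j\<in>?J. \<sigma> A' j powr \<theta>) \<le> (\<Sum>j\<in>?J. \<sigma> A' j) powr \<theta> * real (card ?J) powr (1 - \<theta>)"
    by (intro sum_powr_le \<theta> \<sigma>0)
  also have "(\<Sum>j\<in>?J. \<sigma> A' j) = \<sigma> A i"
    unfolding \<sigma>_def using A P0 by (intro sum_residues_nested) auto
  also have "real (card ?J) powr (1 - \<theta>) = real P powr (real (A' - A) * (1 - \<theta>))"
    unfolding card_residues[OF P0 i A(1)] using P0 by (simp add: powr_powr flip: powr_realpow)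
  finally have "?N A i \<le> C * real P powr (2 * \<delta> * real (A' - A)) * real P ^ ((A' - A) * (tri l - 1)) *
     (E * m' * real P powr (real ((n - A') * (tri k - 1)) * \<theta>) * (\<sigma> A i powr \<theta> * real P powr (real (A' - A) * (1 - \<theta>))))"
    using C E m' P0 by (simp add: mult_left_mono)
  also have "\<dots> = C * real P powr (2 * \<delta> * real (A' - A)) * E * ((real P powr (real ((A' - A) * (tri l - 1))) *
     real P powr (real ((n - A') * (tri k - 1)) * \<theta>) * real P powr (real (A' - A) * (1 - \<theta>))) * \<sigma> A i powr \<theta> * m')"
  proof -
    have "real P ^ ((A' - A) * (tri l - 1)) = real P powr (real ((A' - A) * (tri l - 1)))"
      using P0 by (simp only: powr_realpow of_nat_0_less_iff)
    then show ?thesis by (simp only: mult_ac)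
  qed
  also have "real P powr (real ((A' - A) * (tri l - 1))) * real P powr (real ((n - A') * (tri k - 1)) * \<theta>) *
      real P powr (real (A' - A) * (1 - \<theta>)) = real P powr (real ((n - A) * (tri k - 1)) * \<theta>)"
  proof -
    have Kth: "real (tri k) * \<theta> = tri l" using K by (simp add: \<theta>_def)
    have "real ((A' - A) * (tri l - 1)) + real ((n - A') * (tri k - 1)) * \<theta> + real (A' - A) * (1 - \<theta>) =
      (real A' - real A) * (real (tri k) * \<theta> - 1) + (real n - real A') * (real (tri k) - 1) * \<theta> + (real A' - real A) * (1 - \<theta>)"
      unfolding Kth using A K by (simp add: of_nat_diff)
    also have "\<dots> = (real n - real A) * (real (tri k) - 1) * \<theta>" by (simp add: algebra_simps)
    finally show ?thesis using A K by (simp add: of_nat_diff flip: powr_add)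
  qed
  also have "real P powr (real ((n - A) * (tri k - 1)) * \<theta>) * \<sigma> A i powr \<theta> = mass P k n a X A i powr \<theta>"
    unfolding mass_\<sigma> using P0 \<sigma>0 by (simp add: powr_mult powr_powr flip: powr_realpow)
  finally show "?N A i \<le> C * real P powr (2 * \<delta> * real (A' - A)) * E * (mass P k n a X A i powr (tri l / tri k) * mass P k n a X B i' powr (1 - tri l / tri k))"
    by (simp add: m'_def \<theta>_def)
qed

section \<open>Hoelder's inequality between bilinear forms\<close>

lemma tri_less: "l < k \<Longrightarrow> tri l < tri k"
  using two_tri[of l] two_tri[of k] mult_strict_mono[of l k "l + 1" "k + 1"] by linarith

text \<open>This equation determines t. It matches the powers of the first factor when the forms
  with exponents tri (l - 1) and, with the factors exchanged, tri (k - l) are interpolated; the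
  powers of the second factor then match because every form has total exponent 2 tri k.\<close>

lemma tri_Holder_identity:
  fixes l k :: nat
  assumes "1 \<le> l" "l < k"
  defines "t \<equiv> real (k - l) / real (k - l + 1)"
  shows "real (tri (l - 1)) * t + (real (tri k) - real (tri (k - l))) * (1 - t) = real (tri l)"
proof -
  obtain b where k: "k = l + b" "b > 0" using assms by (metis less_imp_add_positive)
  obtain c where l: "l = Suc c" using assms by (cases l) auto
  have b1: "real b + 1 > 0" by simp
  have t: "t = real b / (real b + 1)" by (simp add: t_def k)
  have t': "1 - t = 1 / (real b + 1)" using b1 by (simp add: t field_simps)
  have "real (tri (l - 1)) * real b + (real (tri k) - real (tri (k - l))) = real (tri l) * (real b + 1)"
    unfolding k l by (simp add: real_tri field_simps)
  then show ?thesis unfolding t' unfolding t using b1 by (simp add: add_divide_distrib[symmetric] divide_eq_eq)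
qed

text \<open>One of the two forms lowers l to l - 1, the other exchanges the two classes and turns l
  into k - l. Each has a weaker restriction on the scales than the form at l, and this leaves room
  for a further decoupling in lower degree.\<close>

lemma Bil_Holder:
  assumes P: "P > 0" and l: "1 \<le> l" "l < k" and AB: "A \<le> n" "B \<le> n"
    and B1: "Bil P k (l - 1) n A B C1" and B2: "Bil P k (k - l) n B A C2"
    and C: "C1 \<ge> 0" "C2 \<ge> 0"
  defines "t \<equiv> real (k - l) / real (k - l + 1)"
  shows "Bil P k l n A B (C1 powr t * C2 powr (1 - t))"
  unfolding Bil_def
proof (intro allI impI)
  fix a X i i'
  assume X: "finite (X :: int set)" and i: "i \<in> {0..<int P ^ A}" and i': "i' \<in> {0..<int P ^ B}"
    and ne: "i mod int P \<noteq> i' mod int P" and m: "0 < mass P k n a X A i"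
  let ?G = "phases P k (k * n)"
  let ?K = "tri k" and ?L = "tri l" and ?Lm = "tri (l - 1)" and ?Ln = "tri (k - l)"
  have k0: "k > 0" using l by simp
  have L: "?L \<ge> 1" "?L < ?K" "?Lm < ?K" "?Ln < ?K"
    using l tri_pos[of l] tri_less[of l k] tri_less[of "l - 1" k] tri_less[of "k - l" k] by auto
  have t: "0 < t" "t < 1" using l by (auto simp: t_def)
  define x where "x \<xi> = cmod (expsum a (rclass P X A i) \<xi>)" for \<xi>
  define y where "y \<xi> = cmod (expsum a (rclass P X B i') \<xi>)" for \<xi>
  have xy: "x \<xi> \<ge> 0" "y \<xi> \<ge> 0" for \<xi> by (auto simp: x_def y_def)
  define M where "M = mass P k n a X A i"
  define M' where "M' = mass P k n a X B i'"
  have M': "M' \<ge> 0" unfolding M'_def by (rule mass_nonneg)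
  have M: "M > 0" using m by (simp add: M_def)
  show "av ?G (\<lambda>\<xi>. x \<xi> ^ (2 * ?L) * y \<xi> ^ (2 * ?K - 2 * ?L)) \<le>
      C1 powr t * C2 powr (1 - t) * (M powr (?L / ?K) * M' powr (1 - ?L / ?K))"
  proof (cases "M' = 0")
    case True
    have "av ?G (\<lambda>\<xi>. x \<xi> ^ (2 * ?L) * y \<xi> ^ (2 * ?K - 2 * ?L)) = av ?G (\<lambda>_. 0)"
      using mass_eq_0[OF P X AB(2) _ _ k0, of a i'] True L by (intro av_cong) (auto simp: M'_def y_def power_0_left)
    then have "av ?G (\<lambda>\<xi>. x \<xi> ^ (2 * ?L) * y \<xi> ^ (2 * ?K - 2 * ?L)) = 0" by (simp add: av_def)
    then show ?thesis by simp
  next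
    case False
    then have M'p: "M' > 0" using M' by simp
    have id: "real ?Lm * t + (real ?K - real ?Ln) * (1 - t) = real ?L"
      unfolding t_def by (rule tri_Holder_identity[OF l])
    have pt: "x \<xi> ^ (2 * ?L) * y \<xi> ^ (2 * ?K - 2 * ?L) =
       (x \<xi> ^ (2 * ?Lm) * y \<xi> ^ (2 * ?K - 2 * ?Lm)) powr t * (y \<xi> ^ (2 * ?Ln) * x \<xi> ^ (2 * ?K - 2 * ?Ln)) powr (1 - t)" for \<xi>
    proof (cases "x \<xi> = 0 \<or> y \<xi> = 0")
      case True
      then show ?thesis using L t by (auto simp: power_0_left)
    next
      case False
      then have p: "x \<xi> > 0" "y \<xi> > 0" using xy[of \<xi>] by auto
      have "(x \<xi> ^ (2 * ?Lm) * y \<xi> ^ (2 * ?K - 2 * ?Lm)) powr t * (y \<xi> ^ (2 * ?Ln) * x \<xi> ^ (2 * ?K - 2 * ?Ln)) powr (1 - t) =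
        x \<xi> powr (2 * ?Lm * t + (2 * ?K - 2 * ?Ln) * (1 - t)) * y \<xi> powr ((2 * ?K - 2 * ?Lm) * t + 2 * ?Ln * (1 - t))"
        using p L by (simp add: powr_mult powr_powr powr_add of_nat_diff mult_ac flip: powr_realpow)
      also have "2 * ?Lm * t + (2 * ?K - 2 * ?Ln) * (1 - t) = real (2 * ?L)"
        using id L by (simp add: of_nat_diff algebra_simps)
      also have "(2 * ?K - 2 * ?Lm) * t + 2 * ?Ln * (1 - t) = real (2 * ?K - 2 * ?L)"
        using id L by (simp add: of_nat_diff algebra_simps)
      also have "x \<xi> powr real (2 * ?L) = x \<xi> ^ (2 * ?L)" using p by (simp only: powr_realpow)
      also have "y \<xi> powr real (2 * ?K - 2 * ?L) = y \<xi> ^ (2 * ?K - 2 * ?L)" using p by (simp only: powr_realpow)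
      finally show ?thesis ..
    qed
    have "av ?G (\<lambda>\<xi>. x \<xi> ^ (2 * ?L) * y \<xi> ^ (2 * ?K - 2 * ?L)) \<le>
      av ?G (\<lambda>\<xi>. x \<xi> ^ (2 * ?Lm) * y \<xi> ^ (2 * ?K - 2 * ?Lm)) powr t *
      av ?G (\<lambda>\<xi>. y \<xi> ^ (2 * ?Ln) * x \<xi> ^ (2 * ?K - 2 * ?Ln)) powr (1 - t)"
      unfolding pt by (intro av_Holder) (use t xy in auto)
    also have "\<dots> \<le> (C1 * (M powr (?Lm / ?K) * M' powr (1 - ?Lm / ?K))) powr t *
        (C2 * (M' powr (?Ln / ?K) * M powr (1 - ?Ln / ?K))) powr (1 - t)"
    proof (intro mult_mono powr_mono2)
      show "av ?G (\<lambda>\<xi>. x \<xi> ^ (2 * ?Lm) * y \<xi> ^ (2 * ?K - 2 * ?Lm)) \<le> C1 * (M powr (?Lm / ?K) * M' powr (1 - ?Lm / ?K))"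
        using BilD[OF B1 X i i' ne m] unfolding x_def y_def M_def M'_def .
      show "av ?G (\<lambda>\<xi>. y \<xi> ^ (2 * ?Ln) * x \<xi> ^ (2 * ?K - 2 * ?Ln)) \<le> C2 * (M' powr (?Ln / ?K) * M powr (1 - ?Ln / ?K))"
        using BilD[OF B2 X i' i ne[symmetric]] M'p unfolding x_def y_def M_def M'_def by simp
    qed (use t xy in \<open>auto intro!: av_nonneg\<close>)
    also have "\<dots> = C1 powr t * C2 powr (1 - t) * (M powr (?Lm / ?K * t + (1 - ?Ln / ?K) * (1 - t)) *
        M' powr ((1 - ?Lm / ?K) * t + ?Ln / ?K * (1 - t)))"
      using C M M'p by (simp add: powr_mult powr_powr powr_add mult_ac)
    also have "?Lm / ?K * t + (1 - ?Ln / ?K) * (1 - t) = ?L / ?K"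
      using id L by (simp add: field_simps)
    also have "(1 - ?Lm / ?K) * t + ?Ln / ?K * (1 - t) =
        1 - (real ?Lm * t + (real ?K - real ?Ln) * (1 - t)) / ?K"
      using L by (simp add: field_simps)
    also have "\<dots> = 1 - ?L / ?K" unfolding id ..
    finally show ?thesis .
  qed
qed

text \<open>With l = 0 the first factor is absent and only the n - B levels below the second class
  have to be decoupled. All gains in the iteration originate here.\<close>

lemma Bil_0:
  assumes P: "P > 0" and k: "k > 0" and B: "B \<le> n" and D: "Dec P k (n - B) D" and "0 \<le> D" "D \<le> C"
  shows "Bil P k 0 n A B C"
  unfolding Bil_def
proof (intro allI impI)
  fix a X i i'
  assume X: "finite (X :: int set)" and i': "i' \<in> {0..<int P ^ B}" and m: "0 < mass P k n a X A i"
  have "av (phases P k (k * n)) (\<lambda>\<xi>. cmod (expsum a (rclass P X B i') \<xi>) ^ (2 * tri k)) \<le> D * mass P k n a X B i'"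
    by (rule av_le_mass[OF P D X B i'])
  also have "\<dots> \<le> C * mass P k n a X B i'"
    by (intro mult_right_mono assms mass_nonneg)
  finally show "av (phases P k (k * n)) (\<lambda>\<xi>. cmod (expsum a (rclass P X A i) \<xi>) ^ (2 * tri 0) *
         cmod (expsum a (rclass P X B i') \<xi>) ^ (2 * tri k - 2 * tri 0)) \<le>
     C * (mass P k n a X A i powr (tri 0 / tri k) * mass P k n a X B i' powr (1 - tri 0 / tri k))"
    using m mass_nonneg[of P k n a X B i'] by (simp add: tri_def)
qed

text \<open>Hoelder's inequality with no use of transversality: the starting point of the iteration,
  with gain 0.\<close>

lemma Bil_trivial:
  assumes P: "P > 0" and l: "1 \<le> l" "l < k" and AB: "A \<le> n" "B \<le> n"
    and D: "Dec P k (n - A) D" "Dec P k (n - B) D" and D0: "D \<ge> 0"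
  shows "Bil P k l n A B D"
  unfolding Bil_def
proof (intro allI impI)
  fix a X i i'
  assume X: "finite (X :: int set)" and i: "i \<in> {0..<int P ^ A}" and i': "i' \<in> {0..<int P ^ B}"
  let ?G = "phases P k (k * n)" and ?K = "tri k" and ?L = "tri l"
  define t where "t = real ?L / real ?K"
  have L: "?L < ?K" "?L > 0" using tri_less[OF l(2)] tri_pos[of l] l by auto
  have t: "0 \<le> t" "t \<le> 1" using L by (auto simp: t_def)
  define x where "x \<xi> = cmod (expsum a (rclass P X A i) \<xi>)" for \<xi>
  define y where "y \<xi> = cmod (expsum a (rclass P X B i') \<xi>)" for \<xi>
  have xy: "x \<xi> \<ge> 0" "y \<xi> \<ge> 0" for \<xi> by (auto simp: x_def y_def)
  have pt: "x \<xi> ^ (2 * ?L) * y \<xi> ^ (2 * ?K - 2 * ?L) = (x \<xi> ^ (2 * ?K)) powr t * (y \<xi> ^ (2 * ?K)) powr (1 - t)" for \<xi>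
  proof (cases "x \<xi> = 0 \<or> y \<xi> = 0")
    case True
    then show ?thesis using L by (auto simp: power_0_left)
  next
    case False
    then have p: "x \<xi> > 0" "y \<xi> > 0" using xy[of \<xi>] by auto
    have "(x \<xi> ^ (2 * ?K)) powr t = x \<xi> powr real (2 * ?L)"
      using p L by (simp add: powr_powr t_def flip: powr_realpow)
    moreover have "(y \<xi> ^ (2 * ?K)) powr (1 - t) = y \<xi> powr real (2 * ?K - 2 * ?L)"
      using p L by (simp add: powr_powr t_def of_nat_diff right_diff_distrib flip: powr_realpow)
    ultimately show ?thesis using p by (simp only: powr_realpow)
  qed
  have "av ?G (\<lambda>\<xi>. x \<xi> ^ (2 * ?L) * y \<xi> ^ (2 * ?K - 2 * ?L)) \<le>
      av ?G (\<lambda>\<xi>. x \<xi> ^ (2 * ?K)) powr t * av ?G (\<lambda>\<xi>. y \<xi> ^ (2 * ?K)) powr (1 - t)"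
    unfolding pt by (intro av_Holder t) auto
  also have "\<dots> \<le> (D * mass P k n a X A i) powr t * (D * mass P k n a X B i') powr (1 - t)"
    unfolding x_def y_def
    by (intro mult_mono powr_mono2 av_le_mass[OF P _ X] D AB i i') (use t in \<open>auto intro!: av_nonneg\<close>)
  also have "\<dots> = (D powr t * D powr (1 - t)) * (mass P k n a X A i powr t * mass P k n a X B i' powr (1 - t))"
    using D0 mass_nonneg by (simp add: powr_mult mult_ac)
  also have "D powr t * D powr (1 - t) = D"
    using D0 by (cases "D = 0") (auto simp flip: powr_add)
  finally show "av ?G (\<lambda>\<xi>. x \<xi> ^ (2 * ?L) * y \<xi> ^ (2 * ?K - 2 * ?L)) \<le>
     D * (mass P k n a X A i powr (tri l / tri k) * mass P k n a X B i' powr (1 - tri l / tri k))"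
    by (simp add: t_def)
qed

section \<open>From bilinear back to linear estimates\<close>

lemma norm_expsum_power_le:
  assumes P: "P > 0" and X: "finite X" and i: "i \<in> {0..<int P ^ A}" and A: "A \<le> B" and q: "q > 0"
  shows "cmod (expsum a (rclass P X A i) \<xi>) ^ q \<le> real P ^ ((B - A) * (q - 1)) *
    (\<Sum>j | j \<in> {0..<int P ^ B} \<and> j mod int P ^ A = i. cmod (expsum a (rclass P X B j) \<xi>) ^ q)"
proof -
  let ?J = "{j. j \<in> {0..<int P ^ B} \<and> j mod int P ^ A = i}"
  have "cmod (expsum a (rclass P X A i) \<xi>) ^ q \<le> (\<Sum>j\<in>?J. cmod (expsum a (rclass P X B j) \<xi>)) ^ q"
    unfolding expsum_split[OF P X A, of a i \<xi>] by (intro power_mono norm_sum) auto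
  also have "\<dots> \<le> real (card ?J) ^ (q - 1) * (\<Sum>j\<in>?J. cmod (expsum a (rclass P X B j) \<xi>) ^ q)"
    by (intro sum_power_le q) auto
  finally show ?thesis unfolding card_residues[OF P i A] by (simp add: power_mult)
qed

text \<open>A crude passage to classes modulo P by the power mean inequality. Its cost is
  exponential in A + B with a fixed rate, while the number of rounds can be chosen to make the gain
  at these scales exceed any such rate.\<close>

lemma Bil_coarsen:
  assumes P: "P > 0" and l: "1 \<le> l" "l < k" and A: "1 \<le> A" "A \<le> n" and B: "1 \<le> B" "B \<le> n"
    and bil: "Bil P k l n A B C" and C: "C \<ge> 0"
  shows "Bil P k l n 1 1 (real P ^ ((A + B) * (2 * tri k)) * C)"
  unfolding Bil_def
proof (intro allI impI)
  fix a X i i'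
  assume X: "finite (X :: int set)" and i: "i \<in> {0..<int P ^ 1}" and i': "i' \<in> {0..<int P ^ 1}"
    and ne: "i mod int P \<noteq> i' mod int P" and m: "0 < mass P k n a X 1 i"
  let ?G = "phases P k (k * n)" and ?K = "tri k" and ?L = "tri l"
  have k0: "k > 0" using l by simp
  have L: "?L < ?K" "?L > 0" using tri_less[OF l(2)] tri_pos[of l] l by auto
  define t where "t = real ?L / real ?K"
  have t: "0 < t" "t < 1" using L by (auto simp: t_def)
  let ?I = "{j. j \<in> {0..<int P ^ A} \<and> j mod int P ^ 1 = i}"
  let ?J = "{j. j \<in> {0..<int P ^ B} \<and> j mod int P ^ 1 = i'}"
  let ?E = "mass P k n a X 1 i powr t * mass P k n a X 1 i' powr (1 - t)"
  let ?f = "\<lambda>A i \<xi>. cmod (expsum a (rclass P X A i) \<xi>)"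
  let ?q = "2 * ?K - 2 * ?L"
  have q: "?q > 0" using L by simp
  have "av ?G (\<lambda>\<xi>. ?f 1 i \<xi> ^ (2 * ?L) * ?f 1 i' \<xi> ^ ?q) \<le>
    av ?G (\<lambda>\<xi>. (real P ^ ((A - 1) * (2 * ?L - 1)) * (\<Sum>j\<in>?I. ?f A j \<xi> ^ (2 * ?L))) *
      (real P ^ ((B - 1) * (?q - 1)) * (\<Sum>j'\<in>?J. ?f B j' \<xi> ^ ?q)))"
    using L q by (intro av_mono mult_mono norm_expsum_power_le P X i i' A B)
      (auto intro!: sum_nonneg mult_nonneg_nonneg)
  also have "\<dots> = real P ^ ((A - 1) * (2 * ?L - 1)) * real P ^ ((B - 1) * (?q - 1)) *
      (\<Sum>j\<in>?I. \<Sum>j'\<in>?J. av ?G (\<lambda>\<xi>. ?f A j \<xi> ^ (2 * ?L) * ?f B j' \<xi> ^ ?q))"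
    unfolding av_sum[symmetric] av_cmult[symmetric]
    by (intro av_cong) (simp only: sum_product mult_ac)
  also have "\<dots> \<le> real P ^ ((A - 1) * (2 * ?L - 1)) * real P ^ ((B - 1) * (?q - 1)) *
      (\<Sum>j\<in>?I. \<Sum>j'\<in>?J. C * ?E)"
  proof (intro mult_left_mono sum_mono)
    fix j j' assume "j \<in> ?I" "j' \<in> ?J"
    then have j: "j \<in> {0..<int P ^ A}" "j mod int P ^ 1 = i" and j': "j' \<in> {0..<int P ^ B}" "j' mod int P ^ 1 = i'"
      by auto
    have ne': "j mod int P \<noteq> j' mod int P" using j(2) j'(2) ne by auto
    show "av ?G (\<lambda>\<xi>. ?f A j \<xi> ^ (2 * ?L) * ?f B j' \<xi> ^ ?q) \<le> C * ?E"
    proof (cases "mass P k n a X A j = 0")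
      case True
      have "av ?G (\<lambda>\<xi>. ?f A j \<xi> ^ (2 * ?L) * ?f B j' \<xi> ^ ?q) = av ?G (\<lambda>_. 0)"
        using mass_eq_0[OF P X A(2) True _ k0] L by (intro av_cong) (auto simp: power_0_left)
      also have "\<dots> = 0" by (simp add: av_def)
      finally show ?thesis using C by simp
    next
      case False
      then have "0 < mass P k n a X A j" using mass_nonneg[of P k n a X A j] by linarith
      from BilD[OF bil X j(1) j'(1) ne' this]
      have "av ?G (\<lambda>\<xi>. ?f A j \<xi> ^ (2 * ?L) * ?f B j' \<xi> ^ ?q) \<le>
        C * (mass P k n a X A j powr t * mass P k n a X B j' powr (1 - t))" by (simp add: t_def)
      also have "\<dots> \<le> C * ?E"
        by (intro mult_left_mono mult_mono powr_mono2 mass_mono P A B j(2) j'(2) mass_nonneg C)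
          (use t in auto)
      finally show ?thesis .
    qed
  qed auto
  also have "\<dots> = real P ^ ((A - 1) * (2 * ?L - 1) + (B - 1) * (?q - 1) + (A - 1) + (B - 1)) * (C * ?E)"
    unfolding sum_constant card_residues[OF P i A(1)] card_residues[OF P i' B(1)]
    by (simp add: power_add mult_ac)
  also have "\<dots> \<le> real P ^ ((A + B) * (2 * ?K)) * (C * ?E)"
  proof (intro mult_right_mono power_increasing)
    have "(A - 1) * (2 * ?L - 1) + (A - 1) = (A - 1) * (2 * ?L)" using L by (cases ?L) auto
    also have "\<dots> \<le> A * (2 * ?K)" using L by (intro mult_le_mono) auto
    finally have 1: "(A - 1) * (2 * ?L - 1) + (A - 1) \<le> A * (2 * ?K)" .
    have "(B - 1) * (?q - 1) + (B - 1) = (B - 1) * ?q" using q by (cases ?q) auto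
    also have "\<dots> \<le> B * (2 * ?K)" by (intro mult_le_mono) auto
    finally show "(A - 1) * (2 * ?L - 1) + (B - 1) * (?q - 1) + (A - 1) + (B - 1) \<le> (A + B) * (2 * ?K)"
      using 1 by (simp only: distrib_right)
  qed (use P C in auto)
  finally show "av ?G (\<lambda>\<xi>. ?f 1 i \<xi> ^ (2 * ?L) * ?f 1 i' \<xi> ^ ?q) \<le> real P ^ ((A + B) * (2 * tri k)) * C *
    (mass P k n a X 1 i powr (tri l / tri k) * mass P k n a X 1 i' powr (1 - tri l / tri k))"
    by (simp add: t_def mult_ac)
qed

text \<open>Either one residue class mod \<open>P\<close> dominates the sum, or two different classes are comparable.\<close>

lemma broad_narrow:
  fixes x :: "'a \<Rightarrow> real"
  assumes I: "finite I" "I \<noteq> {}" "card I = P" and P: "P \<ge> 1" and x: "\<And>i. i \<in> I \<Longrightarrow> x i \<ge> 0" and K: "K \<ge> 1"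
  shows "(\<Sum>i\<in>I. x i) ^ (2 * K) \<le> 4 ^ K * (\<Sum>i\<in>I. x i ^ (2 * K)) +
    real P ^ (3 * K) * (\<Sum>i\<in>I. \<Sum>i'\<in>I - {i}. x i ^ K * x i' ^ K)"
proof -
  let ?F = "\<Sum>i\<in>I. x i"
  have F0: "?F \<ge> 0" using x by (simp add: sum_nonneg)
  obtain s where s: "s \<in> I" "\<And>i. i \<in> I \<Longrightarrow> x i \<le> x s"
  proof -
    have "Max (x ` I) \<in> x ` I" using I by (intro Max_in) auto
    then obtain s where "s \<in> I" "Max (x ` I) = x s" by auto
    then show thesis using that I Max_ge[of "x ` I"] by (metis finite_imageI imageI)
  qed
  have nn: "0 \<le> (\<Sum>i\<in>I. x i ^ (2 * K))" "0 \<le> (\<Sum>i\<in>I. \<Sum>i'\<in>I - {i}. x i ^ K * x i' ^ K)"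
    using x by (auto intro!: sum_nonneg)
  show ?thesis
  \<comment> \<open>\<open>s\<close> indexes the largest term. If every other term is at most 1/P of
    it, the sum is at most twice the largest term, with a constant free of P; otherwise two terms
    are comparable within a factor P.\<close>
  proof (cases "\<exists>u\<in>I - {s}. x s < real P * x u")
    case False
    have "?F = x s + (\<Sum>i\<in>I - {s}. x i)" using s I by (simp add: sum.remove)
    also have "(\<Sum>i\<in>I - {s}. x i) \<le> (\<Sum>i\<in>I - {s}. x s / real P)"
      using False P by (intro sum_mono) (auto simp: field_simps not_less)
    also have "\<dots> = real (P - 1) * (x s / real P)" using s I by simp
    also have "\<dots> \<le> real P * (x s / real P)" using s x by (intro mult_right_mono) auto
    also have "\<dots> = x s" using P by simp
    finally have "?F \<le> 2 * x s" by simp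
    then have "?F ^ (2 * K) \<le> (2 * x s) ^ (2 * K)" using F0 by (intro power_mono)
    also have "\<dots> = 4 ^ K * x s ^ (2 * K)" by (simp add: power_mult_distrib power_mult)
    also have "\<dots> \<le> 4 ^ K * (\<Sum>i\<in>I. x i ^ (2 * K))"
      using s x I by (intro mult_left_mono member_le_sum) auto
    finally show ?thesis using nn(2) by (simp add: add_increasing2)
  next
    case True
    then obtain u where u: "u \<in> I" "u \<noteq> s" "x s < real P * x u" by auto
    have "?F \<le> real P * x s" using sum_bounded_above[of I x "x s"] s I by simp
    then have "?F ^ 2 \<le> (real P * x s) ^ 2" using F0 by (intro power_mono)
    also have "\<dots> = real P ^ 2 * x s * x s" by (simp add: power2_eq_square)
    also have "\<dots> \<le> real P ^ 2 * x s * (real P * x u)" using u s x by (intro mult_left_mono) auto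
    also have "\<dots> = real P ^ 3 * (x s * x u)" by (simp add: power2_eq_square power3_eq_cube)
    finally have "(?F ^ 2) ^ K \<le> (real P ^ 3 * (x s * x u)) ^ K" by (intro power_mono) auto
    then have "?F ^ (2 * K) \<le> real P ^ (3 * K) * (x s ^ K * x u ^ K)"
      by (simp add: power_mult power_mult_distrib)
    also have "x s ^ K * x u ^ K \<le> (\<Sum>i'\<in>I - {s}. x s ^ K * x i' ^ K)"
      using u s x I by (intro member_le_sum[of u "I - {s}" "\<lambda>i'. x s ^ K * x i' ^ K"]) auto
    also have "\<dots> \<le> (\<Sum>i\<in>I. \<Sum>i'\<in>I - {i}. x i ^ K * x i' ^ K)"
      using s x I by (intro member_le_sum[of s I "\<lambda>i. \<Sum>i'\<in>I - {i}. x i ^ K * x i' ^ K"]) (auto intro!: sum_nonneg)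
    finally show ?thesis using nn(1) by (simp add: mult_left_mono add_increasing)
  qed
qed

text \<open>In the narrow case each class modulo P is decoupled with one level fewer, and the
  normalisation at level n provides a spare factor \<open>P ^ (tri k - 1)\<close> that absorbs
  \<open>4 ^ tri k\<close>. Hence \<open>D\<close> reappears with coefficient 1, and iterating over
  n accumulates no constant. The broad case is the bilinear estimate in both orders of the
  classes.\<close>

lemma Dec_broad_narrow:
  assumes P: "P \<ge> 8" and l: "1 \<le> l" "l < k" and n: "n \<ge> 1"
    and D: "Dec P k (n - 1) D" and D0: "D \<ge> 0" and bil: "Bil P k l n 1 1 B" and B0: "B \<ge> 0"
  shows "Dec P k n (D + real P ^ (3 * tri k + 2) * B)"
  unfolding Dec_iff_mass
proof (intro allI impI)
  fix a and X :: "int set" assume X: "finite X"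
  let ?G = "phases P k (k * n)" and ?K = "tri k" and ?L = "tri l" and ?I = "{0..<int P}"
  let ?m = "mass P k n a X"
  have P0: "P > 0" using P by simp
  have k0: "k > 0" using l by simp
  have L: "?L < ?K" "?L > 0" using tri_less[OF l(2)] tri_pos[of l] l by auto
  have "tri 2 \<le> ?K" using l by (intro tri_mono) auto
  then have K3: "?K \<ge> 3" by (simp add: tri_def)
  define x where "x i \<xi> = cmod (expsum a (rclass P X 1 i) \<xi>)" for i \<xi>
  have x0: "x i \<xi> \<ge> 0" for i \<xi> by (simp add: x_def)
  have I: "{j. j \<in> {0..<int P ^ 1} \<and> j mod int P ^ 0 = 0} = ?I" by auto
  have pt: "cmod (expsum a X \<xi>) ^ (2 * ?K) \<le> 4 ^ ?K * (\<Sum>i\<in>?I. x i \<xi> ^ (2 * ?K)) +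
    real P ^ (3 * ?K) * (\<Sum>i\<in>?I. \<Sum>i'\<in>?I - {i}. x i \<xi> ^ ?K * x i' \<xi> ^ ?K)" for \<xi>
  proof -
    have "expsum a X \<xi> = (\<Sum>i\<in>?I. expsum a (rclass P X 1 i) \<xi>)"
      using expsum_split[OF P0 X, of 0 1 a 0 \<xi>] unfolding I by simp
    then have "cmod (expsum a X \<xi>) ^ (2 * ?K) \<le> (\<Sum>i\<in>?I. x i \<xi>) ^ (2 * ?K)"
      unfolding x_def by (auto intro!: power_mono norm_sum)
    also have "\<dots> \<le> 4 ^ ?K * (\<Sum>i\<in>?I. x i \<xi> ^ (2 * ?K)) +
      real P ^ (3 * ?K) * (\<Sum>i\<in>?I. \<Sum>i'\<in>?I - {i}. x i \<xi> ^ ?K * x i' \<xi> ^ ?K)"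
      by (intro broad_narrow) (use P0 x0 K3 in auto)
    finally show ?thesis .
  qed
  have m0: "?m A i \<ge> 0" for A i by (rule mass_nonneg)
  have m1: "?m 1 i \<le> ?m 0 0" for i by (rule mass_mono[OF P0]) auto
  have narrow: "(\<Sum>i\<in>?I. av ?G (\<lambda>\<xi>. x i \<xi> ^ (2 * ?K))) \<le> D * real P ^ ((n - 1) * (?K - 1)) *
      (\<Sum>j\<in>{0..<int P ^ n}. av ?G (\<lambda>\<xi>. cmod (expsum a (rclass P X n j) \<xi>) ^ (2 * ?K)))"
  proof -
    have "(\<Sum>i\<in>?I. av ?G (\<lambda>\<xi>. x i \<xi> ^ (2 * ?K))) \<le> (\<Sum>i\<in>?I. D * ?m 1 i)"
      unfolding x_def by (intro sum_mono av_le_mass[OF P0 D X]) (use n in auto)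
    also have "\<dots> = D * real P ^ ((n - 1) * (?K - 1)) * (\<Sum>i\<in>?I. \<Sum>j | j \<in> {0..<int P ^ n} \<and> j mod int P ^ 1 = i.
      av ?G (\<lambda>\<xi>. cmod (expsum a (rclass P X n j) \<xi>) ^ (2 * ?K)))"
      by (simp add: mass_def sum_distrib_left mult_ac)
    also have "(\<Sum>i\<in>?I. \<Sum>j | j \<in> {0..<int P ^ n} \<and> j mod int P ^ 1 = i.
      av ?G (\<lambda>\<xi>. cmod (expsum a (rclass P X n j) \<xi>) ^ (2 * ?K))) =
      (\<Sum>j\<in>{0..<int P ^ n}. av ?G (\<lambda>\<xi>. cmod (expsum a (rclass P X n j) \<xi>) ^ (2 * ?K)))"
      using sum_residues_nested[OF P0, of 0 1 n "\<lambda>j. av ?G (\<lambda>\<xi>. cmod (expsum a (rclass P X n j) \<xi>) ^ (2 * ?K))" 0] n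
      unfolding I by (simp add: atLeastLessThan_def Int_def)
    finally show ?thesis .
  qed
  \<comment> \<open>This needs 2 K \<le> 3 (K - 1), that is K \<ge> 3, available since k \<ge> 2;
    together with P \<ge> 8 it gives the absorption.\<close>
  have "(4::real) ^ ?K \<le> 8 ^ (?K - 1)"
  proof -
    have "(4::real) ^ ?K = 2 ^ (2 * ?K)" by (simp add: power_mult)
    also have "\<dots> \<le> 2 ^ (3 * (?K - 1))" using K3 by (intro power_increasing) auto
    finally show ?thesis by (simp add: power_mult)
  qed
  also have "\<dots> \<le> real P ^ (?K - 1)" using P by (intro power_mono) auto
  finally have P4: "(4::real) ^ ?K \<le> real P ^ (?K - 1)" .
  have broad: "av ?G (\<lambda>\<xi>. x i \<xi> ^ ?K * x i' \<xi> ^ ?K) \<le> B * ?m 0 0" if i: "i \<in> ?I" and i': "i' \<in> ?I - {i}" for i i'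
  proof (cases "?m 1 i = 0 \<or> ?m 1 i' = 0")
    case True
    then have "av ?G (\<lambda>\<xi>. x i \<xi> ^ ?K * x i' \<xi> ^ ?K) = av ?G (\<lambda>_. 0)"
      using mass_eq_0[OF P0 X n _ _ k0] L by (intro av_cong) (auto simp: power_0_left x_def)
    also have "\<dots> = 0" by (simp add: av_def)
    finally show ?thesis using B0 m0 by simp
  next
    case False
    then have mp: "?m 1 i > 0" "?m 1 i' > 0" using m0[of 1 i] m0[of 1 i'] by auto
    define t where "t = real ?L / real ?K"
    have t: "0 < t" "t < 1" using L by (auto simp: t_def)
    let ?q = "2 * ?K - 2 * ?L"
    have bnd: "av ?G (\<lambda>\<xi>. x i \<xi> ^ (2 * ?L) * x i' \<xi> ^ ?q) \<le> B * ?m 0 0"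
      if "i \<in> ?I" "i' \<in> ?I" "i \<noteq> i'" "?m 1 i > 0" for i i'
    proof -
      have "av ?G (\<lambda>\<xi>. x i \<xi> ^ (2 * ?L) * x i' \<xi> ^ ?q) \<le> B * (?m 1 i powr t * ?m 1 i' powr (1 - t))"
        unfolding x_def t_def by (rule BilD[OF bil X]) (use that in auto)
      also have "\<dots> \<le> B * (?m 0 0 powr t * ?m 0 0 powr (1 - t))"
        by (intro mult_left_mono mult_mono powr_mono2 m0 m1 B0) (use t in auto)
      also have "?m 0 0 powr t * ?m 0 0 powr (1 - t) = ?m 0 0"
        using m0[of 0 0] by (cases "?m 0 0 = 0") (auto simp flip: powr_add)
      finally show ?thesis .
    qed
    \<comment> \<open>The symmetric product is the geometric mean of the two ordered bilinear
      integrands, whose exponents are unequal in general.\<close>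
    have pt2: "x i \<xi> ^ ?K * x i' \<xi> ^ ?K = (x i \<xi> ^ (2 * ?L) * x i' \<xi> ^ ?q) powr (1/2) *
        (x i' \<xi> ^ (2 * ?L) * x i \<xi> ^ ?q) powr (1 - 1/2)" for \<xi>
    proof -
      have KL: "u ^ (2 * ?L) * u ^ ?q = (u ^ ?K)\<^sup>2" for u :: real
        using L by (simp add: mult.commute flip: power_add power_mult)
      have "(x i \<xi> ^ (2 * ?L) * x i' \<xi> ^ ?q) * (x i' \<xi> ^ (2 * ?L) * x i \<xi> ^ ?q) = (x i \<xi> ^ ?K * x i' \<xi> ^ ?K)\<^sup>2"
        unfolding power_mult_distrib KL[symmetric] by (simp only: mult_ac)
      then have "sqrt (x i \<xi> ^ (2 * ?L) * x i' \<xi> ^ ?q) * sqrt (x i' \<xi> ^ (2 * ?L) * x i \<xi> ^ ?q) = x i \<xi> ^ ?K * x i' \<xi> ^ ?K"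
        using x0 by (simp flip: real_sqrt_mult)
      then show ?thesis using x0 by (simp add: powr_half_sqrt)
    qed
    have "av ?G (\<lambda>\<xi>. x i \<xi> ^ ?K * x i' \<xi> ^ ?K) \<le> av ?G (\<lambda>\<xi>. x i \<xi> ^ (2 * ?L) * x i' \<xi> ^ ?q) powr (1/2) *
        av ?G (\<lambda>\<xi>. x i' \<xi> ^ (2 * ?L) * x i \<xi> ^ ?q) powr (1 - 1/2)"
      unfolding pt2 by (intro av_Holder) (use x0 in auto)
    also have "\<dots> \<le> (B * ?m 0 0) powr (1/2) * (B * ?m 0 0) powr (1 - 1/2)"
      by (intro mult_mono powr_mono2 bnd) (use i i' mp x0 in \<open>auto intro!: av_nonneg\<close>)
    also have "\<dots> = B * ?m 0 0" using B0 m0 by (simp add: powr_half_sqrt)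
    finally show ?thesis .
  qed
  have "(\<Sum>i\<in>?I. \<Sum>i'\<in>?I - {i}. B * ?m 0 0) \<le> (\<Sum>i\<in>?I. \<Sum>i'\<in>?I. B * ?m 0 0)"
    by (intro sum_mono sum_mono2) (use B0 m0 in auto)
  also have "\<dots> = real P ^ 2 * (B * ?m 0 0)"
    by (simp add: power2_eq_square)
  finally have pairs: "(\<Sum>i\<in>?I. \<Sum>i'\<in>?I - {i}. B * ?m 0 0) \<le> real P ^ 2 * (B * ?m 0 0)" .
  have "av ?G (\<lambda>\<xi>. cmod (expsum a X \<xi>) ^ (2 * ?K)) \<le> av ?G (\<lambda>\<xi>. 4 ^ ?K * (\<Sum>i\<in>?I. x i \<xi> ^ (2 * ?K)) +
    real P ^ (3 * ?K) * (\<Sum>i\<in>?I. \<Sum>i'\<in>?I - {i}. x i \<xi> ^ ?K * x i' \<xi> ^ ?K))"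
    by (intro av_mono pt)
  also have "\<dots> = 4 ^ ?K * (\<Sum>i\<in>?I. av ?G (\<lambda>\<xi>. x i \<xi> ^ (2 * ?K))) +
    real P ^ (3 * ?K) * (\<Sum>i\<in>?I. \<Sum>i'\<in>?I - {i}. av ?G (\<lambda>\<xi>. x i \<xi> ^ ?K * x i' \<xi> ^ ?K))"
    by (simp add: av_add av_cmult av_sum)
  also have "\<dots> \<le> real P ^ (?K - 1) * (D * real P ^ ((n - 1) * (?K - 1)) *
      (\<Sum>j\<in>{0..<int P ^ n}. av ?G (\<lambda>\<xi>. cmod (expsum a (rclass P X n j) \<xi>) ^ (2 * ?K)))) +
    real P ^ (3 * ?K) * (\<Sum>i\<in>?I. \<Sum>i'\<in>?I - {i}. B * ?m 0 0)"
    by (intro add_mono mult_mono P4 narrow sum_mono broad mult_left_mono sum_nonneg av_nonneg) (use x0 in auto)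
  also have "real P ^ (?K - 1) * (D * real P ^ ((n - 1) * (?K - 1)) *
      (\<Sum>j\<in>{0..<int P ^ n}. av ?G (\<lambda>\<xi>. cmod (expsum a (rclass P X n j) \<xi>) ^ (2 * ?K)))) = D * ?m 0 0"
  proof -
    have "n * (?K - 1) = (?K - 1) + (n - 1) * (?K - 1)" using n by (cases n) auto
    then show ?thesis by (simp add: mass_def power_add mult_ac atLeastLessThan_def Int_def)
  qed
  also have "D * ?m 0 0 + real P ^ (3 * ?K) * (\<Sum>i\<in>?I. \<Sum>i'\<in>?I - {i}. B * ?m 0 0) \<le>
      D * ?m 0 0 + real P ^ (3 * ?K) * (real P ^ 2 * (B * ?m 0 0))"
    by (intro add_left_mono mult_left_mono pairs) auto
  finally show "av ?G (\<lambda>\<xi>. cmod (expsum a X \<xi>) ^ (2 * ?K)) \<le> (D + real P ^ (3 * ?K + 2) * B) * ?m 0 0"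
    by (simp add: power_add power2_eq_square algebra_simps)
qed

section \<open>The decoupling theorem for the moment curve\<close>

text \<open>\<open>rate k \<eta> T l\<close> is the exponential gain (per unit of the scale \<open>b\<close>) in the bilinear estimate
  with exponent \<open>tri l\<close> after \<open>T\<close> rounds of Hoelder's inequality and lower-dimensional
  decoupling. The recursion matrix fixes the sum over \<open>1 \<le> l < k\<close>, so the input \<open>\<eta>\<close> at
  \<open>l = 0\<close> makes that sum grow linearly in \<open>T\<close>.\<close>

fun rate :: "nat \<Rightarrow> real \<Rightarrow> nat \<Rightarrow> nat \<Rightarrow> real" where
  "rate k \<eta> 0 l = (if l = 0 then \<eta> else 0)"
| "rate k \<eta> (Suc T) l = (if l = 0 then \<eta> else
     real (k - l) / real (k - l + 1) * rate k \<eta> T (l - 1) + rate k \<eta> T (k - l) / real l)"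

lemma rate_0 [simp]: "rate k \<eta> T 0 = \<eta>"
  by (cases T) auto

text \<open>The rate at m \<ge> 1 is passed on to l = m + 1 with weight (k - m - 1)/(k - m) and to l
  = k - m with weight 1/(k - m), in total 1. The entry m = 0 reaches only l = 1, with weight (k -
  1)/k, since l = k is outside the range; this is the growth per round.\<close>

lemma sum_rate:
  assumes "k \<ge> 1"
  shows "(\<Sum>l\<in>{1..<k}. rate k \<eta> T l) = real T * (real (k - 1) / real k) * \<eta>"
proof (induction T)
  case (Suc T)
  obtain j where j: "k = Suc j" using assms by (cases k) auto
  let ?r = "rate k \<eta> T"
  have "(\<Sum>l\<in>{1..<k}. rate k \<eta> (Suc T) l) =
    (\<Sum>l\<in>{1..<k}. real (k - l) / real (k - l + 1) * ?r (l - 1)) + (\<Sum>l\<in>{1..<k}. ?r (k - l) / real l)"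
    unfolding sum.distrib[symmetric] by (intro sum.cong) auto
  also have "(\<Sum>l\<in>{1..<k}. ?r (k - l) / real l) = (\<Sum>m\<in>{1..<k}. ?r m / real (k - m))"
    by (rule sum.reindex_bij_witness[where i = "\<lambda>m. k - m" and j = "\<lambda>m. k - m"]) auto
  also have "(\<Sum>l\<in>{1..<k}. real (k - l) / real (k - l + 1) * ?r (l - 1)) =
      (\<Sum>m\<in>{0..<j}. real (j - m) / real (j - m + 1) * ?r m)"
    using sum.atLeast_Suc_lessThan_Suc_shift[of "\<lambda>l. real (k - l) / real (k - l + 1) * ?r (l - 1)" 0 j]
    by (simp add: j)
  also have "\<dots> = (\<Sum>m\<in>{0..<k}. real (j - m) / real (j - m + 1) * ?r m)"
    by (simp add: j)
  also have "\<dots> = real j / real (j + 1) * \<eta> + (\<Sum>m\<in>{1..<k}. real (j - m) / real (j - m + 1) * ?r m)"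
    using assms by (simp add: sum.atLeast_Suc_lessThan j)
  also have "\<dots> + (\<Sum>m\<in>{1..<k}. ?r m / real (k - m)) = real j / real (j + 1) * \<eta> +
      (\<Sum>m\<in>{1..<k}. real (j - m) / real (j - m + 1) * ?r m + ?r m / real (k - m))"
    by (simp add: sum.distrib)
  also have "(\<Sum>m\<in>{1..<k}. real (j - m) / real (j - m + 1) * ?r m + ?r m / real (k - m)) = (\<Sum>m\<in>{1..<k}. ?r m)"
  proof (intro sum.cong refl)
    fix m assume m: "m \<in> {1..<k}"
    then have "real (k - m) = real (j - m) + 1" using j by (simp add: of_nat_diff)
    then have "real (j - m) / real (j - m + 1) * ?r m + ?r m / real (k - m) =
        (real (j - m) * ?r m + ?r m) / (real (j - m) + 1)"
      by (simp add: add_divide_distrib add.commute)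
    also have "real (j - m) * ?r m + ?r m = ?r m * (real (j - m) + 1)" by (simp add: algebra_simps)
    finally show "real (j - m) / real (j - m + 1) * ?r m + ?r m / real (k - m) = ?r m"
      by (simp add: add_nonneg_eq_0_iff)
  qed
  also have "\<dots> = real T * (real (k - 1) / real k) * \<eta>" by (rule Suc)
  also have "real j / real (j + 1) * \<eta> + real T * (real (k - 1) / real k) * \<eta> =
      real (Suc T) * (real (k - 1) / real k) * \<eta>"
  proof -
    have "real (k - 1) / real k = real j / real (j + 1)" by (simp add: j)
    then show ?thesis by (simp only: of_nat_Suc distrib_right mult_1)
  qed
  finally show ?case .
qed auto

text \<open>The induction step over the degree. \<open>k < P\<close> makes 1, ..., k invertible
  modulo powers of P, and \<open>8 \<le> P\<close> is what the broad-narrow recursion needs.\<close>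

locale decoupling_step =
  fixes P k :: nat
  assumes prime_P: "prime P" and k_less: "k < P" and P_ge: "8 \<le> P" and k_ge: "2 \<le> k"
    and lower: "\<And>l \<epsilon>. 1 \<le> l \<Longrightarrow> l < k \<Longrightarrow> \<epsilon> > 0 \<Longrightarrow> \<exists>C. \<forall>n. Dec P l n (C * real P powr (\<epsilon> * real n))"
begin

lemma P_pos: "P > 0" using P_ge by simp

lemma Dec_uniform:
  assumes "\<exists>C. \<forall>n. Dec P l n (C * real P powr (\<epsilon> * real n))"
  obtains C where "C \<ge> 1" "\<And>n. Dec P l n (C * real P powr (\<epsilon> * real n))"
proof -
  obtain C where C: "\<forall>n. Dec P l n (C * real P powr (\<epsilon> * real n))" using assms by blast
  show thesis
    by (rule that[of "max C 1"]) (auto intro!: Dec_mono[OF C[rule_format]] mult_right_mono)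
qed

text \<open>The constant is traded for a doubled exponent once n is large. Repeated use of lower
  decoupling would otherwise multiply such constants, in a number growing with the scale.\<close>

lemma Dec_eventually:
  assumes \<epsilon>: "\<epsilon> > 0" and D: "\<And>n. Dec P l n (C * real P powr (\<epsilon> * real n))" and C: "C \<ge> 1"
  obtains c0 where "c0 \<ge> 1" "\<And>n. n \<ge> c0 \<Longrightarrow> Dec P l n (real P powr (2 * \<epsilon> * real n))"
proof -
  define c0 where "c0 = nat \<lceil>ln C / (\<epsilon> * ln P)\<rceil> + 1"
  have lnP: "ln (real P) > 0" using P_ge by simp
  have "Dec P l n (real P powr (2 * \<epsilon> * real n))" if "n \<ge> c0" for n
  proof (rule Dec_mono[OF D])
    have "ln C / (\<epsilon> * ln P) \<le> real n" using that unfolding c0_def by linarith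
    then have "ln C \<le> \<epsilon> * real n * ln P" using \<epsilon> lnP by (simp add: field_simps)
    then have "C \<le> real P powr (\<epsilon> * real n)"
      using C P_pos by (simp add: powr_def ln_ge_iff[symmetric] ln_le_cancel_iff[symmetric] flip: exp_ln_iff)
        (metis exp_le_cancel_iff exp_ln less_le_trans zero_less_one)
    then have "C * real P powr (\<epsilon> * real n) \<le> real P powr (\<epsilon> * real n) * real P powr (\<epsilon> * real n)"
      by (intro mult_right_mono) auto
    then show "C * real P powr (\<epsilon> * real n) \<le> real P powr (2 * \<epsilon> * real n)"
      by (simp add: mult.assoc flip: powr_add)
  qed
  then show thesis using that[of c0] by (auto simp: c0_def)
qed

text \<open>The scale A = (k - l + 1) b / l saturates the condition l A \<le> b (k - l + 1) of lower
  decoupling. The two forms produced by Hoelder's inequality have their own saturated scales, (k - l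
  + 2) b / (l - 1) \<ge> A for l - 1 > 0 and (l + 1) A / (k - l) \<ge> b for k - l; the induction
  hypothesis holds there, at parameter b and A respectively, and \<open>Bil_refine\<close> brings it
  back. Divisibility by \<open>fact k ^ T\<close> keeps the scales integral through T rounds, and
  \<open>k ^ (T + 1) * b \<le> n\<close> keeps them below n.\<close>

lemma bilinear_iteration:
  assumes \<eta>: "\<eta> \<ge> 0"
    and Dec_k: "\<And>\<epsilon>. \<epsilon> > 0 \<Longrightarrow> \<exists>C. \<forall>n. Dec P k n (C * real P powr ((\<eta> + \<epsilon>) * real n))"
  shows "\<lbrakk>1 \<le> l; l < k; \<epsilon> > 0\<rbrakk> \<Longrightarrow> \<exists>C b0. 0 \<le> C \<and> (\<forall>n b. b0 \<le> b \<longrightarrow> fact k ^ T dvd b \<longrightarrow> k ^ (T + 1) * b \<le> n \<longrightarrow>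
     Bil P k l n ((k - l + 1) * b div l) b (C * real P powr ((\<eta> + \<epsilon>) * real n - rate k \<eta> T l * real b)))"
proof (induction T arbitrary: l \<epsilon>)
  case 0
  obtain C where C: "C \<ge> 1" "\<And>n. Dec P k n (C * real P powr ((\<eta> + \<epsilon>) * real n))"
    using Dec_uniform[OF Dec_k[OF 0(3)]] by blast
  show ?case
  proof (intro exI[of _ C] exI[of _ 0] conjI allI impI)
    fix n b :: nat assume b: "k ^ (0 + 1) * b \<le> n"
    have "(k - l + 1) * b div l \<le> (k - l + 1) * b" by simp
    also have "\<dots> \<le> k * b" using 0 by (intro mult_le_mono1) auto
    finally have A: "(k - l + 1) * b div l \<le> n" using b by simp
    have "1 * b \<le> k * b" using k_ge by (intro mult_le_mono1) simp
    moreover have "k * b \<le> n" using b by simp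
    ultimately have B: "b \<le> n" by linarith
    have D: "Dec P k (n - c) (C * real P powr ((\<eta> + \<epsilon>) * real n))" for c
      using C(1) \<eta> 0 P_pos by (intro Dec_mono[OF C(2)] mult_left_mono powr_mono) auto
    show "Bil P k l n ((k - l + 1) * b div l) b (C * real P powr ((\<eta> + \<epsilon>) * real n - rate k \<eta> 0 l * real b))"
      using Bil_trivial[OF P_pos 0(1,2) A B D D] C(1) 0(1) by simp
  qed (use C in auto)
next
  case (Suc T)
  \<comment> \<open>One third is spent by the induction hypothesis and two thirds by
    \<open>Bil_refine\<close>.\<close>
  define \<delta> where "\<delta> = \<epsilon> / 3"
  have \<delta>: "\<delta> > 0" using Suc.prems by (simp add: \<delta>_def)
  define t where "t = real (k - l) / real (k - l + 1)"
  have t: "0 < t" "t < 1" using Suc.prems by (auto simp: t_def)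
  define A where "A b = (k - l + 1) * b div l" for b
  have Aex: "l * A b = (k - l + 1) * b" "fact k ^ T dvd A b" if dv: "fact k ^ Suc T dvd b" for b
  proof -
    obtain c where c: "b = fact k ^ Suc T * c" using dv by (elim dvdE)
    have "l dvd fact k" using Suc.prems by (intro dvd_fact) auto
    then obtain u where u: "fact k = l * u" by (auto simp: dvd_def)
    have "(k - l + 1) * b = l * (fact k ^ T * ((k - l + 1) * u * c))"
      unfolding c power_Suc by (subst u) (simp only: mult_ac)
    then have "A b = fact k ^ T * ((k - l + 1) * u * c)" using Suc.prems unfolding A_def by simp
    then show "l * A b = (k - l + 1) * b" "fact k ^ T dvd A b"
      using \<open>(k - l + 1) * b = _\<close> by simp_all
  qed
  have A_le: "A b \<le> k * b" for b
  proof -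
    have "A b \<le> (k - l + 1) * b" by (simp add: A_def)
    also have "\<dots> \<le> k * b" using Suc.prems by (intro mult_le_mono1) auto
    finally show ?thesis .
  qed
  have A_ge: "b \<le> k * A b" if "fact k ^ Suc T dvd b" for b
  proof -
    have "b \<le> l * A b" unfolding Aex[OF that] by simp
    also have "\<dots> \<le> k * A b" using Suc.prems by (intro mult_le_mono1) auto
    finally show ?thesis .
  qed
  have refine: "\<exists>C b0. 0 \<le> C \<and> (\<forall>n A' A B E. b0 \<le> A' \<longrightarrow> A' \<le> A \<longrightarrow> A \<le> n \<longrightarrow> l' * A \<le> B * (k - l' + 1) \<longrightarrow> 0 \<le> E \<longrightarrow>
      Bil P k l' n A B E \<longrightarrow> Bil P k l' n A' B (C * real P powr (2 * \<delta> * real n) * E))"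
    if l': "1 \<le> l'" "l' < k" for l'
  proof -
    obtain C where C: "C \<ge> 1" "\<And>n. Dec P l' n (C * real P powr (\<delta> * real n))"
      using Dec_uniform[OF lower[OF l' \<delta>]] by blast
    obtain c0 where c0: "c0 \<ge> 1" "\<And>n. n \<ge> c0 \<Longrightarrow> Dec P l' n (real P powr (2 * \<delta> * real n))"
      using Dec_eventually[OF \<delta> C(2,1)] by blast
    show ?thesis
    proof (intro exI[of _ C] exI[of _ "l' * c0"] conjI allI impI)
      fix n A' A B :: nat and E :: real
      assume *: "l' * c0 \<le> A'" "A' \<le> A" "A \<le> n" "l' * A \<le> B * (k - l' + 1)" "0 \<le> E" "Bil P k l' n A B E"
      have "Bil P k l' n A' B (C * real P powr (2 * \<delta> * real (A - A')) * E)"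
        by (rule Bil_refine[OF prime_P k_less l'(1) less_imp_le[OF l'(2)] \<delta> C(2,1) c0(2,1)]) (use * in auto)
      moreover have "2 * \<delta> * real (A - A') \<le> 2 * \<delta> * real n" using * \<delta> by simp
      then have "real P powr (2 * \<delta> * real (A - A')) \<le> real P powr (2 * \<delta> * real n)"
        using P_pos by (intro powr_mono) auto
      then have "C * real P powr (2 * \<delta> * real (A - A')) * E \<le> C * real P powr (2 * \<delta> * real n) * E"
        using C(1) *(5) by (intro mult_right_mono mult_left_mono) auto
      ultimately show "Bil P k l' n A' B (C * real P powr (2 * \<delta> * real n) * E)"
        by (rule Bil_mono)
    qed (use C in auto)
  qed
  have first: "\<exists>C b0. 0 \<le> C \<and> (\<forall>n b. b0 \<le> b \<longrightarrow> fact k ^ Suc T dvd b \<longrightarrow> k ^ (Suc T + 1) * b \<le> n \<longrightarrow>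
     Bil P k (l - 1) n (A b) b (C * real P powr ((\<eta> + \<epsilon>) * real n - rate k \<eta> T (l - 1) * real b)))"
  proof (cases "l = 1")
    \<comment> \<open>For l = 1 the form at l - 1 = 0 is bounded directly: decoupling n - b instead
      of n levels yields the rate \<open>\<eta>\<close> per unit of b.\<close>
    case True
    obtain C where C: "C \<ge> 1" "\<And>n. Dec P k n (C * real P powr ((\<eta> + \<epsilon>) * real n))"
      using Dec_uniform[OF Dec_k[OF Suc.prems(3)]] by blast
    show ?thesis
    proof (intro exI[of _ C] exI[of _ 0] conjI allI impI)
      fix n b :: nat assume "k ^ (Suc T + 1) * b \<le> n"
      moreover have "1 * b \<le> k ^ (Suc T + 1) * b" using k_ge by (intro mult_le_mono1) simp
      ultimately have B: "b \<le> n" by linarith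
      have "(\<eta> + \<epsilon>) * real (n - b) \<le> (\<eta> + \<epsilon>) * real n - \<eta> * real b"
        using B Suc.prems by (simp add: of_nat_diff algebra_simps)
      then have "C * real P powr ((\<eta> + \<epsilon>) * real (n - b)) \<le> C * real P powr ((\<eta> + \<epsilon>) * real n - \<eta> * real b)"
        using C(1) P_pos by (intro mult_left_mono powr_mono) auto
      then show "Bil P k (l - 1) n (A b) b (C * real P powr ((\<eta> + \<epsilon>) * real n - rate k \<eta> T (l - 1) * real b))"
        using Bil_0[OF P_pos _ B C(2)] C(1) k_ge by (simp add: True)
    qed (use C in auto)
  next
    case False
    then have l': "1 \<le> l - 1" "l - 1 < k" using Suc.prems by auto
    obtain C b0 where C: "0 \<le> C" "\<And>n b. b0 \<le> b \<Longrightarrow> fact k ^ T dvd b \<Longrightarrow> k ^ (T + 1) * b \<le> n \<Longrightarrow>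
       Bil P k (l - 1) n ((k - (l - 1) + 1) * b div (l - 1)) b (C * real P powr ((\<eta> + \<delta>) * real n - rate k \<eta> T (l - 1) * real b))"
      using Suc.IH[OF l' \<delta>] by blast
    obtain C' b0' where C': "0 \<le> C'" "\<And>n A' A B E. b0' \<le> A' \<Longrightarrow> A' \<le> A \<Longrightarrow> A \<le> n \<Longrightarrow>
        (l - 1) * A \<le> B * (k - (l - 1) + 1) \<Longrightarrow> 0 \<le> E \<Longrightarrow>
        Bil P k (l - 1) n A B E \<Longrightarrow> Bil P k (l - 1) n A' B (C' * real P powr (2 * \<delta> * real n) * E)"
      using refine[OF l'] by blast
    show ?thesis
    proof (intro exI[of _ "C' * C"] exI[of _ "b0 + k * b0'"] conjI allI impI)
      fix n b :: nat assume b: "b0 + k * b0' \<le> b" "fact k ^ Suc T dvd b" "k ^ (Suc T + 1) * b \<le> n"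
      have "k * b0' \<le> k * A b" using A_ge[OF b(2)] b(1) by linarith
      then have A0: "b0' \<le> A b" using k_ge by simp
      have "k ^ (T + 1) * b \<le> k ^ (Suc T + 1) * b" using k_ge by (intro mult_le_mono1 power_increasing) auto
      then have kb: "k ^ (T + 1) * b \<le> n" using b(3) by linarith
      define A1 where "A1 = (k - (l - 1) + 1) * b div (l - 1)"
      have "(k - l + 1) * b div l \<le> (k - l + 1) * b div (l - 1)"
        using l' by (intro div_le_mono2) auto
      also have "\<dots> \<le> A1" unfolding A1_def using Suc.prems by (intro div_le_mono mult_le_mono1) auto
      finally have A01: "A b \<le> A1" by (simp add: A_def)
      have "A1 \<le> (k - (l - 1) + 1) * b" by (simp add: A1_def)
      also have "\<dots> \<le> k * b" using l' by (intro mult_le_mono1) auto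
      also have "\<dots> \<le> k ^ (T + 1) * b" using k_ge by (intro mult_le_mono1) simp
      finally have A1n: "A1 \<le> n" using kb by linarith
      have ex: "(l - 1) * A1 \<le> b * (k - (l - 1) + 1)" unfolding A1_def
        by (metis mult.commute times_div_less_eq_dividend)
      have "Bil P k (l - 1) n (A b) b (C' * real P powr (2 * \<delta> * real n) *
          (C * real P powr ((\<eta> + \<delta>) * real n - rate k \<eta> T (l - 1) * real b)))"
      proof (rule C'(2)[OF A0 A01 A1n ex])
        have "fact k ^ T dvd b" using b(2) by (simp add: dvd_mult_right power_commutes)
        then show "Bil P k (l - 1) n A1 b (C * real P powr ((\<eta> + \<delta>) * real n - rate k \<eta> T (l - 1) * real b))"
          unfolding A1_def using b(1) kb by (intro C(2)) auto
      qed (use C in auto)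
      also have "C' * real P powr (2 * \<delta> * real n) * (C * real P powr ((\<eta> + \<delta>) * real n - rate k \<eta> T (l - 1) * real b)) =
        C' * C * real P powr (2 * \<delta> * real n + ((\<eta> + \<delta>) * real n - rate k \<eta> T (l - 1) * real b))"
        by (simp add: powr_add)
      also have "2 * \<delta> * real n + ((\<eta> + \<delta>) * real n - rate k \<eta> T (l - 1) * real b) =
          (\<eta> + \<epsilon>) * real n - rate k \<eta> T (l - 1) * real b"
        by (simp add: \<delta>_def algebra_simps)
      finally show "Bil P k (l - 1) n (A b) b (C' * C * real P powr ((\<eta> + \<epsilon>) * real n - rate k \<eta> T (l - 1) * real b))" .
    qed (use C C' in auto)
  qed
  have second: "\<exists>C b0. 0 \<le> C \<and> (\<forall>n b. b0 \<le> b \<longrightarrow> fact k ^ Suc T dvd b \<longrightarrow> k ^ (Suc T + 1) * b \<le> n \<longrightarrow>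
     Bil P k (k - l) n b (A b) (C * real P powr ((\<eta> + \<epsilon>) * real n - rate k \<eta> T (k - l) * real (A b))))"
  proof -
    have l': "1 \<le> k - l" "k - l < k" "k - (k - l) = l" using Suc.prems by auto
    obtain C b0 where C: "0 \<le> C" "\<And>n b. b0 \<le> b \<Longrightarrow> fact k ^ T dvd b \<Longrightarrow> k ^ (T + 1) * b \<le> n \<Longrightarrow>
       Bil P k (k - l) n ((l + 1) * b div (k - l)) b (C * real P powr ((\<eta> + \<delta>) * real n - rate k \<eta> T (k - l) * real b))"
      using Suc.IH[OF l'(1,2) \<delta>] unfolding l'(3) by blast
    obtain C' b0' where C': "0 \<le> C'" "\<And>n A' A B E. b0' \<le> A' \<Longrightarrow> A' \<le> A \<Longrightarrow> A \<le> n \<Longrightarrow>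
        (k - l) * A \<le> B * (l + 1) \<Longrightarrow> 0 \<le> E \<Longrightarrow>
        Bil P k (k - l) n A B E \<Longrightarrow> Bil P k (k - l) n A' B (C' * real P powr (2 * \<delta> * real n) * E)"
      using refine[OF l'(1,2)] unfolding l'(3) by blast
    show ?thesis
    proof (intro exI[of _ "C' * C"] exI[of _ "k * b0 + b0'"] conjI allI impI)
      fix n b :: nat assume b: "k * b0 + b0' \<le> b" "fact k ^ Suc T dvd b" "k ^ (Suc T + 1) * b \<le> n"
      have "k * b0 \<le> k * A b" using A_ge[OF b(2)] b(1) by linarith
      then have A0: "b0 \<le> A b" using k_ge by simp
      have "k ^ (T + 1) * A b \<le> k ^ (T + 1) * (k * b)" by (intro mult_le_mono2 A_le)
      also have "\<dots> = k ^ (Suc T + 1) * b" by simp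
      finally have kA: "k ^ (T + 1) * A b \<le> n" using b(3) by linarith
      define A1 where "A1 = (l + 1) * A b div (k - l)"
      have "(k - l) * b \<le> l * A b" unfolding Aex(1)[OF b(2)] by simp
      also have "\<dots> \<le> (l + 1) * A b" by simp
      finally have A01: "b \<le> A1" unfolding A1_def using l'(1) by (simp add: less_eq_div_iff_mult_less_eq mult.commute)
      have "A1 \<le> (l + 1) * A b" by (simp add: A1_def)
      also have "\<dots> \<le> k * A b" using Suc.prems by (intro mult_le_mono1) auto
      also have "\<dots> \<le> k ^ (T + 1) * A b" using k_ge by (intro mult_le_mono1) simp
      finally have A1n: "A1 \<le> n" using kA by linarith
      have ex: "(k - l) * A1 \<le> A b * (l + 1)" unfolding A1_def
        by (metis mult.commute times_div_less_eq_dividend)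
      have "Bil P k (k - l) n b (A b) (C' * real P powr (2 * \<delta> * real n) *
          (C * real P powr ((\<eta> + \<delta>) * real n - rate k \<eta> T (k - l) * real (A b))))"
      proof (rule C'(2)[OF _ A01 A1n ex])
        show "Bil P k (k - l) n A1 (A b) (C * real P powr ((\<eta> + \<delta>) * real n - rate k \<eta> T (k - l) * real (A b)))"
          unfolding A1_def using A0 kA Aex(2)[OF b(2)] by (intro C(2)) auto
      qed (use C b in auto)
      also have "C' * real P powr (2 * \<delta> * real n) * (C * real P powr ((\<eta> + \<delta>) * real n - rate k \<eta> T (k - l) * real (A b))) =
        C' * C * real P powr (2 * \<delta> * real n + ((\<eta> + \<delta>) * real n - rate k \<eta> T (k - l) * real (A b)))"
        by (simp add: powr_add)
      also have "2 * \<delta> * real n + ((\<eta> + \<delta>) * real n - rate k \<eta> T (k - l) * real (A b)) =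
          (\<eta> + \<epsilon>) * real n - rate k \<eta> T (k - l) * real (A b)"
        by (simp add: \<delta>_def algebra_simps)
      finally show "Bil P k (k - l) n b (A b) (C' * C * real P powr ((\<eta> + \<epsilon>) * real n - rate k \<eta> T (k - l) * real (A b)))" .
    qed (use C C' in auto)
  qed
  obtain C1 b1 where 1: "0 \<le> C1" "\<And>n b. b1 \<le> b \<Longrightarrow> fact k ^ Suc T dvd b \<Longrightarrow> k ^ (Suc T + 1) * b \<le> n \<Longrightarrow>
     Bil P k (l - 1) n (A b) b (C1 * real P powr ((\<eta> + \<epsilon>) * real n - rate k \<eta> T (l - 1) * real b))"
    using first by blast
  obtain C2 b2 where 2: "0 \<le> C2" "\<And>n b. b2 \<le> b \<Longrightarrow> fact k ^ Suc T dvd b \<Longrightarrow> k ^ (Suc T + 1) * b \<le> n \<Longrightarrow>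
     Bil P k (k - l) n b (A b) (C2 * real P powr ((\<eta> + \<epsilon>) * real n - rate k \<eta> T (k - l) * real (A b)))"
    using second by blast
  show ?case
  proof (intro exI[of _ "C1 powr t * C2 powr (1 - t)"] exI[of _ "b1 + b2"] conjI allI impI)
    fix n b :: nat assume b: "b1 + b2 \<le> b" "fact k ^ Suc T dvd b" "k ^ (Suc T + 1) * b \<le> n"
    have "k * b \<le> k ^ (Suc T + 1) * b" using k_ge by (intro mult_le_mono1) simp
    moreover have "1 * b \<le> k * b" using k_ge by (intro mult_le_mono1) simp
    ultimately have le: "A b \<le> n" "b \<le> n" using A_le[of b] b(3) by linarith+
    let ?e1 = "(\<eta> + \<epsilon>) * real n - rate k \<eta> T (l - 1) * real b"
    let ?e2 = "(\<eta> + \<epsilon>) * real n - rate k \<eta> T (k - l) * real (A b)"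
    have "Bil P k l n (A b) b ((C1 * real P powr ?e1) powr t * (C2 * real P powr ?e2) powr (1 - t))"
      unfolding t_def using b Suc.prems 1 2 by (intro Bil_Holder P_pos le) auto
    also have "(C1 * real P powr ?e1) powr t * (C2 * real P powr ?e2) powr (1 - t) =
      C1 powr t * C2 powr (1 - t) * real P powr (?e1 * t + ?e2 * (1 - t))"
      using 1 2 by (simp add: powr_mult powr_powr powr_add)
    also have "?e1 * t + ?e2 * (1 - t) = (\<eta> + \<epsilon>) * real n - rate k \<eta> (Suc T) l * real b"
    proof -
      \<comment> \<open>The swapped form gains at scale A with Hoelder weight 1 - t = 1/(k - l + 1).
        Saturation turns (1 - t) A into b / l, the coefficient in the second term of
        \<open>rate\<close>.\<close>
      have "real l * real (A b) = real (k - l + 1) * real b"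
        using Aex(1)[OF b(2)] by (metis of_nat_mult)
      then have "real (A b) / real (k - l + 1) = real b / real l"
        using Suc.prems by (subst frac_eq_eq) (auto simp: mult.commute)
      moreover have "1 - t = 1 / real (k - l + 1)" by (simp add: t_def field_simps)
      ultimately have "(1 - t) * real (A b) = real b / real l" by simp
      then have "rate k \<eta> T (k - l) * ((1 - t) * real (A b)) = rate k \<eta> T (k - l) * (real b / real l)" by simp
      moreover have "rate k \<eta> (Suc T) l = t * rate k \<eta> T (l - 1) + rate k \<eta> T (k - l) / real l"
        using Suc.prems by (simp add: t_def)
      ultimately show ?thesis by (simp add: algebra_simps)
    qed
    finally show "Bil P k l n ((k - l + 1) * b div l) b (C1 powr t * C2 powr (1 - t) *
        real P powr ((\<eta> + \<epsilon>) * real n - rate k \<eta> (Suc T) l * real b))"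
      unfolding A_def .
  qed (use 1 2 in auto)
qed

text \<open>If the optimal exponent \<open>\<eta>\<close> were positive, enough rounds of the iteration would give a
  bilinear estimate with a strictly smaller exponent.\<close>

lemma Dec_exponent_improves:
  assumes \<eta>: "\<eta> > 0"
    and Dec_k: "\<And>\<epsilon>. \<epsilon> > 0 \<Longrightarrow> \<exists>C. \<forall>n. Dec P k n (C * real P powr ((\<eta> + \<epsilon>) * real n))"
  shows "\<exists>\<mu>. 0 \<le> \<mu> \<and> \<mu> < \<eta> \<and> (\<exists>C. \<forall>n. Dec P k n (C * real P powr (\<mu> * real n)))"
proof -
  \<comment> \<open>The mean of the k - 1 rates is T \<eta> / k by \<open>sum_rate\<close>.
    Coarsening costs at most 4 tri k k per unit of b, so T is taken large enough to leave a surplus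
    of 1.\<close>
  define T where "T = nat \<lceil>real k * (4 * real (tri k) * real k + 1) / \<eta>\<rceil>"
  have T: "real k * (4 * real (tri k) * real k + 1) \<le> real T * \<eta>"
  proof -
    have "real k * (4 * real (tri k) * real k + 1) / \<eta> \<le> real T" unfolding T_def by linarith
    then show ?thesis using \<eta> by (simp add: field_simps)
  qed
  have "\<exists>l\<in>{1..<k}. real T * \<eta> / real k \<le> rate k \<eta> T l"
  proof (rule ccontr)
    assume "\<not> ?thesis"
    then have "(\<Sum>l\<in>{1..<k}. rate k \<eta> T l) < (\<Sum>l\<in>{1..<k}. real T * \<eta> / real k)"
      using k_ge by (intro sum_strict_mono) (auto simp: not_le)
    then show False using sum_rate[of k \<eta> T] k_ge by (simp add: mult_ac)
  qed
  then obtain l where l: "1 \<le> l" "l < k" and rl: "real T * \<eta> / real k \<le> rate k \<eta> T l" by auto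
  have rate: "4 * real (tri k) * real k + 1 \<le> rate k \<eta> T l"
    using T rl k_ge by (intro order.trans[OF _ rl]) (simp add: field_simps)
  define Q where "Q = (fact k :: nat) ^ T"
  define R where "R = k ^ (T + 1)"
  have QR: "Q \<ge> 1" "R \<ge> 1" using k_ge by (auto simp: Q_def R_def)
  \<comment> \<open>The surplus b is about \<kappa> n. Half of it pays for the \<epsilon> in the
    hypothesis on \<open>\<eta>\<close>, half is the improvement; the maximum in
    \<open>\<mu>\<close> keeps the new exponent positive, so that \<open>\<rho>\<close> below
    exceeds 1.\<close>
  define \<kappa> where "\<kappa> = 1 / real R"
  define \<mu> where "\<mu> = max (\<eta> - \<kappa> / 2) (\<eta> / 2)"
  have \<kappa>: "\<kappa> > 0" using QR by (simp add: \<kappa>_def)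
  have \<mu>: "0 < \<mu>" "\<mu> < \<eta>" "\<eta> - \<kappa> / 2 \<le> \<mu>" using \<eta> \<kappa> by (auto simp: \<mu>_def)
  obtain C b0 where C: "0 \<le> C" and bil: "\<And>n b. b0 \<le> b \<Longrightarrow> fact k ^ T dvd b \<Longrightarrow> k ^ (T + 1) * b \<le> n \<Longrightarrow>
     Bil P k l n ((k - l + 1) * b div l) b (C * real P powr ((\<eta> + \<kappa> / 2) * real n - rate k \<eta> T l * real b))"
    using bilinear_iteration[OF less_imp_le[OF \<eta>] Dec_k l half_gt_zero[OF \<kappa>], of T] by blast
  define n0 where "n0 = R * Q * (b0 + k + 1)"
  define C1 where "C1 = C * real P powr real Q"
  have C1: "C1 \<ge> 0" using C by (simp add: C1_def)
  have bil11: "Bil P k l n 1 1 (C1 * real P powr (\<mu> * real n))" if n: "n \<ge> n0" for n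
  proof -
    \<comment> \<open>A multiple of Q with R b \<le> n. Rounding down costs at most Q in the
      inequality \<kappa> n \<le> b + Q, which becomes the factor P^Q in \<open>C1\<close>.\<close>
    define b where "b = Q * (n div (Q * R))"
    have Rb: "R * b \<le> n" unfolding b_def by (metis mult.assoc mult.commute times_div_less_eq_dividend)
    have "b0 + k + 1 \<le> n div (Q * R)"
      using n QR unfolding n0_def by (simp add: less_eq_div_iff_mult_less_eq mult_ac)
    also have "\<dots> \<le> b" using QR by (simp add: b_def)
    finally have b: "b0 + k + 1 \<le> b" .
    have "n = (n div (Q * R)) * (Q * R) + n mod (Q * R)" by (rule div_mult_mod_eq[symmetric])
    also have "\<dots> \<le> R * b + Q * R" using QR mod_less_divisor[of "Q * R" n] by (simp add: b_def mult_ac del: mod_less_divisor)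
    finally have "real n \<le> real R * real b + real Q * real R" by (metis of_nat_add of_nat_le_iff of_nat_mult)
    then have nb: "\<kappa> * real n \<le> real b + real Q" using QR by (simp add: \<kappa>_def field_simps)
    define A where "A = (k - l + 1) * b div l"
    have "A \<le> (k - l + 1) * b" by (simp add: A_def)
    also have "\<dots> \<le> k * b" using l by (intro mult_le_mono1) auto
    finally have Akb: "A \<le> k * b" .
    also have "k * b \<le> R * b" using k_ge by (intro mult_le_mono1) (simp add: R_def)
    finally have An: "A \<le> n" using Rb by linarith
    have "1 * b \<le> R * b" using QR by (intro mult_le_mono1) auto
    then have bn: "b \<le> n" using Rb by linarith
    have "l \<le> b" using l b by linarith
    have "l \<le> (k - l + 1) * b" using \<open>l \<le> b\<close> by (simp add: trans_le_add2)
    then have A1: "1 \<le> A" unfolding A_def using l by (simp add: less_eq_div_iff_mult_less_eq)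
    let ?E = "C * real P powr ((\<eta> + \<kappa> / 2) * real n - rate k \<eta> T l * real b)"
    have "Bil P k l n A b ?E"
      unfolding A_def using b Rb by (intro bil) (auto simp: b_def Q_def R_def)
    then have "Bil P k l n 1 1 (real P ^ ((A + b) * (2 * tri k)) * ?E)"
      using A1 An b bn C by (intro Bil_coarsen[OF P_pos l, of A n b]) auto
    moreover have "real P ^ ((A + b) * (2 * tri k)) * ?E \<le> C1 * real P powr (\<mu> * real n)"
    proof -
      have "(A + b) * (2 * tri k) \<le> (k * b + k * b) * (2 * tri k)"
        using Akb k_ge by (intro mult_le_mono1 add_mono) auto
      also have "\<dots> = 4 * tri k * k * b" by simp
      finally have "real P ^ ((A + b) * (2 * tri k)) \<le> real P ^ (4 * tri k * k * b)"
        using P_pos by (intro power_increasing) auto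
      then have "real P ^ ((A + b) * (2 * tri k)) * ?E \<le> real P powr (real (4 * tri k * k * b)) * ?E"
        using C P_pos by (intro mult_right_mono) (simp_all only: powr_realpow of_nat_0_less_iff, auto)
      also have "\<dots> = C * real P powr (real (4 * tri k * k * b) + ((\<eta> + \<kappa> / 2) * real n - rate k \<eta> T l * real b))"
        by (simp add: powr_add)
      also have "\<dots> \<le> C * real P powr (real Q + \<mu> * real n)"
      proof (intro mult_left_mono powr_mono C)
        have "(4 * real (tri k) * real k + 1) * real b \<le> rate k \<eta> T l * real b"
          using rate by (intro mult_right_mono) auto
        then have "real (4 * tri k * k * b) + ((\<eta> + \<kappa> / 2) * real n - rate k \<eta> T l * real b) \<le> (\<eta> + \<kappa> / 2) * real n - real b"
          by (simp add: algebra_simps)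
        also have "\<dots> \<le> (\<eta> + \<kappa> / 2) * real n - (\<kappa> * real n - real Q)" using nb by linarith
        also have "\<dots> = real Q + (\<eta> - \<kappa> / 2) * real n" by (simp add: algebra_simps)
        also have "\<dots> \<le> real Q + \<mu> * real n" using \<mu> by (intro add_left_mono mult_right_mono) auto
        finally show "real (4 * tri k * k * b) + ((\<eta> + \<kappa> / 2) * real n - rate k \<eta> T l * real b) \<le> real Q + \<mu> * real n" .
      qed (use P_pos in auto)
      finally show ?thesis by (simp add: C1_def powr_add mult_ac)
    qed
    ultimately show ?thesis by (rule Bil_mono)
  qed
  define C2 where "C2 = real P ^ (3 * tri k + 2) * C1"
  have C2: "C2 \<ge> 0" using C1 by (simp add: C2_def)
  define \<rho> where "\<rho> = real P powr \<mu>"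
  have \<rho>: "\<rho> > 1" unfolding \<rho>_def using P_ge \<mu> by (intro gr_one_powr) auto
  have \<rho>n: "real P powr (\<mu> * real n) = \<rho> ^ n" for n
    using P_pos by (simp add: \<rho>_def powr_powr flip: powr_realpow)
  \<comment> \<open>The first entry closes the recursion, as C3 (\<rho> - 1) \<ge> C2 \<rho> absorbs
    the broad term at each level; the second covers the levels below n0 by the trivial
    constant.\<close>
  define C3 where "C3 = max (C2 * \<rho> / (\<rho> - 1)) (real P ^ (n0 * tri k))"
  have C3: "C3 \<ge> real P ^ (n0 * tri k)" "C3 * (\<rho> - 1) \<ge> C2 * \<rho>" "C3 \<ge> 0"
  proof -
    show "C3 \<ge> real P ^ (n0 * tri k)" by (simp add: C3_def)
    then show "C3 \<ge> 0" by (rule order.trans[rotated]) simp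
    have "C2 * \<rho> / (\<rho> - 1) \<le> C3" by (simp add: C3_def)
    then show "C3 * (\<rho> - 1) \<ge> C2 * \<rho>" using \<rho> by (simp add: field_simps)
  qed
  have "Dec P k n (C3 * \<rho> ^ n)" for n
  proof (induction n)
    case 0
    have "1 \<le> real P ^ (n0 * tri k)" using P_pos by (intro one_le_power) auto
    then have "real P ^ (0 * tri k) \<le> C3" using C3(1) by simp
    then show ?case using Dec_mono[OF Dec_trivial[OF P_pos, of k 0]] k_ge by simp
  next
    case (Suc n)
    show ?case
    proof (cases "n0 \<le> Suc n")
      case True
      have "Dec P k (Suc n) (C3 * \<rho> ^ n + real P ^ (3 * tri k + 2) * (C1 * \<rho> ^ Suc n))"
        using Suc.IH bil11[OF True] C1 C3 \<rho> unfolding \<rho>n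
        by (intro Dec_broad_narrow[OF P_ge l]) auto
      moreover have "C3 * \<rho> ^ n + real P ^ (3 * tri k + 2) * (C1 * \<rho> ^ Suc n) \<le> C3 * \<rho> ^ Suc n"
      proof -
        have "C2 * \<rho> * \<rho> ^ n \<le> C3 * (\<rho> - 1) * \<rho> ^ n" using C3(2) \<rho> by (intro mult_right_mono) auto
        then show ?thesis by (simp add: C2_def algebra_simps)
      qed
      ultimately show ?thesis by (rule Dec_mono)
    next
      case False
      have "real P ^ (Suc n * tri k) \<le> real P ^ (n0 * tri k)"
        using False P_pos by (intro power_increasing mult_le_mono1) auto
      also have "\<dots> \<le> C3 * 1" using C3 by simp
      also have "\<dots> \<le> C3 * \<rho> ^ Suc n" using \<rho> C3 by (intro mult_left_mono one_le_power) auto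
      finally show ?thesis using Dec_mono[OF Dec_trivial[OF P_pos, of k "Suc n"]] k_ge by simp
    qed
  qed
  then show ?thesis using \<mu> unfolding \<rho>n[symmetric] by (intro exI[of _ \<mu>]) auto
qed

text \<open>The infimum of the admissible exponents need not be attained, but
  \<open>Dec_exponent_improves\<close> asks only for exponents above it and then produces one
  strictly below. So the infimum is 0.\<close>

lemma Dec_k_small: "\<epsilon> > 0 \<Longrightarrow> \<exists>C. \<forall>n. Dec P k n (C * real P powr (\<epsilon> * real n))"
proof -
  define S where "S = {x. 0 \<le> x \<and> (\<exists>C. \<forall>n. Dec P k n (C * real P powr (x * real n)))}"
  have "real (tri k) \<in> S"
  proof -
    have "real P powr (real (tri k) * real n) = real P ^ (n * tri k)" for n
      using P_pos by (simp add: mult.commute powr_powr[symmetric] flip: powr_realpow)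
    then show ?thesis unfolding S_def using Dec_trivial[OF P_pos, of k] k_ge
      by (auto intro!: exI[of _ 1])
  qed
  then have ne: "S \<noteq> {}" by auto
  have bdd: "bdd_below S" by (auto simp: S_def intro!: bdd_belowI[of _ 0])
  define \<eta> where "\<eta> = Inf S"
  have \<eta>0: "\<eta> \<ge> 0" unfolding \<eta>_def using ne by (intro cInf_greatest) (auto simp: S_def)
  have near: "\<exists>C. \<forall>n. Dec P k n (C * real P powr ((\<eta> + \<epsilon>) * real n))" if \<epsilon>: "\<epsilon> > 0" for \<epsilon>
  proof -
    obtain x where x: "x \<in> S" "x < \<eta> + \<epsilon>"
      using cInf_lessD[OF ne, of "\<eta> + \<epsilon>"] \<epsilon> by (auto simp: \<eta>_def)
    then obtain C where C: "C \<ge> 1" "\<And>n. Dec P k n (C * real P powr (x * real n))"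
      using Dec_uniform[of k x] unfolding S_def by blast
    have "Dec P k n (C * real P powr ((\<eta> + \<epsilon>) * real n))" for n
      using C(1) x(2) P_pos
      by (intro Dec_mono[OF C(2)] mult_left_mono powr_mono mult_right_mono) auto
    then show ?thesis by blast
  qed
  have "\<eta> = 0"
  proof (rule ccontr)
    assume "\<eta> \<noteq> 0"
    then have "\<eta> > 0" using \<eta>0 by simp
    from Dec_exponent_improves[OF this near] obtain x where "x \<in> S" "x < \<eta>"
      by (auto simp: S_def)
    then show False using cInf_lower[OF _ bdd] unfolding \<eta>_def by force
  qed
  then show "\<epsilon> > 0 \<Longrightarrow> ?thesis" using near by simp
qed

end

theorem decoupling:
  assumes P: "prime P" "8 \<le> P" and k: "1 \<le> k" "k < P" and \<epsilon>: "\<epsilon> > 0"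
  shows "\<exists>C. \<forall>n. Dec P k n (C * real P powr (\<epsilon> * real n))"
  using k \<epsilon>
proof (induction k arbitrary: \<epsilon> rule: less_induct)
  case (less k)
  show ?case
  proof (cases "k = 1")
    case True
    have "Dec P k n (1 * real P powr (\<epsilon> * real n))" for n
      unfolding True using P less.prems by (intro Dec_mono[OF Dec_one]) (auto intro!: ge_one_powr_ge_zero)
    then show ?thesis by blast
  next
    case False
    interpret decoupling_step P k
      using P less False by unfold_locales auto
    show ?thesis by (rule Dec_k_small) fact
  qed
qed

section \<open>Distance to the nearest integer and geometric sums\<close>

abbreviation dni :: "real \<Rightarrow> real" where "dni \<equiv> dist_nearest_int"

lemma dni_le: "dni x \<le> \<bar>x - of_int n\<bar>"
  unfolding dist_nearest_int_def by (rule round_diff_minimal)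

lemma dni_nonneg [simp]: "0 \<le> dni x"
  by (simp add: dist_nearest_int_def)

lemma dni_le_half: "dni x \<le> 1 / 2"
  using of_int_round_abs_le[of x] by (simp add: dist_nearest_int_def abs_minus_commute)

lemma dni_le_abs: "dni x \<le> \<bar>x\<bar>"
  using dni_le[of x 0] by simp

lemma dni_minus [simp]: "dni (- x) = dni x"
proof -
  have *: "dni (- x) \<le> dni x" for x
    using dni_le[of "- x" "- round x"] by (simp add: dist_nearest_int_def)
  show ?thesis using *[of x] *[of "- x"] by simp
qed

lemma norm_e_minus_1_eq: "cmod (e y - 1) = 2 * \<bar>sin (pi * y)\<bar>"
proof -
  have "cmod (e y - 1) ^ 2 = (cos (2 * pi * y) - 1) ^ 2 + sin (2 * pi * y) ^ 2"
    by (simp add: e_def cmod_power2)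
  also have "\<dots> = 2 - 2 * cos (2 * (pi * y))"
    using sin_cos_squared_add[of "2 * pi * y"] by (simp add: power2_eq_square algebra_simps)
  also have "\<dots> = (2 * \<bar>sin (pi * y)\<bar>) ^ 2" by (simp add: cos_double_sin power_mult_distrib)
  finally show ?thesis by (rule power2_eq_imp_eq) auto
qed

text \<open>It suffices that |sin (pi y)| \<ge> |y| for |y| \<le> 1/2. The cubic Taylor bound gives
  sin z \<ge> z/3 for z up to 1.6, and pi > 3 does the rest; the sharp factor would be 4 instead of
  2.\<close>

lemma norm_e_minus_1: "2 * dni x \<le> cmod (e x - 1)"
proof -
  define y where "y = x - of_int (round x)"
  have y: "\<bar>y\<bar> = dni x" "\<bar>y\<bar> \<le> 1 / 2" using dni_le_half[of x] by (auto simp: y_def dist_nearest_int_def)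
  have "x = y + of_int (round x)" by (simp add: y_def)
  then have "e x = e y" by (metis e_add_int)
  moreover have "\<bar>y\<bar> \<le> \<bar>sin (pi * y)\<bar>"
  proof -
    define z where "z = pi * \<bar>y\<bar>"
    have pi: "3 < pi" "pi \<le> 3.2" using pi_gt3 pi_approx(2) by simp_all
    have z: "0 \<le> z" "z \<le> 1.6" using y(2) pi mult_mono[of pi "3.2" "\<bar>y\<bar>" "1/2"] by (auto simp: z_def)
    have "\<bar>sin z - (\<Sum>m<3. sin_coeff m * z ^ m)\<bar> \<le> inverse (fact 3) * \<bar>z\<bar> ^ 3"
      by (rule Maclaurin_sin_bound)
    then have "\<bar>sin z - z\<bar> \<le> z ^ 3 / 6"
      using z by (simp add: sin_coeff_def numeral_3_eq_3 fact_numeral)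
    moreover have "z ^ 3 \<le> 1.6 * 1.6 * z"
      unfolding power3_eq_cube using z by (intro mult_mono) auto
    ultimately have "sin z \<ge> z / 3" using z by linarith
    moreover have "z / 3 \<ge> \<bar>y\<bar>" using mult_right_mono[of 3 pi "\<bar>y\<bar>"] pi by (simp add: z_def)
    moreover have "\<bar>sin (pi * y)\<bar> = \<bar>sin z\<bar>" by (auto simp: z_def abs_if)
    ultimately show ?thesis by linarith
  qed
  ultimately show ?thesis using y(1) by (simp add: norm_e_minus_1_eq)
qed

lemma norm_e_minus_1_le: "cmod (e x - 1) \<le> 2 * pi * \<bar>x\<bar>"
  using abs_sin_x_le_abs_x[of "pi * x"] by (simp add: norm_e_minus_1_eq abs_mult)

text \<open>The usual minimum of M and 1 / dni x in bounds for geometric sums, with 1/0 read as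
  infinity; division in HOL would give 0 there.\<close>

definition rcap :: "real \<Rightarrow> real \<Rightarrow> real" where
  "rcap M x = (if dni x = 0 then M else min M (1 / dni x))"

lemma rcap_le: "rcap M x \<le> M"
  by (simp add: rcap_def)

lemma rcap_nonneg: "M \<ge> 0 \<Longrightarrow> rcap M x \<ge> 0"
  by (simp add: rcap_def)

lemma rcap_le_inverse: "0 < y \<Longrightarrow> y \<le> dni x \<Longrightarrow> rcap M x \<le> 1 / y"
  by (auto simp: rcap_def min_le_iff_disj intro!: divide_left_mono)

lemma rcap_minus [simp]: "rcap M (- x) = rcap M x"
  by (simp add: rcap_def)

lemma rcap_mono: "M \<le> M' \<Longrightarrow> rcap M x \<le> rcap M' x"
  by (auto simp: rcap_def)

lemma norm_sum_e_le: "cmod (\<Sum>i<L. e (x * real i + c)) \<le> rcap (real L) x"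
proof -
  have eq: "(\<Sum>i<L. e (x * real i + c)) = e c * (\<Sum>i<L. e x ^ i)"
    by (simp add: e_add e_power sum_distrib_left mult.commute)
  have triv: "cmod (\<Sum>i<L. e (x * real i + c)) \<le> real L"
    by (rule order.trans[OF norm_sum]) simp
  show ?thesis
  proof (cases "dni x = 0")
    case False
    then have pos: "dni x > 0" using dni_nonneg[of x] by linarith
    then have "e x \<noteq> 1" using norm_e_minus_1[of x] by auto
    then have "cmod (\<Sum>i<L. e x ^ i) = cmod (e x ^ L - 1) / cmod (e x - 1)"
      by (simp add: geometric_sum norm_divide)
    also have "\<dots> \<le> 2 / (2 * dni x)"
    proof (intro frac_le)
      show "cmod (e x ^ L - 1) \<le> 2"
        using norm_triangle_ineq4[of "e x ^ L" 1] by (simp add: norm_power)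
    qed (use pos norm_e_minus_1[of x] in auto)
    finally show ?thesis using triv False unfolding eq by (simp add: rcap_def norm_mult)
  qed (use triv in \<open>simp add: rcap_def\<close>)
qed

section \<open>Well-spaced points and the large sieve\<close>

lemma harm_le_ln: "n \<ge> 1 \<Longrightarrow> (\<Sum>i=1..n. 1 / real i) \<le> 1 + ln (real n)"
proof (induction n rule: nat_induct_at_least)
  case (Suc n)
  have "ln (real n / real (Suc n)) \<le> real n / real (Suc n) - 1"
    by (intro ln_le_minus_one) (use Suc in auto)
  also have "real n / real (Suc n) - 1 = - 1 / real (Suc n)" by (simp add: field_simps)
  finally have "1 / real (Suc n) \<le> ln (real (Suc n)) - ln (real n)"
    using Suc by (simp add: ln_div)
  then show ?case using Suc by simp
qed auto

text \<open>Every point is represented in [-1/2, 1/2], which is cut into cells of length \<delta>;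
  by the spacing no cell holds two points. The two cells adjacent to 0 contribute at most M each,
  and the n-th further cell on either side at most 1/(n \<delta>), which sums to a harmonic sum of
  length about 1/\<delta>.\<close>

lemma sum_rcap_spaced:
  assumes I: "finite I" and \<delta>: "0 < \<delta>" "\<delta> \<le> 1" and M: "M \<ge> 0"
    and sp: "\<And>i j. i \<in> I \<Longrightarrow> j \<in> I \<Longrightarrow> i \<noteq> j \<Longrightarrow> \<delta> \<le> dni (p i - p j)"
  shows "(\<Sum>i\<in>I. rcap M (p i)) \<le> 2 * M + 2 / \<delta> * (1 + ln (1 / \<delta>))"
proof -
  define y where "y i = p i - of_int (round (p i))" for i
  define m where "m i = \<lfloor>y i / \<delta>\<rfloor>" for i
  have y: "\<bar>y i\<bar> = dni (p i)" "\<bar>y i\<bar> \<le> 1 / 2" for i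
    using dni_le_half[of "p i"] by (auto simp: y_def dist_nearest_int_def)
  have m_le: "of_int (m i) * \<delta> \<le> y i" for i
    unfolding m_def by (rule floor_divide_lower) fact
  have m_gt: "y i < (of_int (m i) + 1) * \<delta>" for i
    unfolding m_def by (rule floor_divide_upper) fact
  have inj: "inj_on m I"
  proof (rule inj_onI, rule ccontr)
    fix i j assume ij: "i \<in> I" "j \<in> I" "m i = m j" "i \<noteq> j"
    have "\<bar>y i - y j\<bar> < \<delta>"
      using m_le[of i] m_gt[of i] m_le[of j] m_gt[of j] ij(3) by (auto simp: abs_less_iff algebra_simps)
    moreover have "dni (p i - p j) \<le> \<bar>y i - y j\<bar>"
      using dni_le[of "p i - p j" "round (p i) - round (p j)"] by (simp add: y_def algebra_simps)
    ultimately show False using sp[OF ij(1,2,4)] by linarith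
  qed
  define L where "L = nat \<lfloor>1 / \<delta>\<rfloor>"
  have "1 \<le> 1 / \<delta>" using \<delta> by simp
  then have L: "real L \<le> 1 / \<delta>" unfolding L_def by (intro of_nat_floor) linarith
  have L1: "L \<ge> 1" unfolding L_def using \<open>1 \<le> 1 / \<delta>\<close> by (simp add: le_nat_floor)
  have upper: "n \<le> int L" if "of_int n * \<delta> \<le> 1 / 2" for n
  proof -
    have "of_int n \<le> 1 / (2 * \<delta>)" using that \<delta> by (simp add: field_simps)
    also have "\<dots> \<le> 1 / \<delta>" using \<delta> by (simp add: field_simps)
    finally have "n \<le> \<lfloor>1 / \<delta>\<rfloor>" by (simp add: le_floor_iff)
    then show ?thesis using \<delta> by (simp add: L_def)
  qed
  define I0 where "I0 = {i \<in> I. m i = 0 \<or> m i = - 1}"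
  define I1 where "I1 = {i \<in> I. m i \<ge> 1}"
  define I2 where "I2 = {i \<in> I. m i \<le> - 2}"
  have I_eq: "I = I0 \<union> (I1 \<union> I2)" by (auto simp: I0_def I1_def I2_def)
  have fin: "finite I0" "finite I1" "finite I2" using I by (auto simp: I0_def I1_def I2_def)
  have "(\<Sum>i\<in>I. rcap M (p i)) = (\<Sum>i\<in>I0. rcap M (p i)) + ((\<Sum>i\<in>I1. rcap M (p i)) + (\<Sum>i\<in>I2. rcap M (p i)))"
    unfolding I_eq using fin
    by (subst sum.union_disjoint, simp, simp, force simp: I0_def I1_def I2_def,
        subst sum.union_disjoint) (auto simp: I0_def I1_def I2_def)
  moreover have "(\<Sum>i\<in>I0. rcap M (p i)) \<le> 2 * M"
  proof -
    have "card I0 \<le> card {0, - 1 :: int}"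
      by (rule card_inj_on_le[of m]) (auto simp: I0_def intro: inj_on_subset[OF inj])
    then have "real (card I0) \<le> 2" by simp
    moreover have "(\<Sum>i\<in>I0. rcap M (p i)) \<le> real (card I0) * M" by (intro sum_bounded_above rcap_le)
    ultimately show ?thesis using mult_right_mono[of "real (card I0)" 2 M] M by linarith
  qed
  moreover have part: "(\<Sum>i\<in>J. rcap M (p i)) \<le> 1 / \<delta> * (1 + ln (1 / \<delta>))"
    if J: "J \<subseteq> I" and h: "inj_on h J" "\<And>i. i \<in> J \<Longrightarrow> h i \<ge> 1" "\<And>i. i \<in> J \<Longrightarrow> real (h i) * \<delta> \<le> dni (p i)" for J and h :: "'a \<Rightarrow> nat"
  proof -
    have finJ: "finite J" using J I finite_subset by blast
    have hL: "h i \<le> L" if "i \<in> J" for i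
      using upper[of "int (h i)"] h(3)[OF that] dni_le_half[of "p i"] by simp
    have "(\<Sum>i\<in>J. rcap M (p i)) \<le> (\<Sum>i\<in>J. 1 / (real (h i) * \<delta>))"
      using h \<delta> by (intro sum_mono rcap_le_inverse) (auto simp: Suc_le_eq)
    also have "\<dots> = (\<Sum>n\<in>h ` J. 1 / (real n * \<delta>))" by (subst sum.reindex[OF h(1)]) simp
    also have "\<dots> \<le> (\<Sum>n\<in>{1..L}. 1 / (real n * \<delta>))"
      using h hL \<delta> by (intro sum_mono2) auto
    also have "\<dots> = 1 / \<delta> * (\<Sum>n=1..L. 1 / real n)" by (simp add: sum_distrib_left mult.commute)
    also have "\<dots> \<le> 1 / \<delta> * (1 + ln (real L))" using \<delta> harm_le_ln[OF L1] by (intro mult_left_mono) auto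
    also have "\<dots> \<le> 1 / \<delta> * (1 + ln (1 / \<delta>))"
      using L L1 \<delta> by (intro mult_left_mono add_left_mono ln_mono) auto
    finally show ?thesis .
  qed
  moreover have "(\<Sum>i\<in>I1. rcap M (p i)) \<le> 1 / \<delta> * (1 + ln (1 / \<delta>))"
  proof (rule part[of _ "\<lambda>i. nat (m i)"])
    show "inj_on (\<lambda>i. nat (m i)) I1"
      using inj by (auto simp: inj_on_def I1_def)
    show "real (nat (m i)) * \<delta> \<le> dni (p i)" if "i \<in> I1" for i
      using that m_le[of i] y(1)[of i] by (simp add: I1_def)
  qed (auto simp: I1_def)
  moreover have "(\<Sum>i\<in>I2. rcap M (p i)) \<le> 1 / \<delta> * (1 + ln (1 / \<delta>))"
  \<comment> \<open>On the negative side the cell m lies between m \<delta> and (m + 1) \<delta>, so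
    its distance from 0 is governed by - m - 1; hence the cell -1 belongs to the part bounded by
    M.\<close>
  proof (rule part[of _ "\<lambda>i. nat (- m i - 1)"])
    show "inj_on (\<lambda>i. nat (- m i - 1)) I2"
      using inj by (auto simp: inj_on_def I2_def)
    show "real (nat (- m i - 1)) * \<delta> \<le> dni (p i)" if "i \<in> I2" for i
      using that m_gt[of i] y(1)[of i] by (simp add: I2_def algebra_simps)
  qed (auto simp: I2_def)
  ultimately have "(\<Sum>i\<in>I. rcap M (p i)) \<le> 2 * M + 2 * (1 / \<delta> * (1 + ln (1 / \<delta>)))"
    by linarith
  then show ?thesis by simp
qed

text \<open>Duality: the dual form involves only the Gram matrix, whose rows are bounded by \<open>\<Lambda>\<close>.\<close>

lemma large_sieve:
  fixes B :: "nat \<Rightarrow> complex" and c :: "nat \<Rightarrow> real"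
  assumes \<Lambda>: "\<And>v. v < V \<Longrightarrow> (\<Sum>v'<V. rcap (real N) (c v - c v')) \<le> \<Lambda>" and \<Lambda>0: "\<Lambda> \<ge> 0"
  shows "(\<Sum>v<V. cmod (\<Sum>j<N. B j * e (c v * real j)) ^ 2) \<le> \<Lambda> * (\<Sum>j<N. cmod (B j) ^ 2)"
proof -
  define g where "g v = (\<Sum>j<N. B j * e (c v * real j))" for v
  define S where "S = (\<Sum>v<V. cmod (g v) ^ 2)"
  define b where "b = (\<Sum>j<N. cmod (B j) ^ 2)"
  define D where "D j = (\<Sum>v<V. cnj (g v) * e (c v * real j))" for j
  have S0: "S \<ge> 0" and b0: "b \<ge> 0" by (auto simp: S_def b_def sum_nonneg)
  have "complex_of_real S = (\<Sum>v<V. \<Sum>j<N. B j * (cnj (g v) * e (c v * real j)))"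
    unfolding S_def of_real_sum
    by (intro sum.cong refl) (simp add: complex_norm_square g_def sum_distrib_left sum_distrib_right mult_ac del: of_real_power cnj_sum)
  also have "\<dots> = (\<Sum>j<N. B j * D j)"
    unfolding D_def sum_distrib_left by (rule sum.swap)
  finally have "S = cmod (\<Sum>j<N. B j * D j)" using S0 by (metis abs_of_nonneg norm_of_real)
  also have "\<dots> \<le> (\<Sum>j<N. cmod (B j) * cmod (D j))"
    by (rule order.trans[OF norm_sum]) (simp add: norm_mult)
  finally have "S ^ 2 \<le> (\<Sum>j<N. cmod (B j) * cmod (D j)) ^ 2" using S0 by (intro power_mono)
  also have "\<dots> \<le> b * (\<Sum>j<N. cmod (D j) ^ 2)" unfolding b_def by (rule Cauchy_Schwarz_ineq_sum)
  finally have S2: "S ^ 2 \<le> b * (\<Sum>j<N. cmod (D j) ^ 2)" .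
  have D_le: "(\<Sum>j<N. cmod (D j) ^ 2) \<le> \<Lambda> * S"
  proof -
    have "complex_of_real (\<Sum>j<N. cmod (D j) ^ 2) =
      (\<Sum>j<N. \<Sum>v<V. \<Sum>v'<V. cnj (g v) * g v' * e ((c v - c v') * real j))"
      unfolding of_real_sum
      unfolding complex_norm_square D_def cnj_sum sum_product
      by (intro sum.cong refl) (simp add: e_diff left_diff_distrib right_diff_distrib mult_ac)
    also have "\<dots> = (\<Sum>v<V. \<Sum>v'<V. cnj (g v) * g v' * (\<Sum>j<N. e ((c v - c v') * real j)))"
      unfolding sum_distrib_left by (subst sum.swap) (rule sum.cong[OF refl], rule sum.swap)
    finally have eq: "complex_of_real (\<Sum>j<N. cmod (D j) ^ 2) =
       (\<Sum>v<V. \<Sum>v'<V. cnj (g v) * g v' * (\<Sum>j<N. e ((c v - c v') * real j)))" .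
    have "(\<Sum>j<N. cmod (D j) ^ 2) = cmod (complex_of_real (\<Sum>j<N. cmod (D j) ^ 2))"
      by (simp only: norm_of_real) (simp add: sum_nonneg)
    also have "\<dots> \<le> (\<Sum>v<V. \<Sum>v'<V. cmod (g v) * cmod (g v') * rcap (real N) (c v - c v'))"
      unfolding eq
    proof (intro order.trans[OF norm_sum] sum_mono)
      fix v v'
      show "cmod (cnj (g v) * g v' * (\<Sum>j<N. e ((c v - c v') * real j))) \<le> cmod (g v) * cmod (g v') * rcap (real N) (c v - c v')"
        using norm_sum_e_le[where c = 0, of "c v - c v'" N] by (simp add: norm_mult mult_left_mono)
    qed
    \<comment> \<open>Schur's test: by AM-GM and the symmetry of \<open>rcap\<close>, the quadratic
      form is bounded by the largest row sum.\<close>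
    also have "\<dots> \<le> (\<Sum>v<V. \<Sum>v'<V. (cmod (g v) ^ 2 + cmod (g v') ^ 2) / 2 * rcap (real N) (c v - c v'))"
    proof (intro sum_mono mult_right_mono rcap_nonneg)
      show "cmod (g v) * cmod (g v') \<le> (cmod (g v) ^ 2 + cmod (g v') ^ 2) / 2" for v v'
        using sum_squares_bound[of "cmod (g v)" "cmod (g v')"] by simp
    qed auto
    also have "\<dots> = (\<Sum>v<V. \<Sum>v'<V. cmod (g v) ^ 2 / 2 * rcap (real N) (c v - c v')) +
        (\<Sum>v<V. \<Sum>v'<V. cmod (g v') ^ 2 / 2 * rcap (real N) (c v - c v'))"
      by (simp add: sum.distrib[symmetric] add_divide_distrib distrib_right)
    also have "(\<Sum>v<V. \<Sum>v'<V. cmod (g v') ^ 2 / 2 * rcap (real N) (c v - c v')) =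
        (\<Sum>v<V. \<Sum>v'<V. cmod (g v) ^ 2 / 2 * rcap (real N) (c v - c v'))"
      by (subst sum.swap, intro sum.cong refl) (metis minus_diff_eq rcap_minus)
    also have "(\<Sum>v<V. \<Sum>v'<V. cmod (g v) ^ 2 / 2 * rcap (real N) (c v - c v')) + \<dots> =
        (\<Sum>v<V. cmod (g v) ^ 2 * (\<Sum>v'<V. rcap (real N) (c v - c v')))"
      by (simp add: sum.distrib[symmetric] sum_distrib_left)
    also have "\<dots> \<le> (\<Sum>v<V. cmod (g v) ^ 2 * \<Lambda>)"
      by (intro sum_mono mult_left_mono \<Lambda>) auto
    finally show ?thesis by (simp add: S_def sum_distrib_left mult.commute)
  qed
  have "S * S \<le> (\<Lambda> * b) * S"
    using order.trans[OF S2 mult_left_mono[OF D_le b0]] by (simp add: power2_eq_square mult_ac)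
  moreover have "\<Lambda> * b \<ge> 0" using b0 \<Lambda>0 by simp
  ultimately have "S \<le> \<Lambda> * b"
    using S0 by (cases "S = 0") auto
  then show ?thesis by (simp add: S_def b_def g_def)
qed

section \<open>Vinogradov's mean value\<close>

definition tuples :: "nat \<Rightarrow> nat \<Rightarrow> (nat \<Rightarrow> nat) set" where
  "tuples t U = {..<t} \<rightarrow>\<^sub>E {..<U}"

definition psum :: "nat \<Rightarrow> (nat \<Rightarrow> nat) \<Rightarrow> nat \<Rightarrow> nat" where
  "psum t x j = (\<Sum>i<t. x i ^ j)"

text \<open>Vinogradov's mean value as a count of solutions. This form is what the sieve produces,
  as the sum of the squares of the representation numbers of a vector of power sums.\<close>

definition vino :: "nat \<Rightarrow> nat \<Rightarrow> nat \<Rightarrow> nat" where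
  "vino t k U = card {(x, y). x \<in> tuples t U \<and> y \<in> tuples t U \<and> (\<forall>j\<in>{1..k}. psum t x j = psum t y j)}"

lemma finite_tuples [simp]: "finite (tuples t U)"
  unfolding tuples_def by (intro finite_PiE) auto

lemma sum_power_tuples:
  fixes g :: "nat \<Rightarrow> complex"
  shows "(\<Sum>u<U. g u) ^ t = (\<Sum>x\<in>tuples t U. \<Prod>i<t. g (x i))"
  using prod_sum_PiE[of "{..<t}" "\<lambda>_. {..<U}" "\<lambda>_. g"] by (simp add: tuples_def)

lemma phase_prod_eq:
  assumes "\<xi> \<in> phases P k M" "P > 0"
    and eq: "\<And>j. j \<in> {1..k} \<Longrightarrow> psum t x j = psum t y j"
  shows "(\<Prod>i<t. \<xi> (int (x i))) = (\<Prod>i<t. \<xi> (int (y i)))"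
proof -
  obtain q where q: "degree q \<le> k" "\<xi> = (\<lambda>x. e (of_int (poly q x) / real P ^ M))"
    using assms by (auto simp: phases_def)
  have "(\<Sum>i<t. poly q (int (x i))) = (\<Sum>j\<le>k. coeff q j * int (psum t x j))" for x
    unfolding poly_altdef_le[OF q(1)] psum_def
    by (subst sum.swap) (simp add: sum_distrib_left)
  moreover have "psum t x j = psum t y j" if "j \<le> k" for j
    using eq[of j] that by (cases "j = 0") (auto simp: psum_def)
  ultimately have sum_eq: "(\<Sum>i<t. poly q (int (x i))) = (\<Sum>i<t. poly q (int (y i)))"
    by simp
  have prod_e: "(\<Prod>i<t. \<xi> (int (x i))) = e (of_int (\<Sum>i<t. poly q (int (x i))) / real P ^ M)" for x
    by (simp add: q(2) e_sum[symmetric] sum_divide_distrib)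
  show ?thesis unfolding prod_e sum_eq ..
qed

text \<open>Averages of characters are \<open>0\<close> or \<open>1\<close>; only their positivity is needed.\<close>

lemma vino_le_av:
  assumes P: "P > 0"
  shows "real (vino t k U) \<le> av (phases P k M) (\<lambda>\<xi>. cmod (expsum (\<lambda>_. 1) (int ` {..<U}) \<xi>) ^ (2 * t))"
proof -
  let ?G = "phases P k M"
  define H where "H x y \<xi> = (\<Prod>i<t. \<xi> (int (x i))) * cnj (\<Prod>i<t. \<xi> (int (y i)))" for x y :: "nat \<Rightarrow> nat" and \<xi> :: "int \<Rightarrow> complex"
  have H_mult: "H x y (\<lambda>u. \<xi> u * \<psi> u) = H x y \<xi> * H x y \<psi>" for x y \<xi> \<psi>
    by (simp add: H_def prod.distrib)
  have norm_H: "cmod (H x y \<xi>) = 1" if "\<xi> \<in> ?G" for x y \<xi>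
    using norm_phases[OF that] by (simp add: H_def norm_mult prod_norm[symmetric])
  have exp: "cmod (expsum (\<lambda>_. 1) (int ` {..<U}) \<xi>) ^ (2 * t) = (\<Sum>x\<in>tuples t U. \<Sum>y\<in>tuples t U. Re (H x y \<xi>))" for \<xi>
  proof -
    define S where "S = (\<Sum>u<U. \<xi> (int u))"
    have S: "expsum (\<lambda>_. 1) (int ` {..<U}) \<xi> = S"
      unfolding expsum_def S_def by (subst sum.reindex) auto
    have "complex_of_real (cmod S ^ (2 * t)) = S ^ t * cnj (S ^ t)"
      by (simp add: power_mult complex_norm_square power_mult_distrib del: of_real_power) (metis complex_norm_square of_real_power power_mult_distrib)
    also have "\<dots> = (\<Sum>x\<in>tuples t U. \<Sum>y\<in>tuples t U. H x y \<xi>)"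
      unfolding S_def sum_power_tuples cnj_sum sum_product H_def ..
    finally have "complex_of_real (cmod S ^ (2 * t)) = (\<Sum>x\<in>tuples t U. \<Sum>y\<in>tuples t U. H x y \<xi>)" .
    then have "Re (complex_of_real (cmod S ^ (2 * t))) = (\<Sum>x\<in>tuples t U. \<Sum>y\<in>tuples t U. Re (H x y \<xi>))"
      by (simp del: of_real_power)
    then show ?thesis unfolding S by (simp only: Re_complex_of_real)
  qed
  have av_H: "0 \<le> av ?G (\<lambda>\<xi>. Re (H x y \<xi>))" for x y
  proof (cases "\<forall>\<xi>\<in>?G. H x y \<xi> = 1")
    case True
    then show ?thesis by (intro av_nonneg) auto
  next
    case False
    then obtain \<psi> where \<psi>: "\<psi> \<in> ?G" "H x y \<psi> \<noteq> 1" by blast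
    \<comment> \<open>The average of a character is unchanged by multiplication with any of its
      values, so a value different from 1 forces it to be 0.\<close>
    define c where "c = Complex (av ?G (\<lambda>\<xi>. Re (H x y \<xi>))) (av ?G (\<lambda>\<xi>. Im (H x y \<xi>)))"
    have av_diff: "av ?G (\<lambda>\<xi>. F \<xi> * u - F' \<xi> * v) = av ?G F * u - av ?G F' * v" for F F' u v
      by (simp add: av_def sum_subtractf sum_distrib_right diff_divide_distrib)
    have av_add': "av ?G (\<lambda>\<xi>. F \<xi> * u + F' \<xi> * v) = av ?G F * u + av ?G F' * v" for F F' u v
      by (simp add: av_def sum.distrib sum_distrib_right add_divide_distrib)
    have "c * H x y \<psi> = Complex (av ?G (\<lambda>\<xi>. Re (H x y \<xi> * H x y \<psi>))) (av ?G (\<lambda>\<xi>. Im (H x y \<xi> * H x y \<psi>)))"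
      by (simp add: complex_eq_iff c_def av_diff av_add')
    also have "\<dots> = c"
      unfolding c_def H_mult[symmetric]
      using av_phases_shift[OF P \<psi>(1), of "\<lambda>\<xi>. Re (H x y \<xi>)"] av_phases_shift[OF P \<psi>(1), of "\<lambda>\<xi>. Im (H x y \<xi>)"] by simp
    finally have "c = 0" using \<psi>(2) by simp
    then show ?thesis by (simp add: c_def complex_eq_iff)
  qed
  let ?Z = "{(x, y). x \<in> tuples t U \<and> y \<in> tuples t U \<and> (\<forall>j\<in>{1..k}. psum t x j = psum t y j)}"
  have fin: "finite (tuples t U \<times> tuples t U)" by simp
  have "real (vino t k U) = (\<Sum>(x, y)\<in>?Z. av ?G (\<lambda>\<xi>. 1))"
    using finite_phases[OF P] phases_nonempty by (simp add: vino_def av_const)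
  also have "\<dots> = (\<Sum>(x, y)\<in>?Z. av ?G (\<lambda>\<xi>. Re (H x y \<xi>)))"
  proof (intro sum.cong refl, clarify, intro av_cong)
    fix x y \<xi> assume \<xi>: "\<xi> \<in> ?G" and eq: "\<forall>j\<in>{1..k}. psum t x j = psum t y j"
    have xy: "(\<Prod>i<t. \<xi> (int (x i))) = (\<Prod>i<t. \<xi> (int (y i)))"
      using eq by (intro phase_prod_eq[OF \<xi> P]) auto
    have "cmod (\<Prod>i<t. \<xi> (int (y i))) = 1"
      using norm_phases[OF \<xi>] by (simp add: prod_norm[symmetric])
    then have "H x y \<xi> = 1" unfolding H_def xy by (rule mult_cnj_unit)
    then show "1 = Re (H x y \<xi>)" by simp
  qed
  also have "\<dots> \<le> (\<Sum>(x, y)\<in>tuples t U \<times> tuples t U. av ?G (\<lambda>\<xi>. Re (H x y \<xi>)))"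
    using av_H by (intro sum_mono2[OF fin]) auto
  also have "\<dots> = (\<Sum>x\<in>tuples t U. \<Sum>y\<in>tuples t U. av ?G (\<lambda>\<xi>. Re (H x y \<xi>)))"
    by (simp add: sum.cartesian_product)
  also have "\<dots> = av ?G (\<lambda>\<xi>. cmod (expsum (\<lambda>_. 1) (int ` {..<U}) \<xi>) ^ (2 * t))"
    unfolding exp av_sum ..
  finally show ?thesis .
qed

text \<open>With U \<le> P^n \<le> P U each residue class modulo P^n contains at most one integer
  below U, so the pieces on the right of decoupling are at most 1 in modulus. The prime depends only
  on k, and the factor P lost in the length goes into the constant.\<close>

theorem vinogradov_mean_value:
  assumes k: "1 \<le> k" and \<epsilon>: "\<epsilon> > 0"
  obtains C where "C \<ge> 1" "\<And>U. U \<ge> 1 \<Longrightarrow> real (vino (tri k) k U) \<le> C * real U powr (real (tri k) + \<epsilon>)"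
proof -
  obtain P where P: "prime P" "P > max k 8" using bigger_prime by blast
  have P0: "P > 0" "real P > 1" using P(2) by auto
  obtain C where C: "\<And>n. Dec P k n (C * real P powr (\<epsilon> * real n))"
    using decoupling[OF P(1), of k \<epsilon>] P(2) k \<epsilon> by auto
  define C' where "C' = max C 1"
  have K: "tri k \<ge> 1" using tri_pos[of k] k by simp
  have "real (vino (tri k) k U) \<le> C' * real P powr (real (tri k) + \<epsilon>) * real U powr (real (tri k) + \<epsilon>)" if U: "U \<ge> 1" for U
  proof -
    have "\<exists>n. U \<le> P ^ n \<and> P ^ n \<le> P * U"
    proof -
      define n where "n = (LEAST n. U \<le> P ^ n)"
      have "U < 2 ^ U" by (rule less_exp)
      also have "2 ^ U \<le> P ^ U" using P(2) by (intro power_mono) auto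
      finally have "U \<le> P ^ U" by simp
      then have n: "U \<le> P ^ n" unfolding n_def by (rule LeastI)
      have "P ^ n \<le> P * U"
      proof (cases n)
        case 0
        then show ?thesis using U P0 by simp
      next
        case (Suc m)
        have "\<not> U \<le> P ^ m" using not_less_Least[of m "\<lambda>n. U \<le> P ^ n"] Suc by (simp add: n_def)
        then show ?thesis using Suc by simp
      qed
      then show ?thesis using n by blast
    qed
    then obtain n where n: "U \<le> P ^ n" "P ^ n \<le> P * U" by blast
    let ?G = "phases P k (k * n)" and ?X = "int ` {..<U}"
    have "real (vino (tri k) k U) \<le> av ?G (\<lambda>\<xi>. cmod (expsum (\<lambda>_. 1) ?X \<xi>) ^ (2 * tri k))"
      by (rule vino_le_av[OF P0(1)])
    also have "\<dots> \<le> C * real P powr (\<epsilon> * real n) * real P ^ (n * (tri k - 1)) * (\<Sum>j\<in>{0..<int P ^ n}.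
       av ?G (\<lambda>\<xi>. cmod (expsum (\<lambda>_. 1) (rclass P ?X n j) \<xi>) ^ (2 * tri k)))"
      by (rule DecD[OF C]) simp
    also have "\<dots> \<le> C' * real P powr (\<epsilon> * real n) * real P ^ (n * (tri k - 1)) * (\<Sum>j\<in>{0..<int P ^ n}.
       av ?G (\<lambda>\<xi>. cmod (expsum (\<lambda>_. 1) (rclass P ?X n j) \<xi>) ^ (2 * tri k)))"
      by (intro mult_right_mono sum_nonneg av_nonneg) (auto simp: C'_def)
    also have "\<dots> \<le> C' * real P powr (\<epsilon> * real n) * real P ^ (n * (tri k - 1)) * (\<Sum>j\<in>{0..<int P ^ n}. av ?G (\<lambda>\<xi>. 1))"
    proof (intro mult_left_mono sum_mono av_mono power_le_one)
      fix j \<xi> assume \<xi>: "\<xi> \<in> ?G"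
      have "rclass P ?X n j \<subseteq> {j}"
      proof
        fix x assume x: "x \<in> rclass P ?X n j"
        then obtain u where u: "x = int u" "u < U" by (auto simp: rclass_def)
        then have "x < int P ^ n" using n(1) by (metis less_le_trans of_nat_less_iff of_nat_power)
        then show "x \<in> {j}" using x u by (simp add: rclass_def)
      qed
      then have "rclass P ?X n j = {} \<or> rclass P ?X n j = {j}" by auto
      then show "cmod (expsum (\<lambda>_. 1) (rclass P ?X n j) \<xi>) \<le> 1"
        using norm_phases[OF \<xi>] by (auto simp: expsum_def)
    qed (auto simp: C'_def)
    also have "\<dots> = C' * real P powr (\<epsilon> * real n) * (real P ^ (n * (tri k - 1)) * real P ^ n)"
      using finite_phases[OF P0(1)] phases_nonempty by (simp add: av_const nat_power_eq)
    also have "real P ^ (n * (tri k - 1)) * real P ^ n = real P powr (real n * real (tri k))"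
    proof -
      have "n * (tri k - 1) + n = n * tri k" using K by (cases "tri k") auto
      then have "real P ^ (n * (tri k - 1)) * real P ^ n = real P ^ (n * tri k)"
        by (simp only: power_add[symmetric])
      also have "\<dots> = real P powr real (n * tri k)" using P0 by (subst powr_realpow) auto
      finally show ?thesis by simp
    qed
    also have "C' * real P powr (\<epsilon> * real n) * real P powr (real n * real (tri k)) = C' * (real P ^ n) powr (real (tri k) + \<epsilon>)"
      using P0 by (simp add: powr_powr powr_add[symmetric] algebra_simps flip: powr_realpow)
    also have "\<dots> \<le> C' * (real P * real U) powr (real (tri k) + \<epsilon>)"
    proof (intro mult_left_mono powr_mono2)
      show "real P ^ n \<le> real P * real U" using n(2) by (metis of_nat_le_iff of_nat_mult of_nat_power)
    qed (use \<epsilon> in \<open>auto simp: C'_def\<close>)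
    finally show ?thesis by (simp add: powr_mult mult_ac)
  qed
  moreover have "C' * real P powr (real (tri k) + \<epsilon>) \<ge> 1"
  proof -
    have "1 \<le> real P powr (real (tri k) + \<epsilon>)" using P0 \<epsilon> by (intro ge_one_powr_ge_zero) auto
    then have "1 * 1 \<le> C' * real P powr (real (tri k) + \<epsilon>)" by (intro mult_mono) (auto simp: C'_def)
    then show ?thesis by simp
  qed
  ultimately show thesis using that by blast
qed

section \<open>Bilinear sums with a well-spaced coefficient\<close>

text \<open>The t-th power of the inner sum is expanded by the power sums of its variables. The sums
  of degrees below k, collected in \<open>key\<close>, are separated by Cauchy-Schwarz at the cost
  of their number, so the coefficients \<open>c v j\<close> with j < k may depend on v in any way;
  the large sieve acts on the top coefficient alone. The squares of the fibre sizes
  \<open>card (F m N)\<close> add up to \<open>vino t k U\<close>.\<close>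

lemma sieve_mean_value:
  fixes a :: "nat \<Rightarrow> complex" and c :: "nat \<Rightarrow> nat \<Rightarrow> real"
  assumes k: "k \<ge> 1" and t: "t \<ge> 1" and U: "U \<ge> 1" and a: "\<And>u. cmod (a u) \<le> 1"
    and \<Lambda>: "\<And>v. v < V \<Longrightarrow> (\<Sum>v'<V. rcap (real (t * U ^ k + 1)) (c v k - c v' k)) \<le> \<Lambda>" and \<Lambda>0: "\<Lambda> \<ge> 0"
  shows "(\<Sum>v<V. cmod (\<Sum>u<U. a u * e (\<Sum>j=1..k. c v j * real u ^ j)) ^ (2 * t)) \<le>
    (\<Prod>j\<in>{1..<k}. real (t * U ^ j + 1)) * \<Lambda> * real (vino t k U)"
proof -
  let ?T = "tuples t U" and ?N = "t * U ^ k + 1"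
  define key where "key x = restrict (psum t x) {1..<k}" for x
  define A where "A x = (\<Prod>i<t. a (x i))" for x :: "nat \<Rightarrow> nat"
  have normA: "cmod (A x) \<le> 1" for x
    unfolding A_def prod_norm[symmetric] by (intro prod_le_1) (auto simp: a)
  have psum_le: "psum t x j \<le> t * U ^ j" if "x \<in> ?T" for x j
  proof -
    have "psum t x j \<le> (\<Sum>i<t. U ^ j)" unfolding psum_def
      using that by (intro sum_mono power_mono) (auto simp: tuples_def PiE_iff less_imp_le)
    then show ?thesis by simp
  qed
  define Ms where "Ms = key ` ?T"
  have finMs: "finite Ms" by (simp add: Ms_def)
  have cardMs: "real (card Ms) \<le> (\<Prod>j\<in>{1..<k}. real (t * U ^ j + 1))"
  proof -
    have "Ms \<subseteq> (\<Pi>\<^sub>E j\<in>{1..<k}. {..<t * U ^ j + 1})"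
      using psum_le by (auto simp: Ms_def key_def less_Suc_eq_le)
    then have "card Ms \<le> card (\<Pi>\<^sub>E j\<in>{1..<k}. {..<t * U ^ j + 1})"
      by (intro card_mono finite_PiE) auto
    also have "\<dots> = (\<Prod>j\<in>{1..<k}. t * U ^ j + 1)" by (simp add: card_PiE)
    finally show ?thesis by (metis of_nat_le_iff of_nat_prod)
  qed
  define F where "F m N = {x \<in> ?T. key x = m \<and> psum t x k = N}" for m N
  define B where "B m N = (\<Sum>x\<in>F m N. A x)" for m N
  have normB: "cmod (B m N) \<le> real (card (F m N))" for m N
    unfolding B_def by (rule order.trans[OF norm_sum]) (use sum_bounded_above[of "F m N" "\<lambda>x. cmod (A x)" 1] normA in auto)
  have expand: "(\<Sum>u<U. a u * e (\<Sum>j=1..k. c v j * real u ^ j)) ^ t =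
    (\<Sum>m\<in>Ms. e (\<Sum>j\<in>{1..<k}. c v j * real (m j)) * (\<Sum>N<?N. B m N * e (c v k * real N)))" for v
  proof -
    have "(\<Sum>u<U. a u * e (\<Sum>j=1..k. c v j * real u ^ j)) ^ t =
      (\<Sum>x\<in>?T. A x * e (\<Sum>j=1..k. c v j * real (psum t x j)))"
      unfolding sum_power_tuples
    proof (intro sum.cong refl)
      fix x
      have "(\<Sum>i<t. \<Sum>j=1..k. c v j * real (x i) ^ j) = (\<Sum>j=1..k. c v j * real (psum t x j))"
        by (subst sum.swap) (simp add: psum_def sum_distrib_left)
      then show "(\<Prod>i<t. a (x i) * e (\<Sum>j=1..k. c v j * real (x i) ^ j)) = A x * e (\<Sum>j=1..k. c v j * real (psum t x j))"
        by (simp add: prod.distrib A_def e_sum[symmetric])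
    qed
    also have "\<dots> = (\<Sum>x\<in>?T. A x * (e (\<Sum>j\<in>{1..<k}. c v j * real (key x j)) * e (c v k * real (psum t x k))))"
    proof (intro sum.cong refl)
      fix x
      have "{1..k} = insert k {1..<k}" using k by auto
      then have "(\<Sum>j=1..k. c v j * real (psum t x j)) = (\<Sum>j\<in>{1..<k}. c v j * real (psum t x j)) + c v k * real (psum t x k)"
        by simp
      then show "A x * e (\<Sum>j=1..k. c v j * real (psum t x j)) = A x * (e (\<Sum>j\<in>{1..<k}. c v j * real (key x j)) * e (c v k * real (psum t x k)))"
        by (simp add: e_add key_def)
    qed
    also have "\<dots> = (\<Sum>(m, N)\<in>Ms \<times> {..<?N}. \<Sum>x\<in>{x \<in> ?T. (key x, psum t x k) = (m, N)}.
        A x * (e (\<Sum>j\<in>{1..<k}. c v j * real (key x j)) * e (c v k * real (psum t x k))))"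
    proof -
      have "(\<lambda>x. (key x, psum t x k)) ` ?T \<subseteq> Ms \<times> {..<?N}"
        using psum_le by (auto simp: Ms_def less_Suc_eq_le)
      then show ?thesis unfolding case_prod_unfold prod.collapse
        by (intro sum.group[symmetric]) (use finMs in auto)
    qed
    also have "\<dots> = (\<Sum>(m, N)\<in>Ms \<times> {..<?N}. B m N * (e (\<Sum>j\<in>{1..<k}. c v j * real (m j)) * e (c v k * real N)))"
      by (intro sum.cong refl) (auto simp: B_def F_def sum_distrib_right intro!: sum.cong)
    also have "\<dots> = (\<Sum>m\<in>Ms. \<Sum>N<?N. B m N * (e (\<Sum>j\<in>{1..<k}. c v j * real (m j)) * e (c v k * real N)))"
      by (rule sum.cartesian_product[symmetric])
    also have "\<dots> = (\<Sum>m\<in>Ms. e (\<Sum>j\<in>{1..<k}. c v j * real (m j)) * (\<Sum>N<?N. B m N * e (c v k * real N)))"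
      by (intro sum.cong refl) (simp add: sum_distrib_left mult_ac del: sum.lessThan_Suc)
    finally show ?thesis .
  qed
  have "(\<Sum>v<V. cmod (\<Sum>u<U. a u * e (\<Sum>j=1..k. c v j * real u ^ j)) ^ (2 * t)) \<le>
    (\<Sum>v<V. real (card Ms) * (\<Sum>m\<in>Ms. cmod (\<Sum>N<?N. B m N * e (c v k * real N)) ^ 2))"
  proof (rule sum_mono)
    fix v
    let ?S = "\<Sum>u<U. a u * e (\<Sum>j=1..k. c v j * real u ^ j)"
    have "cmod ?S ^ (2 * t) = cmod (?S ^ t) ^ 2" by (simp add: norm_power power_mult mult.commute flip: power_mult)
    also have "cmod (?S ^ t) \<le> (\<Sum>m\<in>Ms. cmod (\<Sum>N<?N. B m N * e (c v k * real N)))"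
      unfolding expand by (rule order.trans[OF norm_sum]) (simp add: norm_mult del: sum.lessThan_Suc)
    then have "cmod (?S ^ t) ^ 2 \<le> (\<Sum>m\<in>Ms. cmod (\<Sum>N<?N. B m N * e (c v k * real N))) ^ 2"
      by (intro power_mono) auto
    also have "\<dots> \<le> real (card Ms) ^ (2 - 1) * (\<Sum>m\<in>Ms. cmod (\<Sum>N<?N. B m N * e (c v k * real N)) ^ 2)"
      by (intro sum_power_le) auto
    finally show "cmod ?S ^ (2 * t) \<le> real (card Ms) * (\<Sum>m\<in>Ms. cmod (\<Sum>N<?N. B m N * e (c v k * real N)) ^ 2)"
      by (simp del: sum.lessThan_Suc)
  qed
  also have "\<dots> = real (card Ms) * (\<Sum>m\<in>Ms. \<Sum>v<V. cmod (\<Sum>N<?N. B m N * e (c v k * real N)) ^ 2)"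
    unfolding sum_distrib_left by (rule sum.swap)
  also have "\<dots> \<le> real (card Ms) * (\<Sum>m\<in>Ms. \<Lambda> * (\<Sum>N<?N. cmod (B m N) ^ 2))"
    by (intro mult_left_mono sum_mono large_sieve \<Lambda> \<Lambda>0) auto
  also have "\<dots> \<le> real (card Ms) * (\<Sum>m\<in>Ms. \<Lambda> * (\<Sum>N<?N. real (card (F m N)) ^ 2))"
    by (intro mult_left_mono sum_mono power_mono normB \<Lambda>0) auto
  also have "(\<Sum>m\<in>Ms. \<Lambda> * (\<Sum>N<?N. real (card (F m N)) ^ 2)) = \<Lambda> * real (vino t k U)"
  proof -
    let ?Z = "{(x, y). x \<in> ?T \<and> y \<in> ?T \<and> (\<forall>j\<in>{1..k}. psum t x j = psum t y j)}"
    have key_eq: "(key x = key y \<and> psum t x k = psum t y k) \<longleftrightarrow> (\<forall>j\<in>{1..k}. psum t x j = psum t y j)" for x y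
    proof -
      have "{1..k} = insert k {1..<k}" using k by auto
      moreover have "key x = key y \<longleftrightarrow> (\<forall>j\<in>{1..<k}. psum t x j = psum t y j)"
        by (auto simp: key_def restrict_def fun_eq_iff)
      ultimately show ?thesis by auto
    qed
    have "?Z = (\<Union>(m, N)\<in>Ms \<times> {..<?N}. F m N \<times> F m N)"
    proof (intro set_eqI iffI)
      fix z assume "z \<in> ?Z"
      then obtain x y where z: "z = (x, y)" "x \<in> ?T" "y \<in> ?T" "\<forall>j\<in>{1..k}. psum t x j = psum t y j" by auto
      have "(key x, psum t x k) \<in> Ms \<times> {..<?N}" using psum_le[OF z(2), of k] z by (auto simp: Ms_def)
      moreover have "z \<in> F (key x) (psum t x k) \<times> F (key x) (psum t x k)"
        using z key_eq[of x y] by (auto simp: F_def)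
      ultimately show "z \<in> (\<Union>(m, N)\<in>Ms \<times> {..<?N}. F m N \<times> F m N)" by blast
    next
      fix z assume "z \<in> (\<Union>(m, N)\<in>Ms \<times> {..<?N}. F m N \<times> F m N)"
      then obtain m N x y where "z = (x, y)" "x \<in> F m N" "y \<in> F m N" by auto
      then show "z \<in> ?Z" using key_eq[of x y] by (auto simp: F_def)
    qed
    moreover have "card (\<Union>(m, N)\<in>Ms \<times> {..<?N}. F m N \<times> F m N) = (\<Sum>(m, N)\<in>Ms \<times> {..<?N}. card (F m N) ^ 2)"
    proof (subst card_UN_disjoint)
      show "\<forall>i\<in>Ms \<times> {..<?N}. finite (case i of (m, N) \<Rightarrow> F m N \<times> F m N)"
        by (auto simp: F_def)
      show "\<forall>i\<in>Ms \<times> {..<?N}. \<forall>j\<in>Ms \<times> {..<?N}. i \<noteq> j \<longrightarrow>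
        (case i of (m, N) \<Rightarrow> F m N \<times> F m N) \<inter> (case j of (m, N) \<Rightarrow> F m N \<times> F m N) = {}"
        by (auto simp: F_def)
    qed (use finMs in \<open>auto intro!: sum.cong simp: card_cartesian_product power2_eq_square\<close>)
    ultimately have "real (vino t k U) = (\<Sum>(m, N)\<in>Ms \<times> {..<?N}. real (card (F m N)) ^ 2)"
      by (simp add: vino_def case_prod_beta' del: sum.lessThan_Suc)
    also have "\<dots> = (\<Sum>m\<in>Ms. \<Sum>N<?N. real (card (F m N)) ^ 2)" by (rule sum.cartesian_product[symmetric])
    finally show ?thesis by (simp add: sum_distrib_left del: sum.lessThan_Suc)
  qed
  also have "real (card Ms) * (\<Lambda> * real (vino t k U)) \<le> (\<Prod>j\<in>{1..<k}. real (t * U ^ j + 1)) * (\<Lambda> * real (vino t k U))"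
    using \<Lambda>0 by (intro mult_right_mono cardMs) auto
  finally show ?thesis by (simp add: mult_ac)
qed

section \<open>Twisted exponential sums: the sieve bound\<close>

definition shift_coeff :: "(nat \<Rightarrow> real) \<Rightarrow> nat \<Rightarrow> nat \<Rightarrow> real \<Rightarrow> real" where
  "shift_coeff c N j w = (\<Sum>i=j..N. c i * real (i choose j) * w ^ (i - j))"

lemma shift_expand:
  "(\<Sum>i\<le>N. c i * (u + w) ^ i) = (\<Sum>j\<le>N. shift_coeff c N j w * u ^ j)"
proof -
  have "(\<Sum>i\<le>N. c i * (u + w) ^ i) = (\<Sum>i\<le>N. \<Sum>j\<le>i. c i * real (i choose j) * w ^ (i - j) * u ^ j)"
    by (simp add: binomial_ring sum_distrib_left mult_ac)
  also have "\<dots> = (\<Sum>j\<le>N. \<Sum>i=j..N. c i * real (i choose j) * w ^ (i - j) * u ^ j)"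
    by (subst sum.Sigma, simp, simp, subst sum.Sigma, simp, simp,
        rule sum.reindex_bij_witness[of _ "\<lambda>(j, i). (i, j)" "\<lambda>(i, j). (j, i)"]) auto
  also have "\<dots> = (\<Sum>j\<le>N. shift_coeff c N j w * u ^ j)"
    by (simp add: shift_coeff_def sum_distrib_right)
  finally show ?thesis .
qed

lemma shift_coeff_top [simp]: "shift_coeff c N N w = c N"
  by (simp add: shift_coeff_def)

lemma shift_coeff_next: "shift_coeff c (Suc n) n w = c n + real (Suc n) * c (Suc n) * w"
proof -
  have "{n..Suc n} = {n, Suc n}" by auto
  then show ?thesis by (simp add: shift_coeff_def)
qed

text \<open>The weights \<open>wt n = z ^ binary_digit_sum n\<close> enter only through this factorisation
  over blocks of digits.\<close>

definition digit_mult :: "(nat \<Rightarrow> complex) \<Rightarrow> bool" where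
  "digit_mult wt \<longleftrightarrow> (\<forall>n. cmod (wt n) = 1) \<and> (\<forall>s u v. u < 2 ^ s \<longrightarrow> wt (u + 2 ^ s * v) = wt u * wt v)"

text \<open>The form of type at most 1 that the estimates use: for all q \<ge> 1, with a constant
  that absorbs the finitely many q invisible to a limes inferior.\<close>

definition badly_approx_type :: "real \<Rightarrow> bool" where
  "badly_approx_type \<alpha> \<longleftrightarrow> (\<forall>\<eta>>0. \<exists>c>0. \<forall>q::nat. q \<ge> 1 \<longrightarrow> c * real q powr (- (1 + \<eta>)) \<le> dni (\<alpha> * real q))"

lemma sum_lessThan_split_block:
  fixes F :: "nat \<Rightarrow> 'a :: comm_monoid_add"
  assumes "s \<le> r"
  shows "(\<Sum>n<2 ^ r. F n) = (\<Sum>v<2 ^ (r - s). \<Sum>u<2 ^ s. F (u + 2 ^ s * v))"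
proof -
  have "(2::nat) ^ r = 2 ^ (r - s) * 2 ^ s" using assms by (simp flip: power_add)
  then have "(\<Sum>n<2 ^ r. F n) = (\<Sum>v<2 ^ (r - s). sum F {v * 2 ^ s..<v * 2 ^ s + 2 ^ s})"
    using sum.nat_group[of F "2 ^ s" "2 ^ (r - s)"] by simp
  also have "\<dots> = (\<Sum>v<2 ^ (r - s). \<Sum>u<2 ^ s. F (u + 2 ^ s * v))"
  proof (rule sum.cong[OF refl])
    fix v
    show "sum F {v * 2 ^ s..<v * 2 ^ s + 2 ^ s} = (\<Sum>u<2 ^ s. F (u + 2 ^ s * v))"
      using sum.shift_bounds_nat_ivl[of F 0 "v * 2 ^ s" "2 ^ s"]
      by (simp add: lessThan_atLeast0 add.commute mult.commute)
  qed
  finally show ?thesis .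
qed

lemma spaced_multiples:
  fixes \<alpha> :: real
  assumes dio: "\<And>q::nat. q \<ge> 1 \<Longrightarrow> c * real q powr (- (1 + \<eta>)) \<le> dni (\<alpha> * real q)" and c: "c > 0" and \<eta>: "\<eta> > 0"
    and m: "m \<ge> 1" and v: "v < V" "v' < V" "v \<noteq> v'"
  shows "c * real (m * V) powr (- (1 + \<eta>)) \<le> dni (\<alpha> * real m * (real v - real v'))"
proof -
  have *: "c * real (m * V) powr (- (1 + \<eta>)) \<le> dni (\<alpha> * real m * (real v - real v'))"
    if "v < V" "v' < v" for v v'
  proof -
    define w where "w = v - v'"
    have w: "1 \<le> w" "w \<le> V" "real v - real v' = real w" using that by (auto simp: w_def of_nat_diff)
    have "c * real (m * V) powr (- (1 + \<eta>)) \<le> c * real (m * w) powr (- (1 + \<eta>))"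
      using c \<eta> m w by (intro mult_left_mono powr_mono2') auto
    also have "\<dots> \<le> dni (\<alpha> * real (m * w))" using m w by (intro dio) simp
    finally show ?thesis by (simp add: w(3) mult.assoc)
  qed
  show ?thesis
  proof (cases "v' < v")
    case True
    then show ?thesis using * v by blast
  next
    case False
    have "dni (\<alpha> * real m * (real v - real v')) = dni (- (\<alpha> * real m * (real v - real v')))" by simp
    also have "- (\<alpha> * real m * (real v - real v')) = \<alpha> * real m * (real v' - real v)"
      by (simp add: algebra_simps)
    finally show ?thesis using *[of v' v] v False by simp
  qed
qed

lemma prod_sieve_le:
  assumes "t \<ge> 1" "U \<ge> 1" "k \<ge> 1"
  shows "(\<Prod>j\<in>{1..<k}. real (t * U ^ j + 1)) \<le> real (t + 1) ^ (k - 1) * real U ^ tri (k - 1)"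
proof -
  have "(\<Prod>j\<in>{1..<k}. real (t * U ^ j + 1)) \<le> (\<Prod>j\<in>{1..<k}. real (t + 1) * real U ^ j)"
  proof (intro prod_mono conjI)
    fix j
    have "t * U ^ j + 1 \<le> (t + 1) * U ^ j" using assms by (simp add: algebra_simps)
    then have "real (t * U ^ j + 1) \<le> real ((t + 1) * U ^ j)" by (rule of_nat_mono)
    then show "real (t * U ^ j + 1) \<le> real (t + 1) * real U ^ j" by (simp only: of_nat_mult of_nat_power)
  qed auto
  also have "\<dots> = real (t + 1) ^ (k - 1) * real U ^ (\<Sum>j\<in>{1..<k}. j)"
    by (simp add: prod.distrib power_sum)
  also have "(\<Sum>j\<in>{1..<k}. j) = tri (k - 1)"
  proof -
    have "(\<Sum>j\<in>{1..<Suc n}. j) = n * (n + 1) div 2" for n :: nat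
      by (induction n) auto
    from this[of "k - 1"] show ?thesis using assms by (simp add: tri_def)
  qed
  finally show ?thesis .
qed

lemma tri_pred: "k \<ge> 1 \<Longrightarrow> tri (k - 1) + k = tri k"
  by (cases k) (auto simp: tri_def)

text \<open>With U = 2^s and V = 2^(r - s) the top coefficients are spaced by about (h U V)^(-1 -
  \<epsilon>). The hypothesis says that this is no finer than U^(-k) up to a constant, so the sieve
  costs only U^k, the range of the top power sum. Then U^(tri (k - 1)) from the keys, U^k from the
  sieve and U^(tri k) from the mean value multiply to U^(2 tri k), up to U powr \<epsilon>: compared
  with the trivial bound a full factor V is saved.\<close>

theorem twisted_sum_sieve_bound:
  fixes c :: "nat \<Rightarrow> real"
  assumes dio: "badly_approx_type (c (Suc k))" and k: "k \<ge> 1" and \<epsilon>: "\<epsilon> > 0"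
  obtains C where "C \<ge> 1" "\<And>wt r s h. \<lbrakk>digit_mult wt; s \<le> r; h \<ge> 1;
      (real h * 2 ^ r) powr (1 + \<epsilon>) \<le> (2 ^ s) ^ k\<rbrakk> \<Longrightarrow>
    cmod (\<Sum>n<2 ^ r. wt n * e (real h * (\<Sum>i\<le>Suc k. c i * real n ^ i))) ^ (2 * tri k) \<le>
      C * (2 ^ (r - s)) ^ (2 * tri k - 1) * (2 ^ s) powr (2 * real (tri k) + \<epsilon>)"
proof -
  define t where "t = tri k"
  have t: "t \<ge> 1" using tri_pos[of k] k by (simp add: t_def)
  obtain c0 where c0: "c0 > 0" "\<And>q::nat. q \<ge> 1 \<Longrightarrow> c0 * real q powr (- (1 + \<epsilon>)) \<le> dni (c (Suc k) * real q)"
    using dio \<epsilon> unfolding badly_approx_type_def by blast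
  have \<epsilon>2: "\<epsilon> / 2 > 0" using \<epsilon> by simp
  obtain C2 where C2: "C2 \<ge> 1" "\<And>U. U \<ge> 1 \<Longrightarrow> real (vino t k U) \<le> C2 * real U powr (real t + \<epsilon> / 2)"
    using vinogradov_mean_value[OF k \<epsilon>2] unfolding t_def by blast
  define C0 where "C0 = real (Suc k) powr (1 + \<epsilon>) / c0"
  have C0: "C0 > 0" using c0 by (simp add: C0_def)
  \<comment> \<open>The logarithm from the spaced points is bounded by a power a of its argument;
    U^(k a) is then U^(\<epsilon>/2).\<close>
  define a where "a = \<epsilon> / (2 * real k)"
  have a: "a > 0" using \<epsilon> k by (simp add: a_def)
  define C1 where "C1 = 2 * (real t + 1) + 2 * C0 * (1 + C0 powr a / a)"
  have C1: "C1 \<ge> 1" using C0 a t by (simp add: C1_def)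
  define C where "C = real (t + 1) ^ (k - 1) * C1 * C2"
  have C: "C \<ge> 1"
  proof -
    have "1 * 1 * 1 \<le> real (t + 1) ^ (k - 1) * C1 * C2"
      using C1 C2 by (intro mult_mono one_le_power) auto
    then show ?thesis by (simp add: C_def)
  qed
  have "cmod (\<Sum>n<2 ^ r. wt n * e (real h * (\<Sum>i\<le>Suc k. c i * real n ^ i))) ^ (2 * t) \<le>
      C * (2 ^ (r - s)) ^ (2 * t - 1) * (2 ^ s) powr (2 * real t + \<epsilon>)"
    if wt: "digit_mult wt" and s: "s \<le> r" and h: "h \<ge> 1" and large: "(real h * 2 ^ r) powr (1 + \<epsilon>) \<le> (2 ^ s) ^ k"
    for wt r s h
  proof -
    define U where "U = (2::nat) ^ s"
    define V where "V = (2::nat) ^ (r - s)"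
    have U: "U \<ge> 1" and V: "V \<ge> 1" by (auto simp: U_def V_def)
    have UV: "U * V = 2 ^ r" using s by (simp add: U_def V_def flip: power_add)
    define b where "b v j = real h * shift_coeff c (Suc k) j (real (U * v))" for v j
    \<comment> \<open>The term of degree k + 1 in u has a coefficient independent of v; it is merged
      into the weight and leaves a polynomial of degree k.\<close>
    define w where "w u = wt u * e (real h * c (Suc k) * real u ^ Suc k)" for u
    have normw: "cmod (w u) = 1" for u using wt by (simp add: w_def norm_mult digit_mult_def)
    \<comment> \<open>The integer in the linear form: \<open>b v k - b v' k\<close> is the leading
      coefficient times m (v - v'), with Suc k from the binomial expansion.\<close>
    define m where "m = h * Suc k * U"
    have m: "m \<ge> 1" using h U by (simp add: m_def)
    define \<delta> where "\<delta> = c0 * real (m * V) powr (- (1 + \<epsilon>))"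
    have mV: "m * V \<ge> 1" using m V by simp
    have \<delta>0: "\<delta> > 0" using c0 mV by (simp add: \<delta>_def)
    have \<delta>1: "\<delta> \<le> 1" using c0(2)[OF mV] dni_le_half[of "c (Suc k) * real (m * V)"] by (simp add: \<delta>_def)
    have bdiff: "b v k - b v' k = c (Suc k) * real m * (real v - real v')" for v v'
      by (simp add: b_def shift_coeff_next m_def algebra_simps)
    have inv\<delta>: "1 / \<delta> \<le> C0 * real U ^ k"
    proof -
      have "1 / \<delta> = real (m * V) powr (1 + \<epsilon>) / c0"
        unfolding \<delta>_def powr_minus_divide by simp
      also have "real (m * V) = real (Suc k) * (real h * 2 ^ r)"
      proof -
        have "m * V = Suc k * (h * (U * V))" by (simp add: m_def mult_ac)
        then show ?thesis unfolding UV by (metis of_nat_mult of_nat_numeral of_nat_power)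
      qed
      also have "(real (Suc k) * (real h * 2 ^ r)) powr (1 + \<epsilon>) = real (Suc k) powr (1 + \<epsilon>) * (real h * 2 ^ r) powr (1 + \<epsilon>)"
        by (rule powr_mult)
      also have "\<dots> \<le> real (Suc k) powr (1 + \<epsilon>) * (2 ^ s) ^ k" using large by (intro mult_left_mono) auto
      finally show ?thesis using c0 by (simp add: C0_def U_def divide_right_mono)
    qed
    define \<Lambda> where "\<Lambda> = C1 * real U powr (real k + \<epsilon> / 2)"
    have \<Lambda>0: "\<Lambda> \<ge> 0" using C1 by (simp add: \<Lambda>_def)
    have row: "(\<Sum>v'<V. rcap (real (t * U ^ k + 1)) (b v k - b v' k)) \<le> \<Lambda>" if v: "v < V" for v
    proof -
      have "(\<Sum>v'<V. rcap (real (t * U ^ k + 1)) (b v k - b v' k)) \<le> 2 * real (t * U ^ k + 1) + 2 / \<delta> * (1 + ln (1 / \<delta>))"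
      proof (rule sum_rcap_spaced[OF _ \<delta>0 \<delta>1])
        fix i j assume ij: "i \<in> {..<V}" "j \<in> {..<V}" "i \<noteq> j"
        have "(b v k - b i k) - (b v k - b j k) = c (Suc k) * real m * (real j - real i)"
          using bdiff[of j i] by simp
        then show "\<delta> \<le> dni ((b v k - b i k) - (b v k - b j k))"
          using spaced_multiples[OF c0(2,1) \<epsilon> m, of j V i] ij by (auto simp: \<delta>_def)
      qed auto
      also have "2 * real (t * U ^ k + 1) \<le> 2 * (real t + 1) * real U ^ k"
        using U by (simp add: algebra_simps)
      also have "2 / \<delta> * (1 + ln (1 / \<delta>)) \<le> 2 * (C0 * real U ^ k) * (1 + C0 powr a / a * real U powr (\<epsilon> / 2))"
      proof -
        have 1: "1 \<le> 1 / \<delta>" using \<delta>0 \<delta>1 by simp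
        have "ln (1 / \<delta>) \<le> (1 / \<delta>) powr a / a" by (rule ln_powr_bound[OF 1 a])
        also have "\<dots> \<le> (C0 * real U ^ k) powr a / a"
          using inv\<delta> \<delta>0 a by (intro divide_right_mono powr_mono2) auto
        also have "(C0 * real U ^ k) powr a = C0 powr a * real U powr (\<epsilon> / 2)"
        proof -
          have "(real U ^ k) powr a = real U powr (real k * a)" using U by (simp add: powr_powr flip: powr_realpow)
          then show ?thesis using C0 k by (simp add: powr_mult a_def)
        qed
        finally have "1 + ln (1 / \<delta>) \<le> 1 + C0 powr a / a * real U powr (\<epsilon> / 2)" by simp
        moreover have "0 \<le> 1 + ln (1 / \<delta>)" using 1 by (simp add: ln_ge_zero add_nonneg_nonneg)
        ultimately have "(1 / \<delta>) * (1 + ln (1 / \<delta>)) \<le> (C0 * real U ^ k) * (1 + C0 powr a / a * real U powr (\<epsilon> / 2))"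
          using inv\<delta> C0 \<delta>0 by (intro mult_mono) auto
        then have "2 * ((1 / \<delta>) * (1 + ln (1 / \<delta>))) \<le>
            2 * ((C0 * real U ^ k) * (1 + C0 powr a / a * real U powr (\<epsilon> / 2)))"
          by (rule mult_left_mono) simp
        moreover have two: "2 / \<delta> * X = 2 * ((1 / \<delta>) * X)" for X by simp
        ultimately show ?thesis unfolding two by (simp only: mult.assoc)
      qed
      also have "2 * (real t + 1) * real U ^ k + 2 * (C0 * real U ^ k) * (1 + C0 powr a / a * real U powr (\<epsilon> / 2)) \<le> \<Lambda>"
      proof -
        have u1: "1 \<le> real U powr (\<epsilon> / 2)" using U \<epsilon> by (intro ge_one_powr_ge_zero) auto
        have "2 * (real t + 1) * real U ^ k + 2 * (C0 * real U ^ k) * (1 + C0 powr a / a * real U powr (\<epsilon> / 2)) =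
          real U ^ k * (2 * (real t + 1) * 1 + 2 * C0 * (1 + C0 powr a / a * real U powr (\<epsilon> / 2)))"
          by (simp add: algebra_simps)
        also have "\<dots> \<le> real U ^ k * (2 * (real t + 1) * real U powr (\<epsilon> / 2) +
            2 * C0 * (real U powr (\<epsilon> / 2) + C0 powr a / a * real U powr (\<epsilon> / 2)))"
          using u1 C0 a by (intro mult_left_mono add_mono) auto
        also have "\<dots> = C1 * (real U ^ k * real U powr (\<epsilon> / 2))" by (simp add: C1_def algebra_simps)
        also have "real U ^ k * real U powr (\<epsilon> / 2) = real U powr (real k + \<epsilon> / 2)"
          using U by (simp add: powr_add powr_realpow)
        finally show ?thesis by (simp add: \<Lambda>_def)
      qed
      finally show ?thesis by simp
    qed
    define S where "S v = (\<Sum>u<U. w u * e (\<Sum>j=1..k. b v j * real u ^ j))" for v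
    have inner: "(\<Sum>u<U. wt (u + U * v) * e (real h * (\<Sum>i\<le>Suc k. c i * real (u + U * v) ^ i))) = wt v * e (b v 0) * S v" for v
        unfolding S_def sum_distrib_left[of "wt v * e (b v 0)"]
    proof (intro sum.cong refl)
      fix u assume u: "u \<in> {..<U}"
      have "wt (u + U * v) = wt u * wt v" using wt u by (simp add: digit_mult_def U_def)
      moreover have "real h * (\<Sum>i\<le>Suc k. c i * real (u + U * v) ^ i) =
          b v 0 + (\<Sum>j=1..k. b v j * real u ^ j) + real h * c (Suc k) * real u ^ Suc k"
      proof -
        have "(\<Sum>i\<le>Suc k. c i * real (u + U * v) ^ i) = (\<Sum>j\<le>Suc k. shift_coeff c (Suc k) j (real (U * v)) * real u ^ j)"
          using shift_expand[of c "real u" "real (U * v)" "Suc k"] by simp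
        moreover have "{..Suc k} = insert 0 (insert (Suc k) {1..k})" by auto
        ultimately show ?thesis by (simp add: b_def sum_distrib_left algebra_simps)
      qed
      ultimately show "wt (u + U * v) * e (real h * (\<Sum>i\<le>Suc k. c i * real (u + U * v) ^ i)) =
          wt v * e (b v 0) * (w u * e (\<Sum>j=1..k. b v j * real u ^ j))"
        by (simp only: w_def e_add mult_ac)
    qed
    have "cmod (\<Sum>n<2 ^ r. wt n * e (real h * (\<Sum>i\<le>Suc k. c i * real n ^ i))) =
        cmod (\<Sum>v<V. wt v * e (b v 0) * S v)"
      unfolding sum_lessThan_split_block[OF s] U_def[symmetric] V_def[symmetric] inner ..
    also have "\<dots> \<le> (\<Sum>v<V. cmod (S v))"
      by (rule order.trans[OF norm_sum]) (use wt in \<open>simp add: norm_mult digit_mult_def\<close>)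
    finally have "cmod (\<Sum>n<2 ^ r. wt n * e (real h * (\<Sum>i\<le>Suc k. c i * real n ^ i))) ^ (2 * t) \<le> (\<Sum>v<V. cmod (S v)) ^ (2 * t)"
      by (intro power_mono) auto
    also have "\<dots> \<le> real (card {..<V}) ^ (2 * t - 1) * (\<Sum>v<V. cmod (S v) ^ (2 * t))"
      by (intro sum_power_le) (use t in auto)
    also have "\<dots> \<le> real V ^ (2 * t - 1) * ((\<Prod>j\<in>{1..<k}. real (t * U ^ j + 1)) * \<Lambda> * real (vino t k U))"
      unfolding S_def card_lessThan
      by (intro mult_left_mono sieve_mean_value k t U row \<Lambda>0) (use normw in auto)
    also have "\<dots> \<le> real V ^ (2 * t - 1) * ((real (t + 1) ^ (k - 1) * real U ^ tri (k - 1)) * \<Lambda> * (C2 * real U powr (real t + \<epsilon> / 2)))"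
      using \<Lambda>0 C2(1) by (intro mult_left_mono mult_mono prod_sieve_le t U k C2(2) prod_nonneg) auto
    also have "\<dots> = C * real V ^ (2 * t - 1) * (real U ^ tri (k - 1) * real U powr (real k + \<epsilon> / 2) * real U powr (real t + \<epsilon> / 2))"
      by (simp add: C_def \<Lambda>_def mult_ac)
    also have "real U ^ tri (k - 1) * real U powr (real k + \<epsilon> / 2) * real U powr (real t + \<epsilon> / 2) = real U powr (2 * real t + \<epsilon>)"
    proof -
      have eq: "real (tri (k - 1)) + (real k + \<epsilon> / 2) + (real t + \<epsilon> / 2) = 2 * real t + \<epsilon>"
        using arg_cong[OF tri_pred[OF k], of real] by (simp add: t_def)
      have "real U > 0" using U by simp
      then show ?thesis unfolding eq[symmetric] by (simp only: powr_add powr_realpow)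
    qed
    finally show ?thesis by (simp add: U_def V_def)
  qed
  then show thesis using that[OF C] unfolding t_def by blast
qed

section \<open>The divisor bound\<close>

lemma card_divisors_mult_le:
  fixes a b :: nat
  assumes "a > 0" "b > 0"
  shows "card {d. d dvd a * b} \<le> card {d. d dvd a} * card {d. d dvd b}"
proof -
  have "{d. d dvd a * b} \<subseteq> (\<lambda>(x, y). x * y) ` ({d. d dvd a} \<times> {d. d dvd b})"
    using division_decomp by blast
  then have "card {d. d dvd a * b} \<le> card ((\<lambda>(x, y). x * y) ` ({d. d dvd a} \<times> {d. d dvd b}))"
    using assms by (intro card_mono) auto
  also have "\<dots> \<le> card ({d. d dvd a} \<times> {d. d dvd b})"
    using assms by (intro card_image_le) auto
  finally show ?thesis by (simp add: card_cartesian_product)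
qed

lemma card_divisors_prime_power:
  assumes "prime (p :: nat)"
  shows "card {d. d dvd p ^ i} \<le> i + 1"
proof -
  have "{d. d dvd p ^ i} \<subseteq> (\<lambda>j. p ^ j) ` {..i}"
    using assms by (auto simp: divides_primepow_nat)
  then have "card {d. d dvd p ^ i} \<le> card ((\<lambda>j. p ^ j) ` {..i})" by (intro card_mono) auto
  also have "\<dots> \<le> i + 1" using card_image_le[of "{..i}" "\<lambda>j. p ^ j"] by simp
  finally show ?thesis .
qed

text \<open>Primes \<open>p\<close> with \<open>p powr \<epsilon> \<ge> 2\<close> cost nothing, and each of the finitely many other primes
  costs a bounded factor.\<close>

theorem divisor_bound:
  assumes \<epsilon>: "\<epsilon> > 0"
  obtains C where "C \<ge> 1" "\<And>n :: nat. n \<ge> 1 \<Longrightarrow> real (card {d. d dvd n}) \<le> C * real n powr \<epsilon>"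
proof -
  define B where "B = nat \<lceil>2 powr (1 / \<epsilon>)\<rceil>"
  \<comment> \<open>C1 dominates both 1 and 1/(\<epsilon> ln 2), so that i + 1 \<le> C1 (1 + i
    \<epsilon> ln 2) holds for all i.\<close>
  define C1 where "C1 = max 1 (1 / (\<epsilon> * ln 2))"
  define sm where "sm n = {p. prime p \<and> p dvd n \<and> p < B}" for n :: nat
  have C1: "C1 \<ge> 1" "C1 * (\<epsilon> * ln 2) \<ge> 1"
  proof -
    show "C1 \<ge> 1" by (simp add: C1_def)
    have "1 / (\<epsilon> * ln 2) \<le> C1" by (simp add: C1_def)
    then show "C1 * (\<epsilon> * ln 2) \<ge> 1" using \<epsilon> by (simp add: field_simps)
  qed
  have fin: "finite (sm n)" for n by (rule finite_subset[of _ "{..<B}"]) (auto simp: sm_def)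
  have small: "real (i + 1) \<le> C1 * real (p ^ i) powr \<epsilon>" if "prime p" for p i :: nat
  proof -
    have "1 + real i * \<epsilon> * ln 2 \<le> exp (real i * \<epsilon> * ln 2)" by (rule exp_ge_add_one_self)
    also have "\<dots> = (2 ^ i) powr \<epsilon>" by (simp add: powr_def ln_realpow mult_ac)
    also have "\<dots> \<le> real (p ^ i) powr \<epsilon>"
    proof (rule powr_mono2)
      have "2 ^ i \<le> p ^ i" using prime_ge_2_nat[OF that] by (intro power_mono) auto
      then show "(2::real) ^ i \<le> real (p ^ i)" by (metis of_nat_le_iff of_nat_numeral of_nat_power)
    qed (use \<epsilon> in auto)
    finally have "C1 * (1 + real i * \<epsilon> * ln 2) \<le> C1 * real (p ^ i) powr \<epsilon>" using C1 by (intro mult_left_mono) auto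
    moreover have "real (i + 1) \<le> C1 * (1 + real i * \<epsilon> * ln 2)"
      using C1 mult_left_mono[OF C1(2), of "real i"] by (simp add: algebra_simps)
    ultimately show ?thesis by linarith
  qed
  have big: "real (i + 1) \<le> real (p ^ i) powr \<epsilon>" if "p \<ge> B" "prime p" for p i :: nat
  proof -
    have "2 powr (1 / \<epsilon>) \<le> real p" using that unfolding B_def by linarith
    then have "(2 powr (1 / \<epsilon>)) powr \<epsilon> \<le> real p powr \<epsilon>" using \<epsilon> by (intro powr_mono2) auto
    then have p2: "2 \<le> real p powr \<epsilon>" using \<epsilon> by (simp add: powr_powr)
    have "real (i + 1) \<le> 2 ^ i" by (induction i) auto
    also have "\<dots> \<le> (real p powr \<epsilon>) ^ i" using p2 by (intro power_mono) auto
    also have "\<dots> = real (p ^ i) powr \<epsilon>"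
      using prime_gt_0_nat[OF that(2)] by (simp add: powr_powr mult.commute flip: powr_realpow)
    finally show ?thesis .
  qed
  have main: "real (card {d. d dvd n}) \<le> C1 ^ card (sm n) * real n powr \<epsilon>" if "n \<ge> 1" for n
    using that
  proof (induction n rule: less_induct)
    case (less n)
    show ?case
    proof (cases "n = 1")
      case True
      then show ?thesis using C1 by (simp add: one_le_power)
    next
      case False
      then obtain p where p: "prime p" "p dvd n" using prime_factor_nat by blast
      obtain i m where m: "\<not> p dvd m" "n = m * p ^ i"
        using prime_power_canonical[OF p(1), of n] less.prems by auto
      have i: "i \<noteq> 0" using m p by (intro notI) simp
      have m0: "m > 0" using m less.prems by (intro Nat.gr0I) auto
      have pi: "1 < p ^ i" using i prime_gt_1_nat[OF p(1)] by (intro one_less_power) auto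
      have mn: "m < n" using m(2) pi m0 by simp
      have IH: "real (card {d. d dvd m}) \<le> C1 ^ card (sm m) * real m powr \<epsilon>"
        using less.IH[OF mn] m0 by simp
      have "real (card {d. d dvd n}) \<le> real (card {d. d dvd m} * card {d. d dvd p ^ i})"
        unfolding m(2) using m0 prime_gt_0_nat[OF p(1)] by (intro of_nat_mono card_divisors_mult_le) auto
      also have "\<dots> \<le> real (card {d. d dvd m}) * real (i + 1)"
        unfolding of_nat_mult using card_divisors_prime_power[OF p(1), of i] by (intro mult_left_mono) auto
      also have "\<dots> \<le> C1 ^ card (sm m) * real m powr \<epsilon> * real (i + 1)"
        using IH by (intro mult_right_mono) auto
      also have "\<dots> \<le> C1 ^ card (sm n) * (real m powr \<epsilon> * real (p ^ i) powr \<epsilon>)"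
      proof (cases "p < B")
        case True
        have "insert p (sm m) \<subseteq> sm n" using True p m by (auto simp: sm_def)
        moreover have "p \<notin> sm m" using m by (auto simp: sm_def)
        ultimately have "Suc (card (sm m)) \<le> card (sm n)"
          using card_mono[OF fin, of "insert p (sm m)" n] fin[of m] by simp
        then have "C1 ^ card (sm m) * C1 \<le> C1 ^ card (sm n)"
          using C1 power_increasing[of "Suc (card (sm m))" "card (sm n)" C1] by (simp add: mult.commute)
        then have "C1 ^ card (sm m) * C1 * (real m powr \<epsilon> * real (p ^ i) powr \<epsilon>) \<le> C1 ^ card (sm n) * (real m powr \<epsilon> * real (p ^ i) powr \<epsilon>)"
          by (intro mult_right_mono) auto
        moreover have "C1 ^ card (sm m) * real m powr \<epsilon> * real (i + 1) \<le> C1 ^ card (sm m) * real m powr \<epsilon> * (C1 * real (p ^ i) powr \<epsilon>)"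
          using small[OF p(1)] C1 by (intro mult_left_mono) auto
        ultimately show ?thesis by (simp add: mult_ac)
      next
        case False
        have "sm m \<subseteq> sm n" using m by (auto simp: sm_def)
        then have "C1 ^ card (sm m) \<le> C1 ^ card (sm n)" using C1 fin by (intro power_increasing card_mono) auto
        moreover have "real (i + 1) \<le> real (p ^ i) powr \<epsilon>" using big p False by simp
        ultimately have "C1 ^ card (sm m) * (real m powr \<epsilon> * real (i + 1)) \<le> C1 ^ card (sm n) * (real m powr \<epsilon> * real (p ^ i) powr \<epsilon>)"
          using C1 by (intro mult_mono) auto
        then show ?thesis by (simp add: mult_ac)
      qed
      also have "real m powr \<epsilon> * real (p ^ i) powr \<epsilon> = real n powr \<epsilon>"
        by (simp add: m(2) powr_mult)
      finally show ?thesis .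
    qed
  qed
  have "real (card {d. d dvd n}) \<le> C1 ^ B * real n powr \<epsilon>" if "n \<ge> 1" for n
  proof -
    have "card (sm n) \<le> card {..<B}" by (intro card_mono) (auto simp: sm_def)
    then have "C1 ^ card (sm n) \<le> C1 ^ B" using C1 by (intro power_increasing) auto
    then have "C1 ^ card (sm n) * real n powr \<epsilon> \<le> C1 ^ B * real n powr \<epsilon>" by (intro mult_right_mono) auto
    then show ?thesis using main[OF that] by linarith
  qed
  then show thesis using that[of "C1 ^ B"] C1 by (simp add: one_le_power)
qed

section \<open>Weyl differencing\<close>

text \<open>The square is expanded and the pairs are sorted by their difference x; for each x the
  range shrinks to the overlap of the interval with its translate. This is why the induction below
  is over arbitrary intervals.\<close>

lemma weyl_vdc:
  fixes F :: "int \<Rightarrow> complex"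
  assumes AB: "B - A \<le> int U"
  shows "cmod (\<Sum>u\<in>{A..<B}. F u) ^ 2 \<le>
    (\<Sum>x\<in>{- int U<..<int U}. cmod (\<Sum>u\<in>{max A (A - x)..<min B (B - x)}. F (u + x) * cnj (F u)))"
proof -
  let ?I = "{A..<B}" and ?X = "{- int U<..<int U}"
  have "complex_of_real (cmod (\<Sum>u\<in>?I. F u) ^ 2) = (\<Sum>(u', u)\<in>?I \<times> ?I. F u' * cnj (F u))"
    unfolding complex_norm_square cnj_sum sum_product by (simp add: sum.cartesian_product)
  also have "\<dots> = (\<Sum>(x, u)\<in>(SIGMA x:?X. {max A (A - x)..<min B (B - x)}). F (u + x) * cnj (F u))"
    by (rule sum.reindex_bij_witness[of _ "\<lambda>(x, u). (u + x, u)" "\<lambda>(u', u). (u' - u, u)"]) (use AB in auto)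
  also have "\<dots> = (\<Sum>x\<in>?X. \<Sum>u\<in>{max A (A - x)..<min B (B - x)}. F (u + x) * cnj (F u))"
    by (rule sum.Sigma[symmetric]) auto
  finally have eq: "complex_of_real (cmod (\<Sum>u\<in>?I. F u) ^ 2) = \<dots>" .
  have "cmod (\<Sum>u\<in>?I. F u) ^ 2 = cmod (complex_of_real (cmod (\<Sum>u\<in>?I. F u) ^ 2))"
    by (simp only: norm_of_real) simp
  also have "\<dots> \<le> (\<Sum>x\<in>?X. cmod (\<Sum>u\<in>{max A (A - x)..<min B (B - x)}. F (u + x) * cnj (F u)))"
    unfolding eq by (rule norm_sum)
  finally show ?thesis .
qed

text \<open>\<open>weyl_weight U n \<beta>\<close> is the sum of \<open>rcap U ((n + 1)! \<beta> x\<^sub>1 \<cdots> x\<^sub>n)\<close> over all \<open>|x\<^sub>i| < U\<close>.\<close>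

fun weyl_weight :: "nat \<Rightarrow> nat \<Rightarrow> real \<Rightarrow> real" where
  "weyl_weight U 0 \<beta> = rcap (real U) \<beta>"
| "weyl_weight U (Suc n) \<beta> = (\<Sum>x\<in>{- int U<..<int U}. weyl_weight U n (real (n + 2) * \<beta> * of_int x))"

lemma weyl_weight_nonneg: "weyl_weight U n \<beta> \<ge> 0"
  by (induction n arbitrary: \<beta>) (auto intro!: sum_nonneg rcap_nonneg)

lemma card_sym_interval: "real (card {- int U<..<int U}) \<le> 2 * real U"
  by (simp add: nat_le_iff)

lemma weyl_weight_le: "weyl_weight U n \<beta> \<le> (2 * real U) ^ n * real U"
proof (induction n arbitrary: \<beta>)
  case (Suc n)
  have "weyl_weight U (Suc n) \<beta> \<le> real (card {- int U<..<int U}) * ((2 * real U) ^ n * real U)"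
    unfolding weyl_weight.simps by (intro sum_bounded_above Suc)
  also have "\<dots> \<le> 2 * real U * ((2 * real U) ^ n * real U)"
    by (intro mult_right_mono card_sym_interval) auto
  finally show ?case by (simp add: mult_ac)
qed (simp add: rcap_le)

text \<open>Each differencing step lowers the degree by one and multiplies the leading coefficient
  by (n + 2) x, the recursion in \<open>weyl_weight\<close>. The power of 2 U comes from the power
  mean inequality over x; with the trivial bound for the weight the right-hand side has the trivial
  order U^(2^n).\<close>

lemma weyl_inequality:
  assumes "B - A \<le> int U"
  shows "cmod (\<Sum>u\<in>{A..<B}. e (\<Sum>j\<le>Suc n. c j * of_int u ^ j)) ^ (2 ^ n) \<le>
    (2 * real U) ^ (2 ^ n - (n + 1)) * weyl_weight U n (c (Suc n))"
  using assms
proof (induction n arbitrary: A B c)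
  case 0
  show ?case
  proof (cases "A < B")
    case False
    then show ?thesis by (simp add: rcap_nonneg)
  next
    case True
    define L where "L = nat (B - A)"
    have "(\<Sum>u\<in>{A..<B}. e (\<Sum>j\<le>Suc 0. c j * of_int u ^ j)) = (\<Sum>i<L. e (c 1 * real i + (c 0 + c 1 * of_int A)))"
      by (rule sum.reindex_bij_witness[of _ "\<lambda>i. A + int i" "\<lambda>u. nat (u - A)"])
        (use True in \<open>auto simp: L_def algebra_simps\<close>)
    moreover have "cmod (\<Sum>i<L. e (c 1 * real i + (c 0 + c 1 * of_int A))) \<le> rcap (real L) (c 1)"
      by (rule norm_sum_e_le)
    moreover have "rcap (real L) (c 1) \<le> rcap (real U) (c 1)"
      using 0 by (intro rcap_mono) (simp add: L_def)
    ultimately show ?thesis by simp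
  qed
next
  case (Suc n)
  let ?X = "{- int U<..<int U}"
  let ?\<phi> = "\<lambda>u::int. \<Sum>j\<le>Suc (Suc n). c j * of_int u ^ j"
  define S where "S x = cmod (\<Sum>u\<in>{max A (A - x)..<min B (B - x)}. e (?\<phi> (u + x)) * cnj (e (?\<phi> u)))" for x
  have S: "S x ^ (2 ^ n) \<le> (2 * real U) ^ (2 ^ n - (n + 1)) * weyl_weight U n (real (n + 2) * c (Suc (Suc n)) * of_int x)" for x
  proof -
    define c' where "c' j = shift_coeff c (Suc (Suc n)) j (of_int x) - c j" for j
    have "e (?\<phi> (u + x)) * cnj (e (?\<phi> u)) = e (\<Sum>j\<le>Suc n. c' j * of_int u ^ j)" for u
    proof -
      have "?\<phi> (u + x) - ?\<phi> u = (\<Sum>j\<le>Suc (Suc n). c' j * of_int u ^ j)"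
        using shift_expand[of c "of_int u" "of_int x" "Suc (Suc n)"]
        by (simp only: of_int_add c'_def left_diff_distrib sum_subtractf)
      also have "\<dots> = (\<Sum>j\<le>Suc n. c' j * of_int u ^ j)" by (simp add: c'_def)
      finally show ?thesis by (simp only: e_diff[symmetric])
    qed
    moreover have "c' (Suc n) = real (n + 2) * c (Suc (Suc n)) * of_int x"
      by (simp add: c'_def shift_coeff_next)
    moreover have "min B (B - x) - max A (A - x) \<le> int U" using Suc.prems by linarith
    ultimately show ?thesis using Suc.IH[of "min B (B - x)" "max A (A - x)" c'] by (simp add: S_def)
  qed
  have "cmod (\<Sum>u\<in>{A..<B}. e (?\<phi> u)) ^ (2 ^ Suc n) = (cmod (\<Sum>u\<in>{A..<B}. e (?\<phi> u)) ^ 2) ^ (2 ^ n)"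
    by (simp only: power_Suc power_mult)
  also have "\<dots> \<le> (\<Sum>x\<in>?X. S x) ^ (2 ^ n)"
    unfolding S_def by (intro power_mono weyl_vdc Suc.prems) auto
  also have "\<dots> \<le> real (card ?X) ^ (2 ^ n - 1) * (\<Sum>x\<in>?X. S x ^ (2 ^ n))"
    by (intro sum_power_le) (auto simp: S_def)
  also have "\<dots> \<le> (2 * real U) ^ (2 ^ n - 1) * (\<Sum>x\<in>?X. (2 * real U) ^ (2 ^ n - (n + 1)) * weyl_weight U n (real (n + 2) * c (Suc (Suc n)) * of_int x))"
    by (intro mult_mono power_mono card_sym_interval sum_mono S sum_nonneg) (auto simp: S_def)
  also have "\<dots> = ((2 * real U) ^ (2 ^ n - 1) * (2 * real U) ^ (2 ^ n - (n + 1))) * weyl_weight U (Suc n) (c (Suc (Suc n)))"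
    by (simp add: sum_distrib_left mult_ac)
  also have "(2 * real U) ^ (2 ^ n - 1) * (2 * real U) ^ (2 ^ n - (n + 1)) = (2 * real U) ^ (2 ^ Suc n - (Suc n + 1))"
  proof -
    have "n + 1 \<le> 2 ^ n" by (metis Suc_eq_plus1 Suc_leI less_exp)
    then have "2 ^ n - 1 + (2 ^ n - (n + 1)) = 2 ^ Suc n - (Suc n + 1)" by simp
    then show ?thesis by (simp only: power_add[symmetric])
  qed
  finally show ?case .
qed

section \<open>Products of shifts, and sums over multiples of a real number\<close>

definition nzint :: "nat \<Rightarrow> int set" where
  "nzint Y = {w. w \<noteq> 0 \<and> \<bar>w\<bar> \<le> int Y}"

lemma finite_nzint [simp]: "finite (nzint Y)"
  by (rule finite_subset[of _ "{- int Y..int Y}"]) (auto simp: nzint_def)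

lemma card_nzint: "real (card (nzint Y)) \<le> 2 * real Y"
proof -
  have "nzint Y = {- int Y..-1} \<union> {1..int Y}" by (auto simp: nzint_def)
  then have "card (nzint Y) \<le> card {- int Y..-1} + card {1..int Y}" by (simp only: card_Un_le)
  then show ?thesis by simp
qed

text \<open>A factorisation z = w x is determined by the sign and the absolute value of w, and the
  latter is a divisor of z; so each z arises at most 2 \<tau> times.\<close>

lemma sum_products_le:
  fixes G :: "int \<Rightarrow> real"
  assumes G: "\<And>z. G z \<ge> 0" and U: "U \<ge> 1" and
    \<tau>: "\<And>z. 1 \<le> z \<Longrightarrow> z \<le> Y * U \<Longrightarrow> real (card {d. d dvd z}) \<le> \<tau>"
  shows "(\<Sum>w\<in>nzint Y. \<Sum>x\<in>{- int U<..<int U} - {0}. G (w * x)) \<le> 2 * \<tau> * (\<Sum>z\<in>nzint (Y * U). G z)"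
proof -
  let ?D = "nzint Y \<times> ({- int U<..<int U} - {0})"
  have img: "(\<lambda>(w, x). w * x) ` ?D \<subseteq> nzint (Y * U)"
    by (auto simp: nzint_def abs_mult intro!: mult_mono)
  have "(\<Sum>w\<in>nzint Y. \<Sum>x\<in>{- int U<..<int U} - {0}. G (w * x)) = (\<Sum>p\<in>?D. G (case p of (w, x) \<Rightarrow> w * x))"
    by (simp add: sum.cartesian_product case_prod_beta')
  also have "\<dots> = (\<Sum>z\<in>nzint (Y * U). \<Sum>p\<in>{p \<in> ?D. (case p of (w, x) \<Rightarrow> w * x) = z}. G (case p of (w, x) \<Rightarrow> w * x))"
    by (rule sum.group[symmetric]) (use img in auto)
  also have "\<dots> = (\<Sum>z\<in>nzint (Y * U). real (card {p \<in> ?D. (case p of (w, x) \<Rightarrow> w * x) = z}) * G z)"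
    by (intro sum.cong refl) simp
  also have "\<dots> \<le> (\<Sum>z\<in>nzint (Y * U). 2 * \<tau> * G z)"
  proof (intro sum_mono mult_right_mono G)
    fix z assume z: "z \<in> nzint (Y * U)"
    define m where "m = nat \<bar>z\<bar>"
    have m: "1 \<le> m" "m \<le> Y * U" "\<bar>z\<bar> = int m" using z by (auto simp: nzint_def m_def nat_le_iff)
    let ?E = "{d. d dvd m}"
    have finE: "finite ?E" using m by auto
    have "{p \<in> ?D. (case p of (w, x) \<Rightarrow> w * x) = z} \<subseteq> (\<lambda>(s, d). (s * int d, z div (s * int d))) ` ({1, - 1} \<times> ?E)"
    proof
      fix p assume "p \<in> {p \<in> ?D. (case p of (w, x) \<Rightarrow> w * x) = z}"
      then obtain w x where p: "p = (w, x)" "w \<noteq> 0" "w * x = z" by (auto simp: nzint_def)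
      have "w dvd z" using p by auto
      then have "nat \<bar>w\<bar> dvd m" by (simp add: m_def nat_dvd_iff)
      moreover have "w = sgn w * int (nat \<bar>w\<bar>)" by (simp add: sgn_mult_abs)
      moreover have "sgn w \<in> {1, - 1}" using p by (auto simp: sgn_if)
      moreover have "x = z div w" using p by auto
      ultimately show "p \<in> (\<lambda>(s, d). (s * int d, z div (s * int d))) ` ({1, - 1} \<times> ?E)"
        unfolding p(1) by (intro image_eqI[of _ _ "(sgn w, nat \<bar>w\<bar>)"]) auto
    qed
    then have "card {p \<in> ?D. (case p of (w, x) \<Rightarrow> w * x) = z} \<le> card ((\<lambda>(s, d). (s * int d, z div (s * int d))) ` ({1, - 1 :: int} \<times> ?E))"
      using finE by (intro card_mono) auto
    also have "\<dots> \<le> card ({1, - 1 :: int} \<times> ?E)" using finE by (intro card_image_le) auto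
    also have "\<dots> = 2 * card ?E" by (simp add: card_cartesian_product)
    finally have "real (card {p \<in> ?D. (case p of (w, x) \<Rightarrow> w * x) = z}) \<le> 2 * real (card ?E)" by linarith
    then show "real (card {p \<in> ?D. (case p of (w, x) \<Rightarrow> w * x) = z}) \<le> 2 * \<tau>"
      using \<tau>[OF m(1,2)] by linarith
  qed
  finally show ?thesis by (simp add: sum_distrib_left)
qed

text \<open>The nonzero shifts are multiplied into w one at a time, each step costing a factor 2
  \<tau>. Whenever a shift is 0 the weight is estimated trivially; as one summation has disappeared,
  these terms are still smaller by a factor U than the trivial bound for the whole sum, and they
  form the first summand.\<close>

lemma sum_weyl_weight_le:
  assumes U: "U \<ge> 1" and \<tau>1: "\<tau> \<ge> 1"
  shows "(\<And>z. 1 \<le> z \<Longrightarrow> z \<le> Y * U ^ n \<Longrightarrow> real (card {d. d dvd z}) \<le> \<tau>) \<Longrightarrow>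
    (\<Sum>w\<in>nzint Y. weyl_weight U n (\<beta> * of_int w)) \<le>
    real n * (2 * \<tau>) ^ n * (2 * real Y * (2 * real U) ^ n) +
    (2 * \<tau>) ^ n * (\<Sum>z\<in>nzint (Y * U ^ n). rcap (real U) (fact (n + 1) * \<beta> * of_int z))"
proof (induction n arbitrary: Y \<beta>)
  case 0
  then show ?case by simp
next
  case (Suc n)
  let ?X = "{- int U<..<int U}"
  have \<tau>': "real (card {d. d dvd z}) \<le> \<tau>" if "1 \<le> z" "z \<le> Y * U" for z
  proof (rule Suc.prems[OF that(1)])
    have "Y * U \<le> Y * U ^ Suc n" using U self_le_power[of U "Suc n"] by (intro mult_le_mono2) auto
    then show "z \<le> Y * U ^ Suc n" using that by linarith
  qed
  have "(\<Sum>w\<in>nzint Y. weyl_weight U (Suc n) (\<beta> * of_int w)) =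
    (\<Sum>w\<in>nzint Y. weyl_weight U n 0 + (\<Sum>x\<in>?X - {0}. weyl_weight U n (real (n + 2) * \<beta> * of_int (w * x))))"
  proof (intro sum.cong refl)
    fix w
    have "0 \<in> ?X" using U by auto
    then show "weyl_weight U (Suc n) (\<beta> * of_int w) =
      weyl_weight U n 0 + (\<Sum>x\<in>?X - {0}. weyl_weight U n (real (n + 2) * \<beta> * of_int (w * x)))"
      by (simp add: sum.remove[of _ 0] mult_ac)
  qed
  also have "\<dots> = real (card (nzint Y)) * weyl_weight U n 0 +
      (\<Sum>w\<in>nzint Y. \<Sum>x\<in>?X - {0}. weyl_weight U n (real (n + 2) * \<beta> * of_int (w * x)))"
    by (simp add: sum.distrib)
  also have "\<dots> \<le> 2 * real Y * ((2 * real U) ^ n * real U) +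
      2 * \<tau> * (\<Sum>z\<in>nzint (Y * U). weyl_weight U n (real (n + 2) * \<beta> * of_int z))"
    by (intro add_mono mult_mono card_nzint weyl_weight_le sum_products_le weyl_weight_nonneg U \<tau>') auto
  also have "\<dots> \<le> 2 * real Y * ((2 * real U) ^ n * real U) +
      2 * \<tau> * (real n * (2 * \<tau>) ^ n * (2 * real (Y * U) * (2 * real U) ^ n) +
    (2 * \<tau>) ^ n * (\<Sum>z\<in>nzint (Y * U * U ^ n). rcap (real U) (fact (n + 1) * (real (n + 2) * \<beta>) * of_int z)))"
    using \<tau>1 Suc.prems by (intro add_left_mono mult_left_mono Suc.IH) (auto simp: mult.assoc)
  also have "\<dots> = real Y * (2 * real U) ^ Suc n + 
      real n * (2 * \<tau>) ^ Suc n * (real Y * (2 * real U) ^ Suc n) +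
    (2 * \<tau>) ^ Suc n * (\<Sum>z\<in>nzint (Y * U ^ Suc n). rcap (real U) (fact (Suc n + 1) * \<beta> * of_int z))"
    by (simp add: algebra_simps)
  also have "\<dots> \<le> (2 * \<tau>) ^ Suc n * (2 * real Y * (2 * real U) ^ Suc n) +
      real n * (2 * \<tau>) ^ Suc n * (2 * real Y * (2 * real U) ^ Suc n) +
    (2 * \<tau>) ^ Suc n * (\<Sum>z\<in>nzint (Y * U ^ Suc n). rcap (real U) (fact (Suc n + 1) * \<beta> * of_int z))"
  proof (intro add_mono order_refl)
    have "1 \<le> (2 * \<tau>) ^ Suc n" using \<tau>1 by (intro one_le_power) simp
    then have "1 * (real Y * (2 * real U) ^ Suc n) \<le> (2 * \<tau>) ^ Suc n * (2 * real Y * (2 * real U) ^ Suc n)"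
      using \<tau>1 by (intro mult_mono) auto
    then show "real Y * (2 * real U) ^ Suc n \<le> (2 * \<tau>) ^ Suc n * (2 * real Y * (2 * real U) ^ Suc n)" by simp
    show "real n * (2 * \<tau>) ^ Suc n * (real Y * (2 * real U) ^ Suc n) \<le> real n * (2 * \<tau>) ^ Suc n * (2 * real Y * (2 * real U) ^ Suc n)"
      using \<tau>1 by (intro mult_left_mono mult_right_mono mult_nonneg_nonneg zero_le_power) auto
  qed
  finally show ?case by (simp add: algebra_simps)
qed

lemma sum_nzint_rcap:
  "(\<Sum>z\<in>nzint Z. rcap M (\<beta> * of_int z)) = 2 * (\<Sum>z\<in>{1..Z}. rcap M (\<beta> * real z))"
proof -
  have eq: "nzint Z = (\<lambda>z. int z) ` {1..Z} \<union> (\<lambda>z. - int z) ` {1..Z}"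
  proof (intro set_eqI iffI)
    fix w assume w: "w \<in> nzint Z"
    show "w \<in> (\<lambda>z. int z) ` {1..Z} \<union> (\<lambda>z. - int z) ` {1..Z}"
    proof (cases "w > 0")
      case True
      then have "w = int (nat w)" "nat w \<in> {1..Z}" using w by (auto simp: nzint_def)
      then show ?thesis by blast
    next
      case False
      then have "w = - int (nat (- w))" "nat (- w) \<in> {1..Z}" using w by (auto simp: nzint_def)
      then show ?thesis by blast
    qed
  qed (auto simp: nzint_def)
  have "(\<Sum>z\<in>nzint Z. rcap M (\<beta> * of_int z)) =
    (\<Sum>z\<in>(\<lambda>z. int z) ` {1..Z}. rcap M (\<beta> * of_int z)) + (\<Sum>z\<in>(\<lambda>z. - int z) ` {1..Z}. rcap M (\<beta> * of_int z))"
    unfolding eq by (rule sum.union_disjoint) auto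
  also have "\<dots> = (\<Sum>z\<in>{1..Z}. rcap M (\<beta> * real z)) + (\<Sum>z\<in>{1..Z}. rcap M (\<beta> * real z))"
  proof (rule arg_cong2[where f = "(+)"])
    show "(\<Sum>z\<in>(\<lambda>z. int z) ` {1..Z}. rcap M (\<beta> * of_int z)) = (\<Sum>z\<in>{1..Z}. rcap M (\<beta> * real z))"
      by (subst sum.reindex) (auto simp: inj_on_def)
    show "(\<Sum>z\<in>(\<lambda>z. - int z) ` {1..Z}. rcap M (\<beta> * of_int z)) = (\<Sum>z\<in>{1..Z}. rcap M (\<beta> * real z))"
      by (subst sum.reindex) (auto simp: inj_on_def)
  qed
  finally show ?thesis by simp
qed

text \<open>Among about q/2 consecutive multiples of \<beta> any two are 1/(2 q) apart: a w / q is
  at least 1/q from every integer for 0 < w < q, and the approximation error w/(q Q) is at most 1/(2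
  q) because 2 w \<le> q \<le> Q. The sum is cut into blocks of this length.\<close>

lemma sum_rcap_progression:
  fixes \<beta> M :: real and q Q :: nat and a :: int
  assumes q: "1 \<le> q" "q \<le> Q" and cop: "coprime a (int q)" and app: "\<bar>real q * \<beta> - of_int a\<bar> < 1 / real Q"
    and M: "M \<ge> 0"
  shows "(\<Sum>z\<in>{1..Z}. rcap M (\<beta> * real z)) \<le> (3 * real Z / real q + 1) * (2 * M + 4 * real q * (1 + ln (2 * real q)))"
proof -
  \<comment> \<open>The maximum with 1 keeps the blocks nonempty at q = 1; the inequality q \<le> 3
    L is sharp at q = 3.\<close>
  define L where "L = max 1 (q div 2)"
  have L: "L \<ge> 1" "real q \<le> 3 * real L" unfolding L_def by (auto simp: max_def)
  have sep: "1 / (2 * real q) \<le> dni (\<beta> * real w)" if w: "1 \<le> w" "w < L" for w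
  proof -
    have wq: "2 * w \<le> q" "w < q" using w unfolding L_def by auto
    define n where "n = round (\<beta> * real w)"
    have "\<not> int q dvd a * int w"
    proof
      assume "int q dvd a * int w"
      then have "int q dvd int w" using cop by (metis coprime_commute coprime_dvd_mult_right_iff)
      then have "q dvd w" by simp
      then show False using w wq by (auto dest: dvd_imp_le)
    qed
    then have "a * int w - n * int q \<noteq> 0" by (metis dvd_triv_right eq_iff_diff_eq_0)
    then have "1 \<le> \<bar>a * int w - n * int q\<bar>" by linarith
    then have "real_of_int 1 \<le> real_of_int \<bar>a * int w - n * int q\<bar>" by (rule of_int_le_iff[THEN iffD2])
    then have "1 \<le> \<bar>of_int a * real w - of_int n * real q\<bar>" by simp
    also have "of_int a * real w - of_int n * real q = real q * (\<beta> * real w - of_int n) - (real q * \<beta> - of_int a) * real w"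
      by (simp add: algebra_simps)
    also have "\<bar>\<dots>\<bar> \<le> real q * dni (\<beta> * real w) + \<bar>real q * \<beta> - of_int a\<bar> * real w"
      by (rule order.trans[OF abs_triangle_ineq4]) (simp add: abs_mult dist_nearest_int_def n_def)
    also have "\<bar>real q * \<beta> - of_int a\<bar> * real w \<le> 1 / real Q * (real Q / 2)"
      using app wq q by (intro mult_mono) auto
    also have "\<dots> = 1 / 2" using q by simp
    finally show ?thesis using q by (simp add: field_simps)
  qed
  have block: "(\<Sum>i<L. rcap M (\<beta> * real (1 + b * L + i))) \<le> 2 * M + 4 * real q * (1 + ln (2 * real q))" for b
  proof -
    have "(\<Sum>i<L. rcap M (\<beta> * real (1 + b * L + i))) \<le> 2 * M + 2 / (1 / (2 * real q)) * (1 + ln (1 / (1 / (2 * real q))))"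
    proof (intro sum_rcap_spaced M)
      fix i j assume ij: "i \<in> {..<L}" "j \<in> {..<L}" "i \<noteq> j"
      have *: "1 / (2 * real q) \<le> dni (\<beta> * real (1 + b * L + i) - \<beta> * real (1 + b * L + j))" if "i < L" "j < i" for i j
      proof -
        have "\<beta> * real (1 + b * L + i) - \<beta> * real (1 + b * L + j) = \<beta> * real (i - j)"
          using that by (simp add: of_nat_diff algebra_simps)
        then show ?thesis using sep[of "i - j"] that by simp
      qed
      show "1 / (2 * real q) \<le> dni (\<beta> * real (1 + b * L + i) - \<beta> * real (1 + b * L + j))"
      proof (cases "j < i")
        case False
        then show ?thesis using *[of j i] ij dni_minus[of "\<beta> * real (1 + b * L + i) - \<beta> * real (1 + b * L + j)"] by simp
      qed (use * ij in auto)
    qed (use q in auto)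
    then show ?thesis by simp
  qed
  have "(\<Sum>z\<in>{1..Z}. rcap M (\<beta> * real z)) = (\<Sum>i<Z. rcap M (\<beta> * real (1 + i)))"
    by (rule sum.reindex_bij_witness[of _ "\<lambda>i. 1 + i" "\<lambda>z. z - 1"]) auto
  also have "\<dots> \<le> (\<Sum>i<(Z div L + 1) * L. rcap M (\<beta> * real (1 + i)))"
  proof (rule sum_mono2)
    have "Z < (Z div L + 1) * L" using L dividend_less_div_times[of L Z] by (simp add: algebra_simps)
    then show "{..<Z} \<subseteq> {..<(Z div L + 1) * L}" by auto
  qed (use M in \<open>auto intro: rcap_nonneg\<close>)
  also have "\<dots> = (\<Sum>b<Z div L + 1. \<Sum>i<L. rcap M (\<beta> * real (1 + b * L + i)))"
  proof -
    have "(\<Sum>i<(Z div L + 1) * L. rcap M (\<beta> * real (1 + i))) = (\<Sum>b<Z div L + 1. sum (\<lambda>i. rcap M (\<beta> * real (1 + i))) {b * L..<b * L + L})"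
      by (rule sum.nat_group[symmetric])
    also have "\<dots> = (\<Sum>b<Z div L + 1. \<Sum>i<L. rcap M (\<beta> * real (1 + b * L + i)))"
    proof (rule sum.cong[OF refl])
      fix b
      show "sum (\<lambda>i. rcap M (\<beta> * real (1 + i))) {b * L..<b * L + L} = (\<Sum>i<L. rcap M (\<beta> * real (1 + b * L + i)))"
        using sum.shift_bounds_nat_ivl[of "\<lambda>i. rcap M (\<beta> * real (1 + i))" 0 "b * L" L]
        by (simp add: lessThan_atLeast0 add_ac)
    qed
    finally show ?thesis .
  qed
  also have "\<dots> \<le> real (card {..<Z div L + 1}) * (2 * M + 4 * real q * (1 + ln (2 * real q)))"
    by (intro sum_bounded_above block)
  also have "\<dots> \<le> (3 * real Z / real q + 1) * (2 * M + 4 * real q * (1 + ln (2 * real q)))"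
  proof (intro mult_right_mono)
    have "real (Z div L) \<le> real Z / real L" by (rule of_nat_div_le_of_nat)
    also have "\<dots> \<le> 3 * real Z / real q"
      using L q mult_right_mono[OF L(2), of "real Z"] by (simp add: field_simps)
    finally show "real (card {..<Z div L + 1}) \<le> 3 * real Z / real q + 1" by simp
    show "0 \<le> 2 * M + 4 * real q * (1 + ln (2 * real q))" using M q by (auto intro!: add_nonneg_nonneg mult_nonneg_nonneg ln_ge_zero)
  qed
  finally show ?thesis .
qed

section \<open>Twisted exponential sums: the Weyl bound\<close>

text \<open>Over u the weight \<open>wt u\<close> is a unimodular factor of the whole inner sum and
  disappears when absolute values are squared. The weights of v and v' come out as unimodular
  coefficients, leaving pure polynomial sums over u.\<close>

lemma twisted_sum_Cauchy_Schwarz: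
  fixes \<phi> :: "nat \<Rightarrow> real"
  assumes wt: "digit_mult wt" and s: "s \<le> r"
  shows "cmod (\<Sum>n<2 ^ r. wt n * e (\<phi> n)) ^ 2 \<le> 2 ^ s * (\<Sum>v<2 ^ (r - s). \<Sum>v'<2 ^ (r - s).
    cmod (\<Sum>u<2 ^ s. e (\<phi> (u + 2 ^ s * v) - \<phi> (u + 2 ^ s * v'))))"
proof -
  define U where "U = (2::nat) ^ s"
  define V where "V = (2::nat) ^ (r - s)"
  define g where "g u = (\<Sum>v<V. wt v * e (\<phi> (u + U * v)))" for u
  have norm_wt: "cmod (wt n) = 1" for n using wt by (simp add: digit_mult_def)
  have "(\<Sum>n<2 ^ r. wt n * e (\<phi> n)) = (\<Sum>v<V. \<Sum>u<U. wt u * (wt v * e (\<phi> (u + U * v))))"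
    unfolding sum_lessThan_split_block[OF s] U_def V_def
    using wt by (intro sum.cong refl) (simp add: digit_mult_def)
  also have "\<dots> = (\<Sum>u<U. wt u * g u)"
    by (subst sum.swap) (simp add: g_def sum_distrib_left)
  finally have "cmod (\<Sum>n<2 ^ r. wt n * e (\<phi> n)) \<le> (\<Sum>u<U. cmod (g u))"
    using norm_sum[of "\<lambda>u. wt u * g u" "{..<U}"] by (simp add: norm_mult norm_wt)
  then have "cmod (\<Sum>n<2 ^ r. wt n * e (\<phi> n)) ^ 2 \<le> (\<Sum>u<U. cmod (g u)) ^ 2"
    by (intro power_mono) auto
  also have "\<dots> \<le> real (card {..<U}) ^ (2 - 1) * (\<Sum>u<U. cmod (g u) ^ 2)"
    by (intro sum_power_le) auto
  also have "(\<Sum>u<U. cmod (g u) ^ 2) \<le> (\<Sum>v<V. \<Sum>v'<V. cmod (\<Sum>u<U. e (\<phi> (u + U * v) - \<phi> (u + U * v'))))"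
  proof -
    have "complex_of_real (\<Sum>u<U. cmod (g u) ^ 2) =
      (\<Sum>u<U. \<Sum>v<V. \<Sum>v'<V. wt v * cnj (wt v') * e (\<phi> (u + U * v) - \<phi> (u + U * v')))"
      unfolding of_real_sum complex_norm_square g_def cnj_sum sum_product
      by (intro sum.cong refl) (simp add: e_diff mult_ac)
    also have "\<dots> = (\<Sum>v<V. \<Sum>v'<V. wt v * cnj (wt v') * (\<Sum>u<U. e (\<phi> (u + U * v) - \<phi> (u + U * v'))))"
      unfolding sum_distrib_left by (subst sum.swap) (rule sum.cong[OF refl], rule sum.swap)
    finally have eq: "complex_of_real (\<Sum>u<U. cmod (g u) ^ 2) = \<dots>" .
    have "(\<Sum>u<U. cmod (g u) ^ 2) = cmod (complex_of_real (\<Sum>u<U. cmod (g u) ^ 2))"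
      by (simp only: norm_of_real) (simp add: sum_nonneg)
    also have "\<dots> \<le> (\<Sum>v<V. \<Sum>v'<V. cmod (\<Sum>u<U. e (\<phi> (u + U * v) - \<phi> (u + U * v'))))"
      unfolding eq by (intro order.trans[OF norm_sum] sum_mono) (simp add: norm_mult norm_wt)
    finally show ?thesis .
  qed
  finally show ?thesis by (simp add: U_def V_def mult_left_mono)
qed

text \<open>The terms of degree n + 2 in u agree in both blocks and cancel. What remains has degree
  n + 1 with a leading coefficient proportional to v - v', so n differencing steps make it
  linear.\<close>

lemma block_difference_weyl:
  fixes c :: "nat \<Rightarrow> real" and h U v v' n :: nat
  defines "\<phi> \<equiv> \<lambda>m. real h * (\<Sum>i\<le>n + 2. c i * real m ^ i)"
  shows "cmod (\<Sum>u<U. e (\<phi> (u + U * v) - \<phi> (u + U * v'))) ^ (2 ^ n) \<le> (2 * real U) ^ (2 ^ n - (n + 1)) *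
    weyl_weight U n (real (n + 2) * real h * c (n + 2) * real U * (real v - real v'))"
proof -
  define b where "b j = real h * (shift_coeff c (Suc (Suc n)) j (real (U * v)) - shift_coeff c (Suc (Suc n)) j (real (U * v')))" for j
  have "\<phi> (u + U * v) - \<phi> (u + U * v') = (\<Sum>j\<le>Suc n. b j * of_int (int u) ^ j)" for u
  proof -
    have "(\<Sum>i\<le>n + 2. c i * real (u + U * w) ^ i) = (\<Sum>j\<le>Suc (Suc n). shift_coeff c (Suc (Suc n)) j (real (U * w)) * real u ^ j)" for w
      using shift_expand[of c "real u" "real (U * w)" "Suc (Suc n)"] by simp
    then have "\<phi> (u + U * v) - \<phi> (u + U * v') = (\<Sum>j\<le>Suc (Suc n). b j * real u ^ j)"
      unfolding \<phi>_def by (simp only: right_diff_distrib[symmetric] sum_subtractf[symmetric] left_diff_distrib[symmetric] b_def)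
        (simp only: sum_distrib_left mult.assoc)
    also have "\<dots> = (\<Sum>j\<le>Suc n. b j * real u ^ j)" by (simp add: b_def)
    finally show ?thesis by simp
  qed
  then have "(\<Sum>u<U. e (\<phi> (u + U * v) - \<phi> (u + U * v'))) = (\<Sum>u<U. e (\<Sum>j\<le>Suc n. b j * of_int (int u) ^ j))"
    by simp
  also have "\<dots> = (\<Sum>u\<in>{0..<int U}. e (\<Sum>j\<le>Suc n. b j * of_int u ^ j))"
    by (rule sum.reindex_bij_witness[of _ nat int]) auto
  finally have eq: "(\<Sum>u<U. e (\<phi> (u + U * v) - \<phi> (u + U * v'))) = \<dots>" .
  have "b (Suc n) = real (n + 2) * real h * c (n + 2) * real U * (real v - real v')"
    by (simp add: b_def shift_coeff_next algebra_simps)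
  then show ?thesis using weyl_inequality[where A = 0 and B = "int U" and U = U and n = n and c = b] unfolding eq by simp
qed

lemma sum_differences_le:
  fixes G :: "real \<Rightarrow> real"
  assumes "\<And>x. G x \<ge> 0"
  shows "(\<Sum>v<V. \<Sum>v'\<in>{..<V} - {v}. G (real v - real v')) \<le> real V * (\<Sum>w\<in>nzint V. G (of_int w))"
proof -
  have "(\<Sum>v'\<in>{..<V} - {v}. G (real v - real v')) \<le> (\<Sum>w\<in>nzint V. G (of_int w))" if v: "v < V" for v
  proof -
    have "(\<Sum>v'\<in>{..<V} - {v}. G (real v - real v')) = (\<Sum>w\<in>(\<lambda>v'. int v - int v') ` ({..<V} - {v}). G (of_int w))"
      by (subst sum.reindex) (auto simp: inj_on_def)
    also have "\<dots> \<le> (\<Sum>w\<in>nzint V. G (of_int w))"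
      using v assms by (intro sum_mono2 finite_nzint) (auto simp: nzint_def)
    finally show ?thesis .
  qed
  then have "(\<Sum>v<V. \<Sum>v'\<in>{..<V} - {v}. G (real v - real v')) \<le> (\<Sum>v<V. \<Sum>w\<in>nzint V. G (of_int w))"
    by (intro sum_mono) auto
  then show ?thesis by simp
qed

lemma add_power_le:
  fixes x y :: real
  assumes "x \<ge> 0" "y \<ge> 0"
  shows "(x + y) ^ n \<le> 2 ^ n * (x ^ n + y ^ n)"
proof -
  have "(x + y) ^ n \<le> (2 * max x y) ^ n" using assms by (intro power_mono) auto
  also have "\<dots> = 2 ^ n * max x y ^ n" by (simp add: power_mult_distrib)
  also have "max x y ^ n \<le> x ^ n + y ^ n" using assms by (auto simp: max_def)
  finally show ?thesis by (simp add: mult_left_mono)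
qed

text \<open>G is the saving aimed at off the diagonal. With Z = V U^n, an approximation to \<beta>
  with denominator q \<le> Z U / G makes the terms in q/(Z U) small enough, while type 1 bounds 1/q
  by about h G / Z, which the last hypothesis turns into 1/G.\<close>

theorem twisted_sum_weyl_bound:
  fixes c :: "nat \<Rightarrow> real"
  assumes dio: "badly_approx_type (c (n + 2))" and n: "n \<ge> 1" and \<epsilon>: "\<epsilon> > 0"
  obtains C where "C \<ge> 1" "\<And>wt r s h G. \<lbrakk>digit_mult wt; s \<le> r; h \<ge> 1; real h \<le> 2 ^ r; G \<ge> 1; G \<le> 2 ^ s;
      real h * G ^ 2 \<le> 2 ^ (r - s) * (2 ^ s) ^ n\<rbrakk> \<Longrightarrow>
    cmod (\<Sum>m<2 ^ r. wt m * e (real h * (\<Sum>i\<le>n + 2. c i * real m ^ i))) ^ (2 * 2 ^ n) \<le>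
      C * (2 ^ r) ^ (2 * 2 ^ n) * 2 powr (\<epsilon> * real r) * (1 / (2 ^ (r - s)) ^ (2 ^ n) + 1 / G)"
proof -
  define \<kappa> where "\<kappa> = (2::nat) ^ n"
  have \<kappa>: "\<kappa> \<ge> n + 1" unfolding \<kappa>_def by (metis Suc_eq_plus1 Suc_leI less_exp)
  \<comment> \<open>The three exponents are chosen so that the divisor bound to the power n, the
    logarithm of q and the excess in the Diophantine condition are each at most a constant times R =
    2^(\<epsilon> r / 2). At most two such factors meet in one term, which gives R^2.\<close>
  define b where "b = \<epsilon> / (2 * real n * real (n + 1))"
  define a where "a = \<epsilon> / (2 * real (n + 1))"
  define \<eta> where "\<eta> = \<epsilon> / (2 * real (n + 3))"
  have pos: "b > 0" "a > 0" "\<eta> > 0" using \<epsilon> n by (auto simp: b_def a_def \<eta>_def)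
  obtain Cd where Cd: "Cd \<ge> 1" "\<And>z :: nat. z \<ge> 1 \<Longrightarrow> real (card {d. d dvd z}) \<le> Cd * real z powr b"
    using divisor_bound[OF pos(1)] by blast
  obtain c0 where c0: "c0 > 0" "\<And>q::nat. q \<ge> 1 \<Longrightarrow> c0 * real q powr (- (1 + \<eta>)) \<le> dni (c (n + 2) * real q)"
    using dio pos(3) unfolding badly_approx_type_def by blast
  define F where "F = fact (n + 1) * (n + 2)"
  have F: "F \<ge> 1"
    using mult_le_mono[OF fact_ge_1[of "n + 1"], of 1 "n + 2"] by (simp add: F_def)
  define Cq where "Cq = 2 * real F powr (1 + \<eta>) / c0"
  define Cl where "Cl = 1 + 2 powr a / a"
  define C3 where "C3 = 2 ^ n * Cd ^ n * (real n * 2 ^ (n + 1) + 2 * (6 * Cq + 18 * Cl))"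
  have Cql: "Cq > 0" "Cl \<ge> 1" using c0 F pos by (auto simp: Cq_def Cl_def)
  have C3: "C3 \<ge> 0" using Cql Cd by (simp add: C3_def)
  define C where "C = 2 ^ \<kappa> * (1 + 2 ^ (\<kappa> - (n + 1)) * C3)"
  have C1: "C \<ge> 1"
  proof -
    have "1 * 1 \<le> (2::real) ^ \<kappa> * (1 + 2 ^ (\<kappa> - (n + 1)) * C3)" using C3 by (intro mult_mono) auto
    then show ?thesis by (simp add: C_def)
  qed
  have "cmod (\<Sum>m<2 ^ r. wt m * e (real h * (\<Sum>i\<le>n + 2. c i * real m ^ i))) ^ (2 * \<kappa>) \<le>
      C * (2 ^ r) ^ (2 * \<kappa>) * 2 powr (\<epsilon> * real r) * (1 / (2 ^ (r - s)) ^ \<kappa> + 1 / G)"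
    if wt: "digit_mult wt" and s: "s \<le> r" and h: "h \<ge> 1" "real h \<le> 2 ^ r" and G: "G \<ge> 1" "G \<le> 2 ^ s"
      and hG: "real h * G ^ 2 \<le> 2 ^ (r - s) * (2 ^ s) ^ n" for wt r s h G
  proof -
    define U where "U = (2::nat) ^ s"
    define V where "V = (2::nat) ^ (r - s)"
    define Z where "Z = V * U ^ n"
    define \<phi> where "\<phi> m = real h * (\<Sum>i\<le>n + 2. c i * real m ^ i)" for m
    define T where "T = cmod (\<Sum>m<2 ^ r. wt m * e (\<phi> m))"
    define S where "S v v' = cmod (\<Sum>u<U. e (\<phi> (u + U * v) - \<phi> (u + U * v')))" for v v'
    define \<theta> where "\<theta> = real (n + 2) * real h * c (n + 2) * real U"
    define R where "R = 2 powr (\<epsilon> * real r / 2)"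
    have R: "R \<ge> 1" unfolding R_def using \<epsilon> by (intro ge_one_powr_ge_zero) auto
    have U: "U \<ge> 1" "G \<le> real U" and V: "V \<ge> 1" using G by (auto simp: U_def V_def)
    have UV: "U * V = 2 ^ r" using s by (simp add: U_def V_def flip: power_add)
    have Ur: "U \<le> 2 ^ r" unfolding U_def using s by (intro power_increasing) auto
    have Z: "Z \<ge> 1" "U \<le> Z" "Z * U \<le> 2 ^ ((n + 1) * r)" "Z \<le> 2 ^ ((n + 1) * r)"
    proof -
      show "Z \<ge> 1" using U V by (simp add: Z_def)
      have "1 * U ^ 1 \<le> V * U ^ n" using U V n by (intro mult_le_mono power_increasing) auto
      then show "U \<le> Z" by (simp add: Z_def)
      have "Z * U = (U * V) * U ^ n" by (simp add: Z_def)
      also have "\<dots> \<le> 2 ^ r * (2 ^ r) ^ n" unfolding UV using Ur by (intro mult_le_mono power_mono) auto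
      finally show ZU: "Z * U \<le> 2 ^ ((n + 1) * r)" by (simp add: power_add power_mult[symmetric] mult.commute)
      have "Z * 1 \<le> Z * U" using U by (intro mult_le_mono) auto
      then show "Z \<le> 2 ^ ((n + 1) * r)" using ZU by linarith
    qed
    define \<tau> where "\<tau> = Cd * (2 ^ ((n + 1) * r)) powr b"
    have \<tau>: "real (card {d. d dvd z}) \<le> \<tau>" if "1 \<le> z" "z \<le> V * U ^ n" for z
    proof -
      have "z \<le> 2 ^ ((n + 1) * r)" using that Z(4) by (simp add: Z_def)
      then have "real z \<le> 2 ^ ((n + 1) * r)" by (metis of_nat_le_iff of_nat_numeral of_nat_power)
      then have "Cd * real z powr b \<le> \<tau>" unfolding \<tau>_def using Cd pos by (intro mult_left_mono powr_mono2) auto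
      then show ?thesis using Cd(2)[OF that(1)] by linarith
    qed
    have \<tau>1: "\<tau> \<ge> 1"
    proof -
      have "1 * 1 \<le> Cd * (2 ^ ((n + 1) * r)) powr b"
        using Cd pos by (intro mult_mono ge_one_powr_ge_zero) auto
      then show ?thesis by (simp add: \<tau>_def)
    qed
    have \<tau>n: "\<tau> ^ n = Cd ^ n * R"
    proof -
      have "((2 ^ ((n + 1) * r)) powr b) ^ n = 2 powr (real ((n + 1) * r) * b * real n)"
        by (simp add: powr_powr mult_ac flip: powr_realpow)
      also have "real ((n + 1) * r) * b * real n = \<epsilon> * real r / 2"
      proof -
        have "(y * real r) * (\<epsilon> / (2 * x * y)) * x = \<epsilon> * real r / 2" if "x > 0" "y > 0" for x y :: real
          using that by (simp add: field_simps)
        from this[of "real n" "real (n + 1)"] show ?thesis using n by (simp only: b_def of_nat_mult)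
      qed
      finally show ?thesis by (simp add: \<tau>_def power_mult_distrib R_def)
    qed
    have cancel: "(y * x) * (\<epsilon> / (2 * y)) = \<epsilon> * x / 2" if "y > 0" for x y :: real
      using that by (simp add: field_simps)
    \<comment> \<open>The range of Dirichlet's theorem, just short enough for q/(Z U) \<le> 1/G;
      since Z U / G \<ge> 1, rounding down loses at most a factor 2.\<close>
    define N where "N = nat \<lfloor>real (Z * U) / G\<rfloor>"
    have ZUG: "1 \<le> real (Z * U) / G"
    proof -
      have "G * 1 \<le> real U * real Z" using U Z G by (intro mult_mono) auto
      then show ?thesis using G by (simp add: field_simps)
    qed
    have N1: "N \<ge> 1" unfolding N_def using ZUG by (simp add: le_nat_floor)
    have N_le: "real N \<le> real (Z * U) / G" unfolding N_def using ZUG by (intro of_nat_floor) linarith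
    have N_ge: "real (Z * U) / G \<le> 2 * real N" using ZUG N1 unfolding N_def by linarith
    define \<beta> where "\<beta> = fact (n + 1) * \<theta>"
    obtain z q' where q': "coprime z q'" "0 < q'" "q' \<le> int N" "\<bar>of_int q' * \<beta> - of_int z\<bar> < 1 / real N"
      using Dirichlet_approx_coprime[of N \<beta>] N1 by auto
    define q where "q = nat q'"
    have q: "1 \<le> q" "q \<le> N" "coprime z (int q)" "\<bar>real q * \<beta> - of_int z\<bar> < 1 / real N"
      using q' by (auto simp: q_def)
    have qG: "real q / real (Z * U) \<le> 1 / G"
    proof -
      have "real q \<le> real (Z * U) / G" using N_le q(2) by linarith
      then show ?thesis using Z U G by (simp add: field_simps)
    qed
    have qZU: "q \<le> 2 ^ ((n + 1) * r)"
    proof -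
      have "real (Z * U) / G \<le> real (Z * U) / 1" using G by (intro divide_left_mono) auto
      then have "real q \<le> real (Z * U)" using N_le q(2) by linarith
      then have "q \<le> Z * U" by (simp only: of_nat_le_iff)
      then show ?thesis using Z(3) by linarith
    qed
    define l where "l = 1 + ln (2 * real q)"
    have l: "l \<le> Cl * R" "l \<ge> 1"
    proof -
      show "l \<ge> 1" using q by (simp add: l_def)
      have "ln (2 * real q) \<le> (2 * real q) powr a / a" using q pos by (intro ln_powr_bound) auto
      also have "\<dots> \<le> (2 * 2 ^ ((n + 1) * r)) powr a / a"
      proof (intro divide_right_mono powr_mono2)
        show "2 * real q \<le> 2 * 2 ^ ((n + 1) * r)" using qZU by (simp add: numeral_power_le_of_nat_cancel_iff of_nat_le_numeral_power_cancel_iff)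
      qed (use pos in auto)
      also have "(2 * 2 ^ ((n + 1) * r)) powr a = 2 powr a * R"
      proof -
        have "(2 ^ ((n + 1) * r)) powr a = (2::real) powr (real ((n + 1) * r) * a)"
          by (simp add: powr_powr flip: powr_realpow)
        also have "real ((n + 1) * r) * a = \<epsilon> * real r / 2"
          unfolding a_def of_nat_mult by (rule cancel) simp
        finally show ?thesis by (simp add: powr_mult R_def)
      qed
      finally have "l \<le> 1 * R + 2 powr a / a * R" using R by (simp add: l_def)
      then show "l \<le> Cl * R" by (simp add: Cl_def distrib_right)
    qed
    have invq: "1 / real q \<le> Cq * R / G"
    proof -
      \<comment> \<open>\<open>m\<close> is the integer with \<beta> = m times the leading
        coefficient, so q \<beta> is a multiple of that coefficient by m q and cannot be close to an
        integer unless m q is large.\<close>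
      define m where "m = F * h * U"
      have mq1: "m * q \<ge> 1" using F h U q by (simp add: m_def)
      have eq: "real q * \<beta> = c (n + 2) * real (m * q)"
        by (simp add: \<beta>_def \<theta>_def m_def F_def algebra_simps)
      have "dni (c (n + 2) * real (m * q)) < 1 / real N"
        unfolding eq[symmetric] by (rule le_less_trans[OF dni_le q(4)])
      then have "c0 * real (m * q) powr (- (1 + \<eta>)) < 1 / real N" using c0(2)[OF mq1] by linarith
      then have "c0 / real (m * q) powr (1 + \<eta>) < 1 / real N" unfolding powr_minus_divide by simp
      then have "c0 * real N < real (m * q) powr (1 + \<eta>)"
        using N1 mq1 by (simp add: field_simps)
      also have "\<dots> = real (m * q) * real (m * q) powr \<eta>" using mq1 by (simp add: powr_add)
      also have "real (m * q) powr \<eta> \<le> (real F * 2 ^ ((n + 3) * r)) powr \<eta>"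
      proof (rule powr_mono2)
        have "h \<le> 2 ^ r" using h(2) by (simp add: of_nat_le_numeral_power_cancel_iff)
        then have "F * h * U * q \<le> F * 2 ^ r * 2 ^ r * 2 ^ ((n + 1) * r)"
          using Ur qZU by (intro mult_le_mono) auto
        also have "\<dots> = F * 2 ^ (r + r + (n + 1) * r)" by (simp only: power_add mult.assoc)
        also have "r + r + (n + 1) * r = (n + 3) * r" by (simp add: algebra_simps)
        finally have "real (m * q) \<le> real (F * 2 ^ ((n + 3) * r))" unfolding m_def by (rule of_nat_mono)
        then show "real (m * q) \<le> real F * 2 ^ ((n + 3) * r)" by simp
      qed (use pos in auto)
      also have "(real F * 2 ^ ((n + 3) * r)) powr \<eta> = real F powr \<eta> * R"
      proof -
        have "(2 ^ ((n + 3) * r)) powr \<eta> = (2::real) powr (real ((n + 3) * r) * \<eta>)"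
          by (simp add: powr_powr flip: powr_realpow)
        also have "real ((n + 3) * r) * \<eta> = \<epsilon> * real r / 2"
          unfolding \<eta>_def of_nat_mult by (rule cancel) simp
        finally show ?thesis by (simp add: powr_mult R_def)
      qed
      finally have 1: "c0 * real N \<le> real (m * q) * (real F powr \<eta> * R)"
        by (simp add: mult_left_mono)
      have "c0 * (real (Z * U) / G) \<le> c0 * (2 * real N)" using N_ge c0 by (intro mult_left_mono) auto
      also have "\<dots> \<le> 2 * (real (m * q) * (real F powr \<eta> * R))" using 1 by simp
      also have "\<dots> = 2 * real F powr (1 + \<eta>) * real h * real U * real q * R"
        using F by (simp add: m_def powr_add mult_ac)
      finally have "real U * (c0 * real Z / G) \<le> real U * (2 * real F powr (1 + \<eta>) * real h * real q * R)"
        by (simp add: mult_ac)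
      then have 2: "c0 * real Z / G \<le> 2 * real F powr (1 + \<eta>) * real h * real q * R"
        by (rule mult_left_le_imp_le) (use U in simp)
      have "real h * G ^ 2 \<le> real Z" using hG by (simp add: Z_def V_def U_def)
      then have "c0 * (real h * G ^ 2 / G) \<le> c0 * (real Z / G)"
        using c0 G by (intro mult_left_mono divide_right_mono) auto
      also have "\<dots> \<le> 2 * real F powr (1 + \<eta>) * real h * real q * R" using 2 by simp
      finally have "real h * (c0 * G) \<le> real h * (2 * real F powr (1 + \<eta>) * real q * R)"
        using G by (simp add: power2_eq_square mult_ac)
      then have "c0 * G \<le> 2 * real F powr (1 + \<eta>) * real q * R"
        by (rule mult_left_le_imp_le) (use h in simp)
      then have "G \<le> Cq * R * real q" using c0 by (simp add: Cq_def field_simps)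
      then show ?thesis using q G by (simp add: field_simps)
    qed
    define E where "E = (\<Sum>w\<in>nzint V. weyl_weight U n (\<theta> * of_int w))"
    have E: "E \<le> C3 * R ^ 2 / G * (real Z * real U)"
    proof -
      define Q where "Q = (\<Sum>z\<in>{1..Z}. rcap (real U) (\<beta> * real z))"
      have "E \<le> real n * (2 * \<tau>) ^ n * (2 * real V * (2 * real U) ^ n) +
        (2 * \<tau>) ^ n * (\<Sum>z\<in>nzint (V * U ^ n). rcap (real U) (fact (n + 1) * \<theta> * of_int z))"
        unfolding E_def by (rule sum_weyl_weight_le[OF U(1) \<tau>1 \<tau>])
      also have "(\<Sum>z\<in>nzint (V * U ^ n). rcap (real U) (fact (n + 1) * \<theta> * of_int z)) = 2 * Q"
        unfolding Q_def \<beta>_def Z_def[symmetric] by (rule sum_nzint_rcap)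
      also have "Q \<le> (3 * real Z / real q + 1) * (2 * real U + 4 * real q * l)"
        unfolding Q_def l_def by (rule sum_rcap_progression[OF q]) simp
      also have "\<dots> \<le> (6 * Cq + 18 * Cl) * R / G * (real Z * real U)"
      proof -
        have "(3 * real Z / real q + 1) * (2 * real U + 4 * real q * l) =
          (6 * (1 / real q) + l * (12 / real U) + 2 / real Z + 4 * l * (real q / real (Z * U))) * (real Z * real U)"
          using q U Z by (simp add: field_simps)
        also have "\<dots> \<le> (6 * (Cq * R / G) + l * (12 / G) + 2 * l / G + 4 * l * (1 / G)) * (real Z * real U)"
        proof (intro mult_right_mono add_mono mult_left_mono invq qG)
          show "12 / real U \<le> 12 / G" using U G by (intro divide_left_mono) auto
          have "G \<le> real Z" using U Z by linarith
          then show "2 / real Z \<le> 2 * l / G" using l G Z by (intro frac_le) auto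
        qed (use l in auto)
        also have "6 * (Cq * R / G) + l * (12 / G) + 2 * l / G + 4 * l * (1 / G) = 6 * Cq * R / G + 18 * l / G"
          using G by (simp add: field_simps)
        also have "\<dots> \<le> 6 * Cq * R / G + 18 * (Cl * R) / G"
          using l G by (intro add_left_mono divide_right_mono mult_left_mono) auto
        also have "\<dots> = (6 * Cq + 18 * Cl) * R / G" by (simp add: distrib_right add_divide_distrib)
        finally show ?thesis by (simp add: mult_right_mono)
      qed
      finally have "E \<le> real n * (2 * \<tau>) ^ n * (2 * real V * (2 * real U) ^ n) +
          (2 * \<tau>) ^ n * (2 * ((6 * Cq + 18 * Cl) * R / G * (real Z * real U)))"
        using \<tau>1 by (simp add: mult_left_mono)
      also have "real n * (2 * \<tau>) ^ n * (2 * real V * (2 * real U) ^ n) = (2 * \<tau>) ^ n * (real n * 2 ^ (n + 1) * real Z * 1)"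
        by (simp add: Z_def power_mult_distrib)
      also have "\<dots> \<le> (2 * \<tau>) ^ n * (real n * 2 ^ (n + 1) * real Z * (R * real U / G))"
      proof (intro mult_left_mono)
        have "1 * 1 \<le> R * (real U / G)" using R U G by (intro mult_mono) auto
        then show "1 \<le> R * real U / G" by simp
      qed (use \<tau>1 in auto)
      also have "(2 * \<tau>) ^ n * (real n * 2 ^ (n + 1) * real Z * (R * real U / G)) + (2 * \<tau>) ^ n * (2 * ((6 * Cq + 18 * Cl) * R / G * (real Z * real U))) =
        (2 * \<tau>) ^ n * ((real n * 2 ^ (n + 1) + 2 * (6 * Cq + 18 * Cl)) * R / G * (real Z * real U))"
        using G by (simp add: field_simps)
      also have "(2 * \<tau>) ^ n = 2 ^ n * Cd ^ n * R" by (simp add: power_mult_distrib \<tau>n)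
      finally show ?thesis by (simp add: C3_def power2_eq_square mult_ac)
    qed
    define D where "D = (SIGMA v:{..<V}. {..<V} - {v})"
    define off where "off = (\<Sum>(v, v')\<in>D. S v v')"
    have S0: "S v v' \<ge> 0" for v v' by (simp add: S_def)
    have finD: "finite D" by (simp add: D_def)
    have cardD: "real (card D) \<le> real V ^ 2"
    proof -
      have "card D \<le> card ({..<V} \<times> {..<V})" by (intro card_mono) (auto simp: D_def)
      then have "real (card D) \<le> real (V * V)" by (simp only: card_cartesian_product card_lessThan of_nat_le_iff)
      then show ?thesis by (simp add: power2_eq_square)
    qed
    \<comment> \<open>The diagonal v = v' is estimated trivially; relative to (U V)^2 it contributes
      1/V, the origin of the first term in the final bound.\<close>
    have T2: "T ^ 2 \<le> real U * (real V * real U + off)"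
    proof -
      have "T ^ 2 \<le> real U * (\<Sum>v<V. \<Sum>v'<V. S v v')"
        using twisted_sum_Cauchy_Schwarz[OF wt s, of \<phi>] by (simp add: T_def S_def U_def V_def)
      also have "(\<Sum>v<V. \<Sum>v'<V. S v v') = (\<Sum>v<V. S v v + (\<Sum>v'\<in>{..<V} - {v}. S v v'))"
        by (intro sum.cong refl) (simp add: sum.remove)
      also have "\<dots> = (\<Sum>v<V. S v v) + off"
        by (simp add: sum.distrib off_def D_def sum.Sigma)
      also have "(\<Sum>v<V. S v v) = real V * real U" by (simp add: S_def)
      finally show ?thesis .
    qed
    have off: "off ^ \<kappa> \<le> (real V ^ 2) ^ (\<kappa> - 1) * ((2 * real U) ^ (\<kappa> - (n + 1)) * (real V * E))"
    proof -
      have "off ^ \<kappa> \<le> real (card D) ^ (\<kappa> - 1) * (\<Sum>p\<in>D. (case p of (v, v') \<Rightarrow> S v v') ^ \<kappa>)"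
        unfolding off_def using \<kappa> S0 by (intro sum_power_le) auto
      also have "\<dots> \<le> (real V ^ 2) ^ (\<kappa> - 1) * (\<Sum>(v, v')\<in>D. (2 * real U) ^ (\<kappa> - (n + 1)) * weyl_weight U n (\<theta> * (real v - real v')))"
      proof (intro mult_mono power_mono cardD sum_mono)
        fix p assume "p \<in> D"
        show "(case p of (v, v') \<Rightarrow> S v v') ^ \<kappa> \<le> (case p of (v, v') \<Rightarrow> (2 * real U) ^ (\<kappa> - (n + 1)) * weyl_weight U n (\<theta> * (real v - real v')))"
          using block_difference_weyl[where U = U and h = h and n = n and c = c and v = "fst p" and v' = "snd p"]
          by (simp add: S_def \<phi>_def \<kappa>_def \<theta>_def case_prod_beta')
      qed (use S0 in \<open>auto intro!: sum_nonneg\<close>)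
      also have "(\<Sum>(v, v')\<in>D. (2 * real U) ^ (\<kappa> - (n + 1)) * weyl_weight U n (\<theta> * (real v - real v'))) =
        (2 * real U) ^ (\<kappa> - (n + 1)) * (\<Sum>v<V. \<Sum>v'\<in>{..<V} - {v}. weyl_weight U n (\<theta> * (real v - real v')))"
        by (simp add: D_def sum.Sigma sum_distrib_left case_prod_beta')
      also have "\<dots> \<le> (2 * real U) ^ (\<kappa> - (n + 1)) * (real V * E)"
        unfolding E_def using sum_differences_le[of "\<lambda>x. weyl_weight U n (\<theta> * x)" V]
        by (intro mult_left_mono) (auto simp: weyl_weight_nonneg)
      finally show ?thesis by (simp add: mult_left_mono)
    qed
    have "T ^ (2 * \<kappa>) = (T ^ 2) ^ \<kappa>" by (simp add: power_mult)
    also have "\<dots> \<le> (real U * (real V * real U + off)) ^ \<kappa>"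
      using T2 by (intro power_mono) auto
    also have "\<dots> = real U ^ \<kappa> * (real V * real U + off) ^ \<kappa>" by (simp add: power_mult_distrib)
    also have "\<dots> \<le> real U ^ \<kappa> * (2 ^ \<kappa> * ((real V * real U) ^ \<kappa> + off ^ \<kappa>))"
      by (intro mult_left_mono add_power_le) (auto simp: off_def intro!: sum_nonneg S0)
    also have "\<dots> \<le> real U ^ \<kappa> * (2 ^ \<kappa> * ((real V * real U) ^ \<kappa> +
        (real V ^ 2) ^ (\<kappa> - 1) * ((2 * real U) ^ (\<kappa> - (n + 1)) * (real V * (C3 * R ^ 2 / G * (real Z * real U))))))"
      using order.trans[OF off mult_left_mono[OF mult_left_mono[OF mult_left_mono[OF E, of "real V"], of "(2 * real U) ^ (\<kappa> - (n + 1))"], of "(real V ^ 2) ^ (\<kappa> - 1)"]]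
      by (intro mult_left_mono add_left_mono) auto
    also have "\<dots> = 2 ^ \<kappa> * ((real U * real V) ^ (2 * \<kappa>) * (1 / real V ^ \<kappa>) + 2 ^ (\<kappa> - (n + 1)) * C3 * ((real U * real V) ^ (2 * \<kappa>) * (R ^ 2 / G)))"
    proof -
      have 1: "real U ^ \<kappa> * (real V * real U) ^ \<kappa> = (real U * real V) ^ (2 * \<kappa>) * (1 / real V ^ \<kappa>)"
        using V by (simp add: power_mult_distrib mult_2 power_add)
      have "\<kappa> = (\<kappa> - (n + 1)) + n + 1" using \<kappa> by simp
      then have "real U ^ \<kappa> = real U ^ (\<kappa> - (n + 1)) * real U ^ n * real U"
        by (metis power_add power_one_right)
      then have Uk: "real U ^ (\<kappa> - (n + 1)) * (real U ^ n * real U) = real U ^ \<kappa>" by (simp add: mult.assoc)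
      have "2 * \<kappa> = 2 * (\<kappa> - 1) + 2" using \<kappa> by simp
      then have Vk: "(real V ^ 2) ^ (\<kappa> - 1) * (real V * real V) = real V ^ (2 * \<kappa>)"
        by (metis power_add power_mult power2_eq_square)
      have 2: "real U ^ \<kappa> * ((real V ^ 2) ^ (\<kappa> - 1) * ((2 * real U) ^ (\<kappa> - (n + 1)) * (real V * (C3 * R ^ 2 / G * (real Z * real U))))) =
        2 ^ (\<kappa> - (n + 1)) * C3 * ((real U * real V) ^ (2 * \<kappa>) * (R ^ 2 / G))"
      proof -
        have "real U ^ \<kappa> * ((real V ^ 2) ^ (\<kappa> - 1) * ((2 * real U) ^ (\<kappa> - (n + 1)) * (real V * (C3 * R ^ 2 / G * (real Z * real U))))) =
          2 ^ (\<kappa> - (n + 1)) * C3 * (real U ^ \<kappa> * (real U ^ (\<kappa> - (n + 1)) * (real U ^ n * real U)) * ((real V ^ 2) ^ (\<kappa> - 1) * (real V * real V)) * (R ^ 2 / G))"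
          by (simp add: Z_def power_mult_distrib mult_ac)
        also have "\<dots> = 2 ^ (\<kappa> - (n + 1)) * C3 * ((real U * real V) ^ (2 * \<kappa>) * (R ^ 2 / G))"
          unfolding Uk Vk by (simp add: power_mult_distrib mult_2 power_add)
        finally show ?thesis .
      qed
      have 3: "real U ^ \<kappa> * (2 ^ \<kappa> * (x + y)) = 2 ^ \<kappa> * (real U ^ \<kappa> * x + real U ^ \<kappa> * y)" for x y
        by (simp add: algebra_simps)
      show ?thesis unfolding 3 1 2 ..
    qed
    also have "real U * real V = 2 ^ r" using UV by (metis of_nat_mult of_nat_numeral of_nat_power)
    also have "R ^ 2 = 2 powr (\<epsilon> * real r)" by (simp add: R_def power2_eq_square flip: powr_add)
    also have "2 ^ \<kappa> * ((2 ^ r) ^ (2 * \<kappa>) * (1 / real V ^ \<kappa>) + 2 ^ (\<kappa> - (n + 1)) * C3 * ((2 ^ r) ^ (2 * \<kappa>) * (2 powr (\<epsilon> * real r) / G))) \<le>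
      C * (2 ^ r) ^ (2 * \<kappa>) * 2 powr (\<epsilon> * real r) * (1 / real V ^ \<kappa> + 1 / G)"
    proof -
      define x where "x = 1 / real V ^ \<kappa>"
      define y where "y = 2 powr (\<epsilon> * real r)"
      define k where "k = 2 ^ (\<kappa> - (n + 1)) * C3"
      define B where "B = (2 ^ \<kappa> :: real) * (2 ^ r) ^ (2 * \<kappa>)"
      have nn: "x \<ge> 0" "y \<ge> 1" "k \<ge> 0" "B \<ge> 0" "1 / G \<ge> 0"
        using C3 \<epsilon> G by (auto simp: x_def y_def k_def B_def intro!: ge_one_powr_ge_zero)
      have "x + k * (y / G) \<le> (1 + k) * (y * (x + 1 / G))"
      proof -
        have "1 * x \<le> y * x" using nn by (intro mult_right_mono) auto
        moreover have "(1 + k) * (y * (x + 1 / G)) = y * x + k * (y / G) + (y * (1 / G) + k * (y * x))"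
          by (simp add: algebra_simps add_divide_distrib)
        moreover have "0 \<le> y * (1 / G) + k * (y * x)" using nn by (intro add_nonneg_nonneg mult_nonneg_nonneg) auto
        ultimately show ?thesis by linarith
      qed
      then have "B * (x + k * (y / G)) \<le> B * ((1 + k) * (y * (x + 1 / G)))" using nn by (intro mult_left_mono)
      then show ?thesis by (simp add: B_def C_def x_def[symmetric] y_def[symmetric] k_def algebra_simps)
    qed
    finally show ?thesis by (simp add: T_def \<phi>_def V_def)
  qed
  then show thesis using that[OF C1] unfolding \<kappa>_def by blast
qed

section \<open>The Erdos-Turan inequality\<close>

text \<open>The sawtooth without the symmetric value 0 at the integers. With this convention the
  indicator of a half-open interval [a, b) minus its length is exactly a difference of two
  shifts.\<close>

definition saw :: "real \<Rightarrow> real" where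
  "saw x = frac x - 1 / 2"

lemma saw_bound: "\<bar>saw x\<bar> \<le> 1 / 2"
  unfolding saw_def abs_le_iff using frac_ge_0[of x] frac_lt_1[of x] by linarith

lemma saw_diff_one: "saw (x - 1) = saw x"
  using frac_add_of_int_right[of x "-1"] by (simp add: saw_def)

lemma saw_decrease: "0 \<le> t \<Longrightarrow> saw a - t \<le> saw (a - t)"
proof -
  assume "0 \<le> t"
  then have "\<lfloor>a - t\<rfloor> \<le> \<lfloor>a\<rfloor>" by (intro floor_mono) simp
  then show ?thesis by (simp add: saw_def frac_def)
qed

lemma dni_ge_min: "0 \<le> t \<Longrightarrow> t \<le> 1 \<Longrightarrow> min t (1 - t) \<le> dni t"
  unfolding dist_nearest_int_def by (cases "round t \<le> 0") auto

lemma dni_eq_abs: "\<bar>t\<bar> \<le> 1 / 2 \<Longrightarrow> dni t = \<bar>t\<bar>"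
proof (rule antisym[OF dni_le_abs])
  assume t: "\<bar>t\<bar> \<le> 1 / 2"
  have *: "\<bar>t\<bar> \<le> dni \<bar>t\<bar>" using dni_ge_min[of "\<bar>t\<bar>"] t by auto
  show "\<bar>t\<bar> \<le> dni t"
  proof (cases "t \<ge> 0")
    case False
    then show ?thesis using * dni_minus[of t] by simp
  qed (use * in simp)
qed

lemma sum_shift_periodic:
  fixes \<psi> :: "nat \<Rightarrow> 'a :: ab_group_add"
  assumes "\<psi> L = \<psi> 0"
  shows "(\<Sum>j<L. \<psi> (Suc j)) = (\<Sum>j<L. \<psi> j)"
proof -
  have "(\<Sum>j<L. \<psi> (Suc j)) + \<psi> 0 = (\<Sum>j<Suc L. \<psi> j)"
    by (simp only: sum.lessThan_Suc_shift add.commute)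
  then show ?thesis using assms by simp
qed

lemma saw_step:
  assumes j: "j < L"
  shows "saw (u - real (Suc j) / L) - saw (u - real j / L) = (if j = nat \<lfloor>real L * frac u\<rfloor> then 1 else 0) - 1 / L"
proof -
  define f where "f = frac u"
  have f: "0 \<le> f" "f < 1" by (auto simp: f_def frac_ge_0 frac_lt_1)
  have L: "real L > 0" using j by simp
  have fl: "\<lfloor>u - y\<rfloor> = \<lfloor>u\<rfloor> + (if y \<le> f then 0 else - 1)" if "0 \<le> y" "y \<le> 1" for y
  proof -
    have "u - y = (f - y) + of_int \<lfloor>u\<rfloor>" by (simp add: f_def frac_def)
    then have "\<lfloor>u - y\<rfloor> = \<lfloor>f - y\<rfloor> + \<lfloor>u\<rfloor>" by (metis floor_add_int)
    moreover have "\<lfloor>f - y\<rfloor> = (if y \<le> f then 0 else - 1)" using that f by (auto simp: floor_eq_iff)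
    ultimately show ?thesis by simp
  qed
  have 1: "real j / L \<le> 1" "real (Suc j) / L \<le> 1" using j L by auto
  have A: "real (Suc j) / L = real j / L + 1 / L" by (simp add: add_divide_distrib)
  have iff: "j = nat \<lfloor>real L * f\<rfloor> \<longleftrightarrow> real j / L \<le> f \<and> \<not> real (Suc j) / L \<le> f"
  proof -
    have "j = nat \<lfloor>real L * f\<rfloor> \<longleftrightarrow> \<lfloor>real L * f\<rfloor> = int j"
      using f L by (auto simp: nat_eq_iff)
    also have "\<dots> \<longleftrightarrow> real j \<le> real L * f \<and> real L * f < real j + 1" by (simp add: floor_eq_iff)
    also have "\<dots> \<longleftrightarrow> real j / L \<le> f \<and> \<not> real (Suc j) / L \<le> f"
      using L by (simp add: field_simps not_le)
    finally show ?thesis .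
  qed
  have AL: "1 / real L > 0" using L by simp
  have mono: "real j / L \<le> f" if "real (Suc j) / L \<le> f" using that A AL by linarith
  have fl0: "\<lfloor>u - real j / L\<rfloor> = \<lfloor>u\<rfloor> + (if real j / L \<le> f then 0 else - 1)"
    by (rule fl) (use 1 in auto)
  have fl1: "\<lfloor>u - real (Suc j) / L\<rfloor> = \<lfloor>u\<rfloor> + (if real (Suc j) / L \<le> f then 0 else - 1)"
    by (rule fl) (use 1 in auto)
  have "saw (u - real (Suc j) / L) - saw (u - real j / L) =
      real_of_int \<lfloor>u - real j / L\<rfloor> - real_of_int \<lfloor>u - real (Suc j) / L\<rfloor> - 1 / L"
    unfolding saw_def frac_def A by simp
  also have "real_of_int \<lfloor>u - real j / L\<rfloor> - real_of_int \<lfloor>u - real (Suc j) / L\<rfloor> =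
      (if j = nat \<lfloor>real L * f\<rfloor> then 1 else 0)"
    unfolding fl0 fl1 iff using mono by auto
  finally show ?thesis unfolding f_def .
qed

lemma sum_roots_of_unity:
  assumes h: "\<not> int L dvd h" and L: "L > 0"
  shows "(\<Sum>j<L. e (of_int h * real j / real L)) = 0" "e (of_int h / real L) \<noteq> 1"
proof -
  have pow: "(\<Sum>j<L. e (of_int h * real j / real L)) = (\<Sum>j<L. e (of_int h / real L) ^ j)"
    by (simp add: e_power mult.commute)
  show ne: "e (of_int h / real L) \<noteq> 1"
  proof
    assume "e (of_int h / real L) = 1"
    then obtain z :: int where "of_int h / real L = of_int z" by (auto dest!: e_eq_1D elim: Ints_cases)
    then have "real_of_int h = of_int (z * int L)" using L by (simp add: field_simps)
    then have "h = z * int L" using of_int_eq_iff by blast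
    then show False using h by simp
  qed
  have "e (of_int h / real L) ^ L = 1" using L by (simp add: e_power)
  then show "(\<Sum>j<L. e (of_int h * real j / real L)) = 0"
    unfolding pow using ne by (simp add: geometric_sum)
qed

text \<open>The finite Fourier transform of the sawtooth over the grid \<open>j / L\<close>, by summation by parts:
  the difference sequence is constant apart from one unit jump.\<close>

lemma saw_fourier:
  assumes h: "\<not> int L dvd h" and L: "L > 0"
  shows "(e (- (of_int h / real L)) - 1) * (\<Sum>j<L. e (of_int h * real j / real L) * saw (u - real j / real L)) =
    e (of_int h * real (nat \<lfloor>real L * frac u\<rfloor>) / real L)"
proof -
  let ?E = "\<lambda>j::nat. e (of_int h * real j / real L)"
  define \<phi> where "\<phi> j = saw (u - real j / real L)" for j :: nat
  define S where "S = (\<Sum>j<L. ?E j * \<phi> j)"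
  have per: "(\<Sum>j<L. ?E (Suc j) * \<phi> (Suc j)) = S"
    unfolding S_def
  proof (rule sum_shift_periodic)
    have "?E L = 1" using L by simp
    moreover have "\<phi> L = \<phi> 0" using L saw_diff_one[of u] by (simp add: \<phi>_def)
    ultimately show "?E L * \<phi> L = ?E 0 * \<phi> 0" by simp
  qed
  have E_Suc: "?E (Suc j) = e (of_int h / real L) * ?E j" for j
    by (simp add: e_add[symmetric] add_divide_distrib distrib_left)
  have "e (of_int h / real L) * (\<Sum>j<L. ?E j * \<phi> (Suc j)) = S"
    unfolding per[symmetric] sum_distrib_left by (intro sum.cong refl) (simp only: E_Suc mult.assoc)
  then have "e (- (of_int h / real L)) * S = (e (- (of_int h / real L)) * e (of_int h / real L)) * (\<Sum>j<L. ?E j * \<phi> (Suc j))"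
    by (simp only: mult.assoc)
  also have "e (- (of_int h / real L)) * e (of_int h / real L) = 1" by (simp flip: e_add)
  finally have "(e (- (of_int h / real L)) - 1) * S = (\<Sum>j<L. ?E j * \<phi> (Suc j)) - S"
    by (simp add: left_diff_distrib)
  also have "\<dots> = (\<Sum>j<L. ?E j * complex_of_real (\<phi> (Suc j) - \<phi> j))"
    by (simp add: S_def sum_subtractf right_diff_distrib)
  also have "\<dots> = (\<Sum>j<L. (if j = nat \<lfloor>real L * frac u\<rfloor> then ?E j else 0) - ?E j * complex_of_real (1 / L))"
    by (intro sum.cong refl) (use saw_step in \<open>auto simp: \<phi>_def right_diff_distrib\<close>)
  also have "\<dots> = (\<Sum>j<L. (if j = nat \<lfloor>real L * frac u\<rfloor> then ?E j else 0)) - (\<Sum>j<L. ?E j) * complex_of_real (1 / L)"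
    by (simp add: sum_subtractf sum_divide_distrib)
  also have "(\<Sum>j<L. (if j = nat \<lfloor>real L * frac u\<rfloor> then ?E j else 0)) = ?E (nat \<lfloor>real L * frac u\<rfloor>)"
  proof -
    have "nat \<lfloor>real L * frac u\<rfloor> < L"
    proof -
      have "real L * frac u < real L * 1" using L frac_lt_1[of u] by (intro mult_strict_left_mono) auto
      then have "\<lfloor>real L * frac u\<rfloor> < int L" by (simp add: floor_less_iff)
      then show ?thesis using frac_ge_0[of u] by (simp add: nat_less_iff)
    qed
    then show ?thesis by (simp add: sum.delta)
  qed
  also have "(\<Sum>j<L. ?E j) = 0" by (rule sum_roots_of_unity(1)[OF h L])
  finally show ?thesis by (simp add: S_def \<phi>_def)
qed

text \<open>The zeroth Fourier coefficient on the grid. Its exact value is L f - m - 1/2, with f the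
  fractional part of u and m the integer part of L f.\<close>

lemma saw_average:
  assumes L: "L > 0"
  shows "\<bar>\<Sum>j<L. saw (u - real j / real L)\<bar> \<le> 1"
proof -
  define m where "m = nat \<lfloor>real L * frac u\<rfloor>"
  define f where "f = frac u"
  have f: "0 \<le> f" "f < 1" by (auto simp: f_def frac_ge_0 frac_lt_1)
  have Lf: "0 \<le> real L * f" using L f by simp
  have mL: "m < L"
  proof -
    have "real L * f < real L * 1" using L f by (intro mult_strict_left_mono) auto
    then have "\<lfloor>real L * f\<rfloor> < int L" by (simp add: floor_less_iff)
    then show ?thesis using Lf by (simp add: m_def f_def nat_less_iff)
  qed
  have m: "real m \<le> real L * f" "real L * f < real m + 1"
    using Lf by (auto simp: m_def f_def)
  have saw: "saw (u - real j / real L) = f - real j / real L - 1 / 2 + (if j \<le> m then 0 else 1)" if "j < L" for j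
  proof -
    have "u - real j / real L = (f - real j / real L) + of_int \<lfloor>u\<rfloor>" by (simp add: f_def frac_def)
    then have "frac (u - real j / real L) = frac (f - real j / real L)" by (metis frac_add_of_int_right)
    moreover have "frac (f - real j / real L) = f - real j / real L + (if j \<le> m then 0 else 1)"
    proof (cases "j \<le> m")
      case True
      then have "real j \<le> real L * f" using m by linarith
      then have "real j / real L \<le> f" using L by (simp add: field_simps)
      moreover have "f - real j / real L < 1" using f by (smt (verit) divide_nonneg_nonneg of_nat_0_le_iff)
      ultimately show ?thesis using True by (simp add: frac_eq)
    next
      case False
      then have "real L * f < real j" using m by linarith
      then have "f - real j / real L < 0" using L by (simp add: field_simps)
      moreover have "real j / real L < 1" using that L by simp
      then have "f - real j / real L \<ge> - 1" using f by linarith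
      ultimately have "\<lfloor>f - real j / real L\<rfloor> = - 1" by (simp add: floor_eq_iff)
      then show ?thesis using False by (simp add: frac_def)
    qed
    ultimately show ?thesis by (simp add: saw_def)
  qed
  have "(\<Sum>j<L. saw (u - real j / real L)) = (\<Sum>j<L. f - 1 / 2 - real j / real L + (if j \<le> m then 0 else 1))"
    by (intro sum.cong refl) (simp add: saw)
  also have "\<dots> = real L * (f - 1 / 2) - (\<Sum>j<L. real j) / real L + (\<Sum>j<L. if j \<le> m then 0 else 1)"
    by (simp add: sum.distrib sum_subtractf sum_divide_distrib)
  also have "(\<Sum>j<L. real j) = real L * (real L - 1) / 2"
    by (induction L) (auto simp: field_simps)
  also have "(\<Sum>j<L. if j \<le> m then 0 else (1::real)) = real L - 1 - real m"
  proof -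
    have "(\<Sum>j<L. if j \<le> m then 0 else (1::real)) = (\<Sum>j\<in>{j \<in> {..<L}. \<not> j \<le> m}. 1)"
      by (subst sum.inter_filter) (auto intro!: sum.cong)
    also have "{j \<in> {..<L}. \<not> j \<le> m} = {m<..<L}" by auto
    finally show ?thesis using mL by (simp add: of_nat_diff)
  qed
  also have "real L * (real L - 1) / 2 / real L = (real L - 1) / 2" using L by simp
  finally have "(\<Sum>j<L. saw (u - real j / real L)) = real L * f - real m - 1 / 2"
    by (simp add: right_diff_distrib diff_divide_distrib)
  then show ?thesis using m by (simp add: abs_le_iff)
qed

section \<open>Averages of the sawtooth over a point set\<close>

context
  fixes M :: "'a set" and x :: "'a \<Rightarrow> real" and H :: nat and \<kappa> :: real
  assumes M: "finite M" "M \<noteq> {}" and H: "H \<ge> 1" and \<kappa>0: "\<kappa> \<ge> 0"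
    and \<kappa>: "\<And>h. 1 \<le> h \<Longrightarrow> h < H \<Longrightarrow> cmod (\<Sum>n\<in>M. e (real h * x n)) \<le> \<kappa> * real (card M)"
begin

text \<open>The relative count in [a, b) minus b - a equals \<open>gap b - gap a\<close>, so a
  uniform bound for \<open>gap\<close> suffices. Fourier analysis of \<open>gap\<close> takes place
  on grids y + j / L, which keeps every sum finite.\<close>

definition gap :: "real \<Rightarrow> real" where
  "gap y = (\<Sum>n\<in>M. saw (x n - y)) / real (card M)"

lemma card_M: "real (card M) > 0"
  using M by (simp add: card_gt_0_iff)

lemma gap_bound: "\<bar>gap y\<bar> \<le> 1 / 2"
proof -
  have "\<bar>\<Sum>n\<in>M. saw (x n - y)\<bar> \<le> (\<Sum>n\<in>M. 1 / 2)"
    by (intro order.trans[OF sum_abs] sum_mono saw_bound)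
  then show ?thesis using card_M by (simp add: gap_def field_simps)
qed

lemma gap_decrease: "0 \<le> t \<Longrightarrow> gap y - t \<le> gap (y + t)"
proof -
  assume t: "0 \<le> t"
  have "(\<Sum>n\<in>M. saw (x n - y) - t) \<le> (\<Sum>n\<in>M. saw (x n - (y + t)))"
    using saw_decrease[OF t] by (intro sum_mono) (simp add: diff_diff_add[symmetric])
  then have "(\<Sum>n\<in>M. saw (x n - y)) - real (card M) * t \<le> (\<Sum>n\<in>M. saw (x n - (y + t)))"
    by (simp add: sum_subtractf)
  then have "((\<Sum>n\<in>M. saw (x n - y)) - real (card M) * t) / real (card M) \<le> gap (y + t)"
    unfolding gap_def using card_M by (intro divide_right_mono) auto
  then show ?thesis using card_M by (simp add: gap_def diff_divide_distrib)
qed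

lemma \<kappa>_int:
  assumes "h \<noteq> 0" "\<bar>h\<bar> < int H"
  shows "cmod (\<Sum>n\<in>M. e (of_int h * x n)) \<le> \<kappa> * real (card M)"
proof (cases "h > 0")
  case True
  then show ?thesis using \<kappa>[of "nat h"] assms by simp
next
  case False
  have "(\<Sum>n\<in>M. e (of_int h * x n)) = cnj (\<Sum>n\<in>M. e (real (nat (- h)) * x n))"
    using False by (simp add: e_minus[symmetric])
  then have "cmod (\<Sum>n\<in>M. e (of_int h * x n)) = cmod (\<Sum>n\<in>M. e (real (nat (- h)) * x n))"
    by (simp only: complex_mod_cnj)
  then show ?thesis using \<kappa>[of "nat (- h)"] assms False by simp
qed

text \<open>By \<open>saw_fourier\<close> the coefficient is an average of e(h j_n / L), with j_n /
  L the grid point just below each point, divided by e(- h / L) - 1. Moving the points back from the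
  grid costs 2 pi |h| / L, and the divisor is at least 2 |h| / L in modulus because 2 H \<le>
  L.\<close>

lemma gap_fourier:
  assumes h: "h \<noteq> 0" "\<bar>h\<bar> < int H" and L: "2 * H \<le> L"
  shows "cmod (\<Sum>j<L. e (of_int h * real j / real L) * gap (y + real j / real L)) \<le>
    real L * (\<kappa> / (2 * \<bar>of_int h\<bar>) + pi / real L)"
proof -
  let ?h = "real_of_int h"
  have L0: "L > 0" using L H by simp
  have hL: "\<bar>?h\<bar> / real L \<le> 1 / 2"
  proof -
    have "2 * \<bar>h\<bar> \<le> int L" using h L by linarith
    then have "real_of_int (2 * \<bar>h\<bar>) \<le> real_of_int (int L)" by (rule of_int_le_iff[THEN iffD2])
    then show ?thesis using L0 by (simp add: field_simps)
  qed
  have nd: "\<not> int L dvd h"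
    using h L zdvd_imp_le[of "int L" "\<bar>h\<bar>"] by auto
  define j where "j n = nat \<lfloor>real L * frac (x n - y)\<rfloor>" for n
  define D where "D = e (- (?h / real L)) - 1"
  have D: "2 * \<bar>?h\<bar> / real L \<le> cmod D"
    using norm_e_minus_1[of "- (?h / real L)"] dni_eq_abs[of "?h / real L"] hL by (simp add: D_def)
  have near: "cmod (e (?h * real (j n) / real L) - e (?h * (x n - y))) \<le> 2 * pi * \<bar>?h\<bar> / real L" for n
  proof -
    define f where "f = frac (x n - y)"
    have "?h * (x n - y) = ?h * f + of_int (h * \<lfloor>x n - y\<rfloor>)" by (simp add: f_def frac_def algebra_simps)
    then have "e (?h * (x n - y)) = e (?h * f)" by (metis e_add_int)
    moreover have "e (?h * real (j n) / real L) = e (?h * f) * e (?h * (real (j n) / real L - f))"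
      by (simp add: right_diff_distrib flip: e_add)
    ultimately have "e (?h * real (j n) / real L) - e (?h * (x n - y)) = e (?h * f) * (e (?h * (real (j n) / real L - f)) - 1)"
      by (simp add: right_diff_distrib)
    then have "cmod (e (?h * real (j n) / real L) - e (?h * (x n - y))) \<le> 2 * pi * \<bar>?h * (real (j n) / real L - f)\<bar>"
      using norm_e_minus_1_le by (simp add: norm_mult)
    also have "\<bar>?h * (real (j n) / real L - f)\<bar> \<le> \<bar>?h\<bar> * (1 / real L)"
      unfolding abs_mult
    proof (intro mult_left_mono)
      have "0 \<le> real L * f" by (simp add: f_def)
      then have "real (j n) \<le> real L * f" "real L * f < real (j n) + 1" by (auto simp: j_def f_def)
      then have "\<bar>real (j n) - real L * f\<bar> \<le> 1" by linarith
      moreover have "real (j n) / real L - f = (real (j n) - real L * f) / real L" using L0 by (simp add: field_simps)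
      ultimately show "\<bar>real (j n) / real L - f\<bar> \<le> 1 / real L" using L0 by (simp add: abs_divide divide_right_mono)
    qed auto
    finally show ?thesis by (simp add: mult_left_mono)
  qed
  define S where "S = (\<Sum>j<L. e (?h * real j / real L) * gap (y + real j / real L))"
  have "D * S = (\<Sum>n\<in>M. D * (\<Sum>j<L. e (?h * real j / real L) * saw (x n - y - real j / real L))) / of_nat (card M)"
  proof -
    have "S = (\<Sum>j<L. \<Sum>n\<in>M. e (?h * real j / real L) * saw (x n - y - real j / real L)) / of_nat (card M)"
      by (simp add: S_def gap_def sum_divide_distrib sum_distrib_left diff_diff_add)
    also have "(\<Sum>j<L. \<Sum>n\<in>M. e (?h * real j / real L) * saw (x n - y - real j / real L)) =
      (\<Sum>n\<in>M. \<Sum>j<L. e (?h * real j / real L) * complex_of_real (saw (x n - y - real j / real L)))"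
      by (rule sum.swap)
    finally show ?thesis by (simp add: sum_distrib_left)
  qed
  also have "\<dots> = (\<Sum>n\<in>M. e (?h * real (j n) / real L)) / of_nat (card M)"
    unfolding D_def saw_fourier[OF nd L0] j_def ..
  finally have "cmod D * cmod S = cmod (\<Sum>n\<in>M. e (?h * real (j n) / real L)) / real (card M)"
    by (simp add: norm_mult[symmetric] norm_divide)
  also have "\<dots> \<le> (\<kappa> * real (card M) + real (card M) * (2 * pi * \<bar>?h\<bar> / real L)) / real (card M)"
  proof (intro divide_right_mono)
    have "(\<Sum>n\<in>M. e (?h * real (j n) / real L)) =
      (\<Sum>n\<in>M. e (?h * (x n - y))) + (\<Sum>n\<in>M. e (?h * real (j n) / real L) - e (?h * (x n - y)))"
      by (simp add: sum_subtractf)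
    then have tri: "cmod (\<Sum>n\<in>M. e (?h * real (j n) / real L)) \<le> cmod (\<Sum>n\<in>M. e (?h * (x n - y))) +
        cmod (\<Sum>n\<in>M. e (?h * real (j n) / real L) - e (?h * (x n - y)))"
      by (rule ord_eq_le_trans[OF arg_cong[where f = cmod] norm_triangle_ineq])
    have "(\<Sum>n\<in>M. e (?h * (x n - y))) = (\<Sum>n\<in>M. e (?h * x n)) * e (- (?h * y))"
      unfolding sum_distrib_right by (intro sum.cong refl) (simp add: right_diff_distrib flip: e_add)
    then have "cmod (\<Sum>n\<in>M. e (?h * (x n - y))) \<le> \<kappa> * real (card M)"
      using \<kappa>_int[OF h] by (simp add: norm_mult)
    moreover have "cmod (\<Sum>n\<in>M. e (?h * real (j n) / real L) - e (?h * (x n - y))) \<le> (\<Sum>n\<in>M. 2 * pi * \<bar>?h\<bar> / real L)"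
      by (intro order.trans[OF norm_sum] sum_mono near)
    ultimately show "cmod (\<Sum>n\<in>M. e (?h * real (j n) / real L)) \<le> \<kappa> * real (card M) + real (card M) * (2 * pi * \<bar>?h\<bar> / real L)"
      using tri by simp
  qed auto
  also have "\<dots> = \<kappa> + 2 * pi * \<bar>?h\<bar> / real L" using card_M by (simp add: add_divide_distrib)
  finally have DS: "cmod D * cmod S \<le> \<kappa> + 2 * pi * \<bar>?h\<bar> / real L" .
  have "(2 * \<bar>?h\<bar> / real L) * cmod S \<le> cmod D * cmod S" using D by (intro mult_right_mono) auto
  then have "(2 * \<bar>?h\<bar> / real L) * cmod S \<le> \<kappa> + 2 * pi * \<bar>?h\<bar> / real L" using DS by linarith
  then have "cmod S \<le> (\<kappa> + 2 * pi * \<bar>?h\<bar> / real L) / (2 * \<bar>?h\<bar> / real L)"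
    using h L0 by (subst pos_le_divide_eq) (auto simp: mult.commute)
  also have "\<dots> = real L * (\<kappa> / (2 * \<bar>?h\<bar>) + pi / real L)" using h L0 by (simp add: field_simps)
  finally show ?thesis by (simp add: S_def)
qed

section \<open>The Fejer kernel on a finite grid\<close>

definition fejer :: "real \<Rightarrow> real" where
  "fejer t = cmod (\<Sum>i<H. e (real i * t)) ^ 2 / real H"

lemma fejer_nonneg: "fejer t \<ge> 0"
  by (simp add: fejer_def)

lemma fejer_expand:
  "complex_of_real (fejer (s - c)) = (\<Sum>a<H. \<Sum>b<H. e (- ((real a - real b) * c)) * e ((real a - real b) * s)) / of_nat H"
proof -
  have "complex_of_real (cmod (\<Sum>i<H. e (real i * (s - c))) ^ 2) =
    (\<Sum>a<H. \<Sum>b<H. e (- ((real a - real b) * c)) * e ((real a - real b) * s))"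
    unfolding complex_norm_square cnj_sum sum_product
    by (intro sum.cong refl) (simp add: e_add[symmetric] e_minus[symmetric] algebra_simps)
  then show ?thesis by (simp add: fejer_def del: of_real_power)
qed

text \<open>Weighting by the kernel leaves only the frequencies a - b with absolute value below H,
  exactly those at which the exponential sums are assumed small.\<close>

lemma fejer_weighted:
  "complex_of_real (\<Sum>j<L. fejer (real j / real L - c) * g j) =
    (\<Sum>a<H. \<Sum>b<H. e (- ((real a - real b) * c)) * (\<Sum>j<L. e (of_int (int a - int b) * real j / real L) * g j)) / of_nat H"
proof -
  have "complex_of_real (\<Sum>j<L. fejer (real j / real L - c) * g j) =
    (\<Sum>j<L. (\<Sum>a<H. \<Sum>b<H. e (- ((real a - real b) * c)) * (e (of_int (int a - int b) * real j / real L) * g j))) / of_nat H"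
    unfolding of_real_sum of_real_mult fejer_expand sum_divide_distrib[of _ "{..<L}"] times_divide_eq_left sum_distrib_right mult.assoc
    by (intro sum.cong refl) simp
  also have "(\<Sum>j<L. (\<Sum>a<H. \<Sum>b<H. e (- ((real a - real b) * c)) * (e (of_int (int a - int b) * real j / real L) * g j))) =
    (\<Sum>a<H. \<Sum>b<H. e (- ((real a - real b) * c)) * (\<Sum>j<L. e (of_int (int a - int b) * real j / real L) * g j))"
    unfolding sum_distrib_left by (subst sum.swap) (rule sum.cong[OF refl], rule sum.swap)
  finally show ?thesis .
qed

lemma fejer_total:
  assumes "H \<le> L"
  shows "(\<Sum>j<L. fejer (real j / real L - c)) = real L"
proof -
  have L0: "L > 0" using assms H by simp
  have "(\<Sum>j<L. e (of_int (int a - int b) * real j / real L) * complex_of_real 1) = (if a = b then of_nat L else 0)"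
    if "a < H" "b < H" for a b
  proof (cases "a = b")
    case False
    then have "\<not> int L dvd (int a - int b)"
      using that assms zdvd_imp_le[of "int L" "\<bar>int a - int b\<bar>"] by auto
    then show ?thesis using False sum_roots_of_unity(1)[OF _ L0, of "int a - int b"] by simp
  qed simp
  then have "complex_of_real (\<Sum>j<L. fejer (real j / real L - c) * 1) =
      (\<Sum>a<H. \<Sum>b<H. e (- ((real a - real b) * c)) * (if a = b then of_nat L else 0)) / of_nat H"
    unfolding fejer_weighted by (intro arg_cong2[where f = "(/)"] sum.cong refl) auto
  also have "\<dots> = (\<Sum>a<H. of_nat L) / of_nat H"
    by (intro arg_cong2[where f = "(/)"] sum.cong refl) (simp add: if_distrib cong: if_cong)
  also have "\<dots> = of_nat L" using H by simp
  finally show ?thesis by (simp del: of_real_sum add: of_real_eq_iff[symmetric, where 'a = complex])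
qed

text \<open>For fixed a the frequencies a - b with b \<noteq> a contribute \<kappa> / (2 |a - b|),
  at most a harmonic sum over both sides. The diagonal is \<open>saw_average\<close>, and the
  discretisation errors are collected in 5 H / L.\<close>

lemma fejer_gap_le:
  assumes L: "2 * H \<le> L"
  shows "\<bar>\<Sum>j<L. fejer (real j / real L - c) * gap (y + real j / real L)\<bar> \<le> real L * (\<kappa> * (1 + ln (real H)) + 5 * real H / real L)"
proof -
  have L0: "real L > 0" using L H by simp
  let ?I = "\<lambda>a b. cmod (\<Sum>j<L. e (of_int (int a - int b) * real j / real L) * gap (y + real j / real L))"
  have diag: "?I a a \<le> 1" for a
  proof -
    have "(\<Sum>j<L. gap (y + real j / real L)) = (\<Sum>n\<in>M. \<Sum>j<L. saw (x n - y - real j / real L)) / real (card M)"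
      by (subst sum.swap) (simp add: gap_def sum_divide_distrib diff_diff_add)
    moreover have "\<bar>\<Sum>n\<in>M. \<Sum>j<L. saw (x n - y - real j / real L)\<bar> \<le> (\<Sum>n\<in>M. 1)"
      using L0 by (intro order.trans[OF sum_abs] sum_mono saw_average) auto
    ultimately have "\<bar>\<Sum>j<L. gap (y + real j / real L)\<bar> \<le> 1" using card_M by (simp add: abs_divide pos_divide_le_eq)
    then show ?thesis by (simp flip: of_real_sum)
  qed
  have row: "(\<Sum>b<H. ?I a b) \<le> 1 + real L * (\<kappa> * (1 + ln (real H)) + real H * pi / real L)" if a: "a < H" for a
  proof -
    have "(\<Sum>b<H. ?I a b) = ?I a a + (\<Sum>b\<in>{..<H} - {a}. ?I a b)" using a by (simp add: sum.remove)
    also have "(\<Sum>b\<in>{..<H} - {a}. ?I a b) \<le> (\<Sum>b\<in>{..<H} - {a}. real L * (\<kappa> / (2 * \<bar>real a - real b\<bar>) + pi / real L))"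
    proof (rule sum_mono)
      fix b assume b: "b \<in> {..<H} - {a}"
      show "?I a b \<le> real L * (\<kappa> / (2 * \<bar>real a - real b\<bar>) + pi / real L)"
        using gap_fourier[of "int a - int b" L y] a b L by auto
    qed
    also have "\<dots> = real L * (\<kappa> * (\<Sum>b\<in>{..<H} - {a}. 1 / (2 * \<bar>real a - real b\<bar>)) + real (card ({..<H} - {a})) * (pi / real L))"
      by (simp add: sum_distrib_left sum.distrib distrib_left)
    also have "\<dots> \<le> real L * (\<kappa> * (1 + ln (real H)) + real H * pi / real L)"
    proof (intro mult_left_mono add_mono)
      have "(\<Sum>b\<in>{..<H} - {a}. 1 / (2 * \<bar>real a - real b\<bar>)) = (\<Sum>b\<in>{..<a}. 1 / (2 * real (a - b))) + (\<Sum>b\<in>{a<..<H}. 1 / (2 * real (b - a)))"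
      proof -
        have un: "{..<H} - {a} = {..<a} \<union> {a<..<H}" using a by auto
        have "(\<Sum>b\<in>{..<H} - {a}. 1 / (2 * \<bar>real a - real b\<bar>)) = (\<Sum>b\<in>{..<a}. 1 / (2 * \<bar>real a - real b\<bar>)) + (\<Sum>b\<in>{a<..<H}. 1 / (2 * \<bar>real a - real b\<bar>))"
          unfolding un by (rule sum.union_disjoint) auto
        moreover have "(\<Sum>b\<in>{..<a}. 1 / (2 * \<bar>real a - real b\<bar>)) = (\<Sum>b\<in>{..<a}. 1 / (2 * real (a - b)))"
          by (intro sum.cong refl) (auto simp: of_nat_diff)
        moreover have "(\<Sum>b\<in>{a<..<H}. 1 / (2 * \<bar>real a - real b\<bar>)) = (\<Sum>b\<in>{a<..<H}. 1 / (2 * real (b - a)))"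
          by (intro sum.cong refl) (auto simp: of_nat_diff)
        ultimately show ?thesis by simp
      qed
      also have "(\<Sum>b\<in>{..<a}. 1 / (2 * real (a - b))) = (\<Sum>i\<in>{1..a}. 1 / (2 * real i))"
        by (rule sum.reindex_bij_witness[of _ "\<lambda>i. a - i" "\<lambda>b. a - b"]) auto
      also have "(\<Sum>b\<in>{a<..<H}. 1 / (2 * real (b - a))) = (\<Sum>i\<in>{1..<H - a}. 1 / (2 * real i))"
        by (rule sum.reindex_bij_witness[of _ "\<lambda>i. a + i" "\<lambda>b. b - a"]) auto
      also have "(\<Sum>i\<in>{1..a}. 1 / (2 * real i)) \<le> (\<Sum>i\<in>{1..H}. 1 / (2 * real i))"
        using a by (intro sum_mono2) auto
      also have "(\<Sum>i\<in>{1..<H - a}. 1 / (2 * real i)) \<le> (\<Sum>i\<in>{1..H}. 1 / (2 * real i))"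
        by (intro sum_mono2) auto
      also have "(\<Sum>i\<in>{1..H}. 1 / (2 * real i)) + (\<Sum>i\<in>{1..H}. 1 / (2 * real i)) = (\<Sum>i=1..H. 1 / real i)"
        by (simp add: sum.distrib[symmetric])
      also have "\<dots> \<le> 1 + ln (real H)" by (rule harm_le_ln[OF H])
      finally show "(\<Sum>b\<in>{..<H} - {a}. 1 / (2 * \<bar>real a - real b\<bar>)) \<le> 1 + ln (real H)"
        by simp
      have "real (card ({..<H} - {a})) \<le> real H" using a by simp
      then have "real (card ({..<H} - {a})) * (pi / real L) \<le> real H * (pi / real L)"
        using L0 by (intro mult_right_mono) auto
      then show "real (card ({..<H} - {a})) * (pi / real L) \<le> real H * pi / real L" by simp
    qed (use L0 \<kappa>0 in auto)
    finally show ?thesis using diag[of a] by linarith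
  qed
  have "\<bar>\<Sum>j<L. fejer (real j / real L - c) * gap (y + real j / real L)\<bar> =
    cmod (complex_of_real (\<Sum>j<L. fejer (real j / real L - c) * gap (y + real j / real L)))"
    by (simp only: norm_of_real)
  also have "\<dots> \<le> (\<Sum>a<H. \<Sum>b<H. ?I a b) / real H"
    unfolding fejer_weighted norm_divide norm_of_nat
    by (intro divide_right_mono order.trans[OF norm_sum] sum_mono) (simp_all add: norm_mult)
  also have "\<dots> \<le> (\<Sum>a<H. 1 + real L * (\<kappa> * (1 + ln (real H)) + real H * pi / real L)) / real H"
    by (intro divide_right_mono sum_mono row) auto
  also have "\<dots> = 1 + real L * (\<kappa> * (1 + ln (real H)) + real H * pi / real L)" using H by simp
  also have "\<dots> \<le> real L * (\<kappa> * (1 + ln (real H)) + 5 * real H / real L)"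
  proof -
    have "pi \<le> 4" using pi_approx(2) by simp
    then have "real H * pi \<le> real H * 4" by (intro mult_left_mono) auto
    then have "1 + real H * pi \<le> 5 * real H" using H by linarith
    then show ?thesis using L0 by (simp add: distrib_left)
  qed
  finally show ?thesis .
qed

lemma sum_inverse_squares: "g \<ge> 1 \<Longrightarrow> (\<Sum>i\<in>{g<..m}. 1 / real i ^ 2) \<le> 1 / real g"
proof (induction m)
  case (Suc m)
  have gen: "(\<Sum>i\<in>{g<..m}. 1 / real i ^ 2) \<le> 1 / real g - 1 / real m" if "g \<le> m" "g \<ge> 1" for g m
    using that
  proof (induction m rule: dec_induct)
    case (step m)
    have "{g<..Suc m} = insert (Suc m) {g<..m}" using step by auto
    then have "(\<Sum>i\<in>{g<..Suc m}. 1 / real i ^ 2) = 1 / real (Suc m) ^ 2 + (\<Sum>i\<in>{g<..m}. 1 / real i ^ 2)" by simp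
    moreover have "1 / real (Suc m) ^ 2 \<le> 1 / real m - 1 / real (Suc m)"
    proof -
      have "1 / real m - 1 / real (Suc m) = 1 / (real m * real (Suc m))" using step by (simp add: field_simps)
      moreover have "1 / real (Suc m) ^ 2 \<le> 1 / (real m * real (Suc m))"
        unfolding power2_eq_square using step by (intro divide_left_mono mult_right_mono) auto
      ultimately show ?thesis by simp
    qed
    ultimately show ?case using step by simp
  qed auto
  show ?case
  proof (cases "g \<le> Suc m")
    case True
    then show ?thesis using gen[OF True Suc.prems] by (smt (verit) divide_nonneg_nonneg of_nat_0_le_iff)
  qed (use Suc in auto)
qed auto

text \<open>The kernel is at most 1 / (H t^2) at distance t from the integers. Beyond g grid steps
  the inverse squares sum to at most 1/g on each side of the circle, and (L^2 / H) (2 / g) is L / 4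
  because g = 8 L / H.\<close>

lemma fejer_tail:
  assumes L: "L = H * l" and l: "l \<ge> 1" and g: "g = 8 * l"
  shows "(\<Sum>j | j < L \<and> 2 * g < j. fejer (real j / real L - real g / real L)) \<le> real L / 4"
proof -
  have L0: "real L > 0" using L l H by simp
  let ?J = "{j. j < L \<and> 2 * g < j}"
  have "(\<Sum>j\<in>?J. fejer (real j / real L - real g / real L)) \<le>
    (\<Sum>j\<in>?J. real L ^ 2 / real H * (1 / real (j - g) ^ 2 + 1 / real (L - (j - g)) ^ 2))"
  proof (rule sum_mono)
    fix j assume j: "j \<in> ?J"
    define i where "i = j - g"
    have i: "1 \<le> i" "i < L" using j by (auto simp: i_def)
    define t where "t = real i / real L"
    have t: "0 < t" "t < 1" using i L0 by (auto simp: t_def)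
    have tt: "real j / real L - real g / real L = t" using j by (simp add: t_def i_def of_nat_diff diff_divide_distrib)
    have m: "min t (1 - t) \<le> dni t" using dni_ge_min[of t] t by simp
    have "cmod (\<Sum>k<H. e (real k * t)) \<le> rcap (real H) t"
      using norm_sum_e_le[where c = 0, of t H] by (simp add: mult.commute)
    also have "\<dots> \<le> 1 / min t (1 - t)" by (rule rcap_le_inverse[OF _ m]) (use t in auto)
    finally have "cmod (\<Sum>k<H. e (real k * t)) ^ 2 \<le> (1 / min t (1 - t)) ^ 2" by (intro power_mono) auto
    also have "\<dots> \<le> 1 / t ^ 2 + 1 / (1 - t) ^ 2" by (auto simp: min_def power_divide)
    also have "1 / t ^ 2 = real L ^ 2 * (1 / real i ^ 2)" by (simp add: t_def power_divide)
    also have "1 - t = real (L - i) / real L" using i L0 by (simp add: t_def of_nat_diff field_simps)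
    finally have "cmod (\<Sum>k<H. e (real k * t)) ^ 2 \<le> real L ^ 2 * (1 / real i ^ 2 + 1 / real (L - i) ^ 2)"
      by (simp add: power_divide distrib_left)
    then have "cmod (\<Sum>k<H. e (real k * t)) ^ 2 / real H \<le> real L ^ 2 * (1 / real i ^ 2 + 1 / real (L - i) ^ 2) / real H"
      by (rule divide_right_mono) simp
    then show "fejer (real j / real L - real g / real L) \<le> real L ^ 2 / real H * (1 / real (j - g) ^ 2 + 1 / real (L - (j - g)) ^ 2)"
      unfolding tt fejer_def i_def by simp
  qed
  also have "\<dots> = real L ^ 2 / real H * ((\<Sum>j\<in>?J. 1 / real (j - g) ^ 2) + (\<Sum>j\<in>?J. 1 / real (L - (j - g)) ^ 2))"
    by (simp only: sum_distrib_left[symmetric] sum.distrib)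
  also have "\<dots> \<le> real L ^ 2 / real H * (1 / real g + 1 / real g)"
  proof (intro mult_left_mono add_mono)
    have g1: "g \<ge> 1" using g l by simp
    have "(\<Sum>j\<in>?J. 1 / real (j - g) ^ 2) = (\<Sum>i\<in>(\<lambda>j. j - g) ` ?J. 1 / real i ^ 2)"
      by (subst sum.reindex) (auto simp: inj_on_def)
    also have "\<dots> \<le> (\<Sum>i\<in>{g<..L}. 1 / real i ^ 2)" by (intro sum_mono2) auto
    also have "\<dots> \<le> 1 / real g" by (rule sum_inverse_squares[OF g1])
    finally show "(\<Sum>j\<in>?J. 1 / real (j - g) ^ 2) \<le> 1 / real g" .
    have "(\<Sum>j\<in>?J. 1 / real (L - (j - g)) ^ 2) = (\<Sum>i\<in>(\<lambda>j. L - (j - g)) ` ?J. 1 / real i ^ 2)"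
      by (subst sum.reindex) (auto simp: inj_on_def)
    also have "\<dots> \<le> (\<Sum>i\<in>{g<..L}. 1 / real i ^ 2)" by (intro sum_mono2) auto
    also have "\<dots> \<le> 1 / real g" by (rule sum_inverse_squares[OF g1])
    finally show "(\<Sum>j\<in>?J. 1 / real (L - (j - g)) ^ 2) \<le> 1 / real g" .
  qed auto
  also have "\<dots> = real L / 4"
    using l H by (simp add: g L field_simps power2_eq_square)
  finally show ?thesis .
qed

text \<open>As \<open>gap\<close> has slope \<open>- 1\<close> apart from upward jumps, an extreme value persists on an interval,
  where the Fejer kernel puts at least three quarters of its mass.\<close>

lemma gap_le: "\<bar>gap y\<bar> \<le> 26 / real H + 2 * \<kappa> * (1 + ln (real H))"
proof -
  \<comment> \<open>The supremum is bounded in terms of itself. It is finite by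
    \<open>gap_bound\<close>, which is what makes the final absorption legitimate.\<close>
  define B where "B = Sup (range (\<lambda>y. \<bar>gap y\<bar>))"
  have bdd: "bdd_above (range (\<lambda>y. \<bar>gap y\<bar>))" using gap_bound by (auto intro!: bdd_aboveI[of _ "1 / 2"])
  have B: "\<bar>gap y\<bar> \<le> B" for y unfolding B_def by (rule cSUP_upper[OF _ bdd]) simp
  have B0: "B \<ge> 0" using B[of 0] by linarith
  \<comment> \<open>This makes L = 5 H^2, so that the discretisation error 5 H / L is just 1 /
    H.\<close>
  define l where "l = 5 * H"
  define L where "L = H * l"
  define g where "g = 8 * l"
  define \<rho> where "\<rho> = real g / real L"
  have l: "l \<ge> 1" using H by (simp add: l_def)
  have L: "2 * H \<le> L" "H \<le> L" using H by (auto simp: L_def l_def)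
  have L0: "real L > 0" using L H by simp
  have \<rho>: "\<rho> = 8 / real H" using H l by (simp add: \<rho>_def g_def L_def)
  define \<Delta> where "\<Delta> = \<kappa> * (1 + ln (real H)) + 1 / real H"
  have "5 * real H / real L = 1 / real H" using H by (simp add: L_def l_def)
  then have \<Delta>: "\<bar>\<Sum>j<L. fejer (real j / real L - c) * gap (y + real j / real L)\<bar> \<le> real L * \<Delta>" for c y
    using fejer_gap_le[OF L(1), of c y] by (simp add: \<Delta>_def)
  let ?F = "\<lambda>j. fejer (real j / real L - \<rho>)"
  \<comment> \<open>If \<open>gap\<close>, up to sign, is at least \<gamma> on a window of 2 g grid
    steps, then the kernel centred in the window weighs \<gamma> with at least 3/4 of its mass and
    the lower bound - B with at most 1/4. The sign covers large positive and large negative values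
    together.\<close>
  have window: "3 / 4 * \<gamma> \<le> \<Delta> + B / 4"
    if win: "\<And>j. j < L \<Longrightarrow> j \<le> 2 * g \<Longrightarrow> \<gamma> \<le> sgn * gap (z + real j / real L)" and sgn: "sgn = 1 \<or> sgn = -1" for \<gamma> z sgn
  proof (cases "\<gamma> < - B")
    case True
    then have "\<gamma> \<le> 0" using B0 by simp
    moreover have "\<Delta> \<ge> 0" using \<kappa>0 H by (simp add: \<Delta>_def)
    ultimately show ?thesis using B0 by linarith
  next
    case False
    define \<tau> where "\<tau> = (\<Sum>j | j < L \<and> 2 * g < j. ?F j)"
    have \<tau>: "\<tau> \<le> real L / 4" unfolding \<tau>_def \<rho>_def by (rule fejer_tail[OF L_def l g_def])
    have split: "(\<Sum>j<L. f j) = (\<Sum>j | j < L \<and> \<not> 2 * g < j. f j) + (\<Sum>j | j < L \<and> 2 * g < j. f j)" for f :: "nat \<Rightarrow> real"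
    proof -
      have "{..<L} = {j. j < L \<and> \<not> 2 * g < j} \<union> {j. j < L \<and> 2 * g < j}" by auto
      then show ?thesis by (simp only:) (rule sum.union_disjoint, auto)
    qed
    have in_mass: "(\<Sum>j | j < L \<and> \<not> 2 * g < j. ?F j) = real L - \<tau>"
      using split[of ?F] fejer_total[OF L(2), of \<rho>] by (simp add: \<tau>_def)
    have "(\<Sum>j | j < L \<and> \<not> 2 * g < j. ?F j * \<gamma>) + (\<Sum>j | j < L \<and> 2 * g < j. ?F j * (- B)) \<le>
      (\<Sum>j | j < L \<and> \<not> 2 * g < j. ?F j * (sgn * gap (z + real j / real L))) +
      (\<Sum>j | j < L \<and> 2 * g < j. ?F j * (sgn * gap (z + real j / real L)))"
    proof (intro add_mono sum_mono mult_left_mono fejer_nonneg)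
      show "- B \<le> sgn * gap (z + real j / real L)" for j using B[of "z + real j / real L"] sgn by auto
    qed (use win in auto)
    also have "\<dots> = sgn * (\<Sum>j<L. ?F j * gap (z + real j / real L))"
      unfolding split[symmetric] by (simp add: sum_distrib_left mult_ac)
    also have "\<dots> \<le> real L * \<Delta>" using \<Delta>[of \<rho> z] sgn by auto
    finally have "(real L - \<tau>) * \<gamma> - \<tau> * B \<le> real L * \<Delta>"
      unfolding sum_distrib_right[symmetric] in_mass \<tau>_def[symmetric] by simp
    moreover have "\<tau> * (\<gamma> + B) \<le> real L / 4 * (\<gamma> + B)" using \<tau> False by (intro mult_right_mono) auto
    ultimately have "real L * (3 / 4 * \<gamma>) \<le> real L * (\<Delta> + B / 4)" by (simp add: algebra_simps)
    then show ?thesis using L0 by simp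
  qed
  have "\<bar>gap y\<bar> \<le> 2 * \<rho> + 4 / 3 * \<Delta> + B / 3" for y
  proof -
    have up: "3 / 4 * (gap y - 2 * \<rho>) \<le> \<Delta> + B / 4"
    proof (rule window[where sgn = 1 and z = y])
      fix j assume "j < L" "j \<le> 2 * g"
      then have "real j / real L \<le> 2 * \<rho>" using L0 by (simp add: \<rho>_def divide_right_mono)
      then show "gap y - 2 * \<rho> \<le> 1 * gap (y + real j / real L)"
        using gap_decrease[of "real j / real L" y] L0 by simp
    qed simp
    have down: "3 / 4 * (- gap y - 2 * \<rho>) \<le> \<Delta> + B / 4"
    proof (rule window[where sgn = "-1" and z = "y - 2 * \<rho>"])
      fix j assume "j < L" "j \<le> 2 * g"
      then have j: "real j / real L \<le> 2 * \<rho>" using L0 by (simp add: \<rho>_def divide_right_mono)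
      then have "gap (y - 2 * \<rho> + real j / real L) - (2 * \<rho> - real j / real L) \<le> gap (y - 2 * \<rho> + real j / real L + (2 * \<rho> - real j / real L))"
        by (intro gap_decrease) simp
      then have "gap (y - 2 * \<rho> + real j / real L) - (2 * \<rho> - real j / real L) \<le> gap y" by simp
      moreover have "0 \<le> real j / real L" using L0 by simp
      ultimately show "- gap y - 2 * \<rho> \<le> - 1 * gap (y - 2 * \<rho> + real j / real L)" by linarith
    qed simp
    have "gap y - 2 * \<rho> \<le> 4 / 3 * \<Delta> + B / 3" "- gap y - 2 * \<rho> \<le> 4 / 3 * \<Delta> + B / 3"
      using up down by (simp_all add: algebra_simps)
    then show ?thesis unfolding abs_le_iff by linarith
  qed
  \<comment> \<open>The coefficient 1/3 of B on the right lets the supremum be absorbed, with a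
    factor 3/2; 3 \<rho> = 24 / H then accounts for most of the constant 26.\<close>
  then have "B \<le> 2 * \<rho> + 4 / 3 * \<Delta> + B / 3" unfolding B_def by (intro cSUP_least) auto
  then have "B \<le> 3 * \<rho> + 2 * \<Delta>" by linarith
  also have "\<dots> = 26 / real H + 2 * \<kappa> * (1 + ln (real H))" by (simp add: \<rho> \<Delta>_def algebra_simps)
  finally show ?thesis using B[of y] by linarith
qed

section \<open>Counting points in intervals\<close>

lemma count_half_open:
  assumes "0 \<le> a" "a \<le> b" "b \<le> 1"
  shows "\<bar>real (card {n \<in> M. frac (x n) \<in> {a..<b}}) / real (card M) - (b - a)\<bar> \<le> 52 / real H + 4 * \<kappa> * (1 + ln (real H))"
proof -
  have pt: "(if frac (x n) \<in> {a..<b} then 1 else 0) - (b - a) = saw (x n - b) - saw (x n - a)" for n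
  proof -
    define f where "f = frac (x n)"
    have f: "0 \<le> f" "f < 1" by (auto simp: f_def frac_ge_0 frac_lt_1)
    have s: "frac (x n - y) = frac (f - y)" for y
    proof -
      have "x n - y = (f - y) + of_int \<lfloor>x n\<rfloor>" by (simp add: f_def frac_def)
      then show ?thesis by (metis frac_add_of_int_right)
    qed
    have fr: "frac (f - y) = (if y \<le> f then f - y else f - y + 1)" if "0 \<le> y" "y \<le> 1" for y
    proof (cases "y \<le> f")
      case True
      then show ?thesis using that f by (simp add: frac_eq)
    next
      case False
      then have "\<lfloor>f - y\<rfloor> = - 1" using that f by (simp add: floor_eq_iff)
      then show ?thesis using False by (simp add: frac_def)
    qed
    show ?thesis using assms fr[of a] fr[of b] f by (auto simp: saw_def s f_def[symmetric])
  qed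
  have "real (card {n \<in> M. frac (x n) \<in> {a..<b}}) = (\<Sum>n\<in>M. if frac (x n) \<in> {a..<b} then 1 else 0)"
    using M by (simp add: sum.If_cases Int_def)
  then have "real (card {n \<in> M. frac (x n) \<in> {a..<b}}) - real (card M) * (b - a) =
      (\<Sum>n\<in>M. (if frac (x n) \<in> {a..<b} then 1 else 0) - (b - a))"
    by (simp add: sum_subtractf)
  also have "\<dots> = (\<Sum>n\<in>M. saw (x n - b)) - (\<Sum>n\<in>M. saw (x n - a))"
    unfolding pt by (simp add: sum_subtractf)
  finally have "real (card {n \<in> M. frac (x n) \<in> {a..<b}}) / real (card M) - (b - a) = gap b - gap a"
    using card_M by (simp add: gap_def field_simps)
  then show ?thesis using gap_le[of a] gap_le[of b] by linarith
qed

text \<open>The interval is compared with half-open intervals between its infimum and supremum: one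
  enlarged by t on the right to include a possible right endpoint, one shortened by t on the left to
  exclude a possibly missing left endpoint. The bound for these is uniform, so t may tend to
  0.\<close>

theorem erdos_turan:
  assumes I: "is_interval I" "I \<subseteq> {0..<1}"
  shows "\<bar>real (card {n \<in> M. frac (x n) \<in> I}) / real (card M) - measure lborel I\<bar> \<le> 52 / real H + 4 * \<kappa> * (1 + ln (real H))"
proof (cases "I = {}")
  case True
  have "0 \<le> 52 / real H + 4 * \<kappa> * (1 + ln (real H))" using \<kappa>0 H by (intro add_nonneg_nonneg mult_nonneg_nonneg) auto
  then show ?thesis using True by simp
next
  case False
  define E where "E = 52 / real H + 4 * \<kappa> * (1 + ln (real H))"
  define a where "a = Inf I"
  define b where "b = Sup I"
  have bdd: "bdd_below I" "bdd_above I" using I(2) by (auto intro!: bdd_belowI[of _ 0] bdd_aboveI[of _ 1])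
  obtain z where z: "z \<in> I" using False by auto
  have a: "a \<le> y" and b: "y \<le> b" if "y \<in> I" for y
    using that bdd by (auto simp: a_def b_def intro: cInf_lower cSup_upper)
  have ab: "a \<le> b" "0 \<le> a" "b \<le> 1"
  proof -
    show "a \<le> b" using a[OF z] b[OF z] by linarith
    show "0 \<le> a" unfolding a_def using False I(2) by (intro cInf_greatest) auto
    show "b \<le> 1" unfolding b_def using False I(2) by (intro cSup_least) auto
  qed
  have inner: "y \<in> I" if y: "a < y" "y < b" for y
  proof -
    obtain u where u: "u \<in> I" "u < y" using y cInf_lessD[OF False, of y] by (auto simp: a_def)
    obtain w where w: "w \<in> I" "y < w" using y less_cSupD[OF False, of y] by (auto simp: b_def)
    show ?thesis using I(1) u w unfolding is_interval_1 by (meson less_imp_le)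
  qed
  have meas: "measure lborel I = b - a"
  proof -
    have sub: "{a<..<b} \<subseteq> I" "I \<subseteq> {a..b}" using inner a b by auto
    have Ib: "I \<in> sets lborel" using real_interval_borel_measurable[OF I(1)] by simp
    have "measure lborel {a<..<b} \<le> measure lborel I"
      by (rule measure_mono_fmeasurable[OF sub(1)]) (use Ib sub in \<open>auto intro!: fmeasurableI2[of "{a..b}"] fmeasurable_cbox[of a b, simplified]\<close>)
    moreover have "measure lborel I \<le> measure lborel {a..b}"
      by (rule measure_mono_fmeasurable[OF sub(2) Ib]) (use fmeasurable_cbox[of a b] in simp)
    ultimately show ?thesis using ab by simp
  qed
  have card_mono': "real (card {n \<in> M. frac (x n) \<in> A}) / real (card M) \<le> real (card {n \<in> M. frac (x n) \<in> B}) / real (card M)"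
    if "\<And>n. frac (x n) \<in> A \<Longrightarrow> frac (x n) \<in> B" for A B
    using M that by (intro divide_right_mono of_nat_mono card_mono) auto
  define X where "X = real (card {n \<in> M. frac (x n) \<in> I}) / real (card M)"
  have X0: "X \<ge> 0" by (simp add: X_def)
  have E0: "E \<ge> 0" unfolding E_def using \<kappa>0 H by (intro add_nonneg_nonneg mult_nonneg_nonneg) auto
  have upper: "X \<le> (b - a) + E + t" if t: "t > 0" for t
  proof -
    \<comment> \<open>Truncation at 1 keeps the enlarged interval within the range of
      \<open>count_half_open\<close> and omits no fractional part.\<close>
    define b' where "b' = min (b + t) 1"
    have b': "a \<le> b'" "b' \<le> 1" "b' \<le> b + t" using ab t by (auto simp: b'_def)
    have "X \<le> real (card {n \<in> M. frac (x n) \<in> {a..<b'}}) / real (card M)"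
      unfolding X_def
    proof (rule card_mono')
      fix n assume n: "frac (x n) \<in> I"
      then show "frac (x n) \<in> {a..<b'}" using a[OF n] b[OF n] t frac_lt_1[of "x n"] by (auto simp: b'_def)
    qed
    also have "\<dots> \<le> (b' - a) + E" using count_half_open[OF ab(2) b'(1,2)] by (simp add: E_def abs_le_iff)
    finally show ?thesis using b'(3) by linarith
  qed
  have lower: "(b - a) - E \<le> X + t" if t: "t > 0" for t
  proof (cases "a + t \<le> b")
    case False
    then show ?thesis using X0 E0 by linarith
  next
    case True
    have "real (card {n \<in> M. frac (x n) \<in> {a + t..<b}}) / real (card M) \<le> X"
      unfolding X_def by (rule card_mono') (use t inner in auto)
    moreover have "(b - (a + t)) - E \<le> real (card {n \<in> M. frac (x n) \<in> {a + t..<b}}) / real (card M)"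
      using count_half_open[OF _ True ab(3)] ab t by (simp add: E_def abs_le_iff)
    ultimately show ?thesis by linarith
  qed
  have "X \<le> (b - a) + E" using upper by (rule field_le_epsilon)
  moreover have "(b - a) - E \<le> X" using lower by (rule field_le_epsilon)
  ultimately show ?thesis unfolding meas X_def[symmetric] E_def[symmetric] by (simp add: abs_le_iff)
qed

end

theorem discrepancy_le:
  assumes "finite M" "M \<noteq> {}" "H \<ge> 1" "\<kappa> \<ge> 0"
    and "\<And>h. 1 \<le> h \<Longrightarrow> h < H \<Longrightarrow> cmod (\<Sum>n\<in>M. e (real h * x n)) \<le> \<kappa> * real (card M)"
  shows "discrepancy x M \<le> 52 / real H + 4 * \<kappa> * (1 + ln (real H))"
  unfolding discrepancy_def
proof (rule cSUP_least)
  have "{} \<in> {I :: real set. is_interval I \<and> I \<subseteq> {0..<1}}" by simp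
  then show "{I :: real set. is_interval I \<and> I \<subseteq> {0..<1}} \<noteq> {}" by blast
qed (use erdos_turan[OF assms] in auto)

section \<open>Sums over digit classes\<close>

lemma binary_digit_sum_eq:
  assumes "n < 2 ^ N"
  shows "binary_digit_sum n = (\<Sum>i<N. n div 2 ^ i mod 2)"
proof -
  have zero: "n div 2 ^ i = 0" if "n < 2 ^ K" "K \<le> i" for i K
  proof -
    have "n < 2 ^ i" using that by (meson less_le_trans one_le_numeral power_increasing)
    then show ?thesis by simp
  qed
  have "(\<Sum>i<K. n div 2 ^ i mod 2) = (\<Sum>i<max n N. n div 2 ^ i mod 2)" if "K \<le> max n N" "n < 2 ^ K" for K
    using that zero[OF that(2)] by (intro sum.mono_neutral_left) auto
  from this[of n] this[of N] assms show ?thesis by (simp add: binary_digit_sum_def)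
qed

lemma binary_digit_sum_add:
  assumes u: "u < 2 ^ s"
  shows "binary_digit_sum (u + 2 ^ s * v) = binary_digit_sum u + binary_digit_sum v"
proof -
  have v: "v < 2 ^ v" by (rule less_exp)
  have "u + 2 ^ s * v < 2 ^ s * (v + 1)" using u by simp
  also have "\<dots> \<le> 2 ^ s * 2 ^ v" using v by (intro mult_left_mono) (simp_all add: Suc_le_eq)
  finally have lt: "u + 2 ^ s * v < 2 ^ (s + v)" by (simp add: power_add)
  have low: "(u + 2 ^ s * v) div 2 ^ i mod 2 = u div 2 ^ i mod 2" if "i < s" for i
  proof -
    have "s = i + Suc (s - Suc i)" using that by simp
    then have "(2::nat) ^ s = 2 ^ i * (2 * 2 ^ (s - Suc i))" by (metis power_add power_Suc)
    then have eq: "u + 2 ^ s * v = u + 2 ^ i * (2 * (2 ^ (s - Suc i) * v))" by (simp only: mult.assoc)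
    show ?thesis by (subst eq) simp
  qed
  have high: "(u + 2 ^ s * v) div 2 ^ (s + i) = v div 2 ^ i" for i
    using u by (simp add: power_add div_mult2_eq)
  have "binary_digit_sum (u + 2 ^ s * v) = (\<Sum>i<s + v. (u + 2 ^ s * v) div 2 ^ i mod 2)"
    by (rule binary_digit_sum_eq[OF lt])
  also have "\<dots> = (\<Sum>i<s. (u + 2 ^ s * v) div 2 ^ i mod 2) + (\<Sum>i<v. (u + 2 ^ s * v) div 2 ^ (s + i) mod 2)"
    by (induction v rule: nat.induct[where P = "\<lambda>t. (\<Sum>i<s + t. f i) = (\<Sum>i<s. f i) + (\<Sum>i<t. f (s + i))" for f :: "nat \<Rightarrow> nat"]) simp_all
  also have "\<dots> = (\<Sum>i<s. u div 2 ^ i mod 2) + (\<Sum>i<v. v div 2 ^ i mod 2)"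
    using low high by (intro arg_cong2[where f = "(+)"] sum.cong) auto
  finally show ?thesis using binary_digit_sum_eq[OF u] binary_digit_sum_eq[OF v] by simp
qed

lemma digit_mult_power: "cmod z = 1 \<Longrightarrow> digit_mult (\<lambda>n. z ^ binary_digit_sum n)"
  by (simp add: digit_mult_def norm_power binary_digit_sum_add power_add)

lemma sum_power_digit_sum:
  fixes z :: complex
  shows "(\<Sum>n<2 ^ r. z ^ binary_digit_sum n) = (1 + z) ^ r"
proof (induction r)
  case 0
  show ?case by (simp add: binary_digit_sum_def)
next
  case (Suc r)
  have one: "binary_digit_sum (Suc 0) = 1" by (simp add: binary_digit_sum_def)
  have "{..<(2::nat) ^ Suc r} = {..<2 ^ r} \<union> (\<lambda>u. u + 2 ^ r * 1) ` {..<2 ^ r}"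
  proof (intro set_eqI iffI)
    fix n :: nat
    assume n: "n \<in> {..<2 ^ Suc r}"
    show "n \<in> {..<2 ^ r} \<union> (\<lambda>u. u + 2 ^ r * 1) ` {..<2 ^ r}"
    proof (cases "n < 2 ^ r")
      case False
      then have "n = (n - 2 ^ r) + 2 ^ r * 1" "n - 2 ^ r < 2 ^ r" using n by auto
      then show ?thesis by blast
    qed simp
  qed auto
  then have "(\<Sum>n<2 ^ Suc r. z ^ binary_digit_sum n) =
      (\<Sum>n<2 ^ r. z ^ binary_digit_sum n) + (\<Sum>n\<in>(\<lambda>u. u + 2 ^ r * 1) ` {..<2 ^ r}. z ^ binary_digit_sum n)"
    by (simp only:) (rule sum.union_disjoint, auto)
  also have "(\<Sum>n\<in>(\<lambda>u. u + 2 ^ r * 1) ` {..<2 ^ r}. z ^ binary_digit_sum n) =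
      (\<Sum>u<2 ^ r. z ^ binary_digit_sum (u + 2 ^ r * 1))"
    by (subst sum.reindex) (auto simp: inj_on_def)
  also have "\<dots> = (\<Sum>u<2 ^ r. z ^ binary_digit_sum u) * z"
    unfolding sum_distrib_right by (intro sum.cong refl) (subst binary_digit_sum_add, auto simp: one power_add)
  finally show ?case by (simp only: Suc.IH) (simp add: algebra_simps)
qed

lemma digit_sum_class_subset: "digit_sum_class k m r \<subseteq> {..<2 ^ r}"
  by (auto simp: digit_sum_class_def)

lemma finite_digit_sum_class [simp]: "finite (digit_sum_class k m r)"
  by (rule finite_subset[OF digit_sum_class_subset]) simp

lemma sum_digit_sum_class:
  assumes m: "m > 0"
  shows "(\<Sum>n\<in>digit_sum_class k m r. g n) =
    (\<Sum>j<m. e (- (real j * real k / real m)) * (\<Sum>n<2 ^ r. e (real j / real m) ^ binary_digit_sum n * g n)) / of_nat m"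
proof -
  have ind: "(\<Sum>j<m. e (- (real j * real k / real m)) * e (real j / real m) ^ binary_digit_sum n) / of_nat m =
      (if [binary_digit_sum n = k] (mod m) then 1 else 0)" for n
  proof -
    define h where "h = int (binary_digit_sum n) - int k"
    have "(\<Sum>j<m. e (- (real j * real k / real m)) * e (real j / real m) ^ binary_digit_sum n) =
        (\<Sum>j<m. e (of_int h * real j / real m))"
      by (intro sum.cong refl)
        (simp add: h_def e_power diff_divide_distrib right_diff_distrib mult.commute flip: e_add)
    moreover have "[binary_digit_sum n = k] (mod m) \<longleftrightarrow> int m dvd h"
      by (simp add: h_def cong_iff_dvd_diff flip: cong_int_iff)
    moreover have "(\<Sum>j<m. e (of_int h * real j / real m)) = of_nat m" if dvd: "int m dvd h"
    proof -
      obtain q where q: "h = int m * q" using dvd by blast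
      have "e (of_int h * real j / real m) = 1" for j
      proof -
        have "of_int h * real j / real m = of_int (q * int j)" using m by (simp add: q)
        then show ?thesis by (metis e_of_int)
      qed
      then show ?thesis by simp
    qed
    ultimately show ?thesis using m sum_roots_of_unity(1)[of m h] by auto
  qed
  have "(\<Sum>n\<in>digit_sum_class k m r. g n) = (\<Sum>n<2 ^ r. (if [binary_digit_sum n = k] (mod m) then 1 else 0) * g n)"
    by (rule sum.mono_neutral_cong_left) (auto simp: digit_sum_class_def)
  also have "\<dots> = (\<Sum>n<2 ^ r. \<Sum>j<m. e (- (real j * real k / real m)) * (e (real j / real m) ^ binary_digit_sum n * g n)) / of_nat m"
    unfolding ind[symmetric] sum_divide_distrib[of _ "{..<2 ^ r}"] times_divide_eq_left sum_distrib_right mult.assoc ..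
  also have "\<dots> = (\<Sum>j<m. e (- (real j * real k / real m)) * (\<Sum>n<2 ^ r. e (real j / real m) ^ binary_digit_sum n * g n)) / of_nat m"
    by (subst sum.swap) (simp add: sum_distrib_left)
  finally show ?thesis .
qed

lemma norm_sum_digit_sum_class_le:
  assumes m: "m > 0" and B: "\<And>wt. digit_mult wt \<Longrightarrow> cmod (\<Sum>n<2 ^ r. wt n * g n) \<le> B"
  shows "cmod (\<Sum>n\<in>digit_sum_class k m r. g n) \<le> B"
proof -
  have "cmod (\<Sum>n\<in>digit_sum_class k m r. g n) \<le> (\<Sum>j<m. B) / real m"
    unfolding sum_digit_sum_class[OF m, of g k r] norm_divide norm_of_nat
    by (intro divide_right_mono order.trans[OF norm_sum] sum_mono) (simp_all add: norm_mult B digit_mult_power)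
  then show ?thesis using m by simp
qed

lemma norm_one_plus_less:
  assumes "cmod w = 1" "w \<noteq> 1"
  shows "cmod (1 + w) < 2"
proof (rule ccontr)
  assume "\<not> cmod (1 + w) < 2"
  moreover have "cmod (1 + w) \<le> cmod 1 + cmod w" by (rule norm_triangle_ineq)
  ultimately have "norm (1 + w) = norm (1::complex) + norm w" using assms by simp
  then have "norm (1::complex) *\<^sub>R w = norm w *\<^sub>R 1" by (simp only: norm_triangle_eq)
  then show False using assms by (simp add: scaleR_conv_of_real)
qed

text \<open>The nontrivial characters contribute powers (1 + e(j / m))^r with base below 2 in
  modulus, so the size is 2^r / m up to an exponentially smaller error, uniformly in k. Half of the
  main term is kept. The inserted 0 in \<open>\<rho>\<close> covers m = 1, where there is no such
  character.\<close>

lemma card_digit_sum_class_ge: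
  assumes m: "m > 0"
  shows "eventually (\<lambda>r. \<forall>k. 2 ^ r / (2 * real m) \<le> real (card (digit_sum_class k m r))) sequentially"
proof -
  define \<rho> where "\<rho> = Max (insert 0 ((\<lambda>j. cmod (1 + e (real j / real m))) ` {1..<m}))"
  have \<rho>_ge: "cmod (1 + e (real j / real m)) \<le> \<rho>" if "1 \<le> j" "j < m" for j
    unfolding \<rho>_def using that by (intro Max_ge) auto
  have \<rho>: "0 \<le> \<rho>" "\<rho> < 2"
  proof -
    show "0 \<le> \<rho>" unfolding \<rho>_def by (intro Max_ge) auto
    have "cmod (1 + e (real j / real m)) < 2" if "j \<in> {1..<m}" for j
      using that sum_roots_of_unity(2)[of m "int j"] m zdvd_imp_le[of "int m" "int j"]
      by (intro norm_one_plus_less) auto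
    then show "\<rho> < 2" unfolding \<rho>_def by (subst Max_less_iff) auto
  qed
  have "(\<lambda>r. (\<rho> / 2) ^ r) \<longlonglongrightarrow> 0"
    using \<rho> by (intro LIMSEQ_realpow_zero) auto
  then have "eventually (\<lambda>r. (\<rho> / 2) ^ r < 1 / (2 * real m)) sequentially"
    using m by (intro order_tendstoD) auto
  then show ?thesis
  proof eventually_elim
    case (elim r)
    show ?case
    proof
      fix k
      let ?t = "\<lambda>j. e (- (real j * real k / real m)) * (1 + e (real j / real m)) ^ r"
      have "of_nat (card (digit_sum_class k m r)) = (\<Sum>j<m. ?t j) / of_nat m"
        using sum_digit_sum_class[OF m, of "\<lambda>_. 1" k r] by (simp add: sum_power_digit_sum)
      also have "{..<m} = insert 0 {1..<m}" using m by auto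
      also have "(\<Sum>j\<in>insert 0 {1..<m}. ?t j) = 2 ^ r + (\<Sum>j\<in>{1..<m}. ?t j)"
        by (subst sum.insert) auto
      finally have "complex_of_real (real m * real (card (digit_sum_class k m r)) - 2 ^ r) = (\<Sum>j\<in>{1..<m}. ?t j)"
        using m by simp
      then have "\<bar>real m * real (card (digit_sum_class k m r)) - 2 ^ r\<bar> = cmod (\<Sum>j\<in>{1..<m}. ?t j)"
        by (metis norm_of_real)
      also have "\<dots> \<le> (\<Sum>j\<in>{1..<m}. \<rho> ^ r)"
        using \<rho>_ge by (intro order.trans[OF norm_sum] sum_mono) (auto simp: norm_mult norm_power intro!: power_mono)
      also have "\<dots> \<le> real m * \<rho> ^ r" using \<rho>(1) by (simp add: mult_right_mono)
      also have "\<dots> \<le> 2 ^ r / 2"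
        using elim m by (simp add: power_divide field_simps)
      finally have "2 ^ r / 2 \<le> real m * real (card (digit_sum_class k m r))" by linarith
      then show "2 ^ r / (2 * real m) \<le> real (card (digit_sum_class k m r))" using m by (simp add: field_simps)
    qed
  qed
qed

section \<open>The Diophantine type\<close>

text \<open>The exponent 1 + \<eta> exceeds the supremum, so the corresponding limes inferior is not
  0 and, being nonnegative, is positive. This gives a constant for all large q; for the remaining q
  the distance is positive by irrationality.\<close>

lemma badly_approx_type_of_diophantine_type:
  assumes irr: "\<alpha> \<notin> \<rat>" and ty: "diophantine_type \<alpha> = 1"
  shows "badly_approx_type \<alpha>"
  unfolding badly_approx_type_def
proof (intro allI impI)
  fix \<eta> :: real
  assume \<eta>: "\<eta> > 0"
  define F where "F q = real q powr (1 + \<eta>) * dni (\<alpha> * real q)" for q :: nat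
  have dni0: "dni x \<ge> 0" for x by (simp add: dist_nearest_int_def)
  have pos: "F q > 0" if "q \<ge> 1" for q
  proof -
    have "dni (\<alpha> * real q) \<noteq> 0"
    proof
      assume "dni (\<alpha> * real q) = 0"
      then have "\<alpha> = of_int (round (\<alpha> * real q)) / of_nat q"
        using that by (simp add: dist_nearest_int_def field_simps)
      then show False using irr by (metis Rats_divide Rats_of_int Rats_of_nat)
    qed
    then show ?thesis using dni0[of "\<alpha> * real q"] that by (simp add: F_def less_le)
  qed
  have ne: "liminf (\<lambda>q. ereal (F q)) \<noteq> 0"
  proof
    assume "liminf (\<lambda>q. ereal (F q)) = 0"
    then have "ereal (1 + \<eta>) \<le> diophantine_type \<alpha>"
      unfolding diophantine_type_def F_def by (intro Sup_upper imageI) simp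
    then show False using ty \<eta> by (simp add: one_ereal_def)
  qed
  have "0 \<le> liminf (\<lambda>q. ereal (F q))"
    by (rule Liminf_bounded) (auto simp: F_def dni0)
  then have "0 < liminf (\<lambda>q. ereal (F q))" using ne by (simp add: less_le)
  then obtain c0 where c0: "0 < ereal c0" "ereal c0 < liminf (\<lambda>q. ereal (F q))"
    using ereal_dense2 by blast
  then obtain N where N: "\<And>q. q \<ge> N \<Longrightarrow> c0 < F q"
    using less_LiminfD[OF c0(2)] by (auto simp: eventually_sequentially)
  define c where "c = Min (insert c0 (F ` {1..N}))"
  have c: "c > 0" unfolding c_def using c0(1) pos by (subst Min_gr_iff) auto
  have "c \<le> F q" if "q \<ge> 1" for q
  proof (cases "q \<le> N")
    case True
    then show ?thesis unfolding c_def using that by (intro Min_le) auto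
  next
    case False
    have "c \<le> c0" unfolding c_def by (intro Min_le) auto
    then show ?thesis using N[of q] False by linarith
  qed
  then have "c * real q powr (- (1 + \<eta>)) \<le> dni (\<alpha> * real q)" if "q \<ge> 1" for q
    using that unfolding F_def powr_minus_divide by (simp add: pos_divide_le_eq mult.commute)
  then show "\<exists>c>0. \<forall>q\<ge>1. c * real q powr (- (1 + \<eta>)) \<le> dni (\<alpha> * real q)" using c by blast
qed

section \<open>Exponents\<close>

lemma le_of_power_le:
  assumes N: "N > 0" and C: "C \<ge> 1" and a: "0 \<le> a" and le: "a ^ N \<le> C * 2 powr (real N * \<beta>)"
  shows "a \<le> C * 2 powr \<beta>"
proof -
  have "C = C ^ 1" by simp
  also have "\<dots> \<le> C ^ N" using N C by (intro power_increasing) auto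
  finally have "C * 2 powr (real N * \<beta>) \<le> C ^ N * (2 powr \<beta>) ^ N"
    by (simp add: powr_power mult.commute)
  then have "a ^ N \<le> (C * 2 powr \<beta>) ^ N" using le by (simp add: power_mult_distrib)
  then show ?thesis using C N by (intro power_le_imp_le_base[of a "N - 1"]) auto
qed

text \<open>The input for the discrepancy bound with about 2^(\<nu> r) frequencies. The threshold
  for r must be uniform in the weights and in h, hence their place inside
  \<open>eventually\<close>.\<close>

definition twisted_sums_le :: "(nat \<Rightarrow> real) \<Rightarrow> nat \<Rightarrow> real \<Rightarrow> bool" where
  "twisted_sums_le c d \<nu> \<longleftrightarrow> (\<forall>\<epsilon>>0. eventually (\<lambda>r. \<forall>wt h. digit_mult wt \<longrightarrow> h \<ge> 1 \<longrightarrow> real h \<le> 2 powr (\<nu> * real r) \<longrightarrow>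
     cmod (\<Sum>n<2 ^ r. wt n * e (real h * (\<Sum>i\<le>d. c i * real n ^ i))) \<le> 2 powr ((1 - \<nu> + \<epsilon>) * real r)) sequentially)"

text \<open>Both savings are set to 2^(2 K \<nu> r) for the power 2 K = 2 * 2^n: V = 2^(2 \<nu> r)
  for the diagonal and G = 2^(2 K \<nu> r) off it. Then G \<le> U reads 2 K \<nu> < 1 - 2 \<nu>,
  which is \<open>sl1\<close>, and h G^2 \<le> V U^n reads \<nu> + 4 K \<nu> < 2 \<nu> + n (1 - 2
  \<nu>), which is \<open>sl2\<close>; strictness pays for rounding to integers.\<close>

lemma twisted_sums_le_weyl:
  assumes dio: "badly_approx_type (c (n + 2))" and n: "n \<ge> 1" and \<nu>: "0 \<le> \<nu>"
    and sl1: "2 * \<nu> * (2 ^ n + 1) < 1" and sl2: "\<nu> * (4 * 2 ^ n + 2 * real n - 1) < real n"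
  shows "twisted_sums_le c (n + 2) \<nu>"
  unfolding twisted_sums_le_def
proof (intro allI impI)
  fix \<epsilon> :: real
  assume \<epsilon>: "\<epsilon> > 0"
  define K where "K = (2::nat) ^ n"
  have K: "K \<ge> 1" by (simp add: K_def)
  have \<epsilon>2: "\<epsilon> / 2 > 0" using \<epsilon> by simp
  obtain C where C: "C \<ge> 1" and bound: "\<And>wt r s h G. \<lbrakk>digit_mult wt; s \<le> r; h \<ge> 1; real h \<le> 2 ^ r; G \<ge> 1; G \<le> 2 ^ s;
      real h * G ^ 2 \<le> 2 ^ (r - s) * (2 ^ s) ^ n\<rbrakk> \<Longrightarrow>
    cmod (\<Sum>m<2 ^ r. wt m * e (real h * (\<Sum>i\<le>n + 2. c i * real m ^ i))) ^ (2 * 2 ^ n) \<le>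
      C * (2 ^ r) ^ (2 * 2 ^ n) * 2 powr (\<epsilon> / 2 * real r) * (1 / (2 ^ (r - s)) ^ (2 ^ n) + 1 / G)"
    using twisted_sum_weyl_bound[of c n, OF dio n \<epsilon>2] by blast
  have "eventually (\<lambda>r::nat. 2 \<le> (1 - 2 * \<nu> * (2 ^ n + 1)) * real r) sequentially"
    using sl1 by real_asymp
  moreover have "eventually (\<lambda>r::nat. 2 + real n \<le> (real n - \<nu> * (4 * 2 ^ n + 2 * real n - 1)) * real r) sequentially"
    using sl2 by real_asymp
  moreover have "eventually (\<lambda>r::nat. 2 * C \<le> 2 powr (\<epsilon> / 2 * real r)) sequentially"
    using \<epsilon> by real_asymp
  ultimately show "eventually (\<lambda>r. \<forall>wt h. digit_mult wt \<longrightarrow> h \<ge> 1 \<longrightarrow> real h \<le> 2 powr (\<nu> * real r) \<longrightarrow>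
     cmod (\<Sum>m<2 ^ r. wt m * e (real h * (\<Sum>i\<le>n + 2. c i * real m ^ i))) \<le> 2 powr ((1 - \<nu> + \<epsilon>) * real r)) sequentially"
  proof eventually_elim
    case (elim r)
    show ?case
    proof (intro allI impI)
      fix wt :: "nat \<Rightarrow> complex" and h :: nat
      assume wt: "digit_mult wt" and h: "h \<ge> 1" "real h \<le> 2 powr (\<nu> * real r)"
      let ?r = "real r"
      define a where "a = nat \<lceil>2 * \<nu> * ?r\<rceil>"
      define g where "g = nat \<lceil>2 * real K * \<nu> * ?r\<rceil>"
      have nn: "0 \<le> 2 * \<nu> * ?r" "0 \<le> 2 * real K * \<nu> * ?r" using \<nu> by auto
      have a: "2 * \<nu> * ?r \<le> real a" "real a \<le> 2 * \<nu> * ?r + 1"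
        using nn(1) unfolding a_def by linarith+
      have g: "2 * real K * \<nu> * ?r \<le> real g" "real g \<le> 2 * real K * \<nu> * ?r + 1"
        using nn(2) unfolding g_def by linarith+
      have e1: "2 \<le> ?r - (2 * \<nu> * ?r + 2 * real K * \<nu> * ?r)" using elim(1) by (simp add: K_def algebra_simps)
      have e2: "2 + real n \<le> real n * ?r - 4 * (real K * \<nu> * ?r) - 2 * (real n * \<nu> * ?r) + \<nu> * ?r" using elim(2) by (simp add: K_def algebra_simps)
      have "real g \<le> ?r - real a" using a g e1 by linarith
      then have ga: "g + a \<le> r" by linarith
      define s where "s = r - a"
      have s: "s \<le> r" "r - s = a" "g \<le> s" "real s = ?r - real a" using ga by (auto simp: s_def)
      have "\<nu> * ?r \<le> ?r"
      proof -
        have "\<nu> * 1 \<le> \<nu> * (2 * (2 ^ n + 1))" using \<nu> by (intro mult_left_mono) auto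
        then have "\<nu> \<le> 1" using sl1 by (simp add: mult_ac)
        then show ?thesis by (simp add: mult_left_le_one_le \<nu>)
      qed
      then have "2 powr (\<nu> * ?r) \<le> 2 powr ?r" by simp
      from order.trans[OF h(2) this] have hr: "real h \<le> 2 ^ r" by (simp add: powr_realpow)
      have "real h * (2 ^ g) ^ 2 \<le> 2 powr (\<nu> * ?r) * 2 powr (2 * real g)"
        using h(2) by (simp add: powr_realpow[symmetric] powr_powr mult.commute flip: powr_numeral)
      also have "\<dots> \<le> 2 powr (real a + real n * real s)"
      proof -
        have "real n * real a \<le> real n * (2 * \<nu> * ?r + 1)" using a by (intro mult_left_mono) auto
        then have "real n * real s \<ge> real n * ?r - real n * (2 * \<nu> * ?r + 1)" by (simp add: s(4) right_diff_distrib)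
        then have "\<nu> * ?r + 2 * real g \<le> real a + real n * real s"
          using a g e2 by (simp add: algebra_simps)
        then show ?thesis by (simp flip: powr_add)
      qed
      also have "\<dots> = 2 ^ (r - s) * (2 ^ s) ^ n"
        by (simp add: s(2) powr_add powr_realpow mult.commute flip: power_mult of_nat_mult)
      finally have hG: "real h * (2 ^ g) ^ 2 \<le> 2 ^ (r - s) * (2 ^ s) ^ n" .
      define T where "T = cmod (\<Sum>m<2 ^ r. wt m * e (real h * (\<Sum>i\<le>n + 2. c i * real m ^ i)))"
      have "T ^ (2 * K) \<le> C * (2 ^ r) ^ (2 * K) * 2 powr (\<epsilon> / 2 * ?r) * (1 / (2 ^ a) ^ K + 1 / 2 ^ g)"
        using bound[OF wt s(1) h(1) hr _ _ hG] s by (simp add: T_def K_def power_increasing)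
      also have "\<dots> \<le> C * (2 ^ r) ^ (2 * K) * 2 powr (\<epsilon> / 2 * ?r) * (2 * 2 powr (- (2 * real K * \<nu> * ?r)))"
      proof -
        have "real K * (2 * \<nu> * ?r) \<le> real K * real a" using a by (intro mult_left_mono) auto
        then have "2 powr (- (real a * real K)) \<le> 2 powr (- (2 * real K * \<nu> * ?r))" by (simp add: mult_ac)
        moreover have "1 / (2 ^ a) ^ K = 2 powr (- (real a * real K))"
          by (simp add: powr_minus_divide powr_realpow flip: power_mult of_nat_mult)
        moreover have "2 powr (- real g) \<le> 2 powr (- (2 * real K * \<nu> * ?r))" using g by simp
        moreover have "1 / 2 ^ g = 2 powr (- real g)" by (simp add: powr_minus_divide powr_realpow)
        ultimately have "1 / (2 ^ a) ^ K + 1 / 2 ^ g \<le> 2 * 2 powr (- (2 * real K * \<nu> * ?r))" by linarith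
        then show ?thesis using C by (intro mult_left_mono) auto
      qed
      also have "\<dots> = 2 * C * 2 powr (real (2 * K) * ((1 - \<nu>) * ?r) + \<epsilon> / 2 * ?r)"
      proof -
        have "(2 ^ r) ^ (2 * K) = 2 powr (?r * real (2 * K))" by (simp add: powr_realpow flip: power_mult of_nat_mult)
        moreover have "2 powr (?r * real (2 * K)) * 2 powr (\<epsilon> / 2 * ?r) * 2 powr (- (2 * real K * \<nu> * ?r)) =
            2 powr (real (2 * K) * ((1 - \<nu>) * ?r) + \<epsilon> / 2 * ?r)"
          unfolding powr_add[symmetric] by (simp add: algebra_simps)
        ultimately show ?thesis by (simp add: mult_ac)
      qed
      also have "\<dots> \<le> 2 * C * 2 powr (real (2 * K) * ((1 - \<nu> + \<epsilon> / 2) * ?r))"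
      proof -
        have "1 * (\<epsilon> / 2 * ?r) \<le> real (2 * K) * (\<epsilon> / 2 * ?r)" using K \<epsilon> by (intro mult_right_mono) auto
        then show ?thesis using C by (intro mult_left_mono) (auto simp: algebra_simps)
      qed
      finally have TK: "T ^ (2 * K) \<le> 2 * C * 2 powr (real (2 * K) * ((1 - \<nu> + \<epsilon> / 2) * ?r))" .
      have "T \<le> 2 * C * 2 powr ((1 - \<nu> + \<epsilon> / 2) * ?r)"
        by (rule le_of_power_le[OF _ _ _ TK]) (use K C in \<open>auto simp: T_def\<close>)
      also have "\<dots> \<le> 2 powr (\<epsilon> / 2 * ?r) * 2 powr ((1 - \<nu> + \<epsilon> / 2) * ?r)"
        using elim(3) by (intro mult_right_mono) auto
      also have "\<dots> = 2 powr ((1 - \<nu> + \<epsilon>) * ?r)"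
        unfolding powr_add[symmetric] by (simp add: algebra_simps)
      finally show "cmod (\<Sum>m<2 ^ r. wt m * e (real h * (\<Sum>i\<le>n + 2. c i * real m ^ i))) \<le> 2 powr ((1 - \<nu> + \<epsilon>) * ?r)"
        by (simp add: T_def)
    qed
  qed
qed

text \<open>The block length \<sigma> r is the shortest that the sieve bound permits, k \<sigma> =
  (1 + \<nu>) (1 + \<delta>). The saving V = 2^((1 - \<sigma>) r) in the power N = k (k + 1)
  suffices if 1 - \<sigma> \<ge> \<nu> N; for \<delta> = 0 this is the hypothesis \<open>sl\<close>,
  multiplied out by k.\<close>

lemma twisted_sums_le_sieve:
  assumes dio: "badly_approx_type (c (Suc k))" and k: "k \<ge> 2" and \<nu>: "0 \<le> \<nu>"
    and sl: "\<nu> * (1 + real (Suc k) * real k ^ 2) \<le> real k - 1"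
  shows "twisted_sums_le c (Suc k) \<nu>"
  unfolding twisted_sums_le_def
proof (intro allI impI)
  fix \<epsilon> :: real
  assume \<epsilon>: "\<epsilon> > 0"
  define N where "N = 2 * tri k"
  have N: "N = k * (k + 1)" by (simp add: N_def two_tri)
  have N1: "N \<ge> 1" using k by (simp add: N)
  have k0: "real k > 0" and k1: "k \<ge> 1" using k by auto
  have \<nu>4: "\<nu> * 4 \<le> 1"
  proof -
    have "4 * real k \<le> 1 + real (Suc k) * real k ^ 2"
    proof -
      have "2 * 2 \<le> real k * real (Suc k)" using k by (intro mult_mono) auto
      then have "(2 * 2) * real k \<le> real k * real (Suc k) * real k" by (intro mult_right_mono) auto
      then show ?thesis by (simp add: power2_eq_square mult_ac)
    qed
    then have "\<nu> * (4 * real k) \<le> real k - 1" using mult_left_mono[OF _ \<nu>] sl by (meson order.trans)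
    then have "(\<nu> * 4) * real k \<le> 1 * real k" by simp
    then show ?thesis using k0 by (simp only: mult_le_cancel_right_pos)
  qed
  \<comment> \<open>The bound 1/4, with \<nu> \<le> 1/4 and k \<ge> 2, keeps \<sigma> at most 25/32,
    so s \<le> r after rounding. The bound \<epsilon>/6 leaves room for the three losses of size
    \<delta>.\<close>
  define \<delta> where "\<delta> = min (\<epsilon> / 6) (1 / 4)"
  have \<delta>: "\<delta> > 0" "\<delta> \<le> 1 / 4" "3 * \<delta> \<le> \<epsilon> / 2" using \<epsilon> by (auto simp: \<delta>_def)
  obtain C where C: "C \<ge> 1" and bound: "\<And>wt r s h. \<lbrakk>digit_mult wt; s \<le> r; h \<ge> 1;
      (real h * 2 ^ r) powr (1 + \<delta>) \<le> (2 ^ s) ^ k\<rbrakk> \<Longrightarrow>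
    cmod (\<Sum>n<2 ^ r. wt n * e (real h * (\<Sum>i\<le>Suc k. c i * real n ^ i))) ^ (2 * tri k) \<le>
      C * (2 ^ (r - s)) ^ (2 * tri k - 1) * (2 ^ s) powr (2 * real (tri k) + \<delta>)"
    using twisted_sum_sieve_bound[of c k, OF dio k1 \<delta>(1)] by blast
  define \<sigma> where "\<sigma> = (1 + \<nu>) * (1 + \<delta>) / real k"
  have \<sigma>: "0 \<le> \<sigma>" "\<sigma> \<le> 25 / 32"
  proof -
    show "0 \<le> \<sigma>" unfolding \<sigma>_def using \<nu> \<delta> k by (intro divide_nonneg_nonneg mult_nonneg_nonneg) auto
    have "(1 + \<nu>) * (1 + \<delta>) \<le> 5 / 4 * (5 / 4)" using \<nu> \<delta> \<nu>4 by (intro mult_mono) auto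
    then have "(1 + \<nu>) * (1 + \<delta>) \<le> 25 / 32 * real k" using k by simp
    then show "\<sigma> \<le> 25 / 32" unfolding \<sigma>_def using k0 by (simp add: pos_divide_le_eq)
  qed
  have \<sigma>N: "\<sigma> \<le> 1 - \<nu> * real N + 2 * \<delta>"
  proof -
    have "(1 + \<nu>) / real k \<le> 1 - \<nu> * real N"
    proof -
      have "1 + \<nu> \<le> (1 - \<nu> * real N) * real k" using sl by (simp add: N power2_eq_square algebra_simps)
      then show ?thesis using k0 by (simp add: pos_divide_le_eq)
    qed
    moreover have "\<sigma> = (1 + \<nu>) / real k + (1 + \<nu>) / real k * \<delta>" using k0 by (simp add: \<sigma>_def field_simps)
    moreover have "(1 + \<nu>) / real k * \<delta> \<le> 2 * \<delta>"
    proof (intro mult_right_mono)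
      have "1 + \<nu> \<le> 2 * real k" using \<nu>4 k by simp
      then show "(1 + \<nu>) / real k \<le> 2" using k0 by (simp add: pos_divide_le_eq)
    qed (use \<delta> in simp)
    ultimately show ?thesis by linarith
  qed
  have "eventually (\<lambda>r::nat. 25 / 32 * real r + 1 \<le> real r) sequentially"
    by real_asymp
  moreover have "eventually (\<lambda>r::nat. 2 * C \<le> 2 powr (\<epsilon> / 2 * real r)) sequentially"
    using \<epsilon> by real_asymp
  ultimately show "eventually (\<lambda>r. \<forall>wt h. digit_mult wt \<longrightarrow> h \<ge> 1 \<longrightarrow> real h \<le> 2 powr (\<nu> * real r) \<longrightarrow>
     cmod (\<Sum>n<2 ^ r. wt n * e (real h * (\<Sum>i\<le>Suc k. c i * real n ^ i))) \<le> 2 powr ((1 - \<nu> + \<epsilon>) * real r)) sequentially"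
  proof eventually_elim
    case (elim r)
    show ?case
    proof (intro allI impI)
      fix wt :: "nat \<Rightarrow> complex" and h :: nat
      assume wt: "digit_mult wt" and h: "h \<ge> 1" "real h \<le> 2 powr (\<nu> * real r)"
      let ?r = "real r"
      define s where "s = nat \<lceil>\<sigma> * ?r\<rceil>"
      have "0 \<le> \<sigma> * ?r" using \<sigma> by simp
      then have s: "\<sigma> * ?r \<le> real s" "real s \<le> \<sigma> * ?r + 1" unfolding s_def by linarith+
      have "\<sigma> * ?r \<le> 25 / 32 * ?r" using \<sigma> by (intro mult_right_mono) auto
      then have "real s \<le> ?r" using s elim(1) by linarith
      then have sr: "s \<le> r" by simp
      have "(real h * 2 ^ r) powr (1 + \<delta>) \<le> (2 powr (\<nu> * ?r) * 2 powr ?r) powr (1 + \<delta>)"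
        using h \<delta> by (intro powr_mono2 mult_mono) (auto simp: powr_realpow)
      also have "\<dots> = 2 powr (real k * (\<sigma> * ?r))"
      proof -
        have "real k * \<sigma> = (1 + \<nu>) * (1 + \<delta>)" using k0 by (simp add: \<sigma>_def)
        then have "real k * (\<sigma> * ?r) = (\<nu> * ?r + ?r) * (1 + \<delta>)"
          by (simp add: mult.assoc[symmetric]) (simp add: algebra_simps)
        then show ?thesis unfolding powr_add[symmetric] powr_powr by simp
      qed
      also have "\<dots> \<le> 2 powr (real k * real s)" using s by (simp add: mult_left_mono)
      also have "\<dots> = (2 ^ s) ^ k" by (simp add: powr_realpow mult.commute flip: power_mult of_nat_mult)
      finally have hk: "(real h * 2 ^ r) powr (1 + \<delta>) \<le> (2 ^ s) ^ k" .
      define T where "T = cmod (\<Sum>n<2 ^ r. wt n * e (real h * (\<Sum>i\<le>Suc k. c i * real n ^ i)))"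
      have "T ^ N \<le> C * (2 ^ (r - s)) ^ (N - 1) * (2 ^ s) powr (real N + \<delta>)"
        using bound[OF wt sr h(1) hk] by (simp add: T_def N_def)
      also have "\<dots> = C * 2 powr (real (r - s) * real (N - 1) + real s * (real N + \<delta>))"
      proof -
        have "(2 ^ (r - s)) ^ (N - 1) = 2 powr (real (r - s) * real (N - 1))"
          by (simp add: powr_realpow flip: power_mult of_nat_mult)
        moreover have "(2 ^ s) powr (real N + \<delta>) = 2 powr (real s * (real N + \<delta>))"
          by (simp add: powr_powr flip: powr_realpow)
        ultimately show ?thesis by (simp only: powr_add mult.assoc)
      qed
      also have "\<dots> \<le> C * (2 * 2 powr (real N * ((1 - \<nu> + 3 * \<delta>) * ?r)))"
      proof -
        have "real (r - s) * real (N - 1) + real s * (real N + \<delta>) = (?r - real s) * (real N - 1) + real s * real N + real s * \<delta>"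
          using sr N1 by (simp add: of_nat_diff distrib_left)
        also have "\<dots> = ?r * real N - ?r + real s + real s * \<delta>" by (simp add: algebra_simps)
        also have "\<dots> \<le> ?r * real N - ?r + (\<sigma> * ?r + 1) + ?r * \<delta>"
          using s \<open>real s \<le> ?r\<close> \<delta> by (intro add_mono mult_right_mono) auto
        also have "\<sigma> * ?r \<le> (1 - \<nu> * real N + 2 * \<delta>) * ?r" using \<sigma>N by (intro mult_right_mono) auto
        finally have "real (r - s) * real (N - 1) + real s * (real N + \<delta>) \<le> 1 + (real N * ((1 - \<nu>) * ?r) + 1 * (3 * \<delta> * ?r))"
          by (simp add: algebra_simps)
        also have "1 * (3 * \<delta> * ?r) \<le> real N * (3 * \<delta> * ?r)" using N1 \<delta> by (intro mult_right_mono) auto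
        finally have "real (r - s) * real (N - 1) + real s * (real N + \<delta>) \<le> 1 + real N * ((1 - \<nu> + 3 * \<delta>) * ?r)"
          by (simp add: algebra_simps)
        then have "2 powr (real (r - s) * real (N - 1) + real s * (real N + \<delta>)) \<le> 2 powr (1 + real N * ((1 - \<nu> + 3 * \<delta>) * ?r))"
          by simp
        then show ?thesis using C by (simp add: powr_add)
      qed
      finally have TN: "T ^ N \<le> 2 * C * 2 powr (real N * ((1 - \<nu> + 3 * \<delta>) * ?r))" by simp
      have "T \<le> 2 * C * 2 powr ((1 - \<nu> + 3 * \<delta>) * ?r)"
        by (rule le_of_power_le[OF _ _ _ TN]) (use N1 C in \<open>auto simp: T_def\<close>)
      also have "\<dots> \<le> 2 powr (\<epsilon> / 2 * ?r) * 2 powr ((1 - \<nu> + \<epsilon> / 2) * ?r)"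
        using elim(2) \<delta> by (intro mult_mono) (auto intro!: mult_right_mono)
      also have "\<dots> = 2 powr ((1 - \<nu> + \<epsilon>) * ?r)"
        unfolding powr_add[symmetric] by (simp add: algebra_simps)
      finally show "cmod (\<Sum>n<2 ^ r. wt n * e (real h * (\<Sum>i\<le>Suc k. c i * real n ^ i))) \<le> 2 powr ((1 - \<nu> + \<epsilon>) * ?r)"
        by (simp add: T_def)
    qed
  qed
qed

lemma nu_nonneg:
  assumes "d \<ge> 3"
  shows "0 \<le> min (nu1 d) (nu2 d)"
proof -
  have "3 * real d \<le> real d * real d" using assms by (intro mult_right_mono) auto
  then have "0 \<le> 2 * real d ^ 2 - 2 * real d + 1" "0 \<le> 2 * real d ^ 2 - 6 * real d + 6"
    by (simp_all add: power2_eq_square)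
  then show ?thesis using assms by (simp add: nu1_def nu2_def)
qed

lemma twisted_sums_le_nu:
  assumes dio: "badly_approx_type (c d)" and d: "d \<ge> 3"
  shows "twisted_sums_le c d (min (nu1 d) (nu2 d))"
proof -
  define \<nu> where "\<nu> = min (nu1 d) (nu2 d)"
  have \<nu>: "0 \<le> \<nu>" unfolding \<nu>_def by (rule nu_nonneg[OF d])
  have weyl: "twisted_sums_le c d \<nu>" if "d = n + 2" "n \<ge> 1" "2 * \<nu> * (2 ^ n + 1) < 1" "\<nu> * (4 * 2 ^ n + 2 * real n - 1) < real n" for n
    using twisted_sums_le_weyl[of c n \<nu>] dio that \<nu> by simp
  consider "d = 3" | "d = 4" | "d = 5" | "d \<ge> 6" using d by linarith
  then have "twisted_sums_le c d \<nu>"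
  proof cases
    case 1
    have "\<nu> \<le> 1 / 13" by (simp add: \<nu>_def nu1_def 1)
    then show ?thesis by (intro weyl[of 1]) (auto simp: 1)
  next
    case 2
    have "\<nu> \<le> 1 / 14" by (simp add: \<nu>_def nu2_def 2)
    then show ?thesis by (intro weyl[of 2]) (auto simp: 2)
  next
    case 3
    have "\<nu> \<le> 1 / 26" by (simp add: \<nu>_def nu2_def 3)
    then show ?thesis by (intro weyl[of 3]) (auto simp: 3)
  next
    case 4
    define k where "k = d - 1"
    have k: "d = Suc k" "k \<ge> 5" using 4 by (auto simp: k_def)
    \<comment> \<open>Written in x = k - 5 \<ge> 0 the difference of the two sides is x^3 + 10 x^2 +
      29 x + 17, with all coefficients positive.\<close>
    define x where "x = real k - 5"
    have x: "x \<ge> 0" "real k = x + 5" using k by (auto simp: x_def)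
    have D: "2 * real d ^ 2 - 6 * real d + 6 = 2 * x ^ 2 + 18 * x + 42"
      by (simp add: k x power2_eq_square algebra_simps)
    have D0: "2 * x ^ 2 + 18 * x + 42 > 0" using x by (intro add_nonneg_pos) auto
    have "\<nu> * (1 + real (Suc k) * real k ^ 2) \<le> nu2 d * (1 + real (Suc k) * real k ^ 2)"
      by (intro mult_right_mono) (auto simp: \<nu>_def)
    also have "\<dots> = (1 + real (Suc k) * real k ^ 2) / (2 * x ^ 2 + 18 * x + 42)"
      unfolding nu2_def D by simp
    also have "\<dots> \<le> real k - 1"
    proof -
      have "0 \<le> x * (x * x) + 10 * (x * x) + 29 * x + 17"
        using x by (intro add_nonneg_nonneg mult_nonneg_nonneg) auto
      then have "1 + real (Suc k) * real k ^ 2 \<le> (real k - 1) * (2 * x ^ 2 + 18 * x + 42)"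
        by (simp add: x power2_eq_square algebra_simps)
      then show ?thesis using D0 by (simp add: pos_divide_le_eq)
    qed
    finally show ?thesis using twisted_sums_le_sieve[of c k \<nu>] dio k \<nu> by simp
  qed
  then show ?thesis by (simp add: \<nu>_def)
qed

theorem theorem2p4:
  fixes f :: "real poly" and d m :: nat
  assumes "degree f = d" and "coeff f 0 = 0" and "d \<ge> 3"
    and "coeff f d \<notin> \<rat>" and "diophantine_type (coeff f d) = 1"
    and "m > 0"
  shows "\<forall>\<epsilon> > 0. \<exists>r\<^sub>0 :: nat. \<forall>k < m. \<forall>r \<ge> r\<^sub>0.
    discrepancy (\<lambda>n. poly f (real n)) (digit_sum_class k m r)
      \<le> 2 powr (- min (nu1 d) (nu2 d) * real r + \<epsilon> * real r)"
proof (intro allI impI)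
  fix \<epsilon> :: real
  assume \<epsilon>: "\<epsilon> > 0"
  define \<nu> where "\<nu> = min (nu1 d) (nu2 d)"
  have \<nu>: "0 \<le> \<nu>" unfolding \<nu>_def by (rule nu_nonneg) fact
  have "\<nu> \<le> nu2 d" by (simp add: \<nu>_def)
  also have "nu2 d \<le> 1"
  proof -
    have "3 * real d \<le> real d * real d" using assms(3) by (intro mult_right_mono) auto
    then show ?thesis unfolding nu2_def by (simp add: power2_eq_square)
  qed
  finally have \<nu>1: "\<nu> \<le> 1" .
  have "twisted_sums_le (coeff f) d \<nu>"
    unfolding \<nu>_def by (intro twisted_sums_le_nu badly_approx_type_of_diophantine_type assms)
  then have "eventually (\<lambda>r. \<forall>wt h. digit_mult wt \<longrightarrow> h \<ge> 1 \<longrightarrow> real h \<le> 2 powr (\<nu> * real r) \<longrightarrow>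
     cmod (\<Sum>n<2 ^ r. wt n * e (real h * (\<Sum>i\<le>d. coeff f i * real n ^ i))) \<le> 2 powr ((1 - \<nu> + \<epsilon> / 2) * real r)) sequentially"
    using \<epsilon> unfolding twisted_sums_le_def by (meson half_gt_zero)
  moreover note card_digit_sum_class_ge[OF \<open>m > 0\<close>]
  moreover have "eventually (\<lambda>r::nat. 52 + 8 * real m * (2 + real r) \<le> 2 powr (\<epsilon> / 2 * real r)) sequentially"
    using \<epsilon> by real_asymp
  ultimately have "eventually (\<lambda>r. \<forall>k. discrepancy (\<lambda>n. poly f (real n)) (digit_sum_class k m r)
      \<le> 2 powr (- \<nu> * real r + \<epsilon> * real r)) sequentially"
  proof eventually_elim
    case (elim r)
    show ?case
    proof
      fix k
      let ?M = "digit_sum_class k m r" and ?r = "real r"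
      have card: "2 ^ r / (2 * real m) \<le> real (card ?M)" using elim(2) by blast
      moreover have "0 < 2 ^ r / (2 * real m)" using \<open>m > 0\<close> by simp
      ultimately have card0: "card ?M > 0" by linarith
      \<comment> \<open>The choice makes 1 / H match the target 2^(- \<nu> r), and rounding up still
        leaves every h < H within the range 2^(\<nu> r) of the exponential sum bound.\<close>
      define H where "H = nat \<lceil>2 powr (\<nu> * ?r)\<rceil>"
      \<comment> \<open>The factor 2 m converts a bound relative to 2^r into one relative to the
        size of the digit class, which is at least 2^r / (2 m).\<close>
      define \<kappa> where "\<kappa> = 2 * real m * 2 powr ((- \<nu> + \<epsilon> / 2) * ?r)"
      have p1: "1 \<le> 2 powr (\<nu> * ?r)" using \<nu> by (intro ge_one_powr_ge_zero) auto
      then have H: "2 powr (\<nu> * ?r) \<le> real H" "real H < 2 powr (\<nu> * ?r) + 1" unfolding H_def by linarith+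
      have "discrepancy (\<lambda>n. poly f (real n)) ?M \<le> 52 / real H + 4 * \<kappa> * (1 + ln (real H))"
      proof (rule discrepancy_le)
        show "?M \<noteq> {}" using card0 by auto
        show "1 \<le> H" using H(1) p1 by linarith
        show "0 \<le> \<kappa>" by (simp add: \<kappa>_def)
        fix h
        assume h: "1 \<le> h" "h < H"
        have "real h \<le> 2 powr (\<nu> * ?r)" using h H(2) by linarith
        then have "cmod (\<Sum>n\<in>?M. e (real h * (\<Sum>i\<le>d. coeff f i * real n ^ i))) \<le> 2 powr ((1 - \<nu> + \<epsilon> / 2) * ?r)"
          using elim(1) h by (intro norm_sum_digit_sum_class_le[OF \<open>m > 0\<close>]) blast
        also have "\<dots> = 2 powr ((- \<nu> + \<epsilon> / 2) * ?r) * 2 ^ r"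
        proof -
          have "(1 - \<nu> + \<epsilon> / 2) * ?r = (- \<nu> + \<epsilon> / 2) * ?r + ?r" by (simp add: algebra_simps)
          then show ?thesis by (simp add: powr_add powr_realpow)
        qed
        also have "2 ^ r = 2 * real m * (2 ^ r / (2 * real m))" using \<open>m > 0\<close> by simp
        also have "2 powr ((- \<nu> + \<epsilon> / 2) * ?r) * (2 * real m * (2 ^ r / (2 * real m))) \<le>
            2 powr ((- \<nu> + \<epsilon> / 2) * ?r) * (2 * real m * real (card ?M))"
          by (intro mult_left_mono card) auto
        also have "\<dots> = \<kappa> * real (card ?M)" by (simp add: \<kappa>_def)
        finally show "cmod (\<Sum>n\<in>?M. e (real h * poly f (real n))) \<le> \<kappa> * real (card ?M)"
          by (simp add: poly_altdef assms(1))
      qed simp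
      also have "\<dots> \<le> 52 * 2 powr ((- \<nu> + \<epsilon> / 2) * ?r) + 4 * \<kappa> * (2 + ?r)"
      proof (rule add_mono)
        have "52 / real H \<le> 52 / 2 powr (\<nu> * ?r)" using H(1) p1 by (intro divide_left_mono) auto
        also have "\<dots> = 52 * 2 powr (- (\<nu> * ?r))" by (simp add: powr_minus_divide)
        also have "\<dots> \<le> 52 * 2 powr ((- \<nu> + \<epsilon> / 2) * ?r)" using \<epsilon> by (simp add: left_diff_distrib)
        finally show "52 / real H \<le> 52 * 2 powr ((- \<nu> + \<epsilon> / 2) * ?r)" .
        have "ln (real H) \<le> ln (2 powr (1 + \<nu> * ?r))"
          using H p1 by (intro ln_mono) (auto simp: powr_add)
        also have "\<dots> = (1 + \<nu> * ?r) * ln 2" by (simp add: ln_powr)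
        also have "\<dots> \<le> (1 + \<nu> * ?r) * 1" using ln_2_less_1 \<nu> by (intro mult_left_mono) auto
        also have "\<dots> \<le> 1 + 1 * ?r" using \<nu>1 by (simp add: mult_left_le_one_le \<nu>)
        finally have "1 + ln (real H) \<le> 2 + ?r" by simp
        then show "4 * \<kappa> * (1 + ln (real H)) \<le> 4 * \<kappa> * (2 + ?r)"
          by (intro mult_left_mono) (simp_all add: \<kappa>_def)
      qed
      also have "\<dots> = 2 powr ((- \<nu> + \<epsilon> / 2) * ?r) * (52 + 8 * real m * (2 + ?r))"
        by (simp add: \<kappa>_def algebra_simps)
      also have "\<dots> \<le> 2 powr ((- \<nu> + \<epsilon> / 2) * ?r) * 2 powr (\<epsilon> / 2 * ?r)"
        using elim(3) by (intro mult_left_mono) auto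
      also have "\<dots> = 2 powr (- \<nu> * ?r + \<epsilon> * ?r)"
        unfolding powr_add[symmetric] by (simp add: algebra_simps)
      finally show "discrepancy (\<lambda>n. poly f (real n)) ?M \<le> 2 powr (- \<nu> * ?r + \<epsilon> * ?r)" .
    qed
  qed
  then show "\<exists>r\<^sub>0 :: nat. \<forall>k < m. \<forall>r \<ge> r\<^sub>0. discrepancy (\<lambda>n. poly f (real n)) (digit_sum_class k m r)
      \<le> 2 powr (- min (nu1 d) (nu2 d) * real r + \<epsilon> * real r)"
    unfolding eventually_sequentially \<nu>_def by blast
qed

end
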